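(* Let $(M,\nabla,\langle\cdot,\cdot\rangle)$ be an infinitely balanced affine-Riemann manifold with $\gamma\ne0$. Then: 1. $(TM,J_1,g_1)$ is balanced with $\rho^B=\rho^C=0$, and it is Kähler if and only if $\gamma=\gamma^*$. 2. For every $k\ge2$, $(T^kM,J_k,g_k)$ is balanced non-Kähler with $\rho^B=\rho^C=0$.
   Context: An affine-Riemann manifold $(M,\nabla,\langle\cdot,\cdot\rangle)$ is a manifold with a flat torsionless connection $\nabla$ and a Riemannian metric. $D$ is the Levi-Civita connection of the metric; the difference tensor is $\gamma_XY=D_XY-\nabla_XY$, and $\gamma^*$ is defined by $\langle\gamma^*_XY,Z\rangle=\langle Y,\gamma_XZ\rangle$. For a local orthonormal frame $(E_i)$, $\mathrm{tr}_{\langle,\rangle}(\gamma)=\sum_i\gamma_{E_i}E_i$, $\mathrm{tr}_{\langle,\rangle}(\gamma^* )=\sum_i\gamma^*_{E_i}E_i$. The affine-Riemann manifold is called infinitely balanced if $\mathrm{tr}_{\langle,\rangle}(\gamma)=\mathrm{tr}_{\langle,\rangle}(\gamma^* )=0$. Canonical sequence: for a vector field $X$ on $M$, $X^h$ is the horizontal lift to $TM$ with respect to $\nabla$ and $X^v$ the vertical lift; $\pi_1:TM\to M$ is the projection. On $TM$: $J_1X^h=X^v$, $J_1X^v=-X^h$; $g_1(X^h,Y^h)=g_1(X^v,Y^v)=\langle X,Y\rangle\circ\pi_1$, $g_1(X^h,Y^v)=0$; $\nabla^1_{X^h}Y^h=(\nabla_XY)^h$, $\nabla^1_{X^h}Y^v=(\nabla_XY)^v$,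 $\nabla^1_{X^v}Y^h=\nabla^1_{X^v}Y^v=0$. Then $(TM,J_1,g_1)$ is Hermitian and $\nabla^1$ is flat torsionless. Inductively, with $T^1M=TM$, $T^kM=T(T^{k-1}M)$, applying the construction to $(T^{k-1}M,\nabla^{k-1},g_{k-1})$ gives $(J_k,g_k,\nabla^k)$ on $T^kM$. For a Hermitian manifold $(N,J,g)$ of real dimension $2m$, with Levi-Civita connection $\nabla^{LC}$: $\omega=g(J\cdot,\cdot)$, $d^*\omega(\cdot)=-\sum_i(\nabla^{LC}_{E_i}\omega)(E_i,\cdot)$, Lee form $\theta=-d^*\omega\circ J$. It is Kähler if $d\omega=0$ and balanced if $\theta=0$. The Bismut and Chern connections are $g(\nabla^B_XY,Z)=g(\nabla^{LC}_XY,Z)+\frac12d\omega(JX,JY,JZ)$ and $g(\nabla^C_XY,Z)=g(\nabla^{LC}_XY,Z)-\frac12d\omega(JX,Y,Z)$. For $\tau\in\{B,C\}$, $R^\tau(X,Y)=\nabla^\tau_{[X,Y]}-\nabla^\tau_X\nabla^\tau_Y+\nabla^\tau_Y\nabla^\tau_X$ and the Ricci form is $\rho^\tau(X,Y)=\frac12\sum_{i=1}^{2m}g(R^\tau(X,Y)E_i,JE_i)$ for a local $g$-orthonormal frame. *)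

theory Defs
  imports "HOL-Analysis.Analysis" "HOL-Library.Function_Algebras"
begin

section \<open>Smooth functions on open subsets of \<open>\<real>\<^sup>n\<close>\<close>

text \<open>
  The dimension of the iterated tangent bundle depends on the number of iterations, so
  \<open>\<real>\<^sup>n\<close> is the carrier of the library topology \<^const>\<open>Euclidean_space\<close>: sequences
  \<open>x :: nat \<Rightarrow> real\<close> with \<open>x a = 0\<close> for \<open>a \<ge> n\<close>.
\<close>

definition pderiv_at :: "nat \<Rightarrow> ((nat \<Rightarrow> real) \<Rightarrow> real) \<Rightarrow> (nat \<Rightarrow> real) \<Rightarrow> real" where
  "pderiv_at a f x = deriv (\<lambda>t. f (x(a := t))) (x a)"

primrec Ck_on :: "nat \<Rightarrow> nat \<Rightarrow> (nat \<Rightarrow> real) set \<Rightarrow> ((nat \<Rightarrow> real) \<Rightarrow> real) \<Rightarrow> bool" where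
  "Ck_on 0 n S f \<longleftrightarrow> continuous_on S f"
| "Ck_on (Suc k) n S f \<longleftrightarrow> continuous_on S f \<and>
     (\<forall>a<n. (\<forall>x\<in>S. (\<lambda>t. f (x(a := t))) differentiable (at (x a))) \<and> Ck_on k n S (pderiv_at a f))"

definition smooth_on :: "nat \<Rightarrow> (nat \<Rightarrow> real) set \<Rightarrow> ((nat \<Rightarrow> real) \<Rightarrow> real) \<Rightarrow> bool" where
  "smooth_on n S f \<longleftrightarrow> (\<forall>k. Ck_on k n S f)"

section \<open>Smooth manifolds\<close>

record ('p, 'i) mfd =
  dim :: nat
  idx :: "'i set"
  dom :: "'i \<Rightarrow> 'p set"
  chart :: "'i \<Rightarrow> 'p \<Rightarrow> nat \<Rightarrow> real"

definition pts :: "('p, 'i) mfd \<Rightarrow> 'p set" where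
  "pts N = (\<Union>i\<in>idx N. dom N i)"

abbreviation chart_inv :: "('p, 'i) mfd \<Rightarrow> 'i \<Rightarrow> (nat \<Rightarrow> real) \<Rightarrow> 'p" where
  "chart_inv N i \<equiv> inv_into (dom N i) (chart N i)"

definition mtop :: "('p, 'i) mfd \<Rightarrow> 'p topology" where
  "mtop N = topology (\<lambda>W. W \<subseteq> pts N \<and>
     (\<forall>i\<in>idx N. openin (Euclidean_space (dim N)) (chart N i ` (W \<inter> dom N i))))"

definition smooth_atlas :: "('p, 'i) mfd \<Rightarrow> bool" where
  "smooth_atlas N \<longleftrightarrow>
     (\<forall>i\<in>idx N. inj_on (chart N i) (dom N i)) \<and>
     (\<forall>i\<in>idx N. \<forall>j\<in>idx N.
        openin (Euclidean_space (dim N)) (chart N i ` (dom N i \<inter> dom N j)) \<and>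
        (\<forall>a<dim N. smooth_on (dim N) (chart N i ` (dom N i \<inter> dom N j))
           (\<lambda>x. chart N j (chart_inv N i x) a)))"

definition smooth_manifold :: "('p, 'i) mfd \<Rightarrow> bool" where
  "smooth_manifold N \<longleftrightarrow>
     smooth_atlas N \<and> Hausdorff_space (mtop N) \<and> second_countable (mtop N)"

section \<open>Tangent vectors, vector fields and brackets\<close>

text \<open>
  A tangent vector at \<open>p\<close> is the family, over all charts around \<open>p\<close>, of its coordinate
  vectors, which are related by the Jacobians of the transition maps.  Entries which carry no
  information (charts not containing \<open>p\<close>, coordinates beyond the dimension) are \<open>0\<close>, so
  that equality of tangent vectors is equality of families.
\<close>

type_synonym 'i tvec = "'i \<Rightarrow> nat \<Rightarrow> real"
type_synonym ('p, 'i) vfield = "'p \<Rightarrow> 'i tvec"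

definition jac :: "('p, 'i) mfd \<Rightarrow> 'i \<Rightarrow> 'i \<Rightarrow> 'p \<Rightarrow> nat \<Rightarrow> nat \<Rightarrow> real" where
  "jac N i j p a b = pderiv_at b (\<lambda>x. chart N j (chart_inv N i x) a) (chart N i p)"

definition tspace :: "('p, 'i) mfd \<Rightarrow> 'p \<Rightarrow> 'i tvec set" where
  "tspace N p = {v.
     (\<forall>i j a. i \<in> idx N \<and> j \<in> idx N \<and> p \<in> dom N i \<inter> dom N j \<and> a < dim N \<longrightarrow>
        v j a = (\<Sum>b<dim N. jac N i j p a b * v i b)) \<and>
     (\<forall>i a. \<not> (i \<in> idx N \<and> p \<in> dom N i \<and> a < dim N) \<longrightarrow> v i a = 0)}"

definition tscale :: "real \<Rightarrow> 'i tvec \<Rightarrow> 'i tvec" where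
  "tscale c v = (\<lambda>i a. c * v i a)"

definition smooth_fun :: "('p, 'i) mfd \<Rightarrow> 'p set \<Rightarrow> ('p \<Rightarrow> real) \<Rightarrow> bool" where
  "smooth_fun N W f \<longleftrightarrow>
     (\<forall>i\<in>idx N. smooth_on (dim N) (chart N i ` (W \<inter> dom N i)) (\<lambda>x. f (chart_inv N i x)))"

definition vfields :: "('p, 'i) mfd \<Rightarrow> 'p set \<Rightarrow> ('p, 'i) vfield set" where
  "vfields N W = {X. (\<forall>p\<in>W. X p \<in> tspace N p) \<and>
     (\<forall>i\<in>idx N. \<forall>a<dim N. smooth_fun N (W \<inter> dom N i) (\<lambda>p. X p i a))}"

definition deriv_in_chart ::
  "('p, 'i) mfd \<Rightarrow> 'i \<Rightarrow> ('p, 'i) vfield \<Rightarrow> ('p \<Rightarrow> real) \<Rightarrow> 'p \<Rightarrow> real" where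
  "deriv_in_chart N i X f p =
     (\<Sum>a<dim N. X p i a * pderiv_at a (\<lambda>x. f (chart_inv N i x)) (chart N i p))"

definition lie_deriv :: "('p, 'i) mfd \<Rightarrow> ('p, 'i) vfield \<Rightarrow> ('p \<Rightarrow> real) \<Rightarrow> 'p \<Rightarrow> real" where
  "lie_deriv N X f p = deriv_in_chart N (SOME i. i \<in> idx N \<and> p \<in> dom N i) X f p"

definition bracket ::
  "('p, 'i) mfd \<Rightarrow> ('p, 'i) vfield \<Rightarrow> ('p, 'i) vfield \<Rightarrow> ('p, 'i) vfield" where
  "bracket N X Y = (\<lambda>p i a.
     if i \<in> idx N \<and> p \<in> dom N i \<and> a < dim N
     then deriv_in_chart N i X (\<lambda>q. Y q i a) p - deriv_in_chart N i Y (\<lambda>q. X q i a) p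
     else 0)"

definition coord_field :: "('p, 'i) mfd \<Rightarrow> 'i \<Rightarrow> nat \<Rightarrow> ('p, 'i) vfield" where
  "coord_field N i b = (\<lambda>p j a.
     if j \<in> idx N \<and> p \<in> dom N j \<and> a < dim N then jac N i j p a b else 0)"

section \<open>Connections\<close>

text \<open>
  A connection acts on vector fields defined on open subsets (as the sheaf morphism induced by
  an operator on global fields).  Since HOL functions are total, a local field on \<open>W\<close> is a
  function that is smooth on \<open>W\<close>, and only its values on \<open>W\<close> may matter there.
\<close>

type_synonym ('p, 'i) cnx = "('p, 'i) vfield \<Rightarrow> ('p, 'i) vfield \<Rightarrow> ('p, 'i) vfield"

definition connection :: "('p, 'i) mfd \<Rightarrow> ('p, 'i) cnx \<Rightarrow> bool" where
  "connection N nab \<longleftrightarrow> (\<forall>W. openin (mtop N) W \<longrightarrow>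
     (\<forall>X\<in>vfields N W. \<forall>Y\<in>vfields N W. nab X Y \<in> vfields N W) \<and>
     (\<forall>X\<in>vfields N W. \<forall>Y\<in>vfields N W. \<forall>X'\<in>vfields N W. \<forall>Y'\<in>vfields N W.
        (\<forall>p\<in>W. X p = X' p \<and> Y p = Y' p) \<longrightarrow> (\<forall>p\<in>W. nab X Y p = nab X' Y' p)) \<and>
     (\<forall>X\<in>vfields N W. \<forall>Y\<in>vfields N W. \<forall>Z\<in>vfields N W. \<forall>p\<in>W.
        nab (X + Y) Z p = nab X Z p + nab Y Z p \<and>
        nab X (Y + Z) p = nab X Y p + nab X Z p) \<and>
     (\<forall>X\<in>vfields N W. \<forall>Y\<in>vfields N W. \<forall>f. smooth_fun N W f \<longrightarrow> (\<forall>p\<in>W.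
        nab (\<lambda>q. tscale (f q) (X q)) Y p = tscale (f p) (nab X Y p) \<and>
        nab X (\<lambda>q. tscale (f q) (Y q)) p =
          tscale (f p) (nab X Y p) + tscale (lie_deriv N X f p) (Y p))))"

definition torsion_free :: "('p, 'i) mfd \<Rightarrow> ('p, 'i) cnx \<Rightarrow> bool" where
  "torsion_free N nab \<longleftrightarrow> (\<forall>W. openin (mtop N) W \<longrightarrow>
     (\<forall>X\<in>vfields N W. \<forall>Y\<in>vfields N W. \<forall>p\<in>W. nab X Y p - nab Y X p = bracket N X Y p))"

definition curvature ::
  "('p, 'i) mfd \<Rightarrow> ('p, 'i) cnx \<Rightarrow> ('p, 'i) vfield \<Rightarrow> ('p, 'i) vfield \<Rightarrow> ('p, 'i) vfield \<Rightarrow> ('p, 'i) vfield"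
  where
  "curvature N nab X Y Z = nab (bracket N X Y) Z - nab X (nab Y Z) + nab Y (nab X Z)"

definition flat :: "('p, 'i) mfd \<Rightarrow> ('p, 'i) cnx \<Rightarrow> bool" where
  "flat N nab \<longleftrightarrow> (\<forall>W. openin (mtop N) W \<longrightarrow>
     (\<forall>X\<in>vfields N W. \<forall>Y\<in>vfields N W. \<forall>Z\<in>vfields N W. \<forall>p\<in>W. curvature N nab X Y Z p = 0))"

section \<open>Riemannian metrics\<close>

type_synonym ('p, 'i) metr = "'p \<Rightarrow> 'i tvec \<Rightarrow> 'i tvec \<Rightarrow> real"

definition riemannian :: "('p, 'i) mfd \<Rightarrow> ('p, 'i) metr \<Rightarrow> bool" where
  "riemannian N g \<longleftrightarrow>
     (\<forall>p\<in>pts N. \<forall>u\<in>tspace N p. \<forall>v\<in>tspace N p.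
        g p u v = g p v u \<and> (u \<noteq> 0 \<longrightarrow> g p u u > 0) \<and>
        (\<forall>w\<in>tspace N p. g p (u + v) w = g p u w + g p v w) \<and>
        (\<forall>c. g p (tscale c u) v = c * g p u v)) \<and>
     (\<forall>W. openin (mtop N) W \<longrightarrow>
        (\<forall>X\<in>vfields N W. \<forall>Y\<in>vfields N W. smooth_fun N W (\<lambda>p. g p (X p) (Y p))))"

definition is_levi_civita :: "('p, 'i) mfd \<Rightarrow> ('p, 'i) metr \<Rightarrow> ('p, 'i) cnx \<Rightarrow> bool" where
  "is_levi_civita N g D \<longleftrightarrow> connection N D \<and> torsion_free N D \<and>
     (\<forall>W. openin (mtop N) W \<longrightarrow>
        (\<forall>X\<in>vfields N W. \<forall>Y\<in>vfields N W. \<forall>Z\<in>vfields N W. \<forall>p\<in>W.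
           lie_deriv N X (\<lambda>q. g q (Y q) (Z q)) p = g p (D X Y p) (Z p) + g p (Y p) (D X Z p)))"

text \<open>
  Unique on smooth fields; only the irrelevant values on other arguments are left open by
  the choice operator.
\<close>

definition levi_civita :: "('p, 'i) mfd \<Rightarrow> ('p, 'i) metr \<Rightarrow> ('p, 'i) cnx" where
  "levi_civita N g = (SOME D. is_levi_civita N g D)"

definition orthonormal_frame ::
  "('p, 'i) mfd \<Rightarrow> ('p, 'i) metr \<Rightarrow> 'p set \<Rightarrow> (nat \<Rightarrow> ('p, 'i) vfield) \<Rightarrow> bool" where
  "orthonormal_frame N g W E \<longleftrightarrow> (\<forall>a<dim N. E a \<in> vfields N W) \<and>
     (\<forall>p\<in>W. \<forall>a<dim N. \<forall>b<dim N. g p (E a p) (E b p) = (if a = b then 1 else 0))"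

definition frame_at :: "('p, 'i) mfd \<Rightarrow> ('p, 'i) metr \<Rightarrow> 'p \<Rightarrow> nat \<Rightarrow> ('p, 'i) vfield" where
  "frame_at N g p = (SOME E. \<exists>W. openin (mtop N) W \<and> p \<in> W \<and> orthonormal_frame N g W E)"

text \<open>
  The tangent vector at \<open>p\<close> that represents, via the metric, the functional \<open>L\<close> of a
  vector field \<open>Z\<close> near \<open>p\<close>; used where a vector is defined by its inner products.
\<close>

definition metric_dual ::
  "('p, 'i) mfd \<Rightarrow> ('p, 'i) metr \<Rightarrow> 'p \<Rightarrow> (('p, 'i) vfield \<Rightarrow> real) \<Rightarrow> 'i tvec" where
  "metric_dual N g p L = (THE v. v \<in> tspace N p \<and>
     (\<forall>W Z. openin (mtop N) W \<and> p \<in> W \<and> Z \<in> vfields N W \<longrightarrow> g p v (Z p) = L Z))"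

section \<open>Affine-Riemann manifolds\<close>

definition affine_riemann :: "('p, 'i) mfd \<Rightarrow> ('p, 'i) cnx \<Rightarrow> ('p, 'i) metr \<Rightarrow> bool" where
  "affine_riemann M nab g \<longleftrightarrow> smooth_manifold M \<and> riemannian M g \<and>
     connection M nab \<and> flat M nab \<and> torsion_free M nab"

definition gam :: "('p, 'i) mfd \<Rightarrow> ('p, 'i) cnx \<Rightarrow> ('p, 'i) metr \<Rightarrow> ('p, 'i) cnx" where
  "gam M nab g X Y = levi_civita M g X Y - nab X Y"

definition gam_star :: "('p, 'i) mfd \<Rightarrow> ('p, 'i) cnx \<Rightarrow> ('p, 'i) metr \<Rightarrow> ('p, 'i) cnx" where
  "gam_star M nab g X Y = (\<lambda>p. metric_dual M g p (\<lambda>Z. g p (Y p) (gam M nab g X Z p)))"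

definition metric_trace ::
  "('p, 'i) mfd \<Rightarrow> ('p, 'i) metr \<Rightarrow> ('p, 'i) cnx \<Rightarrow> ('p, 'i) vfield" where
  "metric_trace M g \<beta> = (\<lambda>p. \<Sum>a<dim M. \<beta> (frame_at M g p a) (frame_at M g p a) p)"

text \<open>Equality of tensors given by their action on smooth local fields.\<close>

definition tensor_eq :: "('p, 'i) mfd \<Rightarrow> ('p, 'i) cnx \<Rightarrow> ('p, 'i) cnx \<Rightarrow> bool" where
  "tensor_eq M \<alpha> \<beta> \<longleftrightarrow> (\<forall>W. openin (mtop M) W \<longrightarrow>
     (\<forall>X\<in>vfields M W. \<forall>Y\<in>vfields M W. \<forall>p\<in>W. \<alpha> X Y p = \<beta> X Y p))"

definition infinitely_balanced :: "('p, 'i) mfd \<Rightarrow> ('p, 'i) cnx \<Rightarrow> ('p, 'i) metr \<Rightarrow> bool" where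
  "infinitely_balanced M nab g \<longleftrightarrow> affine_riemann M nab g \<and>
     (\<forall>p\<in>pts M. metric_trace M g (gam M nab g) p = 0 \<and>
                metric_trace M g (gam_star M nab g) p = 0)"

section \<open>Hermitian manifolds\<close>

type_synonym ('p, 'i) endo = "'p \<Rightarrow> 'i tvec \<Rightarrow> 'i tvec"

definition app :: "('p, 'i) endo \<Rightarrow> ('p, 'i) vfield \<Rightarrow> ('p, 'i) vfield" where
  "app J X = (\<lambda>p. J p (X p))"

definition complex_structure :: "('p, 'i) mfd \<Rightarrow> ('p, 'i) endo \<Rightarrow> bool" where
  "complex_structure N J \<longleftrightarrow>
     (\<forall>p\<in>pts N. \<forall>u\<in>tspace N p. J p u \<in> tspace N p \<and> J p (J p u) = - u \<and>
        (\<forall>v\<in>tspace N p. J p (u + v) = J p u + J p v) \<and>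
        (\<forall>c. J p (tscale c u) = tscale c (J p u))) \<and>
     (\<forall>W. openin (mtop N) W \<longrightarrow> (\<forall>X\<in>vfields N W. app J X \<in> vfields N W)) \<and>
     (\<forall>W. openin (mtop N) W \<longrightarrow> (\<forall>X\<in>vfields N W. \<forall>Y\<in>vfields N W. \<forall>p\<in>W.
        bracket N (app J X) (app J Y) p - bracket N X Y p
          - J p (bracket N (app J X) Y p + bracket N X (app J Y) p) = 0))"

definition hermitian :: "('p, 'i) mfd \<Rightarrow> ('p, 'i) endo \<Rightarrow> ('p, 'i) metr \<Rightarrow> bool" where
  "hermitian N J g \<longleftrightarrow> smooth_manifold N \<and> riemannian N g \<and> complex_structure N J \<and>
     (\<forall>p\<in>pts N. \<forall>u\<in>tspace N p. \<forall>v\<in>tspace N p. g p (J p u) (J p v) = g p u v)"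

definition fund_form ::
  "('p, 'i) endo \<Rightarrow> ('p, 'i) metr \<Rightarrow> ('p, 'i) vfield \<Rightarrow> ('p, 'i) vfield \<Rightarrow> 'p \<Rightarrow> real" where
  "fund_form J g X Y = (\<lambda>p. g p (J p (X p)) (Y p))"

text \<open>Exterior and covariant derivative of 2-forms, by their invariant formulas.\<close>

definition ext_deriv2 ::
  "('p, 'i) mfd \<Rightarrow> (('p, 'i) vfield \<Rightarrow> ('p, 'i) vfield \<Rightarrow> 'p \<Rightarrow> real) \<Rightarrow>
     ('p, 'i) vfield \<Rightarrow> ('p, 'i) vfield \<Rightarrow> ('p, 'i) vfield \<Rightarrow> 'p \<Rightarrow> real" where
  "ext_deriv2 N \<omega> X Y Z p =
     lie_deriv N X (\<omega> Y Z) p + lie_deriv N Y (\<omega> Z X) p + lie_deriv N Z (\<omega> X Y) p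
     - \<omega> (bracket N X Y) Z p - \<omega> (bracket N Y Z) X p - \<omega> (bracket N Z X) Y p"

definition cov_deriv2 ::
  "('p, 'i) mfd \<Rightarrow> ('p, 'i) cnx \<Rightarrow> (('p, 'i) vfield \<Rightarrow> ('p, 'i) vfield \<Rightarrow> 'p \<Rightarrow> real) \<Rightarrow>
     ('p, 'i) vfield \<Rightarrow> ('p, 'i) vfield \<Rightarrow> ('p, 'i) vfield \<Rightarrow> 'p \<Rightarrow> real" where
  "cov_deriv2 N nab \<omega> Z X Y p =
     lie_deriv N Z (\<omega> X Y) p - \<omega> (nab Z X) Y p - \<omega> X (nab Z Y) p"

definition codiff_fund ::
  "('p, 'i) mfd \<Rightarrow> ('p, 'i) endo \<Rightarrow> ('p, 'i) metr \<Rightarrow> ('p, 'i) vfield \<Rightarrow> 'p \<Rightarrow> real" where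
  "codiff_fund N J g X p = - (\<Sum>a<dim N.
     cov_deriv2 N (levi_civita N g) (fund_form J g) (frame_at N g p a) (frame_at N g p a) X p)"

definition lee_form ::
  "('p, 'i) mfd \<Rightarrow> ('p, 'i) endo \<Rightarrow> ('p, 'i) metr \<Rightarrow> ('p, 'i) vfield \<Rightarrow> 'p \<Rightarrow> real" where
  "lee_form N J g X p = - codiff_fund N J g (app J X) p"

definition balanced :: "('p, 'i) mfd \<Rightarrow> ('p, 'i) endo \<Rightarrow> ('p, 'i) metr \<Rightarrow> bool" where
  "balanced N J g \<longleftrightarrow> (\<forall>W. openin (mtop N) W \<longrightarrow>
     (\<forall>X\<in>vfields N W. \<forall>p\<in>W. lee_form N J g X p = 0))"

definition kaehler :: "('p, 'i) mfd \<Rightarrow> ('p, 'i) endo \<Rightarrow> ('p, 'i) metr \<Rightarrow> bool" where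
  "kaehler N J g \<longleftrightarrow> (\<forall>W. openin (mtop N) W \<longrightarrow>
     (\<forall>X\<in>vfields N W. \<forall>Y\<in>vfields N W. \<forall>Z\<in>vfields N W. \<forall>p\<in>W.
        ext_deriv2 N (fund_form J g) X Y Z p = 0))"

definition bismut :: "('p, 'i) mfd \<Rightarrow> ('p, 'i) endo \<Rightarrow> ('p, 'i) metr \<Rightarrow> ('p, 'i) cnx" where
  "bismut N J g X Y = (\<lambda>p. metric_dual N g p (\<lambda>Z. g p (levi_civita N g X Y p) (Z p)
     + 1/2 * ext_deriv2 N (fund_form J g) (app J X) (app J Y) (app J Z) p))"

definition chern :: "('p, 'i) mfd \<Rightarrow> ('p, 'i) endo \<Rightarrow> ('p, 'i) metr \<Rightarrow> ('p, 'i) cnx" where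
  "chern N J g X Y = (\<lambda>p. metric_dual N g p (\<lambda>Z. g p (levi_civita N g X Y p) (Z p)
     - 1/2 * ext_deriv2 N (fund_form J g) (app J X) Y Z p))"

definition ricci_form ::
  "('p, 'i) mfd \<Rightarrow> ('p, 'i) endo \<Rightarrow> ('p, 'i) metr \<Rightarrow> ('p, 'i) cnx \<Rightarrow>
     ('p, 'i) vfield \<Rightarrow> ('p, 'i) vfield \<Rightarrow> 'p \<Rightarrow> real" where
  "ricci_form N J g nab X Y p = 1/2 * (\<Sum>a<dim N.
     g p (curvature N nab X Y (frame_at N g p a) p) (J p (frame_at N g p a p)))"

definition ricci_form_zero ::
  "('p, 'i) mfd \<Rightarrow> ('p, 'i) endo \<Rightarrow> ('p, 'i) metr \<Rightarrow> ('p, 'i) cnx \<Rightarrow> bool" where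
  "ricci_form_zero N J g nab \<longleftrightarrow> (\<forall>W. openin (mtop N) W \<longrightarrow>
     (\<forall>X\<in>vfields N W. \<forall>Y\<in>vfields N W. \<forall>p\<in>W. ricci_form N J g nab X Y p = 0))"

section \<open>The canonical sequence of tangent bundles\<close>

text \<open>
  The type of points is closed under adjoining tangent vectors, so that all iterated tangent
  bundles, whatever the number of iterations, are manifolds over one type.  They are all
  covered by charts with the index set of the original atlas.  A manifold over an arbitrary
  type is obtained via \<open>Base\<close>.
\<close>

datatype ('a, 'i) tpoint = Base 'a | Tan (foot: "('a, 'i) tpoint") (vel: "'i tvec")

type_synonym ('a, 'i) tmfd = "(('a, 'i) tpoint, 'i) mfd"
type_synonym ('a, 'i) tcnx = "(('a, 'i) tpoint, 'i) cnx"
type_synonym ('a, 'i) tmetr = "(('a, 'i) tpoint, 'i) metr"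
type_synonym ('a, 'i) tendo = "(('a, 'i) tpoint, 'i) endo"

definition tangent_bundle :: "('a, 'i) tmfd \<Rightarrow> ('a, 'i) tmfd" where
  "tangent_bundle N = \<lparr> dim = 2 * dim N, idx = idx N,
     dom = (\<lambda>i. {Tan p u | p u. p \<in> dom N i \<and> u \<in> tspace N p}),
     chart = (\<lambda>i \<xi> a. if a < dim N then chart N i (foot \<xi>) a
                       else if a < 2 * dim N then vel \<xi> i (a - dim N) else 0) \<rparr>"

text \<open>
  \<open>christoffel N nab i p c a b\<close> is the \<open>c\<close>-th coordinate, in chart \<open>i\<close>, of the covariant
  derivative of \<open>\<partial>\<^sub>b\<close> along \<open>\<partial>\<^sub>a\<close>.  In the induced coordinates \<open>(x, u)\<close> of the
  tangent bundle, the horizontal lift of \<open>v\<close> is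
  \<open>v\<^sup>a \<partial>/\<partial>x\<^sup>a - \<Gamma>\<^sup>c\<^sub>a\<^sub>b v\<^sup>a u\<^sup>b \<partial>/\<partial>u\<^sup>c\<close> and the vertical lift is
  \<open>v\<^sup>c \<partial>/\<partial>u\<^sup>c\<close>.
\<close>

definition christoffel ::
  "('a, 'i) tmfd \<Rightarrow> ('a, 'i) tcnx \<Rightarrow> 'i \<Rightarrow> ('a, 'i) tpoint \<Rightarrow> nat \<Rightarrow> nat \<Rightarrow> nat \<Rightarrow> real" where
  "christoffel N nab i p c a b = nab (coord_field N i a) (coord_field N i b) p i c"

definition hlift :: "('a, 'i) tmfd \<Rightarrow> ('a, 'i) tcnx \<Rightarrow> ('a, 'i) tendo" where
  "hlift N nab \<xi> v = (\<lambda>i c.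
     if c < dim N then v i c
     else if c < 2 * dim N then
       - (\<Sum>a<dim N. \<Sum>b<dim N. christoffel N nab i (foot \<xi>) (c - dim N) a b * v i a * vel \<xi> i b)
     else 0)"

definition vlift :: "('a, 'i) tmfd \<Rightarrow> ('a, 'i) tendo" where
  "vlift N \<xi> v = (\<lambda>i c. if dim N \<le> c \<and> c < 2 * dim N then v i (c - dim N) else 0)"

text \<open>
  \<open>hpart\<close> and \<open>vpart\<close> are the vectors \<open>x, y\<close> at the foot point of \<open>\<xi>\<close> with
  \<open>w = hlift \<xi> x + vlift \<xi> y\<close> (the differential of the projection and the connector).
\<close>

definition hpart :: "('a, 'i) tmfd \<Rightarrow> 'i tvec \<Rightarrow> 'i tvec" where
  "hpart N w = (\<lambda>i c. if c < dim N then w i c else 0)"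

definition vpart :: "('a, 'i) tmfd \<Rightarrow> ('a, 'i) tcnx \<Rightarrow> ('a, 'i) tendo" where
  "vpart N nab \<xi> w = (\<lambda>i c. if c < dim N then w i (dim N + c)
     + (\<Sum>a<dim N. \<Sum>b<dim N. christoffel N nab i (foot \<xi>) c a b * w i a * vel \<xi> i b) else 0)"

definition hlift_field ::
  "('a, 'i) tmfd \<Rightarrow> ('a, 'i) tcnx \<Rightarrow> (('a, 'i) tpoint, 'i) vfield \<Rightarrow> (('a, 'i) tpoint, 'i) vfield"
  where "hlift_field N nab X = (\<lambda>\<xi>. hlift N nab \<xi> (X (foot \<xi>)))"

definition vlift_field ::
  "('a, 'i) tmfd \<Rightarrow> (('a, 'i) tpoint, 'i) vfield \<Rightarrow> (('a, 'i) tpoint, 'i) vfield"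
  where "vlift_field N X = (\<lambda>\<xi>. vlift N \<xi> (X (foot \<xi>)))"

definition lift_J :: "('a, 'i) tmfd \<Rightarrow> ('a, 'i) tcnx \<Rightarrow> ('a, 'i) tendo" where
  "lift_J N nab \<xi> w = vlift N \<xi> (hpart N w) - hlift N nab \<xi> (vpart N nab \<xi> w)"

definition lift_metric :: "('a, 'i) tmfd \<Rightarrow> ('a, 'i) tcnx \<Rightarrow> ('a, 'i) tmetr \<Rightarrow> ('a, 'i) tmetr" where
  "lift_metric N nab g \<xi> w w' =
     g (foot \<xi>) (hpart N w) (hpart N w') + g (foot \<xi>) (vpart N nab \<xi> w) (vpart N nab \<xi> w')"

definition is_lift_cnx :: "('a, 'i) tmfd \<Rightarrow> ('a, 'i) tcnx \<Rightarrow> ('a, 'i) tcnx \<Rightarrow> bool" where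
  "is_lift_cnx N nab nab1 \<longleftrightarrow> connection (tangent_bundle N) nab1 \<and>
     (\<forall>W. openin (mtop N) W \<longrightarrow> (\<forall>X\<in>vfields N W. \<forall>Y\<in>vfields N W.
        \<forall>\<xi>\<in>pts (tangent_bundle N). foot \<xi> \<in> W \<longrightarrow>
          nab1 (hlift_field N nab X) (hlift_field N nab Y) \<xi> = hlift_field N nab (nab X Y) \<xi> \<and>
          nab1 (hlift_field N nab X) (vlift_field N Y) \<xi> = vlift_field N (nab X Y) \<xi> \<and>
          nab1 (vlift_field N X) (hlift_field N nab Y) \<xi> = 0 \<and>
          nab1 (vlift_field N X) (vlift_field N Y) \<xi> = 0))"

text \<open>
  Lifts of a local frame form a local frame of the tangent bundle, so the conditions determine
  the connection on smooth fields.
\<close>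

definition lift_cnx :: "('a, 'i) tmfd \<Rightarrow> ('a, 'i) tcnx \<Rightarrow> ('a, 'i) tcnx" where
  "lift_cnx N nab = (SOME nab1. is_lift_cnx N nab nab1)"

definition T_mfd :: "('a, 'i) tmfd \<Rightarrow> nat \<Rightarrow> ('a, 'i) tmfd" where
  "T_mfd M k = (tangent_bundle ^^ k) M"

primrec T_cnx :: "('a, 'i) tmfd \<Rightarrow> ('a, 'i) tcnx \<Rightarrow> nat \<Rightarrow> ('a, 'i) tcnx" where
  "T_cnx M nab 0 = nab"
| "T_cnx M nab (Suc k) = lift_cnx (T_mfd M k) (T_cnx M nab k)"

primrec T_metric ::
  "('a, 'i) tmfd \<Rightarrow> ('a, 'i) tcnx \<Rightarrow> ('a, 'i) tmetr \<Rightarrow> nat \<Rightarrow> ('a, 'i) tmetr" where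
  "T_metric M nab g 0 = g"
| "T_metric M nab g (Suc k) = lift_metric (T_mfd M k) (T_cnx M nab k) (T_metric M nab g k)"

text \<open>Meaningful for \<open>k \<ge> 1\<close> only.\<close>

definition T_J :: "('a, 'i) tmfd \<Rightarrow> ('a, 'i) tcnx \<Rightarrow> nat \<Rightarrow> ('a, 'i) tendo" where
  "T_J M nab k = lift_J (T_mfd M (k - 1)) (T_cnx M nab (k - 1))"

text \<open>The defining identities of the almost complex structure and of the metric on lifts.\<close>

lemma hpart_hlift: "v \<in> tspace N p \<Longrightarrow> hpart N (hlift N nab \<xi> v) = v"
  by (auto simp: fun_eq_iff hpart_def hlift_def tspace_def)

lemma hpart_vlift: "hpart N (vlift N \<xi> v) = 0"
  by (auto simp: fun_eq_iff hpart_def vlift_def)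

lemma vpart_hlift: "vpart N nab \<xi> (hlift N nab \<xi> v) = 0"
  by (auto simp: fun_eq_iff vpart_def hlift_def)

lemma vpart_vlift: "v \<in> tspace N p \<Longrightarrow> vpart N nab \<xi> (vlift N \<xi> v) = v"
  by (auto simp: fun_eq_iff vpart_def vlift_def tspace_def)

lemma hlift_zero: "hlift N nab \<xi> 0 = 0" and vlift_zero: "vlift N \<xi> 0 = 0"
  by (auto simp: fun_eq_iff hlift_def vlift_def)

lemma lift_J_hlift: "v \<in> tspace N p \<Longrightarrow> lift_J N nab \<xi> (hlift N nab \<xi> v) = vlift N \<xi> v"
  by (simp add: lift_J_def hpart_hlift vpart_hlift hlift_zero)

lemma lift_J_vlift: "v \<in> tspace N p \<Longrightarrow> lift_J N nab \<xi> (vlift N \<xi> v) = - hlift N nab \<xi> v"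
  by (simp add: lift_J_def hpart_vlift vpart_vlift vlift_zero)

lemma metric_zero:
  assumes "riemannian N g" "p \<in> pts N" "v \<in> tspace N p"
  shows "g p 0 v = 0" "g p v 0 = 0"
proof -
  have z: "(0 :: 'b tvec) \<in> tspace N p" by (simp add: tspace_def)
  have "tscale 0 v = (0 :: 'b tvec)" by (simp add: tscale_def fun_eq_iff)
  with assms show "g p 0 v = 0" unfolding riemannian_def by (metis mult_zero_left)
  with assms z show "g p v 0 = 0" unfolding riemannian_def by metis
qed

lemma lift_metric_lifts:
  assumes "riemannian N g" "foot \<xi> \<in> pts N" "u \<in> tspace N (foot \<xi>)" "v \<in> tspace N (foot \<xi>)"
  shows "lift_metric N nab g \<xi> (hlift N nab \<xi> u) (hlift N nab \<xi> v) = g (foot \<xi>) u v"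
    and "lift_metric N nab g \<xi> (vlift N \<xi> u) (vlift N \<xi> v) = g (foot \<xi>) u v"
    and "lift_metric N nab g \<xi> (hlift N nab \<xi> u) (vlift N \<xi> v) = 0"
proof -
  have z: "(0 :: 'b tvec) \<in> tspace N (foot \<xi>)" by (simp add: tspace_def)
  note mz = metric_zero[OF assms(1,2) assms(3)] metric_zero[OF assms(1,2) assms(4)]
    metric_zero[OF assms(1,2) z]
  show "lift_metric N nab g \<xi> (hlift N nab \<xi> u) (hlift N nab \<xi> v) = g (foot \<xi>) u v"
    "lift_metric N nab g \<xi> (vlift N \<xi> u) (vlift N \<xi> v) = g (foot \<xi>) u v"
    "lift_metric N nab g \<xi> (hlift N nab \<xi> u) (vlift N \<xi> v) = 0"
    using assms(3,4) mz
    by (simp_all add: lift_metric_def hpart_hlift hpart_vlift vpart_hlift vpart_vlift)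
qed

end

theory Submission
  imports Defs
begin

text \<open>
  Write \<open>c(X,Y,Z) = g(\<gamma> X Y, Z)\<close>, which is symmetric in its first two arguments. On horizontal and vertical lifts
  everything upstairs is computed from \<open>\<nabla>\<close> and \<open>c\<close>. With \<open>\<delta> = (\<gamma> - \<gamma>*)/2\<close>, the Levi-Civita derivative of \<open>J\<^sub>1\<close> is
  given by lifts of \<open>\<plusminus> \<delta>\<close>, hence the Lee form is the metric trace of \<open>\<delta>\<close> and the Kaehler condition is \<open>\<gamma> = \<gamma>*\<close>.
  On the lifts of \<open>Y\<close> both the Bismut and the Chern connection act as a metric connection \<open>D\<close> of the base in horizontal
  directions and as \<open>J\<^sub>1\<close> composed with a symmetric endomorphism \<open>A X\<close> in the vertical direction of \<open>X\<close>. The only component of the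
  Ricci form that could survive is therefore a combination of the trace of \<open>A\<close> and of the trace of the commutator of \<open>D\<close> and
  \<open>A\<close>; the first is a trace of \<open>\<gamma>\<close> or \<open>\<gamma>*\<close>, and the second is the derivative of such a trace.
  The difference tensor upstairs has the same traces as \<open>\<gamma>\<close> up to sign, so the hypothesis propagates along the sequence. It is
  self-adjoint only if \<open>c\<close> is totally symmetric and \<open>- c = c\<close>, that is, only if \<open>\<gamma> = 0\<close>.

  All objects are defined on local fields, so the argument runs on germs: an expression that is linear over germs of
  functions is determined by its values on lifts.
\<close>

section \<open>Calculus on open subsets of Euclidean space\<close>

text \<open>Flatness makes horizontal lifts bracket like the fields below: the fibre part of their
  bracket would otherwise contain the curvature of \<open>nab\<close> applied to the velocity. Chern
  and Bismut differ in the pair (D, A) of the overview. For Chern, A X is the self-adjoint part of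
  \<gamma> X and D is \<open>nab\<close> plus that part, so the trace of A is a trace of \<gamma>*.
  For Bismut, D is the Levi-Civita connection and A X Y is \<gamma>* Y X, whose trace is a trace of
  \<gamma>. Hence both traces enter the hypothesis. The main obstacle is that the Levi-Civita
  connection, the frames, the lifted connection and the chart inside \<open>lie_deriv\<close> come
  from the choice operator, and the Chern and Bismut connections from a definite description. They
  can be used only after existence and independence of the choice: by the Koszul formula,
  Gram-Schmidt on germs, a pullback connection and orthonormal expansions. As the dimension grows
  with the iteration, smoothness refers to iterated partial derivatives on sequences vanishing
  beyond \<open>n\<close>, so the chain rule and the symmetry of second derivatives are derived for
  that notion.\<close>

abbreviation eucl :: "nat \<Rightarrow> (nat \<Rightarrow> real) set" where
  "eucl n \<equiv> topspace (Euclidean_space n)"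

lemma eucl_iff: "x \<in> eucl n \<longleftrightarrow> (\<forall>a\<ge>n. x a = 0)"
  by (simp add: topspace_Euclidean_space)

lemma openin_Euclidean_open: "openin (Euclidean_space n) S \<longleftrightarrow> (\<exists>T. open T \<and> S = T \<inter> eucl n)"
proof -
  have "openin (Euclidean_space n) S \<longleftrightarrow> (\<exists>T. open T \<and> S = T \<inter> {x. \<forall>i\<ge>n. x i = 0})"
    unfolding Euclidean_space_def openin_subtopology euclidean_product_topology
    by simp
  then show ?thesis
    by (simp add: topspace_Euclidean_space)
qed

lemma open_box: "open {y :: nat \<Rightarrow> real. \<forall>a<n. \<bar>y a - x a\<bar> < e}"
proof -
  have "{y :: nat \<Rightarrow> real. \<forall>a<n. \<bar>y a - x a\<bar> < e} = (\<Inter>a\<in>{..<n}. (\<lambda>y. y a) -` {x a - e<..<x a + e})"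
    by (auto simp: abs_diff_less_iff)
  also have "open \<dots>"
    by (intro open_INT ballI open_vimage[OF open_greaterThanLessThan] continuous_on_product_coordinates) simp
  finally show ?thesis .
qed

lemma open_contains_box:
  fixes T :: "(nat \<Rightarrow> real) set"
  assumes "open T" "x \<in> T" "x \<in> eucl n"
  shows "\<exists>e>0. \<forall>y\<in>eucl n. (\<forall>a<n. \<bar>y a - x a\<bar> < e) \<longrightarrow> y \<in> T"
proof -
  have "openin (product_topology (\<lambda>i. euclidean) UNIV) T"
    using assms(1) by (simp add: euclidean_product_topology)
  from product_topology_open_contains_basis[OF this assms(2)]
  obtain X where X: "x \<in> (\<Pi>\<^sub>E i\<in>UNIV. X i)" "\<And>i. open (X i)" "finite {i. X i \<noteq> UNIV}"
      "(\<Pi>\<^sub>E i\<in>UNIV. X i) \<subseteq> T"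
    by auto
  have "\<exists>e>0. \<forall>z. \<bar>z - x a\<bar> < e \<longrightarrow> z \<in> X a" for a
    using X(1) X(2)[of a] unfolding open_dist by (auto simp: dist_real_def PiE_iff)
  then obtain d where d: "\<And>a. d a > 0" "\<And>a z. \<bar>z - x a\<bar> < d a \<Longrightarrow> z \<in> X a"
    by metis
  \<comment> \<open>The 1 keeps the set nonempty when \<open>n = 0\<close>.\<close>
  define e where "e = Min (insert 1 (d ` {..<n}))"
  have e: "e > 0" "\<And>a. a < n \<Longrightarrow> e \<le> d a"
    using d(1) by (auto simp: e_def)
  have "y \<in> T" if y: "y \<in> eucl n" "\<forall>a<n. \<bar>y a - x a\<bar> < e" for y
  proof -
    have "y a \<in> X a" for a
    proof (cases "a < n")
      case True
      with y e(2)[of a] show ?thesis by (intro d(2)) fastforce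
    next
      case False
      with y assms(3) have "y a = x a" by (simp add: eucl_iff)
      with X(1) show ?thesis by (auto simp: PiE_iff)
    qed
    with X(4) show ?thesis by (auto simp: PiE_iff)
  qed
  with e(1) show ?thesis by blast
qed

text \<open>Openness in terms of the largest difference among the first \<open>n\<close>
  coordinates. The epsilon arguments of this section use these boxes in place of a metric on
  sequences.\<close>

lemma openin_Euclidean_box:
  "openin (Euclidean_space n) S \<longleftrightarrow> S \<subseteq> eucl n \<and>
     (\<forall>x\<in>S. \<exists>e>0. \<forall>y\<in>eucl n. (\<forall>a<n. \<bar>y a - x a\<bar> < e) \<longrightarrow> y \<in> S)" (is "?L \<longleftrightarrow> ?R")
proof
  assume ?L
  then obtain T where T: "open T" "S = T \<inter> eucl n" by (auto simp: openin_Euclidean_open)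
  show ?R
  proof (intro conjI ballI)
    show "S \<subseteq> eucl n" using T by simp
    fix x assume "x \<in> S"
    then show "\<exists>e>0. \<forall>y\<in>eucl n. (\<forall>a<n. \<bar>y a - x a\<bar> < e) \<longrightarrow> y \<in> S"
      using open_contains_box[OF T(1), of x n] T(2) by fast
  qed
next
  assume R: ?R
  then obtain e where e: "\<And>x. x \<in> S \<Longrightarrow> e x > 0"
      "\<And>x y. x \<in> S \<Longrightarrow> y \<in> eucl n \<Longrightarrow> (\<forall>a<n. \<bar>y a - x a\<bar> < e x) \<Longrightarrow> y \<in> S"
    by metis
  let ?T = "\<Union>x\<in>S. {y. \<forall>a<n. \<bar>y a - x a\<bar> < e x}"
  have "open ?T" by (intro open_UN ballI open_box)
  moreover have "S = ?T \<inter> eucl n"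
  proof (intro equalityI subsetI)
    fix x assume "x \<in> S"
    then show "x \<in> ?T \<inter> eucl n" using R e(1)[of x] by (intro IntI UN_I[of x]) auto
  next
    fix y assume "y \<in> ?T \<inter> eucl n"
    then show "y \<in> S" using e(2) by blast
  qed
  ultimately show ?L by (auto simp: openin_Euclidean_open)
qed

lemma openin_EuclideanD:
  assumes "openin (Euclidean_space n) S" "x \<in> S"
  obtains e where "e > 0" "\<And>y. y \<in> eucl n \<Longrightarrow> (\<And>a. a < n \<Longrightarrow> \<bar>y a - x a\<bar> < e) \<Longrightarrow> y \<in> S"
  using assms unfolding openin_Euclidean_box by metis

lemma continuous_on_box:
  fixes f :: "(nat \<Rightarrow> real) \<Rightarrow> real"
  assumes S: "S \<subseteq> eucl n"
  shows "continuous_on S f \<longleftrightarrow>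
    (\<forall>x\<in>S. \<forall>e>0. \<exists>d>0. \<forall>y\<in>S. (\<forall>a<n. \<bar>y a - x a\<bar> < d) \<longrightarrow> \<bar>f y - f x\<bar> < e)" (is "?L \<longleftrightarrow> ?R")
proof
  assume L: ?L
  show ?R
  proof (intro ballI allI impI)
    fix x and e :: real assume x: "x \<in> S" "e > 0"
    have "open (ball (f x) e)" "f x \<in> ball (f x) e" using x by auto
    with L x obtain A where A: "open A" "x \<in> A" "\<forall>y\<in>S. y \<in> A \<longrightarrow> f y \<in> ball (f x) e"
      unfolding continuous_on_topological by meson
    from open_contains_box[OF A(1,2), of n] x S obtain d where
      "d > 0" "\<forall>y\<in>eucl n. (\<forall>a<n. \<bar>y a - x a\<bar> < d) \<longrightarrow> y \<in> A" by blast
    with A(3) S show "\<exists>d>0. \<forall>y\<in>S. (\<forall>a<n. \<bar>y a - x a\<bar> < d) \<longrightarrow> \<bar>f y - f x\<bar> < e"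
      by (intro exI[of _ d]) (auto simp: dist_real_def abs_minus_commute)
  qed
next
  assume R: ?R
  show ?L
    unfolding continuous_on_topological
  proof (intro ballI allI impI)
    fix x B assume x: "x \<in> S" and B: "open B" "f x \<in> B"
    then obtain e where e: "e > 0" "ball (f x) e \<subseteq> B" by (meson openE)
    from R x e obtain d where d: "d > 0" "\<forall>y\<in>S. (\<forall>a<n. \<bar>y a - x a\<bar> < d) \<longrightarrow> \<bar>f y - f x\<bar> < e" by blast
    show "\<exists>A. open A \<and> x \<in> A \<and> (\<forall>y\<in>S. y \<in> A \<longrightarrow> f y \<in> B)"
      using d e by (intro exI[of _ "{y. \<forall>a<n. \<bar>y a - x a\<bar> < d}"])
        (auto simp: open_box subset_iff dist_real_def abs_minus_commute)
  qed
qed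

section \<open>Partial derivatives on open sets\<close>

lemma eucl_upd: "x \<in> eucl n \<Longrightarrow> a < n \<Longrightarrow> x(a := t) \<in> eucl n"
  by (auto simp: eucl_iff)

lemma eventually_upd_in:
  assumes "openin (Euclidean_space n) S" "x \<in> S" "a < n"
  shows "\<forall>\<^sub>F t in nhds (x a). x(a := t) \<in> S"
proof -
  from openin_EuclideanD[OF assms(1,2)] obtain e where
    e: "e > 0" "\<And>y. y \<in> eucl n \<Longrightarrow> (\<And>a. a < n \<Longrightarrow> \<bar>y a - x a\<bar> < e) \<Longrightarrow> y \<in> S" by blast
  have x: "x \<in> eucl n" using assms(1,2) openin_subset by blast
  show ?thesis
    unfolding eventually_nhds_metric
    using e x assms(3) by (intro exI[of _ e]) (auto simp: dist_real_def intro!: e(2) eucl_upd)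
qed

text \<open>A coordinate line through \<open>x\<close> stays in \<open>S\<close> near
  \<open>x\<close>, as \<open>S\<close> is open in the slice. Partial derivatives therefore depend
  only on the values on \<open>S\<close>.\<close>

lemma pderiv_at_cong:
  assumes "openin (Euclidean_space n) S" "x \<in> S" "a < n" "\<And>y. y \<in> S \<Longrightarrow> f y = h y"
  shows "pderiv_at a f x = pderiv_at a h x"
  unfolding pderiv_at_def
  by (rule deriv_cong_ev) (use eventually_upd_in[OF assms(1-3)] assms(4) in \<open>auto elim: eventually_mono\<close>)

lemma differentiable_upd_cong:
  fixes f h :: "(nat \<Rightarrow> real) \<Rightarrow> real"
  assumes "openin (Euclidean_space n) S" "x \<in> S" "a < n" "\<And>y. y \<in> S \<Longrightarrow> f y = h y"
    and "(\<lambda>t. f (x(a := t))) differentiable (at (x a))"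
  shows "(\<lambda>t. h (x(a := t))) differentiable (at (x a))"
proof -
  from assms(5) obtain D where D: "((\<lambda>t. f (x(a := t))) has_real_derivative D) (at (x a))"
    by (auto simp: real_differentiable_def)
  have "\<forall>\<^sub>F t in nhds (x a). f (x(a := t)) = h (x(a := t))"
    using eventually_upd_in[OF assms(1-3)] assms(4) by (auto elim: eventually_mono)
  with D have "((\<lambda>t. h (x(a := t))) has_real_derivative D) (at (x a))"
    using DERIV_cong_ev[OF refl, of "\<lambda>t. f (x(a := t))" "\<lambda>t. h (x(a := t))"] by blast
  then show ?thesis by (auto simp: real_differentiable_def)
qed

lemma pderiv_at_DERIV:
  fixes f :: "(nat \<Rightarrow> real) \<Rightarrow> real"
  assumes "(\<lambda>t. f (x(a := t))) differentiable (at (x a))"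
  shows "((\<lambda>t. f (x(a := t))) has_real_derivative pderiv_at a f x) (at (x a))"
  using assms unfolding pderiv_at_def by (simp add: DERIV_deriv_iff_real_differentiable)

lemma pderiv_at_DERIV_upd:
  fixes f :: "(nat \<Rightarrow> real) \<Rightarrow> real"
  assumes "(\<lambda>t. f ((x(a := s))(a := t))) differentiable (at ((x(a := s)) a))"
  shows "((\<lambda>t. f (x(a := t))) has_real_derivative pderiv_at a f (x(a := s))) (at s)"
  using pderiv_at_DERIV[of f "x(a := s)" a] assms by simp

lemma pderiv_at_eqI:
  "((\<lambda>t. f (x(a := t))) has_real_derivative D) (at (x a)) \<Longrightarrow> pderiv_at a f x = D"
  unfolding pderiv_at_def by (rule DERIV_imp_deriv)

section \<open>The chain rule for functions with continuous partial derivatives\<close>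

definition C1_on :: "nat \<Rightarrow> (nat \<Rightarrow> real) set \<Rightarrow> ((nat \<Rightarrow> real) \<Rightarrow> real) \<Rightarrow> bool" where
  "C1_on n S f \<longleftrightarrow> (\<forall>a<n. (\<forall>x\<in>S. (\<lambda>t. f (x(a := t))) differentiable (at (x a))) \<and>
     continuous_on S (pderiv_at a f))"

lemma C1_on_DERIV:
  assumes "C1_on n S f" "a < n" "x(a := s) \<in> S"
  shows "((\<lambda>t. f (x(a := t))) has_real_derivative pderiv_at a f (x(a := s))) (at s)"
  using assms unfolding C1_on_def by (intro pderiv_at_DERIV_upd) (auto dest!: spec[of _ a])

text \<open>The increment of a coordinate along a curve may have either sign or vanish, so the mean
  value theorem is phrased with distances from \<open>u\<close> instead of an ordered
  interval.\<close>

lemma mvt_abs: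
  fixes f f' :: "real \<Rightarrow> real"
  assumes "\<And>s. \<bar>s - u\<bar> \<le> \<bar>v - u\<bar> \<Longrightarrow> (f has_real_derivative f' s) (at s)"
  shows "\<exists>s. \<bar>s - u\<bar> \<le> \<bar>v - u\<bar> \<and> f v - f u = f' s * (v - u)"
proof -
  consider "u < v" | "v < u" | "u = v" by linarith
  then show ?thesis
  proof cases
    case 1
    have "\<exists>z. u < z \<and> z < v \<and> f v - f u = (v - u) * f' z"
      by (rule MVT2[OF 1]) (use 1 in \<open>auto intro!: assms\<close>)
    then obtain z where "u < z" "z < v" "f v - f u = (v - u) * f' z" by blast
    then show ?thesis by (intro exI[of _ z]) (auto simp: mult.commute)
  next
    case 2
    have "\<exists>z. v < z \<and> z < u \<and> f u - f v = (u - v) * f' z"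
      by (rule MVT2[OF 2]) (use 2 in \<open>auto intro!: assms\<close>)
    then obtain z where "v < z" "z < u" "f u - f v = (u - v) * f' z" by blast
    then show ?thesis by (intro exI[of _ z]) (auto simp: algebra_simps)
  next
    case 3
    then show ?thesis by auto
  qed
qed

text \<open>Only one coordinate moves at a time, so the mean value theorem applies to each increment.\<close>

lemma C1_on_chain_curve:
  fixes c :: "real \<Rightarrow> nat \<Rightarrow> real"
  assumes T: "openin (Euclidean_space m) T" and F: "C1_on m T F"
    and cT: "c t0 \<in> T" and c: "\<And>t. c t \<in> eucl m"
    and c': "\<And>b. b < m \<Longrightarrow> ((\<lambda>t. c t b) has_real_derivative c' b) (at t0)"
  shows "((\<lambda>t. F (c t)) has_real_derivative (\<Sum>b<m. pderiv_at b F (c t0) * c' b)) (at t0)"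
proof -
  define z where "z k t = (\<lambda>b. if b < k then c t b else c t0 b)" for k :: nat and t
  have z_upd: "z (Suc k) t = (z k t)(k := c t k)" "z k t = (z k t)(k := c t0 k)" for k t
    by (auto simp: z_def fun_eq_iff)
  have zE: "z k t \<in> eucl m" for k t
    using c[of t] c[of t0] by (auto simp: z_def eucl_iff)
  from openin_EuclideanD[OF T cT] obtain r where
    r: "r > 0" "\<And>y. y \<in> eucl m \<Longrightarrow> (\<And>a. a < m \<Longrightarrow> \<bar>y a - c t0 a\<bar> < r) \<Longrightarrow> y \<in> T" by blast
  have near: "\<forall>\<^sub>F t in nhds t0. \<forall>b<m. \<bar>c t b - c t0 b\<bar> < d" if "d > 0" for d
  proof -
    have "\<forall>\<^sub>F t in nhds t0. \<forall>b\<in>{..<m}. \<bar>c t b - c t0 b\<bar> < d"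
    proof (intro eventually_ball_finite ballI)
      fix b assume "b \<in> {..<m}"
      then have "isCont (\<lambda>t. c t b) t0" using c' DERIV_isCont by fastforce
      then have "\<forall>\<^sub>F t in nhds t0. t \<noteq> t0 \<longrightarrow> dist (c t b) (c t0 b) < d"
        using that by (simp add: isCont_def tendsto_iff eventually_at_filter)
      then have "\<forall>\<^sub>F t in nhds t0. dist (c t b) (c t0 b) < d"
        by (rule eventually_mono) (use that in auto)
      then show "\<forall>\<^sub>F t in nhds t0. \<bar>c t b - c t0 b\<bar> < d" by (simp add: dist_real_def)
    qed simp
    then show ?thesis by (rule eventually_mono) auto
  qed
  have "((\<lambda>t. F (z k t)) has_real_derivative (\<Sum>b<k. pderiv_at b F (c t0) * c' b)) (at t0)"
    if "k \<le> m" for k using that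
  proof (induction k)
    case 0
    then show ?case by (simp add: z_def)
  next
    case (Suc k)
    then have k: "k < m" by simp
    let ?Q = "\<lambda>t s. \<bar>s - c t0 k\<bar> \<le> \<bar>c t k - c t0 k\<bar> \<and>
        F (z (Suc k) t) - F (z k t) = pderiv_at k F ((z k t)(k := s)) * (c t k - c t0 k)"
    \<comment> \<open>\<open>\<sigma> t\<close> is the intermediate point of the mean value theorem
      for the move of coordinate \<open>k\<close>. Its explicit value at \<open>t0\<close> makes
      \<open>q t0\<close> the partial derivative at \<open>c t0\<close>.\<close>
    define \<sigma> where "\<sigma> t = (if t = t0 then c t0 k else SOME s. ?Q t s)" for t
    define q where "q t = pderiv_at k F ((z k t)(k := \<sigma> t))" for t
    \<comment> \<open>Every point on the segment in which only coordinate \<open>k\<close> moves is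
      as close to \<open>c t0\<close>, coordinate by coordinate, as \<open>c t\<close> is.\<close>
    have box: "(z k t)(k := s) \<in> T \<and> (\<forall>a<m. \<bar>((z k t)(k := s)) a - c t0 a\<bar> < d)"
      if "\<forall>b<m. \<bar>c t b - c t0 b\<bar> < min d r" "\<bar>s - c t0 k\<bar> \<le> \<bar>c t k - c t0 k\<bar>" "0 < d" for t s d
    proof -
      have "\<bar>((z k t)(k := s)) a - c t0 a\<bar> < min d r" if a: "a < m" for a
      proof (cases "a = k")
        case True
        have "\<bar>c t k - c t0 k\<bar> < min d r" using that(1) k \<open>\<forall>b<m. _\<close> by blast
        with True \<open>\<bar>s - c t0 k\<bar> \<le> _\<close> show ?thesis by simp
      next
        case False
        with a \<open>\<forall>b<m. _\<close> \<open>0 < d\<close> r(1) show ?thesis by (simp add: z_def)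
      qed
      then show ?thesis using zE k by (auto intro!: r(2) eucl_upd)
    qed
    have Q: "?Q t (\<sigma> t)" if t: "\<forall>b<m. \<bar>c t b - c t0 b\<bar> < r" for t
    proof (cases "t = t0")
      case True
      then show ?thesis by (simp add: \<sigma>_def z_def)
    next
      case False
      have "((\<lambda>s. F ((z k t)(k := s))) has_real_derivative pderiv_at k F ((z k t)(k := s))) (at s)"
        if "\<bar>s - c t0 k\<bar> \<le> \<bar>c t k - c t0 k\<bar>" for s
        using box[of t r s] that t r(1) by (intro C1_on_DERIV[OF F k]) auto
      from mvt_abs[of "c t0 k" "c t k", OF this] have "\<exists>s. ?Q t s"
        using z_upd[of k t] by metis
      then show ?thesis using False someI_ex[of "?Q t"] by (simp add: \<sigma>_def)
    qed
    \<comment> \<open>The intermediate point is squeezed towards \<open>c t0\<close>, so the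
      continuity of the partial derivative carries over to \<open>q\<close>, although
      \<open>\<sigma>\<close> itself is an arbitrary choice.\<close>
    have "isCont q t0"
      unfolding isCont_def tendsto_iff
    proof (intro allI impI)
      fix e :: real assume "e > 0"
      have "continuous_on T (pderiv_at k F)" using F k by (simp add: C1_on_def)
      with \<open>e > 0\<close> cT openin_subset[OF T] obtain d where
        d: "d > 0" "\<forall>y\<in>T. (\<forall>a<m. \<bar>y a - c t0 a\<bar> < d) \<longrightarrow> \<bar>pderiv_at k F y - pderiv_at k F (c t0)\<bar> < e"
        by (subst (asm) continuous_on_box) blast+
      have q0: "q t0 = pderiv_at k F (c t0)"
        by (simp add: q_def \<sigma>_def z_def)
      have "\<forall>\<^sub>F t in nhds t0. \<forall>b<m. \<bar>c t b - c t0 b\<bar> < min d r"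
        using d r by (intro near) auto
      then have "\<forall>\<^sub>F t in nhds t0. dist (q t) (q t0) < e"
      proof eventually_elim
        case (elim t)
        then have "\<bar>\<sigma> t - c t0 k\<bar> \<le> \<bar>c t k - c t0 k\<bar>" using Q[of t] by auto
        from box[OF elim this d(1)] d(2) have "\<bar>q t - pderiv_at k F (c t0)\<bar> < e"
          by (auto simp: q_def)
        then show ?case unfolding q0 by (simp add: dist_real_def)
      qed
      then show "\<forall>\<^sub>F t in at t0. dist (q t) (q t0) < e"
        by (auto simp: eventually_at_filter elim: eventually_mono)
    qed
    \<comment> \<open>Caratheodory's form of differentiability: the increment is
      \<open>q t * h t * (t - t0)\<close> with both factors continuous at \<open>t0\<close>. This
      avoids dividing by a coordinate increment that may be zero.\<close>
    from c'[OF k] obtain h where h: "\<And>t. c t k - c t0 k = h t * (t - t0)" "isCont h t0" "h t0 = c' k"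
      unfolding CARAT_DERIV by auto
    have "((\<lambda>t. q t * h t * (t - t0)) has_real_derivative q t0 * h t0) (at t0)"
      unfolding CARAT_DERIV
      by (intro exI[of _ "\<lambda>t. q t * h t"]) (auto intro: continuous_intros h \<open>isCont q t0\<close>)
    moreover have "\<forall>\<^sub>F t in nhds t0. q t * h t * (t - t0) = F (z (Suc k) t) - F (z k t)"
      using near[OF r(1)]
    proof eventually_elim
      case (elim t)
      from Q[OF elim] show ?case by (simp add: q_def h(1) mult.assoc)
    qed
    ultimately have "((\<lambda>t. F (z (Suc k) t) - F (z k t)) has_real_derivative q t0 * h t0) (at t0)"
      using iffD1[OF DERIV_cong_ev[OF refl _ refl]] by fast
    from DERIV_add[OF this Suc.IH] k h(3) show ?case
      by (simp add: q_def \<sigma>_def z_def add.commute)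
  qed
  from this[of m] have "((\<lambda>t. F (z m t)) has_real_derivative (\<Sum>b<m. pderiv_at b F (c t0) * c' b)) (at t0)"
    by simp
  moreover have "z m = c"
    using c by (auto simp: z_def fun_eq_iff eucl_iff)
  ultimately show ?thesis by simp
qed

section \<open>Functions of class Ck and their closure properties\<close>

lemma Ck_on_Suc_C1: "Ck_on (Suc k) n S f \<Longrightarrow> C1_on n S f"
  unfolding C1_on_def by (cases k) auto

lemma Ck_on_continuous: "Ck_on k n S f \<Longrightarrow> continuous_on S f"
  by (cases k) auto

lemma Ck_on_SucD: "Ck_on (Suc k) n S f \<Longrightarrow> Ck_on k n S f"
  by (induction k arbitrary: f) auto

lemma Ck_on_cong:
  assumes S: "openin (Euclidean_space n) S"
  shows "Ck_on k n S f \<Longrightarrow> (\<And>x. x \<in> S \<Longrightarrow> f x = h x) \<Longrightarrow> Ck_on k n S h"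
proof (induction k arbitrary: f h)
  case 0
  then show ?case using continuous_on_cong by force
next
  case (Suc k)
  have "continuous_on S h" using Suc.prems continuous_on_cong[of S S f h] by auto
  moreover have "(\<lambda>t. h (x(a := t))) differentiable (at (x a))" if "a < n" "x \<in> S" for a x
    using differentiable_upd_cong[OF S that(2,1), of f h] Suc.prems that by auto
  moreover have "Ck_on k n S (pderiv_at a h)" if "a < n" for a
    by (rule Suc.IH[of "pderiv_at a f"])
      (use Suc.prems that pderiv_at_cong[OF S _ that Suc.prems(2)] in auto)
  ultimately show ?case by simp
qed

lemma Ck_on_subset: "Ck_on k n S f \<Longrightarrow> S' \<subseteq> S \<Longrightarrow> Ck_on k n S' f"
  by (induction k arbitrary: f) (auto intro: continuous_on_subset)

text \<open>Continuity is local and every partial derivative satisfies the hypothesis again. This is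
  what leads back from germs to smoothness on an open set.\<close>

lemma Ck_on_local:
  assumes S: "S \<subseteq> eucl n"
  shows "(\<And>x. x \<in> S \<Longrightarrow> \<exists>U. openin (Euclidean_space n) U \<and> x \<in> U \<and> Ck_on k n U f) \<Longrightarrow> Ck_on k n S f"
proof (induction k arbitrary: f)
  have cont: "continuous_on S f"
    if "\<And>x. x \<in> S \<Longrightarrow> \<exists>U. openin (Euclidean_space n) U \<and> x \<in> U \<and> continuous_on U f" for f :: "(nat \<Rightarrow> real) \<Rightarrow> real"
    unfolding continuous_on_box[OF S]
  proof (intro ballI allI impI)
    fix x and e :: real assume x: "x \<in> S" "e > 0"
    with that obtain U where U: "openin (Euclidean_space n) U" "x \<in> U" "continuous_on U f" by blast
    from openin_EuclideanD[OF U(1,2)] obtain r where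
      r: "r > 0" "\<And>y. y \<in> eucl n \<Longrightarrow> (\<And>a. a < n \<Longrightarrow> \<bar>y a - x a\<bar> < r) \<Longrightarrow> y \<in> U" by blast
    from U(3) openin_subset[OF U(1)] x(2) U(2) obtain d where
      d: "d > 0" "\<forall>y\<in>U. (\<forall>a<n. \<bar>y a - x a\<bar> < d) \<longrightarrow> \<bar>f y - f x\<bar> < e"
      by (subst (asm) continuous_on_box) blast+
    show "\<exists>d>0. \<forall>y\<in>S. (\<forall>a<n. \<bar>y a - x a\<bar> < d) \<longrightarrow> \<bar>f y - f x\<bar> < e"
      using d r S by (intro exI[of _ "min d r"]) auto
  qed
  {
    case 0
    then show ?case by (simp add: cont)
  next
    case (Suc k)
    show ?case
      unfolding Ck_on.simps
    proof (intro conjI allI impI ballI)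
      show "continuous_on S f" by (rule cont) (use Suc.prems in fastforce)
      fix a assume a: "a < n"
      show "(\<lambda>t. f (x(a := t))) differentiable (at (x a))" if "x \<in> S" for x
        using Suc.prems[OF that] a by auto
      show "Ck_on k n S (pderiv_at a f)"
        by (rule Suc.IH) (use Suc.prems a in fastforce)
    qed
  }
qed

lemma Ck_on_const [simp]: "Ck_on k n S (\<lambda>x. c)"
proof (induction k arbitrary: c)
  case (Suc k)
  have "pderiv_at a (\<lambda>x. c) = (\<lambda>x. 0)" for a by (auto simp: pderiv_at_def)
  with Suc show ?case by simp
qed simp

lemma Ck_on_coord: "Ck_on k n S (\<lambda>x. x b)"
proof -
  have cont: "continuous_on S (\<lambda>x::nat \<Rightarrow> real. x b)"
    by (rule continuous_on_subset[OF continuous_on_product_coordinates subset_UNIV])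
  show ?thesis
proof (cases k)
  case (Suc k')
  have D: "((\<lambda>t. (x(a := t)) b) has_real_derivative (if a = b then 1 else 0)) (at (x a))" for a and x :: "nat \<Rightarrow> real"
    by auto
  then have "pderiv_at a (\<lambda>x. x b) = (\<lambda>x. if a = b then 1 else 0)" for a
    by (intro ext pderiv_at_eqI)
  moreover have "(\<lambda>t. (x(a := t)) b) differentiable (at (x a))" for a and x :: "nat \<Rightarrow> real"
    using D[where a = a and x = x] unfolding real_differentiable_def by blast
  ultimately show ?thesis by (simp add: Suc cont)
qed (simp add: cont)
qed

lemma Ck_on_add:
  assumes S: "openin (Euclidean_space n) S"
  shows "Ck_on k n S f \<Longrightarrow> Ck_on k n S h \<Longrightarrow> Ck_on k n S (\<lambda>x. f x + h x)"
proof (induction k arbitrary: f h)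
  case (Suc k)
  show ?case
    unfolding Ck_on.simps
  proof (intro conjI allI impI ballI)
    show "continuous_on S (\<lambda>x. f x + h x)" using Suc.prems by (auto intro: continuous_intros)
    fix a assume a: "a < n"
    have D: "((\<lambda>t. f (x(a := t)) + h (x(a := t))) has_real_derivative pderiv_at a f x + pderiv_at a h x) (at (x a))"
      if "x \<in> S" for x
      using Suc.prems a that by (intro DERIV_add pderiv_at_DERIV) auto
    show "(\<lambda>t. f (x(a := t)) + h (x(a := t))) differentiable (at (x a))" if "x \<in> S" for x
      using D[OF that] real_differentiable_def by blast
    have "Ck_on k n S (\<lambda>x. pderiv_at a f x + pderiv_at a h x)"
      using Suc.prems a by (intro Suc.IH) auto
    then show "Ck_on k n S (pderiv_at a (\<lambda>x. f x + h x))"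
      by (rule Ck_on_cong[OF S]) (rule pderiv_at_eqI[symmetric, OF D])
  qed
qed (auto intro: continuous_intros)

lemma Ck_on_mult:
  assumes S: "openin (Euclidean_space n) S"
  shows "Ck_on k n S f \<Longrightarrow> Ck_on k n S h \<Longrightarrow> Ck_on k n S (\<lambda>x. f x * h x)"
proof (induction k arbitrary: f h)
  case (Suc k)
  show ?case
    unfolding Ck_on.simps
  proof (intro conjI allI impI ballI)
    show "continuous_on S (\<lambda>x. f x * h x)" using Suc.prems by (auto intro: continuous_intros)
    fix a assume a: "a < n"
    have D: "((\<lambda>t. f (x(a := t)) * h (x(a := t))) has_real_derivative
        f x * pderiv_at a h x + pderiv_at a f x * h x) (at (x a))"
      if "x \<in> S" for x
      using DERIV_mult'[OF pderiv_at_DERIV[of f x a] pderiv_at_DERIV[of h x a]] Suc.prems a that by simp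
    show "(\<lambda>t. f (x(a := t)) * h (x(a := t))) differentiable (at (x a))" if "x \<in> S" for x
      using D[OF that] real_differentiable_def by blast
    have "Ck_on k n S (\<lambda>x. f x * pderiv_at a h x + pderiv_at a f x * h x)"
      using Suc.prems a Ck_on_SucD by (intro Ck_on_add[OF S] Suc.IH) auto
    then show "Ck_on k n S (pderiv_at a (\<lambda>x. f x * h x))"
      by (rule Ck_on_cong[OF S]) (rule pderiv_at_eqI[symmetric, OF D])
  qed
qed (auto intro: continuous_intros)

lemma Ck_on_sum:
  assumes S: "openin (Euclidean_space n) S" and "\<And>i. i \<in> I \<Longrightarrow> Ck_on k n S (f i)"
  shows "Ck_on k n S (\<lambda>x. \<Sum>i\<in>I. f i x)"
  using assms(2) by (induction I rule: infinite_finite_induct) (auto intro: Ck_on_add[OF S])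

text \<open>The derivative of \<open>f\<close> to the power -1/2 is -1/2 times \<open>f'\<close>
  times the cube of that same power, so the induction closes with the product rule alone.
  Gram-Schmidt normalises with this function.\<close>

lemma Ck_on_rsqrt:
  assumes S: "openin (Euclidean_space n) S" and pos: "\<And>x. x \<in> S \<Longrightarrow> f x > 0"
  shows "Ck_on k n S f \<Longrightarrow> Ck_on k n S (\<lambda>x. 1 / sqrt (f x))"
proof (induction k)
  case 0
  then show ?case using pos by (auto intro!: continuous_intros simp: less_imp_neq[symmetric])
next
  case (Suc k)
  let ?r = "\<lambda>x. 1 / sqrt (f x)"
  have IH: "Ck_on k n S ?r" using Suc Ck_on_SucD by blast
  show ?case
    unfolding Ck_on.simps
  proof (intro conjI allI impI ballI)
    show "continuous_on S ?r" using IH Ck_on_continuous by blast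
    fix a assume a: "a < n"
    have D: "((\<lambda>t. 1 / sqrt (f (x(a := t)))) has_real_derivative
        (-1/2) * (pderiv_at a f x * (?r x * (?r x * ?r x)))) (at (x a))" if x: "x \<in> S" for x
    proof -
      have "((\<lambda>t. f (x(a := t))) has_real_derivative pderiv_at a f x) (at (x a))"
        using Suc.prems a x by (intro pderiv_at_DERIV) auto
      moreover have "f x > 0" "sqrt (f x) * sqrt (f x) = f x" using pos[OF x] by auto
      ultimately show ?thesis
        by (auto intro!: derivative_eq_intros simp: field_simps)
    qed
    show "(\<lambda>t. 1 / sqrt (f (x(a := t)))) differentiable (at (x a))" if "x \<in> S" for x
      using D[OF that] real_differentiable_def by blast
    have "Ck_on k n S (\<lambda>x. (-1/2) * (pderiv_at a f x * (?r x * (?r x * ?r x))))"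
      using Suc.prems a IH by (intro Ck_on_mult[OF S]) auto
    then show "Ck_on k n S (pderiv_at a ?r)"
      by (rule Ck_on_cong[OF S]) (rule pderiv_at_eqI[symmetric, OF D])
  qed
qed

text \<open>Padding with zeros places the values of \<open>m\<close> coordinate functions in
  \<open>eucl m\<close>, where the outer function of a composite is differentiated.\<close>

definition tuple :: "nat \<Rightarrow> (nat \<Rightarrow> 'x \<Rightarrow> real) \<Rightarrow> 'x \<Rightarrow> nat \<Rightarrow> real" where
  "tuple m \<phi> x = (\<lambda>b. if b < m then \<phi> b x else 0)"

lemma tuple_eucl [simp]: "tuple m \<phi> x \<in> eucl m"
  by (simp add: tuple_def eucl_iff)

lemma C1_on_chain_DERIV:
  assumes S: "openin (Euclidean_space n) S" and T: "openin (Euclidean_space m) T"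
    and F: "C1_on m T F" and \<phi>: "\<And>b. b < m \<Longrightarrow> C1_on n S (\<phi> b)"
    and x: "x \<in> S" "tuple m \<phi> x \<in> T" and a: "a < n"
  shows "((\<lambda>t. F (tuple m \<phi> (x(a := t)))) has_real_derivative
    (\<Sum>b<m. pderiv_at b F (tuple m \<phi> x) * pderiv_at a (\<phi> b) x)) (at (x a))"
proof -
  have "((\<lambda>t. F (tuple m \<phi> (x(a := t)))) has_real_derivative
    (\<Sum>b<m. pderiv_at b F (tuple m \<phi> (x(a := x a))) * pderiv_at a (\<phi> b) x)) (at (x a))"
  proof (rule C1_on_chain_curve[OF T F])
    fix b assume b: "b < m"
    have "((\<lambda>t. \<phi> b (x(a := t))) has_real_derivative pderiv_at a (\<phi> b) x) (at (x a))"
      using C1_on_DERIV[OF \<phi>[OF b] a, of x "x a"] x by simp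
    then show "((\<lambda>t. tuple m \<phi> (x(a := t)) b) has_real_derivative pderiv_at a (\<phi> b) x) (at (x a))"
      using b by (simp add: tuple_def)
  qed (use x in auto)
  then show ?thesis by simp
qed

text \<open>By the chain rule the partial derivatives are sums of products of composites of the same
  shape. The induction therefore keeps the inner functions fixed and lets \<open>F\<close>
  vary.\<close>

lemma Ck_on_compose:
  assumes S: "openin (Euclidean_space n) S" and T: "openin (Euclidean_space m) T"
    and ST: "\<And>x. x \<in> S \<Longrightarrow> tuple m \<phi> x \<in> T"
  shows "Ck_on k m T F \<Longrightarrow> (\<And>b. b < m \<Longrightarrow> Ck_on k n S (\<phi> b)) \<Longrightarrow> Ck_on k n S (\<lambda>x. F (tuple m \<phi> x))"
proof (induction k arbitrary: F)
  have cont: "continuous_on S (\<lambda>x. F (tuple m \<phi> x))"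
    if "continuous_on T F" "\<And>b. b < m \<Longrightarrow> continuous_on S (\<phi> b)" for F :: "(nat \<Rightarrow> real) \<Rightarrow> real"
  proof (rule continuous_on_compose2[OF that(1)])
    show "continuous_on S (tuple m \<phi>)"
      unfolding tuple_def[abs_def]
    proof (rule continuous_on_coordinatewise_then_product)
      fix i show "continuous_on S (\<lambda>x. if i < m then \<phi> i x else 0)"
        using that(2)[of i] by (cases "i < m") auto
    qed
  qed (use ST in auto)
  {
    case 0
    then show ?case using cont by auto
  next
    case (Suc k)
    show ?case
      unfolding Ck_on.simps
    proof (intro conjI allI impI ballI)
      show "continuous_on S (\<lambda>x. F (tuple m \<phi> x))"
        using Suc.prems cont by auto
      fix a assume a: "a < n"
      have D: "((\<lambda>t. F (tuple m \<phi> (x(a := t)))) has_real_derivative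
          (\<Sum>b<m. pderiv_at b F (tuple m \<phi> x) * pderiv_at a (\<phi> b) x)) (at (x a))" if "x \<in> S" for x
        using Suc.prems Ck_on_Suc_C1 that ST a by (intro C1_on_chain_DERIV[OF S T]) blast+
      show "(\<lambda>t. F (tuple m \<phi> (x(a := t)))) differentiable (at (x a))" if "x \<in> S" for x
        using D[OF that] real_differentiable_def by blast
      have "Ck_on k n S (\<lambda>x. \<Sum>b<m. pderiv_at b F (tuple m \<phi> x) * pderiv_at a (\<phi> b) x)"
        using Suc.prems a Ck_on_SucD by (intro Ck_on_sum[OF S] Ck_on_mult[OF S] Suc.IH) auto
      then show "Ck_on k n S (pderiv_at a (\<lambda>x. F (tuple m \<phi> x)))"
        by (rule Ck_on_cong[OF S]) (rule pderiv_at_eqI[symmetric, OF D])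
    qed
  }
qed

section \<open>Rules for smooth functions and their partial derivatives\<close>

lemma smooth_on_C1: "smooth_on n S f \<Longrightarrow> C1_on n S f"
  unfolding smooth_on_def using Ck_on_Suc_C1 by blast

lemma smooth_on_pderiv: "smooth_on n S f \<Longrightarrow> a < n \<Longrightarrow> smooth_on n S (pderiv_at a f)"
  unfolding smooth_on_def by (metis Ck_on.simps(2))

lemma smooth_on_subset: "smooth_on n S f \<Longrightarrow> S' \<subseteq> S \<Longrightarrow> smooth_on n S' f"
  unfolding smooth_on_def using Ck_on_subset by blast

lemma smooth_on_cong:
  "openin (Euclidean_space n) S \<Longrightarrow> smooth_on n S f \<Longrightarrow> (\<And>x. x \<in> S \<Longrightarrow> f x = h x) \<Longrightarrow> smooth_on n S h"
  unfolding smooth_on_def using Ck_on_cong by blast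

lemma smooth_on_local:
  assumes "S \<subseteq> eucl n" "\<And>x. x \<in> S \<Longrightarrow> \<exists>U. openin (Euclidean_space n) U \<and> x \<in> U \<and> smooth_on n U f"
  shows "smooth_on n S f"
  using assms unfolding smooth_on_def by (meson Ck_on_local)

lemma smooth_on_const: "smooth_on n S (\<lambda>x. c)"
  and smooth_on_coord: "smooth_on n S (\<lambda>x. x b)"
  by (auto simp: smooth_on_def Ck_on_coord)

lemma smooth_on_add:
    "openin (Euclidean_space n) S \<Longrightarrow> smooth_on n S f \<Longrightarrow> smooth_on n S h \<Longrightarrow> smooth_on n S (\<lambda>x. f x + h x)"
  and smooth_on_mult:
    "openin (Euclidean_space n) S \<Longrightarrow> smooth_on n S f \<Longrightarrow> smooth_on n S h \<Longrightarrow> smooth_on n S (\<lambda>x. f x * h x)"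
  by (auto simp: smooth_on_def Ck_on_add Ck_on_mult)

lemma smooth_on_rsqrt:
  "openin (Euclidean_space n) S \<Longrightarrow> smooth_on n S f \<Longrightarrow> (\<And>x. x \<in> S \<Longrightarrow> f x > 0) \<Longrightarrow> smooth_on n S (\<lambda>x. 1 / sqrt (f x))"
  using Ck_on_rsqrt unfolding smooth_on_def by blast

lemma smooth_on_compose:
  assumes "openin (Euclidean_space n) S" "openin (Euclidean_space m) T"
    and "\<And>x. x \<in> S \<Longrightarrow> tuple m \<phi> x \<in> T" "smooth_on m T F" "\<And>b. b < m \<Longrightarrow> smooth_on n S (\<phi> b)"
  shows "smooth_on n S (\<lambda>x. F (tuple m \<phi> x))"
  using Ck_on_compose[OF assms(1-3)] assms(4,5) unfolding smooth_on_def by blast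

lemma pderiv_at_compose:
  assumes "openin (Euclidean_space n) S" "openin (Euclidean_space m) T"
    and "smooth_on m T F" "\<And>b. b < m \<Longrightarrow> smooth_on n S (\<phi> b)"
    and "x \<in> S" "tuple m \<phi> x \<in> T" "a < n"
  shows "pderiv_at a (\<lambda>x. F (tuple m \<phi> x)) x = (\<Sum>b<m. pderiv_at b F (tuple m \<phi> x) * pderiv_at a (\<phi> b) x)"
  using assms smooth_on_C1 by (intro pderiv_at_eqI C1_on_chain_DERIV) blast+

lemma pderiv_at_const: "pderiv_at a (\<lambda>x. c) x = 0"
  by (rule pderiv_at_eqI) auto

lemma pderiv_at_coord: "pderiv_at a (\<lambda>x. x b) x = (if a = b then 1 else 0)"
  by (rule pderiv_at_eqI) auto

lemma smooth_on_DERIV: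
  assumes "smooth_on n S f" "a < n" "x \<in> S"
  shows "((\<lambda>t. f (x(a := t))) has_real_derivative pderiv_at a f x) (at (x a))"
  using C1_on_DERIV[OF smooth_on_C1[OF assms(1)] assms(2), of x "x a"] assms(3) by simp

lemma pderiv_at_add:
  assumes "smooth_on n S f" "smooth_on n S h" "a < n" "x \<in> S"
  shows "pderiv_at a (\<lambda>x. f x + h x) x = pderiv_at a f x + pderiv_at a h x"
  using assms by (intro pderiv_at_eqI DERIV_add smooth_on_DERIV)

lemma pderiv_at_mult:
  assumes "smooth_on n S f" "smooth_on n S h" "a < n" "x \<in> S"
  shows "pderiv_at a (\<lambda>x. f x * h x) x = pderiv_at a f x * h x + f x * pderiv_at a h x"
  using DERIV_mult'[OF smooth_on_DERIV[OF assms(1,3,4)] smooth_on_DERIV[OF assms(2,3,4)]]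
  by (intro pderiv_at_eqI) (simp add: add.commute)

text \<open>Two uses of the mean value theorem: first in direction \<open>a\<close> for the
  increment \<open>\<phi>\<close> taken in direction \<open>b\<close>, then in direction
  \<open>b\<close> for the partial derivative. The left-hand side is symmetric in \<open>a\<close>
  and \<open>b\<close>, the right-hand side is not, which is the point.\<close>

lemma second_difference:
  assumes f: "smooth_on n S f" and ab: "a < n" "b < n" "a \<noteq> b" and h: "0 < h"
    and box: "\<And>s t. \<bar>s\<bar> \<le> h \<Longrightarrow> \<bar>t\<bar> \<le> h \<Longrightarrow> x(a := x a + s, b := x b + t) \<in> S"
  shows "\<exists>s t. 0 < s \<and> s < h \<and> 0 < t \<and> t < h \<and>
    f (x(a := x a + h, b := x b + h)) - f (x(a := x a + h)) - f (x(b := x b + h)) + f x =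
      h * h * pderiv_at b (pderiv_at a f) (x(a := x a + s, b := x b + t))"
proof -
  define \<phi> where "\<phi> s = f (x(b := x b + h, a := s)) - f (x(a := s))" for s
  have in1: "x(b := x b + t, a := s) \<in> S" if "x a \<le> s" "s \<le> x a + h" "0 \<le> t" "t \<le> h" for s t
    using box[of "s - x a" t] that ab(3) by (simp add: fun_upd_twist)
  have in2: "x(a := s) \<in> S" if "x a \<le> s" "s \<le> x a + h" for s
    using in1[of s 0] that h by simp
  have "(\<phi> has_real_derivative
      pderiv_at a f (x(b := x b + h, a := s)) - pderiv_at a f (x(a := s))) (at s)"
    if "x a \<le> s" "s \<le> x a + h" for s
    unfolding \<phi>_def using that h
    by (intro DERIV_diff C1_on_DERIV[OF smooth_on_C1[OF f] ab(1)] in1 in2) auto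
  from MVT2[of "x a" "x a + h" \<phi>, OF _ this] h obtain z where z: "x a < z" "z < x a + h"
    "\<phi> (x a + h) - \<phi> (x a) = h * (pderiv_at a f (x(b := x b + h, a := z)) - pderiv_at a f (x(a := z)))"
    by auto
  have "((\<lambda>t. pderiv_at a f (x(a := z, b := t))) has_real_derivative
      pderiv_at b (pderiv_at a f) (x(a := z, b := t))) (at t)" if "x b \<le> t" "t \<le> x b + h" for t
    using that z in1[of z "t - x b"] ab(3)
    by (intro C1_on_DERIV[OF smooth_on_C1[OF smooth_on_pderiv[OF f ab(1)]] ab(2)])
      (simp add: fun_upd_twist)
  from MVT2[of "x b" "x b + h", OF _ this] h obtain w where w: "x b < w" "w < x b + h"
    "pderiv_at a f (x(a := z, b := x b + h)) - pderiv_at a f (x(a := z, b := x b)) =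
      h * pderiv_at b (pderiv_at a f) (x(a := z, b := w))"
    by auto
  have "x(a := z, b := x b) = x(a := z)" using ab(3) by auto
  with z(3) w(3) ab(3) have "\<phi> (x a + h) - \<phi> (x a) = h * (h * pderiv_at b (pderiv_at a f) (x(a := z, b := w)))"
    by (simp add: fun_upd_twist[of b a])
  moreover have "x(b := x b + h, a := x a) = x(b := x b + h)" using ab(3) by auto
  ultimately show ?thesis
    using z w ab(3) by (intro exI[of _ "z - x a"] exI[of _ "w - x b"])
      (simp add: \<phi>_def algebra_simps fun_upd_twist[of b a])
qed

text \<open>The second difference equals \<open>h * h\<close> times either mixed derivative at some
  point near \<open>x\<close>. Continuity of both mixed derivatives then brings their values at
  \<open>x\<close> within every \<open>e\<close> of each other.\<close>

lemma pderiv_at_commute: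
  assumes S: "openin (Euclidean_space n) S" and f: "smooth_on n S f" and ab: "a < n" "b < n" and x: "x \<in> S"
  shows "pderiv_at a (pderiv_at b f) x = pderiv_at b (pderiv_at a f) x"
proof (cases "a = b")
  case False
  have "\<bar>pderiv_at a (pderiv_at b f) x - pderiv_at b (pderiv_at a f) x\<bar> \<le> e" if "e > 0" for e
  proof -
    from openin_EuclideanD[OF S x] obtain r where
      r: "r > 0" "\<And>y. y \<in> eucl n \<Longrightarrow> (\<And>a. a < n \<Longrightarrow> \<bar>y a - x a\<bar> < r) \<Longrightarrow> y \<in> S" by blast
    have SE: "S \<subseteq> eucl n" using S openin_subset by blast
    have "\<exists>d>0. \<forall>y\<in>S. (\<forall>a<n. \<bar>y a - x a\<bar> < d) \<longrightarrow>
        \<bar>pderiv_at a' (pderiv_at b' f) y - pderiv_at a' (pderiv_at b' f) x\<bar> < e / 2"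
      if "a' < n" "b' < n" for a' b'
    proof -
      have "continuous_on S (pderiv_at a' (pderiv_at b' f))"
        using smooth_on_pderiv[OF smooth_on_pderiv[OF f that(2)] that(1)]
        by (metis smooth_on_def Ck_on.simps(1))
      with x \<open>e > 0\<close> show ?thesis unfolding continuous_on_box[OF SE] by (meson half_gt_zero)
    qed
    from this[OF ab] this[OF ab(2,1)] obtain d d' where
      d: "d > 0" "\<forall>y\<in>S. (\<forall>a<n. \<bar>y a - x a\<bar> < d) \<longrightarrow>
        \<bar>pderiv_at a (pderiv_at b f) y - pderiv_at a (pderiv_at b f) x\<bar> < e / 2" and
      d': "d' > 0" "\<forall>y\<in>S. (\<forall>a<n. \<bar>y a - x a\<bar> < d') \<longrightarrow>
        \<bar>pderiv_at b (pderiv_at a f) y - pderiv_at b (pderiv_at a f) x\<bar> < e / 2"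
      by blast
    \<comment> \<open>Halving the minimum puts the closed box of size \<open>h\<close> inside all
      three open boxes.\<close>
    define h where "h = min r (min d d') / 2"
    have h: "0 < h" "h < r" "h < d" "h < d'" using r(1) d(1) d'(1) by (auto simp: h_def)
    have box: "x(a := x a + s, b := x b + t) \<in> S" if "\<bar>s\<bar> \<le> h" "\<bar>t\<bar> \<le> h" for s t
      using that h r(1) SE x ab False by (intro r(2)) (auto intro!: eucl_upd)
    have box': "x(b := x b + t, a := x a + s) \<in> S" if "\<bar>s\<bar> \<le> h" "\<bar>t\<bar> \<le> h" for s t
      using box[OF that] False by (simp add: fun_upd_twist)
    obtain s t where st: "0 < s" "s < h" "0 < t" "t < h"
      "f (x(a := x a + h, b := x b + h)) - f (x(a := x a + h)) - f (x(b := x b + h)) + f x =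
        h * h * pderiv_at b (pderiv_at a f) (x(a := x a + s, b := x b + t))"
      using second_difference[OF f ab False h(1) box] by blast
    obtain t' s' where st': "0 < s'" "s' < h" "0 < t'" "t' < h"
      "f (x(b := x b + h, a := x a + h)) - f (x(b := x b + h)) - f (x(a := x a + h)) + f x =
        h * h * pderiv_at a (pderiv_at b f) (x(b := x b + t', a := x a + s'))"
      using second_difference[OF f ab(2,1) _ h(1) box'] False by metis
    have "h * h * pderiv_at b (pderiv_at a f) (x(a := x a + s, b := x b + t)) =
        h * h * pderiv_at a (pderiv_at b f) (x(b := x b + t', a := x a + s'))"
      unfolding st(5)[symmetric] st'(5)[symmetric] using False by (simp add: fun_upd_twist[of b a])
    then have "pderiv_at b (pderiv_at a f) (x(a := x a + s, b := x b + t)) =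
        pderiv_at a (pderiv_at b f) (x(b := x b + t', a := x a + s'))"
      using h(1) by simp
    moreover have "\<bar>pderiv_at b (pderiv_at a f) (x(a := x a + s, b := x b + t)) - pderiv_at b (pderiv_at a f) x\<bar> < e / 2"
      using st h by (intro d'(2)[rule_format] box) auto
    moreover have "\<bar>pderiv_at a (pderiv_at b f) (x(b := x b + t', a := x a + s')) - pderiv_at a (pderiv_at b f) x\<bar> < e / 2"
      using st' h by (intro d(2)[rule_format] box') auto
    ultimately show ?thesis by linarith
  qed
  then have "\<bar>pderiv_at a (pderiv_at b f) x - pderiv_at b (pderiv_at a f) x\<bar> \<le> 0"
    by (rule field_le_epsilon) simp
  then show ?thesis by simp
qed simp

section \<open>Germs of functions and vector fields on a manifold\<close>

lemma fun_sum_apply: "(\<Sum>a\<in>A. F a) x = (\<Sum>a\<in>A. F a x)"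
  by (induction A rule: infinite_finite_induct) auto

abbreviation near :: "('p, 'i) mfd \<Rightarrow> 'p \<Rightarrow> ('p \<Rightarrow> bool) \<Rightarrow> bool" where
  "near N p P \<equiv> eventually P (nhdsin (mtop N) p)"

definition sf_at :: "('p, 'i) mfd \<Rightarrow> 'p \<Rightarrow> ('p \<Rightarrow> real) \<Rightarrow> bool" where
  "sf_at N p f \<longleftrightarrow> (\<exists>W. openin (mtop N) W \<and> p \<in> W \<and> smooth_fun N W f)"

definition vf_at :: "('p, 'i) mfd \<Rightarrow> 'p \<Rightarrow> ('p, 'i) vfield \<Rightarrow> bool" where
  "vf_at N p X \<longleftrightarrow> (\<exists>W. openin (mtop N) W \<and> p \<in> W \<and> X \<in> vfields N W)"

definition pd :: "('p, 'i) mfd \<Rightarrow> 'i \<Rightarrow> nat \<Rightarrow> ('p \<Rightarrow> real) \<Rightarrow> 'p \<Rightarrow> real" where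
  "pd N i a f p = pderiv_at a (\<lambda>x. f (chart_inv N i x)) (chart N i p)"

abbreviation fscale :: "('p \<Rightarrow> real) \<Rightarrow> ('p, 'i) vfield \<Rightarrow> ('p, 'i) vfield" where
  "fscale f X \<equiv> (\<lambda>q. tscale (f q) (X q))"

lemma near_near: "near N p P \<Longrightarrow> near N p (\<lambda>q. near N q P)"
  unfolding eventually_nhdsin by blast

lemma jac_pd: "jac N i j p a b = pd N i b (\<lambda>q. chart N j q a) p"
  by (simp add: jac_def pd_def)

lemma deriv_in_chart_pd: "deriv_in_chart N i X f p = (\<Sum>a<dim N. X p i a * pd N i a f p)"
  by (simp add: deriv_in_chart_def pd_def)

section \<open>Algebra of tangent vectors\<close>

lemma tscale_apply [simp]: "tscale c v i a = c * v i a"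
  by (simp add: tscale_def)

lemma tscale_add_right: "tscale c (u + v) = tscale c u + tscale c v"
  and tscale_add_left: "tscale (c + d) u = tscale c u + tscale d u"
  and tscale_tscale: "tscale c (tscale d u) = tscale (c * d) u"
  and tscale_one [simp]: "tscale 1 u = u"
  and tscale_zero [simp]: "tscale 0 u = 0"
  and tscale_zero_right [simp]: "tscale c 0 = 0"
  and tscale_minus_one: "tscale (-1) u = - u"
  and tscale_diff_right: "tscale c (u - v) = tscale c u - tscale c v"
  and tscale_minus_right: "tscale c (- u) = - tscale c u"
  by (auto simp: fun_eq_iff algebra_simps)

lemma tspace_zero: "0 \<in> tspace N p"
  and tspace_add: "u \<in> tspace N p \<Longrightarrow> v \<in> tspace N p \<Longrightarrow> u + v \<in> tspace N p"
  and tspace_scale: "u \<in> tspace N p \<Longrightarrow> tscale c u \<in> tspace N p"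
proof -
  show "0 \<in> tspace N p" by (simp add: tspace_def)
  show "u + v \<in> tspace N p" if "u \<in> tspace N p" "v \<in> tspace N p"
    using that by (auto simp: tspace_def distrib_left sum.distrib)
  show "tscale c u \<in> tspace N p" if u: "u \<in> tspace N p"
    using u by (auto simp: tspace_def sum_distrib_left mult.left_commute)
qed

lemma tspace_minus: "u \<in> tspace N p \<Longrightarrow> - u \<in> tspace N p"
  using tspace_scale[of u N p "-1"] by (simp add: tscale_minus_one)

lemma tspace_diff: "u \<in> tspace N p \<Longrightarrow> v \<in> tspace N p \<Longrightarrow> u - v \<in> tspace N p"
  using tspace_add[of u N p "- v"] tspace_minus[of v N p] by simp

lemma tspace_sum: "(\<And>a. a \<in> A \<Longrightarrow> F a \<in> tspace N p) \<Longrightarrow> (\<Sum>a\<in>A. F a) \<in> tspace N p"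
  by (induction A rule: infinite_finite_induct) (auto intro: tspace_zero tspace_add)

lemma tspaceI:
  assumes "\<And>i j a. i \<in> idx N \<Longrightarrow> j \<in> idx N \<Longrightarrow> p \<in> dom N i \<Longrightarrow> p \<in> dom N j \<Longrightarrow> a < dim N \<Longrightarrow>
      v j a = (\<Sum>b<dim N. jac N i j p a b * v i b)"
    and "\<And>i a. i \<in> idx N \<longrightarrow> p \<in> dom N i \<longrightarrow> \<not> a < dim N \<Longrightarrow> v i a = 0"
  shows "v \<in> tspace N p"
  using assms unfolding tspace_def by blast

lemma tspace_trans:
  "v \<in> tspace N p \<Longrightarrow> i \<in> idx N \<Longrightarrow> j \<in> idx N \<Longrightarrow> p \<in> dom N i \<Longrightarrow> p \<in> dom N j \<Longrightarrow> a < dim N \<Longrightarrow>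
     v j a = (\<Sum>b<dim N. jac N i j p a b * v i b)"
  by (simp add: tspace_def)

lemma tspace_outside: "v \<in> tspace N p \<Longrightarrow> \<not> (i \<in> idx N \<and> p \<in> dom N i \<and> a < dim N) \<Longrightarrow> v i a = 0"
  by (simp add: tspace_def)

text \<open>The Jacobians recover the coordinates in every other chart around \<open>p\<close>, and
  the remaining entries are 0 by convention.\<close>

lemma tspace_eqI:
  assumes uv: "u \<in> tspace N p" "v \<in> tspace N p" and i: "i \<in> idx N" "p \<in> dom N i"
    and eq: "\<And>a. a < dim N \<Longrightarrow> u i a = v i a"
  shows "u = v"
proof (intro ext)
  fix j a
  show "u j a = v j a"
  proof (cases "j \<in> idx N \<and> p \<in> dom N j \<and> a < dim N")
    case True
    with i eq show ?thesis
      using tspace_trans[OF uv(1) i(1), of j a] tspace_trans[OF uv(2) i(1), of j a] by simp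
  next
    case False
    then show ?thesis using tspace_outside uv by metis
  qed
qed

section \<open>The topology of a manifold given by charts\<close>

locale atlas =
  fixes N :: "('p, 'i) mfd"
  assumes atlas: "smooth_atlas N"
begin

abbreviation "n \<equiv> dim N"

lemma inj_chart: "i \<in> idx N \<Longrightarrow> inj_on (chart N i) (dom N i)"
  and open_overlap: "i \<in> idx N \<Longrightarrow> j \<in> idx N \<Longrightarrow> openin (Euclidean_space n) (chart N i ` (dom N i \<inter> dom N j))"
  and smooth_trans: "i \<in> idx N \<Longrightarrow> j \<in> idx N \<Longrightarrow> a < n \<Longrightarrow>
    smooth_on n (chart N i ` (dom N i \<inter> dom N j)) (\<lambda>x. chart N j (chart_inv N i x) a)"
  using atlas by (auto simp: smooth_atlas_def)

lemma open_chart_image: "i \<in> idx N \<Longrightarrow> openin (Euclidean_space n) (chart N i ` dom N i)"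
  using open_overlap[of i i] by simp

lemma chart_eucl: "i \<in> idx N \<Longrightarrow> p \<in> dom N i \<Longrightarrow> chart N i p \<in> eucl n"
  using open_chart_image openin_subset by blast

lemma chart_inv_chart [simp]: "i \<in> idx N \<Longrightarrow> p \<in> dom N i \<Longrightarrow> chart_inv N i (chart N i p) = p"
  by (simp add: inj_chart)

lemma chart_chart_inv: "x \<in> chart N i ` dom N i \<Longrightarrow> chart N i (chart_inv N i x) = x"
  by (simp add: f_inv_into_f)

lemma chart_image_Int:
  "i \<in> idx N \<Longrightarrow> chart N i ` (V \<inter> W \<inter> dom N i) = chart N i ` (V \<inter> dom N i) \<inter> chart N i ` (W \<inter> dom N i)"
proof -
  assume "i \<in> idx N"
  moreover have "V \<inter> W \<inter> dom N i = (V \<inter> dom N i) \<inter> (W \<inter> dom N i)" by blast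
  ultimately show ?thesis using inj_on_image_Int[OF inj_chart, of i "V \<inter> dom N i" "W \<inter> dom N i"] by simp
qed

text \<open>\<open>mtop\<close> is introduced through \<open>topology\<close>, so its predicate must
  first be shown to define one. Closure under intersection rests on the injectivity of the
  charts.\<close>

lemma openin_mtop:
  "openin (mtop N) W \<longleftrightarrow> W \<subseteq> pts N \<and> (\<forall>i\<in>idx N. openin (Euclidean_space n) (chart N i ` (W \<inter> dom N i)))"
proof -
  let ?P = "\<lambda>W. W \<subseteq> pts N \<and> (\<forall>i\<in>idx N. openin (Euclidean_space n) (chart N i ` (W \<inter> dom N i)))"
  have "istopology ?P"
    unfolding istopology_def
  proof (intro conjI allI impI)
    fix V W assume "?P V" "?P W"
    then show "V \<inter> W \<subseteq> pts N" by blast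
    show "\<forall>i\<in>idx N. openin (Euclidean_space n) (chart N i ` (V \<inter> W \<inter> dom N i))"
      using \<open>?P V\<close> \<open>?P W\<close> by (auto simp: chart_image_Int)
  next
    fix K assume K: "\<forall>W\<in>K. ?P W"
    then show "\<Union>K \<subseteq> pts N" by blast
    have "chart N i ` (\<Union>K \<inter> dom N i) = (\<Union>W\<in>K. chart N i ` (W \<inter> dom N i))" for i by blast
    then show "\<forall>i\<in>idx N. openin (Euclidean_space n) (chart N i ` (\<Union>K \<inter> dom N i))"
      using K by (auto intro!: openin_Union)
  qed
  then show ?thesis by (simp add: mtop_def topology_inverse')
qed

lemma openin_dom: "i \<in> idx N \<Longrightarrow> openin (mtop N) (dom N i)"
proof -
  assume i: "i \<in> idx N"
  have "dom N i \<inter> dom N j = dom N j \<inter> dom N i" for j by blast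
  with i open_overlap show ?thesis by (auto simp: openin_mtop pts_def)
qed

lemma openin_pts: "openin (mtop N) (pts N)"
  unfolding pts_def by (intro openin_Union) (auto simp: openin_dom)

lemma topspace_mtop: "topspace (mtop N) = pts N"
  using openin_pts openin_mtop openin_subset[of "mtop N"] openin_topspace[of "mtop N"] by blast

lemma continuous_on_trans:
  assumes "i \<in> idx N" "j \<in> idx N"
  shows "continuous_on (chart N j ` (dom N j \<inter> dom N i)) (\<lambda>x. chart N i (chart_inv N j x))"
proof (rule continuous_on_coordinatewise_then_product)
  fix a
  show "continuous_on (chart N j ` (dom N j \<inter> dom N i)) (\<lambda>x. chart N i (chart_inv N j x) a)"
  proof (cases "a < n")
    case True
    with smooth_trans[OF assms(2,1)] show ?thesis
      by (metis smooth_on_def Ck_on.simps(1))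
  next
    case False
    have "chart N i (chart_inv N j x) a = 0" if "x \<in> chart N j ` (dom N j \<inter> dom N i)" for x
      using that assms False chart_eucl[OF assms(1)] by (auto simp: eucl_iff)
    then show ?thesis by (simp cong: continuous_on_cong)
  qed
qed

text \<open>Together with \<open>openin_mtop\<close> this makes charts homeomorphisms onto their
  images. Seen in chart \<open>j\<close>, the set is a preimage under the transition map, which is
  continuous.\<close>

lemma openin_chart_preimage:
  assumes i: "i \<in> idx N" and U: "openin (Euclidean_space n) U"
  shows "openin (mtop N) {p \<in> dom N i. chart N i p \<in> U}"
  unfolding openin_mtop
proof (intro conjI ballI)
  show "{p \<in> dom N i. chart N i p \<in> U} \<subseteq> pts N" using i by (auto simp: pts_def)
  fix j assume j: "j \<in> idx N"
  let ?A = "chart N j ` (dom N j \<inter> dom N i)" and ?\<phi> = "\<lambda>x. chart N i (chart_inv N j x)"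
  obtain T where T: "open T" "U = T \<inter> eucl n" using U by (auto simp: openin_Euclidean_open)
  obtain B where B: "open B" "?A = B \<inter> eucl n" using open_overlap[OF j i] by (auto simp: openin_Euclidean_open)
  have "openin (top_of_set ?A) (?A \<inter> ?\<phi> -` T)"
    using continuous_openin_preimage_gen[OF continuous_on_trans[OF i j] T(1)] .
  then obtain T' where T': "open T'" "?A \<inter> ?\<phi> -` T = ?A \<inter> T'" by (auto simp: openin_open)
  have "chart N j ` ({p \<in> dom N i. chart N i p \<in> U} \<inter> dom N j) = ?A \<inter> ?\<phi> -` T"
  proof (intro equalityI subsetI)
    fix x assume "x \<in> chart N j ` ({p \<in> dom N i. chart N i p \<in> U} \<inter> dom N j)"
    then show "x \<in> ?A \<inter> ?\<phi> -` T" using T(2) j by auto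
  next
    fix x assume "x \<in> ?A \<inter> ?\<phi> -` T"
    then obtain p where p: "p \<in> dom N j" "p \<in> dom N i" "x = chart N j p" "?\<phi> x \<in> T" by auto
    then have "chart N i p \<in> U" using T(2) j i chart_eucl by auto
    with p show "x \<in> chart N j ` ({p \<in> dom N i. chart N i p \<in> U} \<inter> dom N j)" by blast
  qed
  \<comment> \<open>The preimage is open relative to the overlap, and the overlap is itself open in
    the slice.\<close>
  also have "\<dots> = (B \<inter> T') \<inter> eucl n" using T'(2) B(2) by blast
  finally show "openin (Euclidean_space n) (chart N j ` ({p \<in> dom N i. chart N i p \<in> U} \<inter> dom N j))"
    using B(1) T'(1) by (auto simp: openin_Euclidean_open)
qed

lemma near_iff: "p \<in> pts N \<Longrightarrow> near N p P \<longleftrightarrow> (\<exists>W. openin (mtop N) W \<and> p \<in> W \<and> (\<forall>q\<in>W. P q))"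
  by (simp add: eventually_nhdsin topspace_mtop)

lemma open_pts: "openin (mtop N) W \<Longrightarrow> p \<in> W \<Longrightarrow> p \<in> pts N"
  using openin_mtop by blast

lemma near_openI: "openin (mtop N) W \<Longrightarrow> p \<in> W \<Longrightarrow> (\<And>q. q \<in> W \<Longrightarrow> P q) \<Longrightarrow> near N p P"
  unfolding eventually_nhdsin by blast

lemma near_dom: "i \<in> idx N \<Longrightarrow> p \<in> dom N i \<Longrightarrow> near N p (\<lambda>q. q \<in> dom N i)"
  by (rule near_openI[OF openin_dom])

lemma near_pts: "p \<in> pts N \<Longrightarrow> near N p (\<lambda>q. q \<in> pts N)"
  by (rule near_openI[OF openin_pts])

lemma near_point: "p \<in> pts N \<Longrightarrow> near N p P \<Longrightarrow> P p"
  by (auto simp: near_iff)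

lemma obtain_chart:
  assumes "p \<in> pts N"
  obtains i where "i \<in> idx N" "p \<in> dom N i"
  using assms by (auto simp: pts_def)

lemma dom_pts: "i \<in> idx N \<Longrightarrow> p \<in> dom N i \<Longrightarrow> p \<in> pts N"
  by (auto simp: pts_def)

section \<open>Germs of smooth functions in charts\<close>

lemma near_chart:
  assumes i: "i \<in> idx N" and p: "p \<in> dom N i" and P: "near N p P"
  obtains U where "openin (Euclidean_space n) U" "chart N i p \<in> U" "U \<subseteq> chart N i ` dom N i"
    "\<forall>x\<in>U. P (chart_inv N i x)"
proof -
  from P i p obtain W where W: "openin (mtop N) W" "p \<in> W" "\<forall>q\<in>W. P q"
    by (auto simp: near_iff dom_pts)
  show thesis
  proof (rule that[of "chart N i ` (W \<inter> dom N i)"])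
    show "openin (Euclidean_space n) (chart N i ` (W \<inter> dom N i))" using W(1) i by (simp add: openin_mtop)
    show "\<forall>x\<in>chart N i ` (W \<inter> dom N i). P (chart_inv N i x)" using W(3) i by auto
  qed (use W p in auto)
qed

text \<open>One chart around \<open>p\<close> suffices to test smoothness: in any other chart the
  function is its composite with a smooth transition map.\<close>

lemma sf_chart:
  assumes i: "i \<in> idx N" and p: "p \<in> dom N i"
  shows "sf_at N p f \<longleftrightarrow> (\<exists>U. openin (Euclidean_space n) U \<and> chart N i p \<in> U \<and> U \<subseteq> chart N i ` dom N i \<and>
    smooth_on n U (\<lambda>x. f (chart_inv N i x)))" (is "?L \<longleftrightarrow> ?R")
proof
  assume ?L
  then obtain W where W: "openin (mtop N) W" "p \<in> W" "smooth_fun N W f" by (auto simp: sf_at_def)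
  show ?R
    using W p i by (intro exI[of _ "chart N i ` (W \<inter> dom N i)"]) (auto simp: openin_mtop smooth_fun_def)
next
  assume ?R
  then obtain U where U: "openin (Euclidean_space n) U" "chart N i p \<in> U" "U \<subseteq> chart N i ` dom N i"
    "smooth_on n U (\<lambda>x. f (chart_inv N i x))" by blast
  let ?W = "{q \<in> dom N i. chart N i q \<in> U}"
  have W: "openin (mtop N) ?W" using openin_chart_preimage[OF i U(1)] .
  have "smooth_fun N ?W f"
    unfolding smooth_fun_def
  proof
    fix j assume j: "j \<in> idx N"
    let ?A = "chart N j ` (?W \<inter> dom N j)" and ?\<phi> = "\<lambda>b x. chart N i (chart_inv N j x) b"
    have A: "openin (Euclidean_space n) ?A" using W j by (simp add: openin_mtop)
    have tup: "tuple n ?\<phi> x = chart N i (chart_inv N j x)" if "x \<in> ?A" for x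
      using that i j chart_eucl[of i] by (auto simp: tuple_def fun_eq_iff eucl_iff)
    have "smooth_on n ?A (\<lambda>x. f (chart_inv N i (tuple n ?\<phi> x)))"
    proof (rule smooth_on_compose[OF A U(1) _ U(4)])
      show "tuple n ?\<phi> x \<in> U" if "x \<in> ?A" for x using tup[OF that] that i j by auto
      show "smooth_on n ?A (?\<phi> b)" if "b < n" for b
        by (rule smooth_on_subset[OF smooth_trans[OF j i that]]) auto
    qed
    then show "smooth_on n ?A (\<lambda>x. f (chart_inv N j x))"
      by (rule smooth_on_cong[OF A]) (use tup i j in auto)
  qed
  with W U(2) p show ?L by (auto simp: sf_at_def)
qed

lemma sf_chartE:
  assumes i: "i \<in> idx N" "p \<in> dom N i" and f: "sf_at N p f"
  obtains U where "openin (Euclidean_space n) U" "chart N i p \<in> U" "U \<subseteq> chart N i ` dom N i"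
    "smooth_on n U (\<lambda>x. f (chart_inv N i x))"
  using f unfolding sf_chart[OF i] by blast

lemma sf_pts: "sf_at N p f \<Longrightarrow> p \<in> pts N"
  by (auto simp: sf_at_def intro: open_pts)

text \<open>The bridge between the definitions, which speak of open sets, and the arguments, which
  speak of germs; \<open>vfields_iff\<close> is its counterpart for vector fields.\<close>

lemma smooth_fun_iff:
  assumes W: "openin (mtop N) W"
  shows "smooth_fun N W f \<longleftrightarrow> (\<forall>p\<in>W. sf_at N p f)"
proof
  assume R: "\<forall>p\<in>W. sf_at N p f"
  show "smooth_fun N W f"
    unfolding smooth_fun_def
  proof
    fix i assume i: "i \<in> idx N"
    show "smooth_on n (chart N i ` (W \<inter> dom N i)) (\<lambda>x. f (chart_inv N i x))"
    proof (rule smooth_on_local)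
      show "chart N i ` (W \<inter> dom N i) \<subseteq> eucl n" using i chart_eucl by auto
      fix x assume "x \<in> chart N i ` (W \<inter> dom N i)"
      then obtain p where "p \<in> W" "p \<in> dom N i" "x = chart N i p" by blast
      with R sf_chart[OF i, of p f] show "\<exists>U. openin (Euclidean_space n) U \<and> x \<in> U \<and> smooth_on n U (\<lambda>x. f (chart_inv N i x))"
        by blast
    qed
  qed
qed (use W in \<open>auto simp: sf_at_def\<close>)

lemma sf_near: "sf_at N p f \<Longrightarrow> near N p (\<lambda>q. sf_at N q f)"
proof -
  assume "sf_at N p f"
  then obtain W where W: "openin (mtop N) W" "p \<in> W" "smooth_fun N W f" by (auto simp: sf_at_def)
  with smooth_fun_iff[OF W(1)] show ?thesis by (auto intro: near_openI[OF W(1,2)])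
qed

lemma sf_common_chart:
  assumes i: "i \<in> idx N" "p \<in> dom N i" and f: "sf_at N p f" and h: "sf_at N p h" and P: "near N p P"
  obtains U where "openin (Euclidean_space n) U" "chart N i p \<in> U" "U \<subseteq> chart N i ` dom N i"
    "smooth_on n U (\<lambda>x. f (chart_inv N i x))" "smooth_on n U (\<lambda>x. h (chart_inv N i x))"
    "\<forall>x\<in>U. P (chart_inv N i x)"
proof -
  from sf_chartE[OF i f] obtain U where U: "openin (Euclidean_space n) U" "chart N i p \<in> U"
    "U \<subseteq> chart N i ` dom N i" "smooth_on n U (\<lambda>x. f (chart_inv N i x))" by blast
  from sf_chartE[OF i h] obtain V where V: "openin (Euclidean_space n) V" "chart N i p \<in> V"
    "V \<subseteq> chart N i ` dom N i" "smooth_on n V (\<lambda>x. h (chart_inv N i x))" by blast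
  obtain A where A: "openin (Euclidean_space n) A" "chart N i p \<in> A"
    "A \<subseteq> chart N i ` dom N i" "\<forall>x\<in>A. P (chart_inv N i x)" by (rule near_chart[OF i P])
  show thesis
  proof (rule that[of "U \<inter> V \<inter> A"])
    show "openin (Euclidean_space n) (U \<inter> V \<inter> A)" using U(1) V(1) A(1) by blast
    show "smooth_on n (U \<inter> V \<inter> A) (\<lambda>x. f (chart_inv N i x))" by (rule smooth_on_subset[OF U(4)]) blast
    show "smooth_on n (U \<inter> V \<inter> A) (\<lambda>x. h (chart_inv N i x))" by (rule smooth_on_subset[OF V(4)]) blast
  qed (use U(2,3) V(2) A(2,4) in auto)
qed

lemma sf_const: "p \<in> pts N \<Longrightarrow> sf_at N p (\<lambda>q. c)"
  by (auto simp: sf_at_def smooth_fun_def smooth_on_const intro!: exI[of _ "pts N"] openin_pts)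

lemma sf_cong: "sf_at N p f \<Longrightarrow> near N p (\<lambda>q. f q = h q) \<Longrightarrow> sf_at N p h"
proof -
  assume f: "sf_at N p f" and P: "near N p (\<lambda>q. f q = h q)"
  from sf_pts[OF f] obtain i where i: "i \<in> idx N" "p \<in> dom N i" by (rule obtain_chart)
  obtain U where U: "openin (Euclidean_space n) U" "chart N i p \<in> U" "U \<subseteq> chart N i ` dom N i"
    "smooth_on n U (\<lambda>x. f (chart_inv N i x))" "smooth_on n U (\<lambda>x. f (chart_inv N i x))" "\<forall>x\<in>U. f (chart_inv N i x) = h (chart_inv N i x)"
    by (rule sf_common_chart[OF i f f P])
  from U(1-3) smooth_on_cong[OF U(1,4) U(6)[rule_format]] show ?thesis unfolding sf_chart[OF i] by blast
qed

lemma sf_add: "sf_at N p f \<Longrightarrow> sf_at N p h \<Longrightarrow> sf_at N p (\<lambda>q. f q + h q)"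
  and sf_mult: "sf_at N p f \<Longrightarrow> sf_at N p h \<Longrightarrow> sf_at N p (\<lambda>q. f q * h q)"
proof -
  assume f: "sf_at N p f" and h: "sf_at N p h"
  from sf_pts[OF f] obtain i where i: "i \<in> idx N" "p \<in> dom N i" by (rule obtain_chart)
  have T: "near N p (\<lambda>_. True)" by simp
  obtain U where U: "openin (Euclidean_space n) U" "chart N i p \<in> U" "U \<subseteq> chart N i ` dom N i"
    "smooth_on n U (\<lambda>x. f (chart_inv N i x))" "smooth_on n U (\<lambda>x. h (chart_inv N i x))" "\<forall>x\<in>U. True"
    by (rule sf_common_chart[OF i f h T])
  from U(1-3) smooth_on_add[OF U(1,4,5)] show "sf_at N p (\<lambda>q. f q + h q)"
    unfolding sf_chart[OF i] by blast
  from U(1-3) smooth_on_mult[OF U(1,4,5)] show "sf_at N p (\<lambda>q. f q * h q)"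
    unfolding sf_chart[OF i] by blast
qed

lemma sf_cmult: "sf_at N p f \<Longrightarrow> sf_at N p (\<lambda>q. c * f q)"
  by (rule sf_mult[OF sf_const[OF sf_pts]])

lemma sf_minus: "sf_at N p f \<Longrightarrow> sf_at N p (\<lambda>q. - f q)"
  using sf_cmult[of p f "-1"] by simp

lemma sf_diff: "sf_at N p f \<Longrightarrow> sf_at N p h \<Longrightarrow> sf_at N p (\<lambda>q. f q - h q)"
  using sf_add[OF _ sf_minus, of p f h] by simp

lemma sf_sum:
  "p \<in> pts N \<Longrightarrow> (\<And>a. a \<in> A \<Longrightarrow> sf_at N p (f a)) \<Longrightarrow> sf_at N p (\<lambda>q. \<Sum>a\<in>A. f a q)"
  by (induction A rule: infinite_finite_induct) (auto intro: sf_const sf_add)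

lemma sf_rsqrt:
  assumes f: "sf_at N p f" and pos: "near N p (\<lambda>q. f q > 0)"
  shows "sf_at N p (\<lambda>q. 1 / sqrt (f q))"
proof -
  from sf_pts[OF f] obtain i where i: "i \<in> idx N" "p \<in> dom N i" by (rule obtain_chart)
  obtain U where U: "openin (Euclidean_space n) U" "chart N i p \<in> U" "U \<subseteq> chart N i ` dom N i"
    "smooth_on n U (\<lambda>x. f (chart_inv N i x))" "smooth_on n U (\<lambda>x. f (chart_inv N i x))" "\<forall>x\<in>U. f (chart_inv N i x) > 0"
    by (rule sf_common_chart[OF i f f pos])
  from U(1-3) smooth_on_rsqrt[OF U(1,4) U(6)[rule_format]] show ?thesis unfolding sf_chart[OF i] by blast
qed

lemma sf_chart_coord:
  assumes j: "j \<in> idx N" "p \<in> dom N j" shows "sf_at N p (\<lambda>q. chart N j q a)"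
proof -
  have "smooth_on n (chart N j ` dom N j) (\<lambda>x. x a)" by (rule smooth_on_coord)
  then have "smooth_on n (chart N j ` dom N j) (\<lambda>x. chart N j (chart_inv N j x) a)"
    by (rule smooth_on_cong[OF open_chart_image[OF j(1)]]) (simp add: chart_chart_inv)
  then show ?thesis unfolding sf_chart[OF j] using j open_chart_image[OF j(1)] by blast
qed

section \<open>Partial derivatives in a chart and change of charts\<close>

lemma pd_cong:
  assumes i: "i \<in> idx N" "p \<in> dom N i" and a: "a < n" and P: "near N p (\<lambda>q. f q = h q)"
  shows "pd N i a f p = pd N i a h p"
proof -
  obtain U where U: "openin (Euclidean_space n) U" "chart N i p \<in> U" "U \<subseteq> chart N i ` dom N i"
    "\<forall>x\<in>U. f (chart_inv N i x) = h (chart_inv N i x)" by (rule near_chart[OF i P])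
  show ?thesis unfolding pd_def by (rule pderiv_at_cong[OF U(1,2) a U(4)[rule_format]])
qed

lemma pd_const: "pd N i a (\<lambda>q. c) p = 0"
  by (simp add: pd_def pderiv_at_const)

lemma pd_add:
  assumes i: "i \<in> idx N" "p \<in> dom N i" and a: "a < n" and f: "sf_at N p f" "sf_at N p h"
  shows "pd N i a (\<lambda>q. f q + h q) p = pd N i a f p + pd N i a h p"
    and "pd N i a (\<lambda>q. f q * h q) p = pd N i a f p * h p + f p * pd N i a h p"
proof -
  have T: "near N p (\<lambda>_. True)" by simp
  obtain U where U: "openin (Euclidean_space n) U" "chart N i p \<in> U" "U \<subseteq> chart N i ` dom N i"
    "smooth_on n U (\<lambda>x. f (chart_inv N i x))" "smooth_on n U (\<lambda>x. h (chart_inv N i x))" "\<forall>x\<in>U. True"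
    by (rule sf_common_chart[OF i f T])
  show "pd N i a (\<lambda>q. f q + h q) p = pd N i a f p + pd N i a h p"
    unfolding pd_def by (rule pderiv_at_add[OF U(4,5) a U(2)])
  show "pd N i a (\<lambda>q. f q * h q) p = pd N i a f p * h p + f p * pd N i a h p"
    unfolding pd_def pderiv_at_mult[OF U(4,5) a U(2)] using i by simp
qed

lemma sf_pd:
  assumes i: "i \<in> idx N" "p \<in> dom N i" and a: "a < n" and f: "sf_at N p f"
  shows "sf_at N p (pd N i a f)"
proof -
  from sf_chartE[OF i f] obtain U where U: "openin (Euclidean_space n) U" "chart N i p \<in> U"
    "U \<subseteq> chart N i ` dom N i" "smooth_on n U (\<lambda>x. f (chart_inv N i x))" by blast
  have "smooth_on n U (\<lambda>x. pd N i a f (chart_inv N i x))"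
    by (rule smooth_on_cong[OF U(1) smooth_on_pderiv[OF U(4) a]])
      (use U(3) in \<open>auto simp: pd_def subset_iff chart_chart_inv\<close>)
  with U show ?thesis unfolding sf_chart[OF i] by blast
qed

lemma pd_commute:
  assumes i: "i \<in> idx N" "p \<in> dom N i" and a: "a < n" and b: "b < n" and f: "sf_at N p f"
  shows "pd N i a (pd N i b f) p = pd N i b (pd N i a f) p"
proof -
  from sf_chartE[OF i f] obtain U where U: "openin (Euclidean_space n) U" "chart N i p \<in> U"
    "U \<subseteq> chart N i ` dom N i" "smooth_on n U (\<lambda>x. f (chart_inv N i x))" by blast
  let ?F = "\<lambda>x. f (chart_inv N i x)"
  have "pd N i a (pd N i b f) p = pderiv_at a (pderiv_at b ?F) (chart N i p)" if "a < n" "b < n" for a b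
    unfolding pd_def using U(3) that
    by (intro pderiv_at_cong[OF U(1,2)]) (auto simp: subset_iff chart_chart_inv)
  with pderiv_at_commute[OF U(1,4) a b U(2)] a b show ?thesis by simp
qed

lemma pd_chart:
  assumes i: "i \<in> idx N" "p \<in> dom N i" and a: "a < n"
  shows "pd N i a (\<lambda>q. chart N i q b) p = (if a = b then 1 else 0)"
proof -
  have "pd N i a (\<lambda>q. chart N i q b) p = pderiv_at a (\<lambda>x. x b) (chart N i p)"
    unfolding pd_def using i a
    by (intro pderiv_at_cong[OF open_chart_image[OF i(1)]]) (auto simp: chart_chart_inv)
  then show ?thesis by (simp add: pderiv_at_coord)
qed

lemma pd_chain:
  assumes i: "i \<in> idx N" "p \<in> dom N i" and j: "j \<in> idx N" "p \<in> dom N j" and b: "b < n" and f: "sf_at N p f"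
  shows "pd N i b f p = (\<Sum>a<n. jac N i j p a b * pd N j a f p)"
proof -
  from sf_chartE[OF j f] obtain U where U: "openin (Euclidean_space n) U" "chart N j p \<in> U"
    "U \<subseteq> chart N j ` dom N j" "smooth_on n U (\<lambda>x. f (chart_inv N j x))" by blast
  let ?W = "{q \<in> dom N j. chart N j q \<in> U}"
  let ?A = "chart N i ` (?W \<inter> dom N i)" and ?\<phi> = "\<lambda>c x. chart N j (chart_inv N i x) c"
  have A: "openin (Euclidean_space n) ?A"
    using openin_chart_preimage[OF j(1) U(1)] i by (simp add: openin_mtop)
  have pA: "chart N i p \<in> ?A" using U(2) i j by blast
  have tup: "tuple n ?\<phi> x = chart N j (chart_inv N i x)" if "x \<in> ?A" for x
    using that i j chart_eucl[of j] by (auto simp: tuple_def fun_eq_iff eucl_iff)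
  have "pd N i b f p = pderiv_at b (\<lambda>x. f (chart_inv N j (tuple n ?\<phi> x))) (chart N i p)"
    unfolding pd_def by (rule pderiv_at_cong[OF A pA b]) (use tup i j in auto)
  also have "\<dots> = (\<Sum>a<n. pderiv_at a (\<lambda>x. f (chart_inv N j x)) (tuple n ?\<phi> (chart N i p)) * pderiv_at b (?\<phi> a) (chart N i p))"
  proof (rule pderiv_at_compose[OF A U(1,4) _ pA _ b])
    show "smooth_on n ?A (?\<phi> c)" if "c < n" for c
      by (rule smooth_on_subset[OF smooth_trans[OF i(1) j(1) that]]) auto
    show "tuple n ?\<phi> (chart N i p) \<in> U" using tup[OF pA] U(2) i by simp
  qed
  finally show ?thesis using tup[OF pA] i by (simp add: jac_def pd_def mult.commute)
qed

lemma jac_refl: "i \<in> idx N \<Longrightarrow> p \<in> dom N i \<Longrightarrow> b < n \<Longrightarrow> jac N i i p a b = (if a = b then 1 else 0)"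
  by (simp add: jac_pd pd_chart eq_commute)

text \<open>The chain rule applied to a coordinate function of chart \<open>k\<close>.\<close>

lemma jac_cocycle:
  assumes "i \<in> idx N" "p \<in> dom N i" "j \<in> idx N" "p \<in> dom N j" "k \<in> idx N" "p \<in> dom N k" "b < n"
  shows "jac N i k p a b = (\<Sum>c<n. jac N j k p a c * jac N i j p c b)"
  unfolding jac_pd[of N i k] using pd_chain[OF assms(1-4,7) sf_chart_coord[OF assms(5,6)]]
  by (simp add: jac_pd mult.commute)

lemma sf_jac:
  "i \<in> idx N \<Longrightarrow> p \<in> dom N i \<Longrightarrow> j \<in> idx N \<Longrightarrow> p \<in> dom N j \<Longrightarrow> b < n \<Longrightarrow> sf_at N p (\<lambda>q. jac N i j q a b)"
  unfolding jac_pd by (rule sf_pd) (auto intro: sf_chart_coord)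

lemma coord_field_self:
  "i \<in> idx N \<Longrightarrow> p \<in> dom N i \<Longrightarrow> b < n \<Longrightarrow> coord_field N i b p i a = (if a = b then 1 else 0)"
  by (auto simp: coord_field_def jac_refl)

lemma coord_field_tspace:
  assumes i: "i \<in> idx N" "p \<in> dom N i" "b < n" shows "coord_field N i b p \<in> tspace N p"
proof (rule tspaceI)
  fix j k a assume "j \<in> idx N" "k \<in> idx N" "p \<in> dom N j" "p \<in> dom N k" "a < n"
  then show "coord_field N i b p k a = (\<Sum>c<n. jac N j k p a c * coord_field N i b p j c)"
    using i by (simp add: coord_field_def jac_cocycle[of i p j k])
qed (auto simp: coord_field_def)

lemma tspace_expand:
  assumes v: "v \<in> tspace N p" and i: "i \<in> idx N" "p \<in> dom N i"
  shows "v = (\<Sum>b<n. tscale (v i b) (coord_field N i b p))"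
proof (rule tspace_eqI[OF v _ i])
  show "(\<Sum>b<n. tscale (v i b) (coord_field N i b p)) \<in> tspace N p"
    using i by (intro tspace_sum tspace_scale coord_field_tspace) auto
  fix a assume "a < n"
  then show "v i a = (\<Sum>b<n. tscale (v i b) (coord_field N i b p)) i a"
    using i by (simp add: fun_sum_apply coord_field_self if_distrib[of "\<lambda>x. _ * x"] sum.delta cong: if_cong)
qed

section \<open>Germs of smooth vector fields\<close>

lemma vf_pts: "vf_at N p X \<Longrightarrow> p \<in> pts N"
  by (auto simp: vf_at_def intro: open_pts)

lemma vf_tspace: "vf_at N p X \<Longrightarrow> X p \<in> tspace N p"
  by (auto simp: vf_at_def vfields_def)

lemma vf_comp: "vf_at N p X \<Longrightarrow> i \<in> idx N \<Longrightarrow> p \<in> dom N i \<Longrightarrow> sf_at N p (\<lambda>q. X q i a)"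
proof (cases "a < n")
  case True
  assume "vf_at N p X" "i \<in> idx N" "p \<in> dom N i"
  then show ?thesis
    using openin_dom[of i] True unfolding vf_at_def vfields_def sf_at_def by blast
next
  case False
  assume X: "vf_at N p X" and "i \<in> idx N" "p \<in> dom N i"
  then obtain W where W: "openin (mtop N) W" "p \<in> W" "\<forall>q\<in>W. X q \<in> tspace N q"
    unfolding vf_at_def vfields_def by blast
  have "near N p (\<lambda>q. 0 = X q i a)"
    by (rule near_openI[OF W(1,2)]) (use W(3) False tspace_outside in metis)
  then show ?thesis by (rule sf_cong[OF sf_const[OF vf_pts[OF X]]])
qed

lemma vf_near: "vf_at N p X \<Longrightarrow> near N p (\<lambda>q. vf_at N q X)"
  unfolding vf_at_def by (auto simp: eventually_nhdsin)

text \<open>Smooth components in one chart are enough, since those in another chart are combinations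
  of them with smooth Jacobian entries.\<close>

lemma vf_atI:
  assumes i: "i \<in> idx N" "p \<in> dom N i" and T: "near N p (\<lambda>q. X q \<in> tspace N q)"
    and S: "\<And>a. a < n \<Longrightarrow> sf_at N p (\<lambda>q. X q i a)"
  shows "vf_at N p X"
proof -
  have "near N p (\<lambda>q. q \<in> dom N i \<and> X q \<in> tspace N q \<and> (\<forall>a\<in>{..<n}. sf_at N q (\<lambda>q. X q i a)))"
    using S by (intro eventually_conj near_dom i T eventually_ball_finite) (auto intro: sf_near)
  then obtain W where W: "openin (mtop N) W" "p \<in> W" and
    P: "\<And>q. q \<in> W \<Longrightarrow> q \<in> dom N i \<and> X q \<in> tspace N q \<and> (\<forall>a<n. sf_at N q (\<lambda>q. X q i a))"
    using i by (auto simp: near_iff dom_pts)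
  have "X \<in> vfields N W"
    unfolding vfields_def
  proof (intro CollectI conjI ballI allI impI)
    show "X q \<in> tspace N q" if "q \<in> W" for q using P that by blast
    fix j a assume j: "j \<in> idx N" and a: "a < n"
    have o: "openin (mtop N) (W \<inter> dom N j)" using W openin_dom[OF j] by blast
    show "smooth_fun N (W \<inter> dom N j) (\<lambda>q. X q j a)"
      unfolding smooth_fun_iff[OF o]
    proof
      fix q assume q: "q \<in> W \<inter> dom N j"
      have "sf_at N q (\<lambda>q. \<Sum>b<n. jac N i j q a b * X q i b)"
        using q P[of q] i j by (intro sf_sum sf_mult sf_jac) (auto simp: dom_pts)
      moreover have "near N q (\<lambda>q. (\<Sum>b<n. jac N i j q a b * X q i b) = X q j a)"
        by (rule near_openI[OF o q]) (use P i j a tspace_trans in fastforce)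
      ultimately show "sf_at N q (\<lambda>q. X q j a)" by (rule sf_cong)
    qed
  qed
  with W show ?thesis by (auto simp: vf_at_def)
qed

lemma vf_near_tspace: "vf_at N p X \<Longrightarrow> near N p (\<lambda>q. X q \<in> tspace N q)"
  by (rule eventually_mono[OF vf_near]) (auto intro: vf_tspace)

lemma vfields_iff:
  assumes W: "openin (mtop N) W"
  shows "X \<in> vfields N W \<longleftrightarrow> (\<forall>p\<in>W. vf_at N p X)"
proof
  assume R: "\<forall>p\<in>W. vf_at N p X"
  have "smooth_fun N (W \<inter> dom N i) (\<lambda>p. X p i a)" if "i \<in> idx N" for i a
  proof -
    have "openin (mtop N) (W \<inter> dom N i)" using W openin_dom[OF that] by blast
    then show ?thesis unfolding smooth_fun_iff[OF \<open>openin (mtop N) (W \<inter> dom N i)\<close>] using R vf_comp that by blast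
  qed
  then show "X \<in> vfields N W" unfolding vfields_def using R vf_tspace by blast
qed (use W in \<open>auto simp: vf_at_def\<close>)

lemma vf_cong: "vf_at N p X \<Longrightarrow> near N p (\<lambda>q. X q = Y q) \<Longrightarrow> vf_at N p Y"
proof -
  assume X: "vf_at N p X" and P: "near N p (\<lambda>q. X q = Y q)"
  obtain i where i: "i \<in> idx N" "p \<in> dom N i" using vf_pts[OF X] by (rule obtain_chart)
  show ?thesis
  proof (rule vf_atI[OF i])
    show "near N p (\<lambda>q. Y q \<in> tspace N q)"
      using P vf_near_tspace[OF X] by eventually_elim simp
    show "sf_at N p (\<lambda>q. Y q i a)" for a
      by (rule sf_cong[OF vf_comp[OF X i]]) (use P in \<open>auto elim: eventually_mono\<close>)
  qed
qed

lemma vf_zero: "p \<in> pts N \<Longrightarrow> vf_at N p (\<lambda>q. 0)"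
  by (elim obtain_chart, rule vf_atI) (auto simp: tspace_zero intro: sf_const dom_pts)

lemma vf_add: "vf_at N p X \<Longrightarrow> vf_at N p Y \<Longrightarrow> vf_at N p (X + Y)"
proof -
  assume X: "vf_at N p X" and Y: "vf_at N p Y"
  obtain i where i: "i \<in> idx N" "p \<in> dom N i" using vf_pts[OF X] by (rule obtain_chart)
  show ?thesis
  proof (rule vf_atI[OF i])
    show "near N p (\<lambda>q. (X + Y) q \<in> tspace N q)"
      using vf_near_tspace[OF X] vf_near_tspace[OF Y] by eventually_elim (simp add: tspace_add)
  qed (use X Y i in \<open>auto intro: sf_add vf_comp\<close>)
qed

lemma vf_scale: "sf_at N p f \<Longrightarrow> vf_at N p X \<Longrightarrow> vf_at N p (fscale f X)"
proof -
  assume f: "sf_at N p f" and X: "vf_at N p X"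
  obtain i where i: "i \<in> idx N" "p \<in> dom N i" using vf_pts[OF X] by (rule obtain_chart)
  show ?thesis
  proof (rule vf_atI[OF i])
    show "near N p (\<lambda>q. tscale (f q) (X q) \<in> tspace N q)"
      using vf_near_tspace[OF X] by eventually_elim (simp add: tspace_scale)
  qed (use f X i in \<open>auto intro: sf_mult vf_comp\<close>)
qed

lemma vf_add': "vf_at N p X \<Longrightarrow> vf_at N p Y \<Longrightarrow> vf_at N p (\<lambda>q. X q + Y q)"
  using vf_add[of p X Y] by (simp add: plus_fun_def[of X Y])

lemma vf_cscale: "vf_at N p X \<Longrightarrow> vf_at N p (\<lambda>q. tscale c (X q))"
  by (rule vf_scale[OF sf_const[OF vf_pts]])

lemma vf_minus: "vf_at N p X \<Longrightarrow> vf_at N p (\<lambda>q. - X q)"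
  using vf_cscale[of p X "-1"] by (simp add: tscale_minus_one)

lemma vf_diff: "vf_at N p X \<Longrightarrow> vf_at N p Y \<Longrightarrow> vf_at N p (\<lambda>q. X q - Y q)"
  using vf_add'[OF _ vf_minus, of p X Y] by simp

lemma vf_diff': "vf_at N p X \<Longrightarrow> vf_at N p Y \<Longrightarrow> vf_at N p (X - Y)"
  using vf_diff[of p X Y] by (simp add: fun_diff_def)

lemma vf_sum:
  "p \<in> pts N \<Longrightarrow> (\<And>a. a \<in> A \<Longrightarrow> vf_at N p (F a)) \<Longrightarrow> vf_at N p (\<lambda>q. \<Sum>a\<in>A. F a q)"
  by (induction A rule: infinite_finite_induct) (auto intro: vf_zero vf_add')

lemma vf_coord: "i \<in> idx N \<Longrightarrow> p \<in> dom N i \<Longrightarrow> b < n \<Longrightarrow> vf_at N p (coord_field N i b)"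
proof (rule vf_atI)
  assume i: "i \<in> idx N" "p \<in> dom N i" "b < n"
  show "near N p (\<lambda>q. coord_field N i b q \<in> tspace N q)"
    by (rule near_openI[OF openin_dom i(2)]) (use i in \<open>auto intro: coord_field_tspace\<close>)
  show "sf_at N p (\<lambda>q. coord_field N i b q i a)" for a
    by (rule sf_cong[OF sf_const[of _ "if a = b then 1 else 0"]])
      (use i in \<open>auto simp: dom_pts coord_field_self intro!: near_openI[OF openin_dom i(2)]\<close>)
qed auto

text \<open>Constant coefficients in a coordinate frame do it. The extension lets pointwise
  statements about vectors be tested on fields, on which all operators are defined.\<close>

lemma vf_extend:
  assumes "p \<in> pts N" "v \<in> tspace N p"
  obtains X where "vf_at N p X" "X p = v"
proof -
  obtain i where i: "i \<in> idx N" "p \<in> dom N i" using assms(1) by (rule obtain_chart)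
  show thesis
  proof (rule that[of "\<lambda>q. \<Sum>b<n. tscale (v i b) (coord_field N i b q)"])
    show "vf_at N p (\<lambda>q. \<Sum>b<n. tscale (v i b) (coord_field N i b q))"
      using i assms(1) by (intro vf_sum vf_cscale vf_coord) auto
  qed (rule tspace_expand[OF assms(2) i, symmetric])
qed

text \<open>\<open>lie_deriv\<close> picks some chart by choice. The Jacobian from the chain rule
  for \<open>f\<close> is absorbed by the transformation law of \<open>X p\<close>, so every chart
  gives the same value.\<close>

lemma lie_chart:
  assumes i: "i \<in> idx N" "p \<in> dom N i" and X: "X p \<in> tspace N p" and f: "sf_at N p f"
  shows "lie_deriv N X f p = (\<Sum>a<n. X p i a * pd N i a f p)"
proof -
  define j where "j = (SOME i. i \<in> idx N \<and> p \<in> dom N i)"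
  have j: "j \<in> idx N" "p \<in> dom N j" using someI[of "\<lambda>i. i \<in> idx N \<and> p \<in> dom N i" i] i by (auto simp: j_def)
  have "(\<Sum>a<n. X p i a * pd N i a f p) = (\<Sum>b<n. X p i b * (\<Sum>a<n. jac N i j p a b * pd N j a f p))"
    by (intro sum.cong refl) (simp add: pd_chain[OF i j _ f])
  also have "\<dots> = (\<Sum>a<n. (\<Sum>b<n. jac N i j p a b * X p i b) * pd N j a f p)"
    unfolding sum_distrib_left sum_distrib_right by (subst sum.swap) (simp add: mult_ac)
  also have "\<dots> = (\<Sum>a<n. X p j a * pd N j a f p)"
    by (intro sum.cong refl) (simp add: tspace_trans[OF X i(1) j(1) i(2) j(2)])
  finally show ?thesis by (simp add: lie_deriv_def j_def[symmetric] deriv_in_chart_pd)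
qed

lemma lie_chart_vf:
  "i \<in> idx N \<Longrightarrow> p \<in> dom N i \<Longrightarrow> vf_at N p X \<Longrightarrow> sf_at N p f \<Longrightarrow>
    lie_deriv N X f p = (\<Sum>a<n. X p i a * pd N i a f p)"
  by (simp add: lie_chart vf_tspace)

lemma lie_cong:
  assumes "p \<in> pts N" "vf_at N p X" "sf_at N p f" "near N p (\<lambda>q. f q = h q)" "X p = Y p"
  shows "lie_deriv N X f p = lie_deriv N Y h p"
proof -
  obtain i where i: "i \<in> idx N" "p \<in> dom N i" using assms(1) by (rule obtain_chart)
  have "sf_at N p h" using assms(3,4) sf_cong by blast
  with assms vf_tspace[OF assms(2)] show ?thesis
    using pd_cong[OF i _ assms(4)] lie_chart[OF i, of X f] lie_chart[OF i, of Y h] by simp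
qed

lemma lie_const: "p \<in> pts N \<Longrightarrow> vf_at N p X \<Longrightarrow> lie_deriv N X (\<lambda>q. c) p = 0"
  by (elim obtain_chart) (simp add: lie_chart vf_tspace sf_const dom_pts pd_const)

lemma lie_add:
  assumes X: "vf_at N p X" and f: "sf_at N p f" "sf_at N p h"
  shows "lie_deriv N X (\<lambda>q. f q + h q) p = lie_deriv N X f p + lie_deriv N X h p"
    and "lie_deriv N X (\<lambda>q. f q * h q) p = lie_deriv N X f p * h p + f p * lie_deriv N X h p"
proof -
  obtain i where i: "i \<in> idx N" "p \<in> dom N i" using sf_pts[OF f(1)] by (rule obtain_chart)
  note L = lie_chart_vf[OF i X]
  show "lie_deriv N X (\<lambda>q. f q + h q) p = lie_deriv N X f p + lie_deriv N X h p"
    using f by (simp add: L sf_add pd_add[OF i] algebra_simps sum.distrib)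
  show "lie_deriv N X (\<lambda>q. f q * h q) p = lie_deriv N X f p * h p + f p * lie_deriv N X h p"
    using f by (simp add: L sf_mult pd_add[OF i] algebra_simps sum.distrib sum_distrib_left)
qed

lemma lie_cmult:
  "vf_at N p X \<Longrightarrow> sf_at N p f \<Longrightarrow> lie_deriv N X (\<lambda>q. c * f q) p = c * lie_deriv N X f p"
  by (simp add: lie_add(2)[OF _ sf_const] sf_pts lie_const)

lemma lie_minus:
  "vf_at N p X \<Longrightarrow> sf_at N p f \<Longrightarrow> lie_deriv N X (\<lambda>q. - f q) p = - lie_deriv N X f p"
  using lie_cmult[of p X f "-1"] by simp

lemma lie_sum:
  assumes "p \<in> pts N" "vf_at N p X" "\<And>a. a \<in> A \<Longrightarrow> sf_at N p (f a)"
  shows "lie_deriv N X (\<lambda>q. \<Sum>a\<in>A. f a q) p = (\<Sum>a\<in>A. lie_deriv N X (f a) p)"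
  using assms(3)
proof (induction A rule: infinite_finite_induct)
  case (insert a A)
  then have "sf_at N p (\<lambda>q. \<Sum>a\<in>A. f a q)" by (intro sf_sum[OF assms(1)]) auto
  with insert show ?case by (simp add: lie_add(1)[OF assms(2)])
qed (auto intro: lie_const assms)

lemma lie_fields:
  assumes f: "sf_at N p f" and X: "vf_at N p X" and Y: "vf_at N p Y"
  shows "lie_deriv N (X + Y) f p = lie_deriv N X f p + lie_deriv N Y f p"
    and "lie_deriv N (fscale h X) f p = h p * lie_deriv N X f p"
    and "lie_deriv N (\<lambda>q. X q + Y q) f p = lie_deriv N X f p + lie_deriv N Y f p"
    and "lie_deriv N (\<lambda>q. X q - Y q) f p = lie_deriv N X f p - lie_deriv N Y f p"
    and "lie_deriv N (\<lambda>q. - X q) f p = - lie_deriv N X f p"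
proof -
  obtain i where i: "i \<in> idx N" "p \<in> dom N i" using sf_pts[OF f] by (rule obtain_chart)
  show "lie_deriv N (X + Y) f p = lie_deriv N X f p + lie_deriv N Y f p"
    "lie_deriv N (fscale h X) f p = h p * lie_deriv N X f p"
    "lie_deriv N (\<lambda>q. X q + Y q) f p = lie_deriv N X f p + lie_deriv N Y f p"
    "lie_deriv N (\<lambda>q. X q - Y q) f p = lie_deriv N X f p - lie_deriv N Y f p"
    "lie_deriv N (\<lambda>q. - X q) f p = - lie_deriv N X f p"
    using vf_tspace[OF X] vf_tspace[OF Y] f by (simp_all add: lie_chart[OF i] tspace_add tspace_scale tspace_diff tspace_minus
        algebra_simps sum.distrib sum_subtractf sum_negf sum_distrib_left)
qed

lemma lie_zero_field: "sf_at N p f \<Longrightarrow> X p = 0 \<Longrightarrow> lie_deriv N X f p = 0"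
  by (rule obtain_chart[OF sf_pts], assumption) (simp add: lie_chart tspace_zero)

lemma near_sf_pd_formula:
  assumes i: "i \<in> idx N" "p \<in> dom N i" and X: "vf_at N p X" and f: "sf_at N p f"
  shows "near N p (\<lambda>q. (\<Sum>a<n. X q i a * pd N i a f q) = lie_deriv N X f q)"
  using near_dom[OF i] vf_near_tspace[OF X] sf_near[OF f]
  by eventually_elim (simp add: lie_chart[OF i(1)])

lemma sf_lie: "vf_at N p X \<Longrightarrow> sf_at N p f \<Longrightarrow> sf_at N p (lie_deriv N X f)"
proof -
  assume X: "vf_at N p X" and f: "sf_at N p f"
  obtain i where i: "i \<in> idx N" "p \<in> dom N i" using sf_pts[OF f] by (rule obtain_chart)
  have "sf_at N p (\<lambda>q. \<Sum>a<n. X q i a * pd N i a f q)"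
    by (rule sf_sum[OF sf_pts[OF f]], rule sf_mult[OF vf_comp[OF X i] sf_pd[OF i _ f]]) simp
  from sf_cong[OF this near_sf_pd_formula[OF i X f]] show ?thesis .
qed

section \<open>The Lie bracket\<close>

lemma bracket_comp:
  assumes i: "i \<in> idx N" "p \<in> dom N i" and a: "a < n" and X: "vf_at N p X" and Y: "vf_at N p Y"
  shows "bracket N X Y p i a = lie_deriv N X (\<lambda>q. Y q i a) p - lie_deriv N Y (\<lambda>q. X q i a) p"
  using i a vf_tspace[OF X] vf_tspace[OF Y] vf_comp[OF X i] vf_comp[OF Y i]
  by (simp add: bracket_def deriv_in_chart_pd lie_chart[OF i])

text \<open>The terms with second derivatives are symmetric by \<open>pd_commute\<close> and cancel;
  the first-order terms are the components of the bracket.\<close>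

lemma lie_commutator_chart:
  assumes i: "i \<in> idx N" "p \<in> dom N i" and X: "vf_at N p X" and Y: "vf_at N p Y" and f: "sf_at N p f"
  shows "lie_deriv N X (lie_deriv N Y f) p - lie_deriv N Y (lie_deriv N X f) p =
    (\<Sum>a<n. bracket N X Y p i a * pd N i a f p)"
proof -
  note pp = sf_pts[OF f]
  have L: "lie_deriv N X (lie_deriv N Y f) p =
      (\<Sum>b<n. lie_deriv N X (\<lambda>q. Y q i b) p * pd N i b f p)
      + (\<Sum>b<n. \<Sum>a<n. Y p i b * X p i a * pd N i a (pd N i b f) p)"
    if X: "vf_at N p X" and Y: "vf_at N p Y" for X Y
  proof -
    note s = vf_comp[OF Y i] sf_pd[OF i _ f]
    have "lie_deriv N X (lie_deriv N Y f) p = lie_deriv N X (\<lambda>q. \<Sum>b<n. Y q i b * pd N i b f q) p"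
      by (rule lie_cong[OF pp X, symmetric]) (use near_sf_pd_formula[OF i Y f] s pp in \<open>auto intro!: sf_sum sf_mult\<close>)
    also have "\<dots> = (\<Sum>b<n. lie_deriv N X (\<lambda>q. Y q i b * pd N i b f q) p)"
      using s by (intro lie_sum[OF pp X] sf_mult) auto
    also have "\<dots> = (\<Sum>b<n. lie_deriv N X (\<lambda>q. Y q i b) p * pd N i b f p + Y p i b * lie_deriv N X (pd N i b f) p)"
      by (intro sum.cong refl lie_add(2)[OF X] s) auto
    also have "\<dots> = (\<Sum>b<n. lie_deriv N X (\<lambda>q. Y q i b) p * pd N i b f p)
      + (\<Sum>b<n. \<Sum>a<n. Y p i b * X p i a * pd N i a (pd N i b f) p)"
      by (simp add: sum.distrib lie_chart_vf[OF i X] s sum_distrib_left mult.assoc)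
    finally show ?thesis .
  qed
  have "(\<Sum>b<n. \<Sum>a<n. Y p i b * X p i a * pd N i a (pd N i b f) p) =
      (\<Sum>b<n. \<Sum>a<n. X p i b * Y p i a * pd N i a (pd N i b f) p)"
    by (subst sum.swap, intro sum.cong refl) (simp add: pd_commute[OF i _ _ f] mult_ac)
  then show ?thesis
    unfolding L[OF X Y] L[OF Y X]
    by (simp add: bracket_comp[OF i _ X Y] left_diff_distrib sum_subtractf)
qed

lemma lie_coord:
  assumes i: "i \<in> idx N" "p \<in> dom N i" and a: "a < n" and X: "X p \<in> tspace N p"
  shows "lie_deriv N X (\<lambda>q. chart N i q a) p = X p i a"
  using a by (simp add: lie_chart[of i p X, OF i X] sf_chart_coord[OF i] pd_chart[OF i] if_distrib[of "\<lambda>x. _ * x"] cong: if_cong)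

text \<open>\<open>bracket\<close> is defined separately in each chart. The components in chart
  \<open>j\<close> are commutators applied to the coordinate functions of that chart, and evaluating
  these commutators in chart \<open>i\<close> produces the Jacobian.\<close>

lemma bracket_tspace:
  assumes X: "vf_at N p X" and Y: "vf_at N p Y"
  shows "bracket N X Y p \<in> tspace N p"
proof (rule tspaceI)
  fix i j a assume i: "i \<in> idx N" and j: "j \<in> idx N" and p: "p \<in> dom N i" "p \<in> dom N j" and a: "a < n"
  let ?f = "\<lambda>q. chart N j q a"
  note f = sf_chart_coord[OF j p(2), of a]
  have "lie_deriv N X (\<lambda>q. Y q j a) p = lie_deriv N X (lie_deriv N Y ?f) p"
    if X: "vf_at N p X" and Y: "vf_at N p Y" for X Y
  proof (rule lie_cong[OF vf_pts[OF X] X vf_comp[OF Y j p(2)]])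
    show "near N p (\<lambda>q. Y q j a = lie_deriv N Y ?f q)"
      using near_dom[OF j p(2)] vf_near_tspace[OF Y]
      by eventually_elim (simp add: lie_coord[OF j _ a])
  qed simp
  with X Y have "bracket N X Y p j a = lie_deriv N X (lie_deriv N Y ?f) p - lie_deriv N Y (lie_deriv N X ?f) p"
    by (simp add: bracket_comp[OF j p(2) a X Y])
  then show "bracket N X Y p j a = (\<Sum>b<n. jac N i j p a b * bracket N X Y p i b)"
    unfolding lie_commutator_chart[OF i p(1) X Y f] by (simp add: jac_pd mult.commute)
qed (auto simp: bracket_def)

lemma lie_bracket:
  assumes X: "vf_at N p X" and Y: "vf_at N p Y" and f: "sf_at N p f"
  shows "lie_deriv N (bracket N X Y) f p = lie_deriv N X (lie_deriv N Y f) p - lie_deriv N Y (lie_deriv N X f) p"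
proof -
  obtain i where i: "i \<in> idx N" "p \<in> dom N i" using sf_pts[OF f] by (rule obtain_chart)
  show ?thesis
    unfolding lie_commutator_chart[OF i X Y f] by (rule lie_chart[of i p "bracket N X Y", OF i bracket_tspace[OF X Y] f])
qed

lemma vf_bracket: "vf_at N p X \<Longrightarrow> vf_at N p Y \<Longrightarrow> vf_at N p (bracket N X Y)"
proof -
  assume X: "vf_at N p X" and Y: "vf_at N p Y"
  obtain i where i: "i \<in> idx N" "p \<in> dom N i" using vf_pts[OF X] by (rule obtain_chart)
  show ?thesis
  proof (rule vf_atI[OF i])
    show "near N p (\<lambda>q. bracket N X Y q \<in> tspace N q)"
      using vf_near[OF X] vf_near[OF Y] by eventually_elim (rule bracket_tspace)
    fix a assume a: "a < n"
    have "sf_at N p (\<lambda>q. lie_deriv N X (\<lambda>q. Y q i a) q - lie_deriv N Y (\<lambda>q. X q i a) q)"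
      by (intro sf_diff sf_lie X Y vf_comp i)
    moreover have "near N p (\<lambda>q. lie_deriv N X (\<lambda>q. Y q i a) q - lie_deriv N Y (\<lambda>q. X q i a) q = bracket N X Y q i a)"
      using near_dom[OF i] vf_near[OF X] vf_near[OF Y] by eventually_elim (simp add: bracket_comp[OF i(1) _ a])
    ultimately show "sf_at N p (\<lambda>q. bracket N X Y q i a)" by (rule sf_cong)
  qed
qed

lemma bracket_cong:
  assumes X: "vf_at N p X" and Y: "vf_at N p Y"
    and XX: "near N p (\<lambda>q. X q = X' q)" and YY: "near N p (\<lambda>q. Y q = Y' q)"
  shows "bracket N X Y p = bracket N X' Y' p"
proof -
  note X' = vf_cong[OF X XX] and Y' = vf_cong[OF Y YY] and pp = vf_pts[OF X]
  obtain i where i: "i \<in> idx N" "p \<in> dom N i" using pp by (rule obtain_chart)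
  have eq: "X p = X' p" "Y p = Y' p" using near_point[OF pp XX] near_point[OF pp YY] by auto
  show ?thesis
  proof (rule tspace_eqI[OF bracket_tspace[OF X Y] bracket_tspace[OF X' Y'] i])
    fix a assume a: "a < n"
    have "lie_deriv N X (\<lambda>q. Y q i a) p = lie_deriv N X' (\<lambda>q. Y' q i a) p"
      by (rule lie_cong[where Y = X', OF pp X vf_comp[OF Y i] _ eq(1)]) (use YY in \<open>auto elim: eventually_mono\<close>)
    moreover have "lie_deriv N Y (\<lambda>q. X q i a) p = lie_deriv N Y' (\<lambda>q. X' q i a) p"
      by (rule lie_cong[where Y = Y', OF pp Y vf_comp[OF X i] _ eq(2)]) (use XX in \<open>auto elim: eventually_mono\<close>)
    ultimately show "bracket N X Y p i a = bracket N X' Y' p i a"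
      by (simp add: bracket_comp[OF i a X Y] bracket_comp[OF i a X' Y'])
  qed
qed

lemma bracket_add:
  assumes X: "vf_at N p X" and Y: "vf_at N p Y" and Z: "vf_at N p Z"
  shows "bracket N (X + Y) Z p = bracket N X Z p + bracket N Y Z p"
    and "bracket N X (Y + Z) p = bracket N X Y p + bracket N X Z p"
proof -
  obtain i where i: "i \<in> idx N" "p \<in> dom N i" using vf_pts[OF X] by (rule obtain_chart)
  note c = vf_comp[OF X i] vf_comp[OF Y i] vf_comp[OF Z i]
  note l = lie_add(1)[OF X] lie_add(1)[OF Y] lie_add(1)[OF Z]
  show "bracket N (X + Y) Z p = bracket N X Z p + bracket N Y Z p"
    using lie_fields(1)[OF c(3) X Y] c X Y Z
    by (intro tspace_eqI[OF _ _ i] tspace_add bracket_tspace vf_add) (auto simp: bracket_comp[OF i] l vf_add)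
  show "bracket N X (Y + Z) p = bracket N X Y p + bracket N X Z p"
    using lie_fields(1)[OF c(1) Y Z] c X Y Z
    by (intro tspace_eqI[OF _ _ i] tspace_add bracket_tspace vf_add) (auto simp: bracket_comp[OF i] l vf_add)
qed

lemma bracket_antisym: "bracket N X Y p = - bracket N Y X p"
  by (auto simp: fun_eq_iff bracket_def)

lemma bracket_scale:
  assumes X: "vf_at N p X" and Y: "vf_at N p Y" and f: "sf_at N p f"
  shows "bracket N X (fscale f Y) p = tscale (f p) (bracket N X Y p) + tscale (lie_deriv N X f p) (Y p)"
    and "bracket N (fscale f X) Y p = tscale (f p) (bracket N X Y p) - tscale (lie_deriv N Y f p) (X p)"
proof -
  have *: "bracket N X (fscale f Y) p = tscale (f p) (bracket N X Y p) + tscale (lie_deriv N X f p) (Y p)"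
    if X: "vf_at N p X" and Y: "vf_at N p Y" for X Y
  proof -
    obtain i where i: "i \<in> idx N" "p \<in> dom N i" using vf_pts[OF X] by (rule obtain_chart)
    show ?thesis
      using X Y f vf_scale[OF f Y] vf_tspace[OF Y]
      by (intro tspace_eqI[OF _ _ i] tspace_add tspace_scale bracket_tspace)
        (auto simp: bracket_comp[OF i] lie_add(2) vf_comp[OF _ i] lie_fields(2) algebra_simps)
  qed
  show "bracket N X (fscale f Y) p = tscale (f p) (bracket N X Y p) + tscale (lie_deriv N X f p) (Y p)"
    by (rule *[OF X Y])
  show "bracket N (fscale f X) Y p = tscale (f p) (bracket N X Y p) - tscale (lie_deriv N Y f p) (X p)"
    using *[OF Y X] bracket_antisym[of "fscale f X" Y p] bracket_antisym[of X Y p]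
    by (simp add: tscale_minus_right)
qed

end

section \<open>Tensoriality and connections\<close>

text \<open>Linearity over germs of functions. The third clause is locality: fields are total
  functions, so independence from values away from \<open>p\<close> has to be demanded.\<close>

definition tensorial :: "('p, 'i) mfd \<Rightarrow> 'p \<Rightarrow> (('p, 'i) vfield \<Rightarrow> real) \<Rightarrow> bool" where
  "tensorial N p L \<longleftrightarrow>
     (\<forall>X Y. vf_at N p X \<longrightarrow> vf_at N p Y \<longrightarrow> L (X + Y) = L X + L Y) \<and>
     (\<forall>f X. sf_at N p f \<longrightarrow> vf_at N p X \<longrightarrow> L (fscale f X) = f p * L X) \<and>
     (\<forall>X Y. vf_at N p X \<longrightarrow> vf_at N p Y \<longrightarrow> near N p (\<lambda>q. X q = Y q) \<longrightarrow> L X = L Y)"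

lemma tensorialI:
  assumes "\<And>X Y. vf_at N p X \<Longrightarrow> vf_at N p Y \<Longrightarrow> L (X + Y) = L X + L Y"
    and "\<And>f X. sf_at N p f \<Longrightarrow> vf_at N p X \<Longrightarrow> L (fscale f X) = f p * L X"
    and "\<And>X Y. vf_at N p X \<Longrightarrow> vf_at N p Y \<Longrightarrow> near N p (\<lambda>q. X q = Y q) \<Longrightarrow> L X = L Y"
  shows "tensorial N p L"
  using assms unfolding tensorial_def by blast

lemma tensorialD:
  assumes "tensorial N p L"
  shows "vf_at N p X \<Longrightarrow> vf_at N p Y \<Longrightarrow> L (X + Y) = L X + L Y"
    and "sf_at N p f \<Longrightarrow> vf_at N p X \<Longrightarrow> L (fscale f X) = f p * L X"
    and "vf_at N p X \<Longrightarrow> vf_at N p Y \<Longrightarrow> near N p (\<lambda>q. X q = Y q) \<Longrightarrow> L X = L Y"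
  using assms unfolding tensorial_def by blast+

lemma connectionD:
  assumes C: "connection N nab" and W: "openin (mtop N) W" and X: "X \<in> vfields N W" and Y: "Y \<in> vfields N W"
  shows "nab X Y \<in> vfields N W"
    and "X' \<in> vfields N W \<Longrightarrow> Y' \<in> vfields N W \<Longrightarrow> \<forall>p\<in>W. X p = X' p \<and> Y p = Y' p \<Longrightarrow> p \<in> W \<Longrightarrow>
      nab X Y p = nab X' Y' p"
    and "Z \<in> vfields N W \<Longrightarrow> p \<in> W \<Longrightarrow> nab (X + Y) Z p = nab X Z p + nab Y Z p"
    and "Z \<in> vfields N W \<Longrightarrow> p \<in> W \<Longrightarrow> nab X (Y + Z) p = nab X Y p + nab X Z p"
    and "smooth_fun N W f \<Longrightarrow> p \<in> W \<Longrightarrow> nab (fscale f X) Y p = tscale (f p) (nab X Y p)"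
    and "smooth_fun N W f \<Longrightarrow> p \<in> W \<Longrightarrow>
      nab X (fscale f Y) p = tscale (f p) (nab X Y p) + tscale (lie_deriv N X f p) (Y p)"
proof -
  note * = C[unfolded connection_def, THEN spec, THEN mp, OF W]
  note c = conjunct1[OF *, rule_format] conjunct1[OF conjunct2[OF *], rule_format]
    conjunct1[OF conjunct2[OF conjunct2[OF *]], rule_format] conjunct2[OF conjunct2[OF conjunct2[OF *]], rule_format]
  show "nab X Y \<in> vfields N W" by (rule c(1)[OF X Y])
  show "nab X Y p = nab X' Y' p" if "X' \<in> vfields N W" "Y' \<in> vfields N W" "\<forall>p\<in>W. X p = X' p \<and> Y p = Y' p" "p \<in> W"
    by (rule c(2)[OF X Y that(1,2) _ that(4)]) (use that(3) in blast)
  show "nab (X + Y) Z p = nab X Z p + nab Y Z p" if "Z \<in> vfields N W" "p \<in> W"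
    using c(3)[OF X Y that] by (rule conjunct1)
  show "nab X (Y + Z) p = nab X Y p + nab X Z p" if "Z \<in> vfields N W" "p \<in> W"
    using c(3)[OF X Y that] by (rule conjunct2)
  show "nab (fscale f X) Y p = tscale (f p) (nab X Y p)" if "smooth_fun N W f" "p \<in> W"
    using c(4)[OF X Y that] by (rule conjunct1)
  show "nab X (fscale f Y) p = tscale (f p) (nab X Y p) + tscale (lie_deriv N X f p) (Y p)"
    if "smooth_fun N W f" "p \<in> W"
    using c(4)[OF X Y that] by (rule conjunct2)
qed

section \<open>Calculus of tensorial expressions\<close>

context atlas
begin

lemma tensorial_add: "tensorial N p L \<Longrightarrow> tensorial N p L' \<Longrightarrow> tensorial N p (\<lambda>X. L X + L' X)"
  and tensorial_cmult: "tensorial N p L \<Longrightarrow> tensorial N p (\<lambda>X. c * L X)"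
proof -
  assume L: "tensorial N p L"
  note d = tensorialD[OF L]
  show "tensorial N p (\<lambda>X. c * L X)"
  proof (rule tensorialI)
    fix X Y assume "vf_at N p X" "vf_at N p Y" "near N p (\<lambda>q. X q = Y q)"
    from d(3)[OF this] show "c * L X = c * L Y" by simp
  qed (simp_all add: d(1,2) algebra_simps)
  assume L': "tensorial N p L'"
  note d' = tensorialD[OF L']
  show "tensorial N p (\<lambda>X. L X + L' X)"
  proof (rule tensorialI)
    fix X Y assume "vf_at N p X" "vf_at N p Y" "near N p (\<lambda>q. X q = Y q)"
    from d(3)[OF this] d'(3)[OF this] show "L X + L' X = L Y + L' Y" by simp
  qed (simp_all add: d(1,2) d'(1,2) algebra_simps)
qed

lemma tensorial_cong:
  assumes L: "tensorial N p L" and eq: "\<And>X. vf_at N p X \<Longrightarrow> L' X = L X"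
  shows "tensorial N p L'"
proof (rule tensorialI)
  fix X Y assume "vf_at N p X" "vf_at N p Y" "near N p (\<lambda>q. X q = Y q)"
  with tensorialD(3)[OF L this] show "L' X = L' Y" by (simp add: eq)
qed (simp_all add: eq vf_add vf_scale tensorialD(1,2)[OF L])

lemma tensorial_minus: "tensorial N p L \<Longrightarrow> tensorial N p (\<lambda>X. - L X)"
  using tensorial_cmult[of p L "-1"] by simp

lemma tensorial_diff: "tensorial N p L \<Longrightarrow> tensorial N p L' \<Longrightarrow> tensorial N p (\<lambda>X. L X - L' X)"
  using tensorial_add[OF _ tensorial_minus, of p L L'] by simp

lemma tensorial_sum: "(\<And>a. a \<in> A \<Longrightarrow> tensorial N p (L a)) \<Longrightarrow> tensorial N p (\<lambda>X. \<Sum>a\<in>A. L a X)"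
proof (induction A rule: infinite_finite_induct)
  case (insert a A)
  then show ?case by (simp add: tensorial_add)
qed (simp_all add: tensorial_def)

lemma tensorial_field_sum:
  assumes L: "tensorial N p L" and p: "p \<in> pts N" and F: "\<And>a. a \<in> A \<Longrightarrow> vf_at N p (F a)"
  shows "L (\<lambda>q. \<Sum>a\<in>A. F a q) = (\<Sum>a\<in>A. L (F a))"
proof -
  have z: "L (\<lambda>q. 0) = 0"
    using tensorialD(2)[OF L sf_const[OF p, of 0] vf_zero[OF p]] by simp
  show ?thesis using F
  proof (induction A rule: infinite_finite_induct)
    case (insert a A)
    have "vf_at N p (\<lambda>q. \<Sum>a\<in>A. F a q)" using insert by (intro vf_sum[OF p]) auto
    then have "L (F a + (\<lambda>q. \<Sum>a\<in>A. F a q)) = L (F a) + (\<Sum>a\<in>A. L (F a))"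
      using insert by (subst tensorialD(1)[OF L]) auto
    moreover have "F a + (\<lambda>q. \<Sum>a\<in>A. F a q) = (\<lambda>q. \<Sum>a\<in>insert a A. F a q)"
      using insert by (simp add: fun_eq_iff)
    ultimately show ?case by (simp only: sum.insert[OF insert.hyps(1,2), of "\<lambda>a. L (F a)"])
  qed (simp_all add: z)
qed

text \<open>Near \<open>p\<close> the field is a combination of coordinate fields whose coefficients
  are germs of functions. Pulling the coefficients out leaves only their values at
  \<open>p\<close>.\<close>

lemma tensorial_expand:
  assumes L: "tensorial N p L" and i: "i \<in> idx N" "p \<in> dom N i" and X: "vf_at N p X"
  shows "L X = (\<Sum>a<n. X p i a * L (coord_field N i a))"
proof -
  note pp = dom_pts[OF i]
  let ?F = "\<lambda>a. fscale (\<lambda>q. X q i a) (coord_field N i a)"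
  have F: "vf_at N p (?F a)" if "a < n" for a
    by (rule vf_scale[OF vf_comp[OF X i] vf_coord[OF i that]])
  have "L X = L (\<lambda>q. \<Sum>a<n. ?F a q)"
  proof (rule tensorialD(3)[OF L X])
    show "vf_at N p (\<lambda>q. \<Sum>a<n. ?F a q)" using F by (intro vf_sum[OF pp]) auto
    show "near N p (\<lambda>q. X q = (\<Sum>a<n. ?F a q))"
      using near_dom[OF i] vf_near_tspace[OF X] by eventually_elim (rule tspace_expand[OF _ i(1)])
  qed
  also have "\<dots> = (\<Sum>a<n. L (?F a))" using F by (intro tensorial_field_sum[OF L pp]) auto
  also have "\<dots> = (\<Sum>a<n. X p i a * L (coord_field N i a))"
    by (intro sum.cong refl tensorialD(2)[OF L vf_comp[OF X i] vf_coord[OF i]]) simp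
  finally show ?thesis .
qed

lemma tensorial_pt:
  assumes L: "tensorial N p L" and X: "vf_at N p X" and Y: "vf_at N p Y" and eq: "X p = Y p"
  shows "L X = L Y"
proof -
  obtain i where i: "i \<in> idx N" "p \<in> dom N i" using vf_pts[OF X] by (rule obtain_chart)
  show ?thesis unfolding tensorial_expand[OF L i X] tensorial_expand[OF L i Y] eq ..
qed

lemma tensorial_comb:
  assumes L: "tensorial N p L" and X: "vf_at N p X" and F: "\<And>a. a \<in> A \<Longrightarrow> vf_at N p (F a)"
    and eq: "X p = (\<Sum>a\<in>A. tscale (c a) (F a p))"
  shows "L X = (\<Sum>a\<in>A. c a * L (F a))"
proof -
  obtain i where i: "i \<in> idx N" "p \<in> dom N i" using vf_pts[OF X] by (rule obtain_chart)
  have "L X = (\<Sum>b<n. \<Sum>a\<in>A. c a * (F a p i b * L (coord_field N i b)))"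
    unfolding tensorial_expand[OF L i X] eq by (simp add: fun_sum_apply sum_distrib_right mult.assoc)
  also have "\<dots> = (\<Sum>a\<in>A. c a * L (F a))"
    by (subst sum.swap) (simp add: tensorial_expand[OF L i F] sum_distrib_left)
  finally show ?thesis .
qed

lemma tensorial_pt_add:
  assumes L: "tensorial N p L" and X: "vf_at N p X" and Y: "vf_at N p Y" and Z: "vf_at N p Z"
    and eq: "X p = Y p + Z p"
  shows "L X = L Y + L Z"
  using tensorial_pt[OF L X vf_add[OF Y Z]] tensorialD(1)[OF L Y Z] eq by simp

section \<open>Connections acting on germs\<close>

lemma vf_common_open:
  assumes "near N p P" "p \<in> pts N"
  obtains W where "openin (mtop N) W" "p \<in> W" "\<forall>q\<in>W. P q"
  using assms by (auto simp: near_iff)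

text \<open>Finitely many germs have a common open set of definition, on which the axioms of
  \<open>connection\<close> apply.\<close>

lemma conn_germ:
  assumes C: "connection N nab" and X: "vf_at N p X" and Y: "vf_at N p Y"
  shows conn_vf: "vf_at N p (nab X Y)"
    and conn_cong: "near N p (\<lambda>q. X q = X' q) \<Longrightarrow> near N p (\<lambda>q. Y q = Y' q) \<Longrightarrow> nab X Y p = nab X' Y' p"
    and conn_add1: "vf_at N p Z \<Longrightarrow> nab (X + Y) Z p = nab X Z p + nab Y Z p"
    and conn_add2: "vf_at N p Z \<Longrightarrow> nab X (Y + Z) p = nab X Y p + nab X Z p"
    and conn_scale1: "sf_at N p f \<Longrightarrow> nab (fscale f X) Y p = tscale (f p) (nab X Y p)"
    and conn_scale2: "sf_at N p f \<Longrightarrow>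
      nab X (fscale f Y) p = tscale (f p) (nab X Y p) + tscale (lie_deriv N X f p) (Y p)"
proof -
  note pp = vf_pts[OF X]
  have ex: "\<exists>W. openin (mtop N) W \<and> p \<in> W \<and> X \<in> vfields N W \<and> Y \<in> vfields N W \<and> (\<forall>q\<in>W. P q)"
    if "near N p P" for P
  proof -
    have "near N p (\<lambda>q. vf_at N q X \<and> vf_at N q Y \<and> P q)"
      by (intro eventually_conj vf_near X Y that)
    then obtain W where "openin (mtop N) W" "p \<in> W" "\<forall>q\<in>W. vf_at N q X \<and> vf_at N q Y \<and> P q"
      using pp by (rule vf_common_open)
    then show ?thesis by (intro exI[of _ W]) (auto simp: vfields_iff)
  qed
  from ex[of "\<lambda>q. True"] obtain W where W: "openin (mtop N) W" "p \<in> W" "X \<in> vfields N W" "Y \<in> vfields N W" by auto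
  then have "nab X Y \<in> vfields N W" by (intro connectionD(1)[OF C])
  with W show "vf_at N p (nab X Y)" by (auto simp: vf_at_def)
  show "nab X Y p = nab X' Y' p" if X': "near N p (\<lambda>q. X q = X' q)" and Y': "near N p (\<lambda>q. Y q = Y' q)"
  proof -
    have "near N p (\<lambda>q. vf_at N q X' \<and> vf_at N q Y' \<and> X q = X' q \<and> Y q = Y' q)"
      by (intro eventually_conj vf_near vf_cong[OF X X'] vf_cong[OF Y Y'] X' Y')
    from ex[OF this] obtain W where "openin (mtop N) W" "p \<in> W" "X \<in> vfields N W" "Y \<in> vfields N W"
      "\<forall>q\<in>W. vf_at N q X' \<and> vf_at N q Y' \<and> X q = X' q \<and> Y q = Y' q" by blast
    then show ?thesis by (intro connectionD(2)[OF C, of W]) (auto simp: vfields_iff)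
  qed
  show "nab (X + Y) Z p = nab X Z p + nab Y Z p" "nab X (Y + Z) p = nab X Y p + nab X Z p" if Z: "vf_at N p Z"
  proof -
    from ex[OF vf_near[OF Z]] obtain W where W: "openin (mtop N) W" "p \<in> W" "X \<in> vfields N W" "Y \<in> vfields N W"
      "\<forall>q\<in>W. vf_at N q Z" by blast
    then have Z: "Z \<in> vfields N W" by (auto simp: vfields_iff)
    show "nab (X + Y) Z p = nab X Z p + nab Y Z p" "nab X (Y + Z) p = nab X Y p + nab X Z p"
      using connectionD(3,4)[OF C W(1,3,4) Z W(2)] .
  qed
  show "nab (fscale f X) Y p = tscale (f p) (nab X Y p)"
    "nab X (fscale f Y) p = tscale (f p) (nab X Y p) + tscale (lie_deriv N X f p) (Y p)" if f: "sf_at N p f"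
  proof -
    from ex[OF sf_near[OF f]] obtain W where W: "openin (mtop N) W" "p \<in> W" "X \<in> vfields N W" "Y \<in> vfields N W"
      "\<forall>q\<in>W. sf_at N q f" by blast
    then have f: "smooth_fun N W f" by (simp add: smooth_fun_iff)
    show "nab (fscale f X) Y p = tscale (f p) (nab X Y p)"
      "nab X (fscale f Y) p = tscale (f p) (nab X Y p) + tscale (lie_deriv N X f p) (Y p)"
      using connectionD(5,6)[OF C W(1,3,4) f W(2)] .
  qed
qed

lemma connectionI:
  assumes "\<And>p X Y. vf_at N p X \<Longrightarrow> vf_at N p Y \<Longrightarrow> vf_at N p (nab X Y)"
    and "\<And>p X Y X' Y'. vf_at N p X \<Longrightarrow> vf_at N p Y \<Longrightarrow> near N p (\<lambda>q. X q = X' q) \<Longrightarrow>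
      near N p (\<lambda>q. Y q = Y' q) \<Longrightarrow> nab X Y p = nab X' Y' p"
    and "\<And>p X Y Z. vf_at N p X \<Longrightarrow> vf_at N p Y \<Longrightarrow> vf_at N p Z \<Longrightarrow> nab (X + Y) Z p = nab X Z p + nab Y Z p"
    and "\<And>p X Y Z. vf_at N p X \<Longrightarrow> vf_at N p Y \<Longrightarrow> vf_at N p Z \<Longrightarrow> nab X (Y + Z) p = nab X Y p + nab X Z p"
    and "\<And>p X Y f. vf_at N p X \<Longrightarrow> vf_at N p Y \<Longrightarrow> sf_at N p f \<Longrightarrow> nab (fscale f X) Y p = tscale (f p) (nab X Y p)"
    and "\<And>p X Y f. vf_at N p X \<Longrightarrow> vf_at N p Y \<Longrightarrow> sf_at N p f \<Longrightarrow>
      nab X (fscale f Y) p = tscale (f p) (nab X Y p) + tscale (lie_deriv N X f p) (Y p)"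
  shows "connection N nab"
  unfolding connection_def
proof (intro allI impI)
  fix W assume W: "openin (mtop N) W"
  note v = vfields_iff[OF W]
  have eq: "near N p (\<lambda>q. X q = X' q)" if "\<forall>p\<in>W. X p = X' p" "p \<in> W" for p and X X' :: "('p, 'i) vfield"
    by (rule near_openI[OF W that(2)]) (use that in auto)
  show "(\<forall>X\<in>vfields N W. \<forall>Y\<in>vfields N W. nab X Y \<in> vfields N W) \<and>
     (\<forall>X\<in>vfields N W. \<forall>Y\<in>vfields N W. \<forall>X'\<in>vfields N W. \<forall>Y'\<in>vfields N W.
        (\<forall>p\<in>W. X p = X' p \<and> Y p = Y' p) \<longrightarrow> (\<forall>p\<in>W. nab X Y p = nab X' Y' p)) \<and>
     (\<forall>X\<in>vfields N W. \<forall>Y\<in>vfields N W. \<forall>Z\<in>vfields N W. \<forall>p\<in>W.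
        nab (X + Y) Z p = nab X Z p + nab Y Z p \<and>
        nab X (Y + Z) p = nab X Y p + nab X Z p) \<and>
     (\<forall>X\<in>vfields N W. \<forall>Y\<in>vfields N W. \<forall>f. smooth_fun N W f \<longrightarrow> (\<forall>p\<in>W.
        nab (fscale f X) Y p = tscale (f p) (nab X Y p) \<and>
        nab X (fscale f Y) p = tscale (f p) (nab X Y p) + tscale (lie_deriv N X f p) (Y p)))"
  proof (intro conjI ballI allI impI)
    fix X Y X' Y' p
    assume "X \<in> vfields N W" "Y \<in> vfields N W" "X' \<in> vfields N W" "Y' \<in> vfields N W"
      "\<forall>p\<in>W. X p = X' p \<and> Y p = Y' p" "p \<in> W"
    then show "nab X Y p = nab X' Y' p" by (intro assms(2) eq) (auto simp: v)
  qed (auto simp: v smooth_fun_iff[OF W] intro!: assms(1,3-6))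
qed

lemma conn_lin2:
  assumes C: "connection N nab" and X: "vf_at N p X" and Y: "vf_at N p Y"
  shows conn_plus2: "vf_at N p Z \<Longrightarrow> nab X (\<lambda>q. Y q + Z q) p = nab X Y p + nab X Z p"
    and conn_cscale2: "nab X (\<lambda>q. tscale c (Y q)) p = tscale c (nab X Y p)"
    and conn_minus2: "nab X (\<lambda>q. - Y q) p = - nab X Y p"
    and conn_diff2: "vf_at N p Z \<Longrightarrow> nab X (\<lambda>q. Y q - Z q) p = nab X Y p - nab X Z p"
proof -
  have plus: "nab X (\<lambda>q. Y q + Z q) p = nab X Y p + nab X Z p" if Y: "vf_at N p Y" and Z: "vf_at N p Z" for Y Z
    using conn_add2[OF C X Y Z] by (simp add: plus_fun_def[of Y Z])
  have c: "nab X (\<lambda>q. tscale c (Y q)) p = tscale c (nab X Y p)" if Y: "vf_at N p Y" for c Y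
    using conn_scale2[OF C X Y sf_const[OF vf_pts[OF X]]] lie_const[OF vf_pts[OF X] X] by simp
  have m: "nab X (\<lambda>q. - Y q) p = - nab X Y p" if Y: "vf_at N p Y" for Y
    using c[OF Y, of "-1"] by (simp add: tscale_minus_one)
  show "nab X (\<lambda>q. Y q + Z q) p = nab X Y p + nab X Z p" if "vf_at N p Z" by (rule plus[OF Y that])
  show "nab X (\<lambda>q. tscale c (Y q)) p = tscale c (nab X Y p)" by (rule c[OF Y])
  show "nab X (\<lambda>q. - Y q) p = - nab X Y p" by (rule m[OF Y])
  show "nab X (\<lambda>q. Y q - Z q) p = nab X Y p - nab X Z p" if Z: "vf_at N p Z"
    using plus[OF Y vf_minus[OF Z]] m[OF Z] by simp
qed

lemma conn_tensorial1: "connection N nab \<Longrightarrow> vf_at N p Y \<Longrightarrow> tensorial N p (\<lambda>X. nab X Y p i c)"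
proof (rule tensorialI)
  assume C: "connection N nab" and Y: "vf_at N p Y"
  fix X X' assume "vf_at N p X" "near N p (\<lambda>q. X q = X' q)"
  then have "nab X Y p = nab X' Y p" by (intro conn_cong[OF C _ Y]) auto
  then show "nab X Y p i c = nab X' Y p i c" by simp
qed (auto simp: conn_add1 conn_scale1)

lemma conn_pt1:
  assumes "connection N nab" "vf_at N p X" "vf_at N p X'" "vf_at N p Y" "X p = X' p"
  shows "nab X Y p = nab X' Y p"
  using tensorial_pt[OF conn_tensorial1[OF assms(1,4)] assms(2,3,5)] by (intro ext)

lemma conn_lin1:
  assumes C: "connection N nab" and X: "vf_at N p X" and Z: "vf_at N p Z"
  shows conn_plus1: "vf_at N p Y \<Longrightarrow> nab (\<lambda>q. X q + Y q) Z p = nab X Z p + nab Y Z p"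
    and conn_cscale1: "nab (\<lambda>q. tscale c (X q)) Z p = tscale c (nab X Z p)"
    and conn_minus1: "nab (\<lambda>q. - X q) Z p = - nab X Z p"
proof -
  show "nab (\<lambda>q. X q + Y q) Z p = nab X Z p + nab Y Z p" if "vf_at N p Y"
    using conn_add1[OF C X that Z] by (simp add: plus_fun_def[of X Y])
  show c: "nab (\<lambda>q. tscale c (X q)) Z p = tscale c (nab X Z p)" for c
    using conn_scale1[OF C X Z sf_const[OF vf_pts[OF X]]] by simp
  show "nab (\<lambda>q. - X q) Z p = - nab X Z p" using c[of "-1"] by (simp add: tscale_minus_one)
qed

lemma conn_near_cong:
  assumes "connection N nab" "vf_at N p X" "vf_at N p Y" "near N p (\<lambda>q. X q = X' q)" "near N p (\<lambda>q. Y q = Y' q)"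
  shows "near N p (\<lambda>q. nab X Y q = nab X' Y' q)"
  using vf_near[OF assms(2)] vf_near[OF assms(3)] near_near[OF assms(4)] near_near[OF assms(5)]
  by eventually_elim (rule conn_cong[OF assms(1)])

lemma conn_zero2:
  assumes C: "connection N nab" and X: "vf_at N p X" and Z: "near N p (\<lambda>q. Z q = 0)"
  shows "nab X Z p = 0"
proof -
  note z = vf_zero[OF vf_pts[OF X]]
  have "nab X (\<lambda>q. 0) p = nab X Z p"
    by (rule conn_cong[OF C X z]) (use Z in \<open>auto elim: eventually_mono\<close>)
  moreover have "nab X (\<lambda>q. 0) p = 0" using conn_cscale2[OF C X z, of 0] by simp
  ultimately show ?thesis by simp
qed

lemma conn_tspace: "connection N nab \<Longrightarrow> vf_at N p X \<Longrightarrow> vf_at N p Y \<Longrightarrow> nab X Y p \<in> tspace N p"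
  by (rule vf_tspace[OF conn_vf])

section \<open>Curvature and torsion are tensorial\<close>

lemma curvature_apply:
  "curvature N nab X Y Z p = nab (bracket N X Y) Z p - nab X (nab Y Z) p + nab Y (nab X Z) p"
  by (simp add: curvature_def)

lemma curvature_tspace:
  assumes C: "connection N nab" and "vf_at N p X" "vf_at N p Y" "vf_at N p Z"
  shows "curvature N nab X Y Z p \<in> tspace N p"
  unfolding curvature_apply
  by (intro tspace_add tspace_diff conn_tspace[OF C] vf_bracket conn_vf[OF C] assms)

text \<open>For \<open>fscale f Z\<close> the terms with one derivative of \<open>f\<close> are
  symmetric in \<open>X\<close> and \<open>Y\<close> and cancel. The commutator of second
  derivatives is the derivative along the bracket, by \<open>lie_bracket\<close>, and cancels the
  Leibniz term of \<open>nab (bracket N X Y)\<close>.\<close>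

lemma curvature_tensorial3:
  assumes C: "connection N nab" and X: "vf_at N p X" and Y: "vf_at N p Y"
  shows "tensorial N p (\<lambda>Z. curvature N nab X Y Z p i c)"
proof (rule tensorialI)
  note B = vf_bracket[OF X Y]
  fix Z Z' assume Z: "vf_at N p Z" "vf_at N p Z'"
  have "nab X (nab Y (Z + Z')) p = nab X (\<lambda>q. nab Y Z q + nab Y Z' q) p"
    if X: "vf_at N p X" and Y: "vf_at N p Y" for X Y
  proof (rule conn_cong[OF C X conn_vf[OF C Y vf_add[OF Z]]])
    show "near N p (\<lambda>q. nab Y (Z + Z') q = nab Y Z q + nab Y Z' q)"
      using vf_near[OF Y] vf_near[OF Z(1)] vf_near[OF Z(2)]
      by eventually_elim (rule conn_add2[OF C])
  qed simp
  then show "curvature N nab X Y (Z + Z') p i c = curvature N nab X Y Z p i c + curvature N nab X Y Z' p i c"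
    using X Y Z B by (simp add: curvature_apply conn_add2[OF C] conn_plus2[OF C] conn_vf[OF C])
  show "curvature N nab X Y Z p i c = curvature N nab X Y Z' p i c" if ZZ: "near N p (\<lambda>q. Z q = Z' q)"
  proof -
    have e: "near N p (\<lambda>q. X q = X q)" for X :: "('p, 'i) vfield" by simp
    have "nab X (nab Y Z) p = nab X (nab Y Z') p" if "vf_at N p X" "vf_at N p Y" for X Y
      using that Z ZZ by (intro conn_cong[OF C] conn_vf[OF C] conn_near_cong[OF C] e)
    then show ?thesis using X Y Z B by (simp add: curvature_apply conn_cong[OF C B Z(1) e ZZ])
  qed
next
  fix f Z assume f: "sf_at N p f" and Z: "vf_at N p Z"
  note B = vf_bracket[OF X Y]
  have *: "nab X (nab Y (fscale f Z)) p = tscale (f p) (nab X (nab Y Z) p) + tscale (lie_deriv N X f p) (nab Y Z p)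
      + tscale (lie_deriv N Y f p) (nab X Z p) + tscale (lie_deriv N X (lie_deriv N Y f) p) (Z p)"
    if X: "vf_at N p X" and Y: "vf_at N p Y" for X Y
  proof -
    note YZ = conn_vf[OF C Y Z] and Yf = sf_lie[OF Y f]
    have "nab X (nab Y (fscale f Z)) p = nab X (\<lambda>q. tscale (f q) (nab Y Z q) + tscale (lie_deriv N Y f q) (Z q)) p"
    proof (rule conn_cong[OF C X conn_vf[OF C Y vf_scale[OF f Z]]])
      show "near N p (\<lambda>q. nab Y (fscale f Z) q = tscale (f q) (nab Y Z q) + tscale (lie_deriv N Y f q) (Z q))"
        using vf_near[OF Y] vf_near[OF Z] sf_near[OF f] by eventually_elim (rule conn_scale2[OF C])
    qed simp
    also have "\<dots> = nab X (fscale f (nab Y Z)) p + nab X (fscale (lie_deriv N Y f) Z) p"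
      by (rule conn_plus2[OF C X vf_scale[OF f YZ] vf_scale[OF Yf Z]])
    finally show ?thesis
      by (simp add: conn_scale2[OF C X YZ f] conn_scale2[OF C X Z Yf] add.assoc)
  qed
  show "curvature N nab X Y (fscale f Z) p i c = f p * curvature N nab X Y Z p i c"
    by (simp add: curvature_apply *[OF X Y] *[OF Y X] conn_scale2[OF C B Z f] lie_bracket[OF X Y f] algebra_simps)
qed

lemma curvature_antisym:
  assumes C: "connection N nab" and X: "vf_at N p X" and Y: "vf_at N p Y" and Z: "vf_at N p Z"
  shows "curvature N nab X Y Z p = - curvature N nab Y X Z p"
proof -
  note B = vf_bracket[OF Y X]
  have "nab (bracket N X Y) Z p = nab (\<lambda>q. - bracket N Y X q) Z p"
    by (rule conn_pt1[OF C vf_bracket[OF X Y] vf_minus[OF B] Z bracket_antisym])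
  then show ?thesis by (simp add: curvature_apply conn_minus1[OF C B Z])
qed

text \<open>Scaling \<open>X\<close> by \<open>f\<close> produces the derivative of \<open>f\<close>
  along \<open>Y\<close> twice, once in the bracket and once when \<open>nab Y\<close> meets the
  scaled inner field, with opposite signs.\<close>

lemma curvature_tensorial1:
  assumes C: "connection N nab" and Y: "vf_at N p Y" and Z: "vf_at N p Z"
  shows "tensorial N p (\<lambda>X. curvature N nab X Y Z p i c)"
proof (rule tensorialI)
  fix X X' assume X: "vf_at N p X" "vf_at N p X'"
  have 1: "nab Y (nab (X + X') Z) p = nab Y (\<lambda>q. nab X Z q + nab X' Z q) p"
  proof (rule conn_cong[OF C Y conn_vf[OF C vf_add[OF X] Z]])
    show "near N p (\<lambda>q. nab (X + X') Z q = nab X Z q + nab X' Z q)"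
      using vf_near[OF Z] vf_near[OF X(1)] vf_near[OF X(2)]
      by eventually_elim (rule conn_add1[OF C])
  qed simp
  have 2: "nab (bracket N (X + X') Y) Z p = nab (bracket N X Y + bracket N X' Y) Z p"
    using X Y Z by (intro conn_pt1[OF C] vf_bracket vf_add) (auto simp: bracket_add)
  show "curvature N nab (X + X') Y Z p i c = curvature N nab X Y Z p i c + curvature N nab X' Y Z p i c"
    using X Y Z by (simp add: curvature_apply 1 2 conn_add1[OF C] conn_plus2[OF C] conn_vf[OF C] vf_bracket)
  show "curvature N nab X Y Z p i c = curvature N nab X' Y Z p i c" if XX: "near N p (\<lambda>q. X q = X' q)"
  proof -
    have e: "near N p (\<lambda>q. X q = X q)" for X :: "('p, 'i) vfield" by simp
    have "nab Y (nab X Z) p = nab Y (nab X' Z) p"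
      using X Y Z XX by (intro conn_cong[OF C] conn_vf[OF C] conn_near_cong[OF C] e)
    moreover have "nab X (nab Y Z) p = nab X' (nab Y Z) p"
      using X Y Z XX by (intro conn_cong[OF C] conn_vf[OF C] e)
    moreover have "nab (bracket N X Y) Z p = nab (bracket N X' Y) Z p"
      using X Y Z XX by (intro conn_pt1[OF C] vf_bracket bracket_cong e)
    ultimately show ?thesis by (simp add: curvature_apply)
  qed
next
  fix f X assume f: "sf_at N p f" and X: "vf_at N p X"
  note B = vf_bracket[OF X Y] and fX = vf_scale[OF f X] and XZ = conn_vf[OF C X Z] and Yf = sf_lie[OF Y f]
  have "nab Y (nab (fscale f X) Z) p = nab Y (fscale f (nab X Z)) p"
  proof (rule conn_cong[OF C Y conn_vf[OF C fX Z]])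
    show "near N p (\<lambda>q. nab (fscale f X) Z q = tscale (f q) (nab X Z q))"
      using vf_near[OF X] vf_near[OF Z] sf_near[OF f] by eventually_elim (rule conn_scale1[OF C])
  qed simp
  moreover have "nab (bracket N (fscale f X) Y) Z p = nab (fscale f (bracket N X Y) + fscale (\<lambda>q. - lie_deriv N Y f q) X) Z p"
    by (rule conn_pt1[OF C vf_bracket[OF fX Y] vf_add[OF vf_scale[OF f B] vf_scale[OF sf_minus[OF Yf] X]] Z])
      (auto simp: bracket_scale(2)[OF X Y f] fun_eq_iff)
  ultimately show "curvature N nab (fscale f X) Y Z p i c = f p * curvature N nab X Y Z p i c"
    by (simp add: curvature_apply conn_add1[OF C vf_scale[OF f B] vf_scale[OF sf_minus[OF Yf] X] Z]
        conn_scale1[OF C B Z f] conn_scale1[OF C X Z sf_minus[OF Yf]] conn_scale2[OF C Y XZ f]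
        conn_scale1[OF C X conn_vf[OF C Y Z] f] algebra_simps)
qed

lemma curvature_tensorial2:
  assumes C: "connection N nab" and X: "vf_at N p X" and Z: "vf_at N p Z"
  shows "tensorial N p (\<lambda>Y. curvature N nab X Y Z p i c)"
  by (rule tensorial_cong[OF tensorial_minus[OF curvature_tensorial1[OF C X Z, of i c]]])
    (simp add: curvature_antisym[OF C X _ Z])

text \<open>The Leibniz term of \<open>nab Y\<close> cancels that of the bracket. With this,
  torsion-freeness of the lifted connection need only be checked on lifts.\<close>

lemma torsion_tensorial:
  assumes C: "connection N nab" and Y: "vf_at N p Y"
  shows "tensorial N p (\<lambda>X. (nab X Y p - nab Y X p - bracket N X Y p) i c)"
proof (rule tensorialI)
  fix X X' assume X: "vf_at N p X" "vf_at N p X'"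
  show "(nab (X + X') Y p - nab Y (X + X') p - bracket N (X + X') Y p) i c =
      (nab X Y p - nab Y X p - bracket N X Y p) i c + (nab X' Y p - nab Y X' p - bracket N X' Y p) i c"
    using X Y by (simp add: conn_add1[OF C] conn_add2[OF C] bracket_add)
  have e: "near N p (\<lambda>q. Y q = Y q)" by simp
  show "(nab X Y p - nab Y X p - bracket N X Y p) i c = (nab X' Y p - nab Y X' p - bracket N X' Y p) i c"
    if XX: "near N p (\<lambda>q. X q = X' q)"
    by (simp add: conn_cong[OF C X(1) Y XX e] conn_cong[OF C Y X(1) e XX] bracket_cong[OF X(1) Y XX e])
next
  fix f X assume f: "sf_at N p f" and X: "vf_at N p X"
  show "(nab (fscale f X) Y p - nab Y (fscale f X) p - bracket N (fscale f X) Y p) i c =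
      f p * (nab X Y p - nab Y X p - bracket N X Y p) i c"
    by (simp add: conn_scale1[OF C X Y f] conn_scale2[OF C Y X f] bracket_scale(2)[OF X Y f] algebra_simps)
qed

lemma torsion_free_iff:
  "torsion_free N nab \<longleftrightarrow> (\<forall>p X Y. vf_at N p X \<longrightarrow> vf_at N p Y \<longrightarrow> nab X Y p - nab Y X p = bracket N X Y p)"
  (is "?L \<longleftrightarrow> ?R")
proof
  assume L: ?L
  show ?R
  proof (intro allI impI)
    fix p X Y assume X: "vf_at N p X" and Y: "vf_at N p Y"
    have "near N p (\<lambda>q. vf_at N q X \<and> vf_at N q Y)" by (intro eventually_conj vf_near X Y)
    then obtain W where "openin (mtop N) W" "p \<in> W" "\<forall>q\<in>W. vf_at N q X \<and> vf_at N q Y"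
      using vf_pts[OF X] by (rule vf_common_open)
    with L show "nab X Y p - nab Y X p = bracket N X Y p" unfolding torsion_free_def by (auto simp: vfields_iff)
  qed
qed (auto simp: torsion_free_def vfields_iff)

lemma flat_iff:
  "flat N nab \<longleftrightarrow> (\<forall>p X Y Z. vf_at N p X \<longrightarrow> vf_at N p Y \<longrightarrow> vf_at N p Z \<longrightarrow> curvature N nab X Y Z p = 0)"
  (is "?L \<longleftrightarrow> ?R")
proof
  assume L: ?L
  show ?R
  proof (intro allI impI)
    fix p X Y Z assume X: "vf_at N p X" and Y: "vf_at N p Y" and Z: "vf_at N p Z"
    have "near N p (\<lambda>q. vf_at N q X \<and> vf_at N q Y \<and> vf_at N q Z)" by (intro eventually_conj vf_near X Y Z)
    then obtain W where "openin (mtop N) W" "p \<in> W" "\<forall>q\<in>W. vf_at N q X \<and> vf_at N q Y \<and> vf_at N q Z"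
      using vf_pts[OF X] by (rule vf_common_open)
    with L show "curvature N nab X Y Z p = 0" unfolding flat_def by (auto simp: vfields_iff)
  qed
qed (auto simp: flat_def vfields_iff)

end

section \<open>Riemannian metrics\<close>

text \<open>Provides the dimension count used in \<open>onb_expand\<close>.\<close>

lemma vector_space_tscale: "vector_space (tscale :: real \<Rightarrow> 'i tvec \<Rightarrow> 'i tvec)"
  by unfold_locales (auto simp: fun_eq_iff algebra_simps)

lemma sum_delta_mult:
  fixes f :: "nat \<Rightarrow> real"
  shows "b < n \<Longrightarrow> (\<Sum>a<n. f a * (if a = b then 1 else 0)) = f b"
    and "b < n \<Longrightarrow> (\<Sum>a<n. f a * (if b = a then 1 else 0)) = f b"
    and "b < n \<Longrightarrow> (\<Sum>a<n. (if a = b then 1 else 0) * f a) = f b"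
    and "b < n \<Longrightarrow> (\<Sum>a<n. (if b = a then 1 else 0) * f a) = f b"
  by (simp_all add: if_distrib[of "\<lambda>x. _ * x"] if_distrib[of "\<lambda>x. x * _"] cong: if_cong)

text \<open>The right-hand side of the Koszul formula: for the Levi-Civita connection D it equals
  twice the inner product of D X Y with Z.\<close>

definition koszul :: "('p, 'i) mfd \<Rightarrow> ('p, 'i) metr \<Rightarrow> ('p, 'i) vfield \<Rightarrow> ('p, 'i) vfield \<Rightarrow> ('p, 'i) vfield \<Rightarrow> 'p \<Rightarrow> real" where
  "koszul N g X Y Z p =
     lie_deriv N X (\<lambda>q. g q (Y q) (Z q)) p + lie_deriv N Y (\<lambda>q. g q (X q) (Z q)) p
     - lie_deriv N Z (\<lambda>q. g q (X q) (Y q)) p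
     + g p (bracket N X Y p) (Z p) - g p (bracket N X Z p) (Y p) - g p (bracket N Y Z p) (X p)"

locale riem = atlas N for N :: "('p, 'i) mfd" +
  fixes g :: "('p, 'i) metr"
  assumes riem: "riemannian N g"
begin

lemma g_point:
  assumes "p \<in> pts N" "u \<in> tspace N p" "v \<in> tspace N p"
  shows g_sym: "g p u v = g p v u" and g_pos: "u \<noteq> 0 \<Longrightarrow> g p u u > 0"
    and g_add1: "w \<in> tspace N p \<Longrightarrow> g p (u + v) w = g p u w + g p v w"
    and g_scale1: "g p (tscale c u) v = c * g p u v"
  using riem assms unfolding riemannian_def by blast+

lemma g_linear:
  assumes p: "p \<in> pts N" and u: "u \<in> tspace N p" and v: "v \<in> tspace N p"
  shows g_add2: "w \<in> tspace N p \<Longrightarrow> g p w (u + v) = g p w u + g p w v"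
    and g_scale2: "g p u (tscale c v) = c * g p u v"
    and g_minus1: "g p (- u) v = - g p u v"
    and g_minus2: "g p u (- v) = - g p u v"
    and g_diff1: "w \<in> tspace N p \<Longrightarrow> g p (u - v) w = g p u w - g p v w"
    and g_diff2: "w \<in> tspace N p \<Longrightarrow> g p w (u - v) = g p w u - g p w v"
    and g_zero1: "g p 0 v = 0" and g_zero2: "g p u 0 = 0"
proof -
  show a: "g p w (u + v) = g p w u + g p w v" if "w \<in> tspace N p"
    using g_add1[OF p u v that] g_sym[OF p that tspace_add[OF u v]] g_sym[OF p that u] g_sym[OF p that v] by simp
  show s: "g p u (tscale c v) = c * g p u v" for c
    using g_scale1[OF p v u] g_sym[OF p u tspace_scale[OF v]] g_sym[OF p u v] by simp
  show m1: "g p (- u) v = - g p u v" using g_scale1[OF p u v, of "-1"] by (simp add: tscale_minus_one)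
  show m2: "g p u (- v) = - g p u v" using s[of "-1"] by (simp add: tscale_minus_one)
  show "g p (u - v) w = g p u w - g p v w" if w: "w \<in> tspace N p"
    using g_add1[OF p u tspace_minus[OF v] w] g_scale1[OF p v w, of "-1"] by (simp add: tscale_minus_one)
  then show "g p w (u - v) = g p w u - g p w v" if w: "w \<in> tspace N p"
    using w g_sym[OF p w tspace_diff[OF u v]] g_sym[OF p w u] g_sym[OF p w v] by simp
  show "g p 0 v = 0" "g p u 0 = 0" using metric_zero[OF riem p] u v by auto
qed

lemma g_sum1:
  assumes p: "p \<in> pts N" and w: "w \<in> tspace N p" and F: "\<And>a. a \<in> A \<Longrightarrow> F a \<in> tspace N p"
  shows "g p (\<Sum>a\<in>A. F a) w = (\<Sum>a\<in>A. g p (F a) w)"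
  using F by (induction A rule: infinite_finite_induct) (auto simp: g_zero1[OF p w w] g_add1[OF p _ tspace_sum w])

lemma g_sum2:
  assumes p: "p \<in> pts N" and w: "w \<in> tspace N p" and F: "\<And>a. a \<in> A \<Longrightarrow> F a \<in> tspace N p"
  shows "g p w (\<Sum>a\<in>A. F a) = (\<Sum>a\<in>A. g p w (F a))"
proof -
  have "g p w (\<Sum>a\<in>A. F a) = (\<Sum>a\<in>A. g p (F a) w)"
    using g_sum1[OF p w F] g_sym[OF p w tspace_sum[of A F, OF F]] by simp
  also have "\<dots> = (\<Sum>a\<in>A. g p w (F a))" using F w by (intro sum.cong refl g_sym[OF p]) auto
  finally show ?thesis .
qed

lemma g_nondeg:
  assumes p: "p \<in> pts N" and u: "u \<in> tspace N p" and v: "v \<in> tspace N p"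
    and eq: "\<And>w. w \<in> tspace N p \<Longrightarrow> g p u w = g p v w"
  shows "u = v"
proof (rule ccontr)
  assume "u \<noteq> v"
  then have "g p (u - v) (u - v) > 0" by (intro g_pos[OF p tspace_diff[OF u v] tspace_diff[OF u v]]) simp
  then show False using eq[OF tspace_diff[OF u v]] by (simp add: g_diff1[OF p u v tspace_diff[OF u v]])
qed

lemma g_nondeg_vf:
  assumes p: "p \<in> pts N" and u: "u \<in> tspace N p" and v: "v \<in> tspace N p"
    and eq: "\<And>Z. vf_at N p Z \<Longrightarrow> g p u (Z p) = g p v (Z p)"
  shows "u = v"
proof (rule g_nondeg[OF p u v])
  fix w assume "w \<in> tspace N p"
  with p obtain Z where "vf_at N p Z" "Z p = w" by (rule vf_extend)
  with eq show "g p u w = g p v w" by blast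
qed

lemma sf_ip: "vf_at N p X \<Longrightarrow> vf_at N p Y \<Longrightarrow> sf_at N p (\<lambda>q. g q (X q) (Y q))"
proof -
  assume X: "vf_at N p X" and Y: "vf_at N p Y"
  have "near N p (\<lambda>q. vf_at N q X \<and> vf_at N q Y)" by (intro eventually_conj vf_near X Y)
  then obtain W where W: "openin (mtop N) W" "p \<in> W" "\<forall>q\<in>W. vf_at N q X \<and> vf_at N q Y"
    using vf_pts[OF X] by (rule vf_common_open)
  then have "X \<in> vfields N W" "Y \<in> vfields N W" by (auto simp: vfields_iff)
  from riem[unfolded riemannian_def, THEN conjunct2, rule_format, OF W(1) this]
  have "smooth_fun N W (\<lambda>q. g q (X q) (Y q))" .
  with W show ?thesis by (auto simp: sf_at_def)
qed

section \<open>Orthonormal frames and traces\<close>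

definition onb :: "'p \<Rightarrow> (nat \<Rightarrow> 'i tvec) \<Rightarrow> bool" where
  "onb p e \<longleftrightarrow> (\<forall>a<n. e a \<in> tspace N p) \<and> (\<forall>a<n. \<forall>b<n. g p (e a) (e b) = (if a = b then 1 else 0))"

lemma orthogonal_independent:
  assumes p: "p \<in> pts N" and S: "finite S" "S \<subseteq> tspace N p"
    and o: "\<And>u v. u \<in> S \<Longrightarrow> v \<in> S \<Longrightarrow> u \<noteq> v \<Longrightarrow> g p u v = 0" and nz: "0 \<notin> S"
  shows "\<not> module.dependent tscale S"
proof -
  interpret tv: vector_space "tscale :: real \<Rightarrow> 'i tvec \<Rightarrow> 'i tvec" by (rule vector_space_tscale)
  show ?thesis
  proof (rule tv.independent_if_scalars_zero[OF S(1)])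
    fix f u assume z: "(\<Sum>v\<in>S. tscale (f v) v) = 0" and u: "u \<in> S"
    have uT: "u \<in> tspace N p" using u S by blast
    have "0 = g p (\<Sum>v\<in>S. tscale (f v) v) u" using z g_zero1[OF p uT uT] by simp
    also have "\<dots> = (\<Sum>v\<in>S. f v * g p v u)"
      using S(2) g_sum1[OF p uT, of S "\<lambda>v. tscale (f v) v"] g_scale1[OF p _ uT] by (auto simp: tspace_scale subset_iff)
    also have "\<dots> = f u * g p u u"
      using o[OF _ u] by (subst sum.remove[OF S(1) u]) (auto intro!: sum.neutral)
    finally show "f u = 0" using g_pos[OF p uT uT] u nz by force
  qed
qed

text \<open>A nonzero remainder \<open>w\<close> would be orthogonal to the \<open>n\<close> basis
  vectors. Together these would be \<open>n + 1\<close> independent vectors in the span of the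
  \<open>n\<close> coordinate vectors.\<close>

lemma onb_expand:
  assumes p: "p \<in> pts N" and e: "onb p e" and v: "v \<in> tspace N p"
  shows "v = (\<Sum>a<n. tscale (g p v (e a)) (e a))"
proof (rule ccontr)
  assume ne: "v \<noteq> (\<Sum>a<n. tscale (g p v (e a)) (e a))"
  interpret tv: vector_space "tscale :: real \<Rightarrow> 'i tvec \<Rightarrow> 'i tvec" by (rule vector_space_tscale)
  obtain i where i: "i \<in> idx N" "p \<in> dom N i" using p by (rule obtain_chart)
  have eT: "e a \<in> tspace N p" if "a < n" for a using e that by (simp add: onb_def)
  have ee: "g p (e a) (e b) = (if a = b then 1 else 0)" if "a < n" "b < n" for a b using e that by (simp add: onb_def)
  let ?s = "\<Sum>a<n. tscale (g p v (e a)) (e a)"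
  define w where "w = v - ?s"
  have sT: "?s \<in> tspace N p" using eT by (intro tspace_sum tspace_scale) auto
  have wT: "w \<in> tspace N p" unfolding w_def by (rule tspace_diff[OF v sT])
  have w0: "w \<noteq> 0" using ne by (simp add: w_def)
  have we: "g p w (e b) = 0" if b: "b < n" for b
  proof -
    have "g p ?s (e b) = (\<Sum>a<n. g p v (e a) * (if a = b then 1 else 0))"
      using b eT by (subst g_sum1[OF p]) (auto simp: tspace_scale g_scale1[OF p] ee)
    then show ?thesis using b eT by (simp add: w_def g_diff1[OF p v sT] sum_delta_mult)
  qed
  let ?S = "insert w (e ` {..<n})"
  have inj: "inj_on e {..<n}"
  proof (rule inj_onI)
    fix a b assume "a \<in> {..<n}" "b \<in> {..<n}" "e a = e b"
    then show "a = b" using ee[of a b] ee[of b b] by (auto split: if_splits)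
  qed
  have e0: "e a \<noteq> 0" if "a < n" for a
  proof
    assume "e a = 0"
    with ee[OF that that] g_zero1[OF p v v] show False using g_zero1[OF p eT[OF that] eT[OF that]] by simp
  qed
  have "w \<noteq> e a" if "a < n" for a using we[OF that] ee[OF that that] by auto
  then have card: "card ?S = Suc n" using card_image[OF inj] by (subst card_insert_disjoint) auto
  have ind: "\<not> tv.dependent ?S"
  proof (rule orthogonal_independent[OF p])
    show "?S \<subseteq> tspace N p" using wT eT by auto
    fix u u' assume "u \<in> ?S" "u' \<in> ?S" "u \<noteq> u'"
    then show "g p u u' = 0" using we ee g_sym[OF p wT eT] by (auto split: if_splits)
  qed (use w0 e0 in auto)
  let ?B = "(\<lambda>b. coord_field N i b p) ` {..<n}"
  have "u \<in> tv.span ?B" if "u \<in> tspace N p" for u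
    by (subst tspace_expand[OF that i]) (rule tv.span_sum, rule tv.span_scale, rule tv.span_base, simp)
  then have "?S \<subseteq> tv.span ?B" using wT eT by auto
  from tv.independent_span_bound[OF _ ind this] have "card ?S \<le> card ?B" by simp
  moreover have "card ?B \<le> n" using card_image_le[of "{..<n}"] by simp
  ultimately show False using card by simp
qed

text \<open>Gram-Schmidt on the coordinate fields, carried out on germs so that the frame is smooth.
  The induction also records that the frame is triangular, \<open>E a q i c = 0\<close> for
  \<open>c > a\<close>. The next vector before normalisation then has \<open>k\<close>-th coordinate
  1, which rules out that it vanishes anywhere near \<open>p\<close>.\<close>

lemma frame_exists:
  assumes p: "p \<in> pts N"
  obtains E where "\<And>a. a < n \<Longrightarrow> vf_at N p (E a)" "near N p (\<lambda>q. onb q (\<lambda>a. E a q))"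
proof -
  obtain i where i: "i \<in> idx N" "p \<in> dom N i" using p by (rule obtain_chart)
  let ?P = "\<lambda>k E q. (\<forall>a<k. \<forall>b<k. g q (E a q) (E b q) = (if a = b then 1 else 0)) \<and> (\<forall>a<k. \<forall>c>a. E a q i c = 0)"
  have "\<exists>E. (\<forall>a<k. vf_at N p (E a)) \<and> near N p (?P k E)" if "k \<le> n" for k using that
  proof (induction k)
    case (Suc k)
    then obtain E where E: "\<And>a. a < k \<Longrightarrow> vf_at N p (E a)" and P: "near N p (?P k E)" by auto
    have k: "k < n" using Suc.prems by simp
    let ?c = "coord_field N i k"
    define F where "F = (\<lambda>q. ?c q - (\<Sum>a<k. tscale (g q (?c q) (E a q)) (E a q)))"
    have vc: "vf_at N p ?c" by (rule vf_coord[OF i k])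
    have vs: "vf_at N p (\<lambda>q. \<Sum>a<k. tscale (g q (?c q) (E a q)) (E a q))"
      by (rule vf_sum[OF p], rule vf_scale[OF sf_ip[OF vc E] E]) auto
    have vF: "vf_at N p F" unfolding F_def by (rule vf_diff[OF vc vs])
    have vE: "near N p (\<lambda>q. \<forall>a\<in>{..<k}. vf_at N q (E a))"
      by (intro eventually_ball_finite) (auto intro: vf_near E)
    have good: "near N p (\<lambda>q. F q i k = 1 \<and> (\<forall>c>k. F q i c = 0) \<and> (\<forall>b<k. g q (F q) (E b q) = 0) \<and>
        F q \<in> tspace N q \<and> g q (F q) (F q) > 0)"
      using P vE near_dom[OF i] vf_near[OF vc] vf_near[OF vF]
    proof eventually_elim
      case (elim q)
      have q: "q \<in> pts N" using dom_pts[OF i(1) elim(3)] .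
      have Eq: "E a q \<in> tspace N q" if "a < k" for a using elim(2) that vf_tspace by auto
      have cq: "?c q \<in> tspace N q" using elim(4) vf_tspace by blast
      have Fq: "F q \<in> tspace N q" using elim(5) vf_tspace by blast
      have Fc: "F q i c = (if c = k then 1 else 0)" if "c \<ge> k" for c
        using elim(1) that by (simp add: F_def fun_sum_apply coord_field_self[OF i(1) elim(3) k])
      have "g q (F q) (E b q) = 0" if b: "b < k" for b
      proof -
        have "g q (\<Sum>a<k. tscale (g q (?c q) (E a q)) (E a q)) (E b q) =
            (\<Sum>a<k. g q (?c q) (E a q) * (if a = b then 1 else 0))"
          using Eq b elim(1) by (subst g_sum1[OF q]) (auto simp: tspace_scale g_scale1[OF q])
        moreover have "(\<Sum>a<k. tscale (g q (?c q) (E a q)) (E a q)) \<in> tspace N q"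
          using Eq by (intro tspace_sum tspace_scale) auto
        ultimately show ?thesis
          using Eq[OF b] b cq by (simp add: F_def g_diff1[OF q] sum_delta_mult)
      qed
      moreover have "F q \<noteq> 0" using Fc[of k] by auto
      ultimately show ?case using Fc Fq g_pos[OF q Fq Fq] by auto
    qed
    let ?r = "\<lambda>q. 1 / sqrt (g q (F q) (F q))"
    define E' where "E' = E(k := fscale ?r F)"
    have "near N p (\<lambda>q. g q (F q) (F q) > 0)" using good by (rule eventually_mono) simp
    then have vk: "vf_at N p (fscale ?r F)" by (rule vf_scale[OF sf_rsqrt[OF sf_ip[OF vF vF]] vF])
    have "near N p (?P (Suc k) E')"
      using good P vE near_dom[OF i]
    proof eventually_elim
      case (elim q)
      have q: "q \<in> pts N" using dom_pts[OF i(1) elim(4)] .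
      have Eq: "E a q \<in> tspace N q" if "a < k" for a using elim(3) that vf_tspace by auto
      have Fq: "F q \<in> tspace N q" and pos: "g q (F q) (F q) > 0" using elim(1) by auto
      have kk: "g q (tscale (?r q) (F q)) (tscale (?r q) (F q)) = 1"
        using pos by (simp add: g_scale1[OF q] g_scale2[OF q] Fq tspace_scale)
      have kb: "g q (tscale (?r q) (F q)) (E b q) = 0" "g q (E b q) (tscale (?r q) (F q)) = 0" if "b < k" for b
        using elim(1) that Eq[OF that] Fq g_sym[OF q Fq Eq[OF that]] by (simp_all add: g_scale1[OF q] g_scale2[OF q])
      show ?case
      proof (intro conjI allI impI)
        fix a b assume "a < Suc k" "b < Suc k"
        then show "g q (E' a q) (E' b q) = (if a = b then 1 else 0)"
          using elim(2) kk kb by (auto simp: E'_def less_Suc_eq)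
      next
        fix a c :: nat assume "a < Suc k" "a < c"
        then show "E' a q i c = 0" using elim(1,2) by (auto simp: E'_def less_Suc_eq)
      qed
    qed
    moreover have "\<forall>a<Suc k. vf_at N p (E' a)" using E vk by (auto simp: E'_def less_Suc_eq)
    ultimately show ?case by blast
  qed simp
  from this[of n] obtain E where E: "\<forall>a<n. vf_at N p (E a)" and P: "near N p (?P n E)" by blast
  have "near N p (\<lambda>q. \<forall>a\<in>{..<n}. vf_at N q (E a))"
    by (intro eventually_ball_finite) (use E vf_near in auto)
  with P have "near N p (\<lambda>q. onb q (\<lambda>a. E a q))"
    by eventually_elim (auto simp: onb_def intro: vf_tspace)
  with E show thesis by (intro that[of E]) auto
qed

lemma frame_at_spec:
  assumes p: "p \<in> pts N"
  shows vf_frame_at: "a < n \<Longrightarrow> vf_at N p (frame_at N g p a)"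
    and onb_frame_at: "onb p (\<lambda>a. frame_at N g p a p)"
proof -
  obtain E where E: "\<And>a. a < n \<Longrightarrow> vf_at N p (E a)" "near N p (\<lambda>q. onb q (\<lambda>a. E a q))"
    by (rule frame_exists[OF p]) blast
  have "near N p (\<lambda>q. onb q (\<lambda>a. E a q) \<and> (\<forall>a\<in>{..<n}. vf_at N q (E a)))"
    using E by (intro eventually_conj eventually_ball_finite) (auto intro: vf_near)
  then obtain W where W: "openin (mtop N) W" "p \<in> W" "\<forall>q\<in>W. onb q (\<lambda>a. E a q) \<and> (\<forall>a\<in>{..<n}. vf_at N q (E a))"
    using p by (rule vf_common_open)
  then have "orthonormal_frame N g W E"
    by (auto simp: orthonormal_frame_def onb_def vfields_iff)
  with W have "\<exists>E W. openin (mtop N) W \<and> p \<in> W \<and> orthonormal_frame N g W E" by blast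
  then have "\<exists>W. openin (mtop N) W \<and> p \<in> W \<and> orthonormal_frame N g W (frame_at N g p)"
    unfolding frame_at_def by (rule someI_ex)
  then obtain W where W: "openin (mtop N) W" "p \<in> W" "orthonormal_frame N g W (frame_at N g p)" by blast
  show v: "vf_at N p (frame_at N g p a)" if "a < n" for a
    using W that by (auto simp: orthonormal_frame_def vf_at_def)
  then show "onb p (\<lambda>a. frame_at N g p a p)"
    using W(2,3) by (auto simp: onb_def orthonormal_frame_def intro: vf_tspace)
qed

text \<open>The matrix \<open>?m\<close> between two orthonormal frames is orthogonal, as expanding
  \<open>F\<close> in \<open>E\<close> shows. The lemma is needed because the traces in the
  definitions use the frame chosen by \<open>frame_at\<close>, while computations upstairs use lifts
  of a frame.\<close>

lemma trace_frame_indep: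
  assumes p: "p \<in> pts N"
    and B1: "\<And>Y. vf_at N p Y \<Longrightarrow> tensorial N p (\<lambda>X. B X Y)" and B2: "\<And>X. vf_at N p X \<Longrightarrow> tensorial N p (B X)"
    and E: "\<And>a. a < n \<Longrightarrow> vf_at N p (E a)" "onb p (\<lambda>a. E a p)"
    and F: "\<And>a. a < n \<Longrightarrow> vf_at N p (F a)" "onb p (\<lambda>a. F a p)"
  shows "(\<Sum>a<n. B (E a) (E a)) = (\<Sum>a<n. B (F a) (F a))"
proof -
  let ?m = "\<lambda>a b. g p (E a p) (F b p)"
  have x: "E a p = (\<Sum>b<n. tscale (?m a b) (F b p))" if "a < n" for a
    using onb_expand[OF p F(2) vf_tspace[OF E(1)[OF that]]] .
  have "B (E a) (E a) = (\<Sum>b<n. \<Sum>c<n. ?m a b * ?m a c * B (F b) (F c))" if a: "a < n" for a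
  proof -
    have "B (E a) (E a) = (\<Sum>b<n. ?m a b * B (F b) (E a))"
      using F(1) tensorial_comb[where c = "?m a" and F = F and A = "{..<n}", OF B1[OF E(1)[OF a]] E(1)[OF a] _ x[OF a]] by simp
    also have "\<dots> = (\<Sum>b<n. ?m a b * (\<Sum>c<n. ?m a c * B (F b) (F c)))"
    proof (intro sum.cong refl)
      fix b assume "b \<in> {..<n}"
      then have "B (F b) (E a) = (\<Sum>c<n. ?m a c * B (F b) (F c))"
        using F(1) tensorial_comb[where c = "?m a" and F = F and A = "{..<n}", OF B2[OF F(1), of b] E(1)[OF a] _ x[OF a]] by simp
      then show "?m a b * B (F b) (E a) = ?m a b * (\<Sum>c<n. ?m a c * B (F b) (F c))" by simp
    qed
    finally show ?thesis by (simp add: sum_distrib_left mult.assoc)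
  qed
  then have "(\<Sum>a<n. B (E a) (E a)) = (\<Sum>a<n. \<Sum>b<n. \<Sum>c<n. ?m a b * ?m a c * B (F b) (F c))" by simp
  also have "\<dots> = (\<Sum>b<n. \<Sum>a<n. \<Sum>c<n. ?m a b * ?m a c * B (F b) (F c))" by (rule sum.swap)
  also have "\<dots> = (\<Sum>b<n. \<Sum>c<n. \<Sum>a<n. ?m a b * ?m a c * B (F b) (F c))"
    by (intro sum.cong refl sum.swap)
  also have "\<dots> = (\<Sum>b<n. \<Sum>c<n. B (F b) (F c) * (if c = b then 1 else 0))"
  proof (intro sum.cong refl)
    fix b c assume "b \<in> {..<n}" "c \<in> {..<n}"
    then have b: "b < n" and c: "c < n" by auto
    note Tb = vf_tspace[OF F(1)[OF b]] and Tc = vf_tspace[OF F(1)[OF c]]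
    have TE: "E a p \<in> tspace N p" if "a < n" for a by (rule vf_tspace[OF E(1)[OF that]])
    have "(if c = b then 1 else 0) = g p (F b p) (F c p)" using F(2) b c by (simp add: onb_def eq_commute)
    also have "\<dots> = g p (\<Sum>a<n. tscale (g p (F b p) (E a p)) (E a p)) (F c p)"
      using onb_expand[OF p E(2) Tb] by simp
    also have "\<dots> = (\<Sum>a<n. g p (tscale (g p (F b p) (E a p)) (E a p)) (F c p))"
      using TE by (intro g_sum1[OF p Tc] tspace_scale) auto
    also have "\<dots> = (\<Sum>a<n. ?m a b * ?m a c)"
    proof (intro sum.cong refl)
      fix a assume "a \<in> {..<n}"
      then show "g p (tscale (g p (F b p) (E a p)) (E a p)) (F c p) = ?m a b * ?m a c"
        using g_scale1[OF p TE Tc, of a] g_sym[OF p Tb TE, of a] by simp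
    qed
    finally show "(\<Sum>a<n. ?m a b * ?m a c * B (F b) (F c)) = B (F b) (F c) * (if c = b then 1 else 0)"
      by (simp add: sum_distrib_right[symmetric])
  qed
  also have "\<dots> = (\<Sum>b<n. B (F b) (F b))" by (intro sum.cong refl) (simp add: sum_delta_mult)
  finally show ?thesis .
qed

section \<open>Vectors defined by their inner products\<close>

lemma metric_dual_eq:
  assumes p: "p \<in> pts N" and v: "v \<in> tspace N p" and L: "\<And>Z. vf_at N p Z \<Longrightarrow> g p v (Z p) = L Z"
  shows "metric_dual N g p L = v"
  unfolding metric_dual_def
proof (rule the_equality)
  show "v \<in> tspace N p \<and> (\<forall>W Z. openin (mtop N) W \<and> p \<in> W \<and> Z \<in> vfields N W \<longrightarrow> g p v (Z p) = L Z)"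
  proof (intro conjI allI impI)
    fix W Z assume "openin (mtop N) W \<and> p \<in> W \<and> Z \<in> vfields N W"
    then show "g p v (Z p) = L Z" by (intro L) (auto simp: vf_at_def)
  qed (rule v)
  fix u assume u: "u \<in> tspace N p \<and> (\<forall>W Z. openin (mtop N) W \<and> p \<in> W \<and> Z \<in> vfields N W \<longrightarrow> g p u (Z p) = L Z)"
  show "u = v"
  proof (rule g_nondeg_vf[OF p _ v])
    fix Z assume "vf_at N p Z"
    moreover from this obtain W where "openin (mtop N) W \<and> p \<in> W \<and> Z \<in> vfields N W" by (auto simp: vf_at_def)
    with u have "g p u (Z p) = L Z" by blast
    ultimately show "g p u (Z p) = g p v (Z p)" by (simp add: L)
  qed (use u in blast)
qed

text \<open>The coefficient at \<open>E a\<close> of the representing vector is forced to be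
  \<open>L (E a)\<close>; tensoriality extends this from the frame to all fields.\<close>

lemma metric_dual_frame:
  assumes p: "p \<in> pts N" and L: "tensorial N p L"
    and E: "\<And>a. a < n \<Longrightarrow> vf_at N p (E a)" "onb p (\<lambda>a. E a p)"
  shows "metric_dual N g p L = (\<Sum>a<n. tscale (L (E a)) (E a p))"
proof (rule metric_dual_eq[OF p])
  have T: "E a p \<in> tspace N p" if "a < n" for a by (rule vf_tspace[OF E(1)[OF that]])
  then show "(\<Sum>a<n. tscale (L (E a)) (E a p)) \<in> tspace N p" by (intro tspace_sum tspace_scale) auto
  fix Z assume Z: "vf_at N p Z"
  note Zt = vf_tspace[OF Z]
  have "g p (\<Sum>a<n. tscale (L (E a)) (E a p)) (Z p) = (\<Sum>a<n. g p (tscale (L (E a)) (E a p)) (Z p))"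
    using T by (intro g_sum1[OF p Zt] tspace_scale) auto
  also have "\<dots> = (\<Sum>a<n. g p (Z p) (E a p) * L (E a))"
  proof (intro sum.cong refl)
    fix a assume "a \<in> {..<n}"
    then show "g p (tscale (L (E a)) (E a p)) (Z p) = g p (Z p) (E a p) * L (E a)"
      using g_scale1[OF p T Zt, of a] g_sym[OF p Zt T, of a] by simp
  qed
  also have "\<dots> = L Z"
    using E(1) tensorial_comb[where c = "\<lambda>a. g p (Z p) (E a p)" and F = E and A = "{..<n}", OF L Z _ onb_expand[OF p E(2) Zt]]
    by simp
  finally show "g p (\<Sum>a<n. tscale (L (E a)) (E a p)) (Z p) = L Z" .
qed

lemma metric_dual_spec:
  assumes p: "p \<in> pts N" and L: "tensorial N p L"
  shows metric_dual_tspace: "metric_dual N g p L \<in> tspace N p"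
    and metric_dual_ip: "vf_at N p Z \<Longrightarrow> g p (metric_dual N g p L) (Z p) = L Z"
proof -
  note E = vf_frame_at[OF p] onb_frame_at[OF p]
  let ?v = "\<Sum>a<n. tscale (L (frame_at N g p a)) (frame_at N g p a p)"
  have T: "frame_at N g p a p \<in> tspace N p" if "a < n" for a by (rule vf_tspace[OF E(1)[OF that]])
  have eq: "metric_dual N g p L = ?v" by (rule metric_dual_frame[OF p L E])
  show "metric_dual N g p L \<in> tspace N p" unfolding eq using T by (intro tspace_sum tspace_scale) auto
  assume Z: "vf_at N p Z"
  note Zt = vf_tspace[OF Z]
  have "g p ?v (Z p) = (\<Sum>a<n. g p (tscale (L (frame_at N g p a)) (frame_at N g p a p)) (Z p))"
    using T by (intro g_sum1[OF p Zt] tspace_scale) auto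
  also have "\<dots> = (\<Sum>a<n. g p (Z p) (frame_at N g p a p) * L (frame_at N g p a))"
  proof (intro sum.cong refl)
    fix a assume "a \<in> {..<n}"
    then show "g p (tscale (L (frame_at N g p a)) (frame_at N g p a p)) (Z p) = g p (Z p) (frame_at N g p a p) * L (frame_at N g p a)"
      using g_scale1[OF p T Zt, of a] g_sym[OF p Zt T, of a] by simp
  qed
  also have "\<dots> = L Z"
    using E(1) tensorial_comb[where c = "\<lambda>a. g p (Z p) (frame_at N g p a p)" and F = "frame_at N g p" and A = "{..<n}",
        OF L Z _ onb_expand[OF p E(2) Zt]]
    by simp
  finally show "g p (metric_dual N g p L) (Z p) = L Z" unfolding eq .
qed

text \<open>The definite description carries no smoothness. It comes from the frame formula, with
  one frame serving all points near \<open>p\<close>.\<close>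

lemma vf_metric_dual:
  assumes p: "p \<in> pts N" and L: "near N p (\<lambda>q. tensorial N q (L q))"
    and S: "\<And>Z. vf_at N p Z \<Longrightarrow> sf_at N p (\<lambda>q. L q Z)"
  shows "vf_at N p (\<lambda>q. metric_dual N g q (L q))"
proof -
  obtain E where E: "\<And>a. a < n \<Longrightarrow> vf_at N p (E a)" "near N p (\<lambda>q. onb q (\<lambda>a. E a q))"
    by (rule frame_exists[OF p]) blast
  have v: "vf_at N p (\<lambda>q. \<Sum>a<n. tscale (L q (E a)) (E a q))"
    by (rule vf_sum[OF p], rule vf_scale[OF S[OF E(1)] E(1)]) auto
  have "near N p (\<lambda>q. \<forall>a\<in>{..<n}. vf_at N q (E a))"
    by (intro eventually_ball_finite) (auto intro: vf_near E)
  then have "near N p (\<lambda>q. (\<Sum>a<n. tscale (L q (E a)) (E a q)) = metric_dual N g q (L q))"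
    using E(2) L near_pts[OF p]
  proof eventually_elim
    case (elim q)
    then show ?case by (intro metric_dual_frame[symmetric]) auto
  qed
  with v show ?thesis by (rule vf_cong)
qed

end

section \<open>The Levi-Civita connection\<close>

context riem
begin

lemma near_ip_rules:
  assumes "vf_at N p Y" "vf_at N p Z"
  shows "near N p (\<lambda>q. q \<in> pts N \<and> Y q \<in> tspace N q \<and> Z q \<in> tspace N q)"
  by (intro eventually_conj near_pts vf_pts[OF assms(1)] vf_near_tspace assms)

lemma lie_ip_cong:
  assumes X: "vf_at N p X" and Y: "vf_at N p Y" and Z: "vf_at N p Z"
    and "near N p (\<lambda>q. Y q = Y' q)" "near N p (\<lambda>q. Z q = Z' q)" "X p = X' p"
  shows "lie_deriv N X (\<lambda>q. g q (Y q) (Z q)) p = lie_deriv N X' (\<lambda>q. g q (Y' q) (Z' q)) p"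
proof (rule lie_cong[where Y = X', OF vf_pts[OF X] X sf_ip[OF Y Z] _ assms(6)])
  show "near N p (\<lambda>q. g q (Y q) (Z q) = g q (Y' q) (Z' q))" using assms(4,5) by eventually_elim simp
qed

lemma lie_ip_sym:
  assumes X: "vf_at N p X" and Y: "vf_at N p Y" and Z: "vf_at N p Z"
  shows "lie_deriv N X (\<lambda>q. g q (Y q) (Z q)) p = lie_deriv N X (\<lambda>q. g q (Z q) (Y q)) p"
proof (rule lie_cong[where Y = X, OF vf_pts[OF X] X sf_ip[OF Y Z] _ refl])
  show "near N p (\<lambda>q. g q (Y q) (Z q) = g q (Z q) (Y q))"
    using near_ip_rules[OF Y Z] by eventually_elim (simp add: g_sym)
qed

lemma lie_ip_add1:
  assumes X: "vf_at N p X" and Y: "vf_at N p Y" and Y': "vf_at N p Y'" and Z: "vf_at N p Z"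
  shows "lie_deriv N X (\<lambda>q. g q (Y q + Y' q) (Z q)) p =
    lie_deriv N X (\<lambda>q. g q (Y q) (Z q)) p + lie_deriv N X (\<lambda>q. g q (Y' q) (Z q)) p"
proof -
  have "lie_deriv N X (\<lambda>q. g q (Y q + Y' q) (Z q)) p = lie_deriv N X (\<lambda>q. g q (Y q) (Z q) + g q (Y' q) (Z q)) p"
  proof (rule lie_cong[where Y = X, OF vf_pts[OF X] X sf_ip[OF vf_add'[OF Y Y'] Z] _ refl])
    show "near N p (\<lambda>q. g q (Y q + Y' q) (Z q) = g q (Y q) (Z q) + g q (Y' q) (Z q))"
      using near_ip_rules[OF Y Z] vf_near_tspace[OF Y'] by eventually_elim (simp add: g_add1)
  qed
  then show ?thesis by (simp add: lie_add(1)[OF X sf_ip[OF Y Z] sf_ip[OF Y' Z]])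
qed

lemma lie_ip_scale1:
  assumes X: "vf_at N p X" and f: "sf_at N p f" and Y: "vf_at N p Y" and Z: "vf_at N p Z"
  shows "lie_deriv N X (\<lambda>q. g q (tscale (f q) (Y q)) (Z q)) p =
    lie_deriv N X f p * g p (Y p) (Z p) + f p * lie_deriv N X (\<lambda>q. g q (Y q) (Z q)) p"
proof -
  have "lie_deriv N X (\<lambda>q. g q (tscale (f q) (Y q)) (Z q)) p = lie_deriv N X (\<lambda>q. f q * g q (Y q) (Z q)) p"
  proof (rule lie_cong[where Y = X, OF vf_pts[OF X] X sf_ip[OF vf_scale[OF f Y] Z] _ refl])
    show "near N p (\<lambda>q. g q (tscale (f q) (Y q)) (Z q) = f q * g q (Y q) (Z q))"
      using near_ip_rules[OF Y Z] by eventually_elim (simp add: g_scale1)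
  qed
  then show ?thesis by (simp add: lie_add(2)[OF X f sf_ip[OF Y Z]])
qed

lemma lie_ip_add2:
  assumes X: "vf_at N p X" and Y: "vf_at N p Y" and Y': "vf_at N p Y'" and Z: "vf_at N p Z"
  shows "lie_deriv N X (\<lambda>q. g q (Z q) (Y q + Y' q)) p =
    lie_deriv N X (\<lambda>q. g q (Z q) (Y q)) p + lie_deriv N X (\<lambda>q. g q (Z q) (Y' q)) p"
  using lie_ip_add1[OF assms] lie_ip_sym[OF X vf_add'[OF Y Y'] Z] lie_ip_sym[OF X Y Z] lie_ip_sym[OF X Y' Z] by simp

lemma lie_ip_scale2:
  assumes X: "vf_at N p X" and f: "sf_at N p f" and Y: "vf_at N p Y" and Z: "vf_at N p Z"
  shows "lie_deriv N X (\<lambda>q. g q (Z q) (tscale (f q) (Y q))) p =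
    lie_deriv N X f p * g p (Z p) (Y p) + f p * lie_deriv N X (\<lambda>q. g q (Z q) (Y q)) p"
  using lie_ip_scale1[OF assms] lie_ip_sym[OF X vf_scale[OF f Y] Z] lie_ip_sym[OF X Y Z]
    g_sym[OF vf_pts[OF X] vf_tspace[OF Y] vf_tspace[OF Z]] by simp

lemma koszul_cong:
  assumes X: "vf_at N p X" and Y: "vf_at N p Y" and Z: "vf_at N p Z"
    and e: "near N p (\<lambda>q. X q = X' q)" "near N p (\<lambda>q. Y q = Y' q)" "near N p (\<lambda>q. Z q = Z' q)"
  shows "koszul N g X Y Z p = koszul N g X' Y' Z' p"
proof -
  note pp = vf_pts[OF X]
  note q = near_point[OF pp e(1)] near_point[OF pp e(2)] near_point[OF pp e(3)]
  show ?thesis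
    unfolding koszul_def lie_ip_cong[where X' = X', OF X Y Z e(2,3) q(1)]
      lie_ip_cong[where X' = Y', OF Y X Z e(1,3) q(2)] lie_ip_cong[where X' = Z', OF Z X Y e(1,2) q(3)] bracket_cong[OF X Y e(1,2)] bracket_cong[OF X Z e(1,3)]
      bracket_cong[OF Y Z e(2,3)] q ..
qed

text \<open>The two identities that become torsion-freeness and metric compatibility for the
  connection given by half of \<open>koszul\<close>.\<close>

lemma koszul_algebra:
  assumes X: "vf_at N p X" and Y: "vf_at N p Y" and Z: "vf_at N p Z"
  shows koszul_torsion: "koszul N g X Y Z p - koszul N g Y X Z p = 2 * g p (bracket N X Y p) (Z p)"
    and koszul_metric: "koszul N g X Y Z p + koszul N g X Z Y p = 2 * lie_deriv N X (\<lambda>q. g q (Y q) (Z q)) p"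
proof -
  note pp = vf_pts[OF X]
  note t = vf_tspace[OF X] vf_tspace[OF Y] vf_tspace[OF Z]
  have "g p (bracket N V U p) w = - g p (bracket N U V p) w" if "vf_at N p U" "vf_at N p V" "w \<in> tspace N p" for U V w
    using that g_minus1[OF pp bracket_tspace[OF that(1,2)] that(3)] bracket_antisym[of V U p] by simp
  note b = this
  show "koszul N g X Y Z p - koszul N g Y X Z p = 2 * g p (bracket N X Y p) (Z p)"
    using lie_ip_sym[OF Z X Y] b[OF X Y t(3)] by (simp add: koszul_def)
  show "koszul N g X Y Z p + koszul N g X Z Y p = 2 * lie_deriv N X (\<lambda>q. g q (Y q) (Z q)) p"
    using lie_ip_sym[OF X Z Y] b[OF Y Z t(1)] by (simp add: koszul_def)
qed

lemma koszul_add: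
  assumes X: "vf_at N p X" and Y: "vf_at N p Y" and Z: "vf_at N p Z" and V: "vf_at N p V"
  shows "koszul N g (V + X) Y Z p = koszul N g V Y Z p + koszul N g X Y Z p"
    and "koszul N g X (V + Y) Z p = koszul N g X V Z p + koszul N g X Y Z p"
    and "koszul N g X Y (V + Z) p = koszul N g X Y V p + koszul N g X Y Z p"
proof -
  note pp = vf_pts[OF X]
  note t = vf_tspace[OF X] vf_tspace[OF Y] vf_tspace[OF Z] vf_tspace[OF V]
  note v = X Y Z V
  note r = g_add1[OF pp] g_add2[OF pp] bracket_add lie_ip_add1 lie_ip_add2 lie_fields(1)[OF sf_ip]
    bracket_tspace v t
  show "koszul N g (V + X) Y Z p = koszul N g V Y Z p + koszul N g X Y Z p"
    "koszul N g X (V + Y) Z p = koszul N g X V Z p + koszul N g X Y Z p"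
    "koszul N g X Y (V + Z) p = koszul N g X Y V p + koszul N g X Y Z p"
    by (simp_all add: koszul_def r)
qed

text \<open>Linear over functions in \<open>X\<close> and \<open>Z\<close>, with a Leibniz term in
  \<open>Y\<close>: linearity in \<open>Z\<close> makes the dual vector exist, and the other two
  rules are the axioms of a connection.\<close>

lemma koszul_scale:
  assumes X: "vf_at N p X" and Y: "vf_at N p Y" and Z: "vf_at N p Z" and f: "sf_at N p f"
  shows "koszul N g (fscale f X) Y Z p = f p * koszul N g X Y Z p"
    and "koszul N g X (fscale f Y) Z p = f p * koszul N g X Y Z p + 2 * lie_deriv N X f p * g p (Y p) (Z p)"
    and "koszul N g X Y (fscale f Z) p = f p * koszul N g X Y Z p"
proof -
  note pp = vf_pts[OF X]
  note t = vf_tspace[OF X] vf_tspace[OF Y] vf_tspace[OF Z]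
  note v = X Y Z f
  note s = g_sym[OF pp t(2) t(1)] g_sym[OF pp t(3) t(1)] g_sym[OF pp t(3) t(2)]
  note r = g_add1[OF pp] g_diff1[OF pp] g_scale1[OF pp] g_scale2[OF pp] bracket_scale lie_ip_scale1 lie_ip_scale2
    lie_fields(2)[OF sf_ip[OF Y Z] X X] lie_fields(2)[OF sf_ip[OF X Z] Y Y] lie_fields(2)[OF sf_ip[OF X Y] Z Z]
    bracket_tspace tspace_scale v t s algebra_simps
  show "koszul N g (fscale f X) Y Z p = f p * koszul N g X Y Z p"
    "koszul N g X (fscale f Y) Z p = f p * koszul N g X Y Z p + 2 * lie_deriv N X f p * g p (Y p) (Z p)"
    "koszul N g X Y (fscale f Z) p = f p * koszul N g X Y Z p"
    by (simp_all add: koszul_def r)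
qed

lemma koszul_tensorial:
  assumes X: "vf_at N p X" and Y: "vf_at N p Y"
  shows "tensorial N p (\<lambda>Z. 1/2 * koszul N g X Y Z p)"
proof (rule tensorial_cmult, rule tensorialI)
  fix Z Z' assume "vf_at N p Z" "vf_at N p Z'" "near N p (\<lambda>q. Z q = Z' q)"
  then show "koszul N g X Y Z p = koszul N g X Y Z' p" by (intro koszul_cong X Y) auto
qed (simp_all add: koszul_add[OF X Y] koszul_scale[OF X Y])

lemma sf_koszul: "vf_at N p X \<Longrightarrow> vf_at N p Y \<Longrightarrow> vf_at N p Z \<Longrightarrow> sf_at N p (koszul N g X Y Z)"
  unfolding koszul_def by (intro sf_add sf_diff sf_lie sf_ip vf_bracket)

lemma is_levi_civitaI:
  assumes "connection N D"
    and "\<And>p X Y. vf_at N p X \<Longrightarrow> vf_at N p Y \<Longrightarrow> D X Y p - D Y X p = bracket N X Y p"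
    and "\<And>p X Y Z. vf_at N p X \<Longrightarrow> vf_at N p Y \<Longrightarrow> vf_at N p Z \<Longrightarrow>
      lie_deriv N X (\<lambda>q. g q (Y q) (Z q)) p = g p (D X Y p) (Z p) + g p (Y p) (D X Z p)"
  shows "is_levi_civita N g D"
  unfolding is_levi_civita_def
proof (intro conjI allI impI ballI)
  show "torsion_free N D" unfolding torsion_free_iff using assms(2) by blast
  fix W X Y Z p assume "openin (mtop N) W" "X \<in> vfields N W" "Y \<in> vfields N W" "Z \<in> vfields N W" "p \<in> W"
  then show "lie_deriv N X (\<lambda>q. g q (Y q) (Z q)) p = g p (D X Y p) (Z p) + g p (Y p) (D X Z p)"
    by (intro assms(3)) (auto simp: vfields_iff)
qed (rule assms(1))

text \<open>\<open>levi_civita\<close> is a choice, so existence is what gives it its properties.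
  The witness represents half of \<open>koszul\<close> by a vector.\<close>

lemma levi_civita_exists: "\<exists>D. is_levi_civita N g D"
proof
  define D where "D X Y = (\<lambda>p. metric_dual N g p (\<lambda>Z. 1/2 * koszul N g X Y Z p))" for X Y
  have T: "D X Y p \<in> tspace N p" and I: "\<And>Z. vf_at N p Z \<Longrightarrow> g p (D X Y p) (Z p) = 1/2 * koszul N g X Y Z p"
    if "vf_at N p X" "vf_at N p Y" for p X Y
    using metric_dual_spec[OF vf_pts koszul_tensorial, OF that(1) that] by (auto simp: D_def)
  have V: "vf_at N p (D X Y)" if X: "vf_at N p X" and Y: "vf_at N p Y" for p X Y
    unfolding D_def
  proof (rule vf_metric_dual[OF vf_pts[OF X]])
    show "near N p (\<lambda>q. tensorial N q (\<lambda>Z. 1/2 * koszul N g X Y Z q))"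
      using vf_near[OF X] vf_near[OF Y] by eventually_elim (rule koszul_tensorial)
    show "sf_at N p (\<lambda>q. 1/2 * koszul N g X Y Z q)" if "vf_at N p Z" for Z
      by (rule sf_cmult[OF sf_koszul[OF X Y that]])
  qed
  have eqI: "u = v" if "p \<in> pts N" "u \<in> tspace N p" "v \<in> tspace N p"
    "\<And>Z. vf_at N p Z \<Longrightarrow> g p u (Z p) = g p v (Z p)" for u v p using that by (rule g_nondeg_vf)
  show "is_levi_civita N g D"
  proof (rule is_levi_civitaI)
    show "connection N D"
    proof (rule connectionI)
      fix p X Y X' Y' assume X: "vf_at N p X" and Y: "vf_at N p Y"
        and XX: "near N p (\<lambda>q. X q = X' q)" and YY: "near N p (\<lambda>q. Y q = Y' q)"
      note X' = vf_cong[OF X XX] and Y' = vf_cong[OF Y YY]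
      show "D X Y p = D X' Y' p"
      proof (rule eqI[OF vf_pts[OF X] T[OF X Y] T[OF X' Y']])
        fix Z assume Z: "vf_at N p Z"
        have "koszul N g X Y Z p = koszul N g X' Y' Z p" by (rule koszul_cong[OF X Y Z XX YY]) simp
        then show "g p (D X Y p) (Z p) = g p (D X' Y' p) (Z p)" by (simp add: I[OF X Y Z] I[OF X' Y' Z])
      qed
    next
      fix p X Y Z assume X: "vf_at N p X" and Y: "vf_at N p Y" and Z: "vf_at N p Z"
      show "D (X + Y) Z p = D X Z p + D Y Z p"
        by (rule eqI[OF vf_pts[OF X]])
          (use X Y Z in \<open>simp_all add: T I vf_add tspace_add g_add1[OF vf_pts[OF X]] vf_tspace koszul_add\<close>)
      show "D X (Y + Z) p = D X Y p + D X Z p"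
        by (rule eqI[OF vf_pts[OF X]])
          (use X Y Z in \<open>simp_all add: T I vf_add tspace_add g_add1[OF vf_pts[OF X]] vf_tspace koszul_add\<close>)
    next
      fix p X Y f assume X: "vf_at N p X" and Y: "vf_at N p Y" and f: "sf_at N p f"
      show "D (fscale f X) Y p = tscale (f p) (D X Y p)"
        by (rule eqI[OF vf_pts[OF X]])
          (use X Y f in \<open>simp_all add: T I vf_scale tspace_scale g_scale1[OF vf_pts[OF X]] vf_tspace koszul_scale\<close>)
      show "D X (fscale f Y) p = tscale (f p) (D X Y p) + tscale (lie_deriv N X f p) (Y p)"
        by (rule eqI[OF vf_pts[OF X]])
          (use X Y f in \<open>simp_all add: T I vf_scale tspace_scale tspace_add g_add1[OF vf_pts[OF X]]
            g_scale1[OF vf_pts[OF X]] vf_tspace koszul_scale algebra_simps\<close>)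
    qed (rule V)
    fix p X Y assume X: "vf_at N p X" and Y: "vf_at N p Y"
    note pp = vf_pts[OF X]
    show "D X Y p - D Y X p = bracket N X Y p"
    proof (rule eqI[OF pp tspace_diff[OF T[OF X Y] T[OF Y X]] bracket_tspace[OF X Y]])
      fix Z assume Z: "vf_at N p Z"
      show "g p (D X Y p - D Y X p) (Z p) = g p (bracket N X Y p) (Z p)"
        using koszul_torsion[OF X Y Z] by (simp add: g_diff1[OF pp T[OF X Y] T[OF Y X] vf_tspace[OF Z]] I X Y Z)
    qed
    fix Z assume Z: "vf_at N p Z"
    show "lie_deriv N X (\<lambda>q. g q (Y q) (Z q)) p = g p (D X Y p) (Z p) + g p (Y p) (D X Z p)"
      using koszul_metric[OF X Y Z] g_sym[OF pp vf_tspace[OF Y] T[OF X Z]] I[OF X Y Z] I[OF X Z Y] by simp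
  qed
qed

section \<open>Properties of the chosen Levi-Civita connection\<close>

abbreviation "LC \<equiv> levi_civita N g"

lemma LC: "is_levi_civita N g LC"
  unfolding levi_civita_def by (rule someI_ex[OF levi_civita_exists])

lemma LC_conn: "connection N LC"
  using LC by (simp add: is_levi_civita_def)

lemma LC_torsion: "vf_at N p X \<Longrightarrow> vf_at N p Y \<Longrightarrow> LC X Y p - LC Y X p = bracket N X Y p"
  using LC torsion_free_iff[of LC] by (simp add: is_levi_civita_def)

lemma LC_metric:
  assumes X: "vf_at N p X" and Y: "vf_at N p Y" and Z: "vf_at N p Z"
  shows "lie_deriv N X (\<lambda>q. g q (Y q) (Z q)) p = g p (LC X Y p) (Z p) + g p (Y p) (LC X Z p)"
proof -
  have "near N p (\<lambda>q. vf_at N q X \<and> vf_at N q Y \<and> vf_at N q Z)" by (intro eventually_conj vf_near X Y Z)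
  then obtain W where W: "openin (mtop N) W" "p \<in> W" "\<forall>q\<in>W. vf_at N q X \<and> vf_at N q Y \<and> vf_at N q Z"
    using vf_pts[OF X] by (rule vf_common_open)
  then have "X \<in> vfields N W" "Y \<in> vfields N W" "Z \<in> vfields N W" by (auto simp: vfields_iff)
  from LC[unfolded is_levi_civita_def, THEN conjunct2, THEN conjunct2, rule_format, OF W(1) this W(2)]
  show ?thesis .
qed

lemmas LC_tspace = conn_tspace[OF LC_conn] and LC_vf = conn_vf[OF LC_conn]

text \<open>The uniqueness half: metric compatibility and vanishing torsion alone force the Koszul
  formula, so the values on smooth fields do not depend on the choice.\<close>

lemma LC_koszul:
  assumes X: "vf_at N p X" and Y: "vf_at N p Y" and Z: "vf_at N p Z"
  shows "2 * g p (LC X Y p) (Z p) = koszul N g X Y Z p"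
proof -
  note pp = vf_pts[OF X]
  note t = vf_tspace[OF X] vf_tspace[OF Y] vf_tspace[OF Z]
  note s = g_sym[OF pp t(1) LC_tspace] g_sym[OF pp t(2) LC_tspace] g_sym[OF pp t(3) LC_tspace]
  have b: "g p (bracket N U V p) w = g p (LC U V p) w - g p (LC V U p) w"
    if "vf_at N p U" "vf_at N p V" "w \<in> tspace N p" for U V w
    using g_diff1[OF pp LC_tspace[OF that(1,2)] LC_tspace[OF that(2,1)] that(3)] LC_torsion[OF that(1,2)] by simp
  show ?thesis
    unfolding koszul_def LC_metric[OF X Y Z] LC_metric[OF Y X Z] LC_metric[OF Z X Y]
      b[OF X Y t(3)] b[OF X Z t(2)] b[OF Y Z t(1)] s(1)[OF Y Z] s(2)[OF X Z] s(1)[OF Z Y] by simp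
qed

lemma tensorial_ip_right: "p \<in> pts N \<Longrightarrow> w \<in> tspace N p \<Longrightarrow> tensorial N p (\<lambda>Z. g p w (Z p))"
proof (rule tensorialI)
  assume p: "p \<in> pts N"
  fix X Y :: "('p, 'i) vfield" assume "near N p (\<lambda>q. X q = Y q)"
  then have "X p = Y p" using near_point[OF p] by blast
  then show "g p w (X p) = g p w (Y p)" by simp
qed (auto simp: g_add2 g_scale2 vf_tspace)

text \<open>\<open>tensorial\<close> is about real-valued expressions, so tensoriality of a
  vector-valued \<open>V\<close> is stated for all its components \<open>V X i c\<close>.\<close>

lemma tensorial_ip_left:
  assumes p: "p \<in> pts N" and w: "w \<in> tspace N p" and V: "\<And>X. vf_at N p X \<Longrightarrow> V X \<in> tspace N p"
    and T: "\<And>i c. tensorial N p (\<lambda>X. V X i c)"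
  shows "tensorial N p (\<lambda>X. g p (V X) w)"
proof (rule tensorialI)
  fix X Y assume X: "vf_at N p X" and Y: "vf_at N p Y"
  have "V (X + Y) = V X + V Y" by (intro ext) (simp add: tensorialD(1)[OF T X Y])
  then show "g p (V (X + Y)) w = g p (V X) w + g p (V Y) w" using g_add1[OF p V[OF X] V[OF Y] w] by simp
  show "g p (V X) w = g p (V Y) w" if "near N p (\<lambda>q. X q = Y q)"
  proof -
    have "V X = V Y" by (intro ext) (rule tensorialD(3)[OF T X Y that])
    then show ?thesis by simp
  qed
next
  fix f X assume f: "sf_at N p f" and X: "vf_at N p X"
  have "V (fscale f X) = tscale (f p) (V X)" by (intro ext) (simp add: tensorialD(2)[OF T f X])
  then show "g p (V (fscale f X)) w = f p * g p (V X) w" using g_scale1[OF p V[OF X] w] by simp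
qed

text \<open>A connection altered by a tensor that is given through inner products is again a
  connection. The Chern and Bismut connections are both of this kind, with \<open>\<tau>\<close>
  half of the differential of the fundamental form, up to sign and insertions of
  \<open>J\<close>.\<close>

lemma dual_connection:
  assumes C: "connection N nab"
    and t1: "\<And>p Y Z. vf_at N p Y \<Longrightarrow> vf_at N p Z \<Longrightarrow> tensorial N p (\<lambda>X. \<tau> X Y Z p)"
    and t2: "\<And>p X Z. vf_at N p X \<Longrightarrow> vf_at N p Z \<Longrightarrow> tensorial N p (\<lambda>Y. \<tau> X Y Z p)"
    and t3: "\<And>p X Y. vf_at N p X \<Longrightarrow> vf_at N p Y \<Longrightarrow> tensorial N p (\<lambda>Z. \<tau> X Y Z p)"
    and s: "\<And>p X Y Z. vf_at N p X \<Longrightarrow> vf_at N p Y \<Longrightarrow> vf_at N p Z \<Longrightarrow> sf_at N p (\<tau> X Y Z)"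
    and nab': "\<And>X Y. nab' X Y = (\<lambda>p. metric_dual N g p (\<lambda>Z. g p (nab X Y p) (Z p) + \<tau> X Y Z p))"
  shows "connection N nab'"
    and "\<And>p X Y Z. vf_at N p X \<Longrightarrow> vf_at N p Y \<Longrightarrow> vf_at N p Z \<Longrightarrow>
      g p (nab' X Y p) (Z p) = g p (nab X Y p) (Z p) + \<tau> X Y Z p"
proof -
  let ?L = "\<lambda>X Y p Z. g p (nab X Y p) (Z p) + \<tau> X Y Z p"
  have tens: "tensorial N p (?L X Y p)" if X: "vf_at N p X" and Y: "vf_at N p Y" for p X Y
    by (rule tensorial_add[OF tensorial_ip_right[OF vf_pts[OF X] conn_tspace[OF C X Y]] t3[OF X Y]])
  have T: "nab' X Y p \<in> tspace N p" and I: "\<And>Z. vf_at N p Z \<Longrightarrow> g p (nab' X Y p) (Z p) = g p (nab X Y p) (Z p) + \<tau> X Y Z p"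
    if X: "vf_at N p X" and Y: "vf_at N p Y" for p X Y
    using metric_dual_spec[OF vf_pts[OF X] tens[OF X Y]] by (auto simp: nab')
  show "\<And>p X Y Z. vf_at N p X \<Longrightarrow> vf_at N p Y \<Longrightarrow> vf_at N p Z \<Longrightarrow>
      g p (nab' X Y p) (Z p) = g p (nab X Y p) (Z p) + \<tau> X Y Z p" by (rule I)
  have V: "vf_at N p (nab' X Y)" if X: "vf_at N p X" and Y: "vf_at N p Y" for p X Y
    unfolding nab'
  proof (rule vf_metric_dual[OF vf_pts[OF X]])
    show "near N p (\<lambda>q. tensorial N q (?L X Y q))"
      using vf_near[OF X] vf_near[OF Y] by eventually_elim (rule tens)
    show "sf_at N p (\<lambda>q. g q (nab X Y q) (Z q) + \<tau> X Y Z q)" if Z: "vf_at N p Z" for Z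
      by (rule sf_add[OF sf_ip[OF conn_vf[OF C X Y] Z] s[OF X Y Z]])
  qed
  show "connection N nab'"
  proof (rule connectionI)
    fix p X Y X' Y' assume X: "vf_at N p X" and Y: "vf_at N p Y"
      and XX: "near N p (\<lambda>q. X q = X' q)" and YY: "near N p (\<lambda>q. Y q = Y' q)"
    note X' = vf_cong[OF X XX] and Y' = vf_cong[OF Y YY]
    show "nab' X Y p = nab' X' Y' p"
    proof (rule g_nondeg_vf[OF vf_pts[OF X] T[OF X Y] T[OF X' Y']])
      fix Z assume Z: "vf_at N p Z"
      have "\<tau> X Y Z p = \<tau> X' Y' Z p"
        using tensorialD(3)[OF t1[OF Y Z] X X' XX] tensorialD(3)[OF t2[OF X' Z] Y Y' YY] by simp
      then show "g p (nab' X Y p) (Z p) = g p (nab' X' Y' p) (Z p)"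
        by (simp add: I[OF X Y Z] I[OF X' Y' Z] conn_cong[OF C X Y XX YY])
    qed
  next
    fix p X Y Z assume X: "vf_at N p X" and Y: "vf_at N p Y" and Z: "vf_at N p Z"
    note pp = vf_pts[OF X]
    show "nab' (X + Y) Z p = nab' X Z p + nab' Y Z p"
    proof (rule g_nondeg_vf[OF pp T[OF vf_add[OF X Y] Z] tspace_add[OF T[OF X Z] T[OF Y Z]]])
      fix V assume V: "vf_at N p V"
      show "g p (nab' (X + Y) Z p) (V p) = g p (nab' X Z p + nab' Y Z p) (V p)"
        using tensorialD(1)[OF t1[OF Z V] X Y]
        by (simp add: I[OF vf_add[OF X Y] Z V] conn_add1[OF C X Y Z] g_add1[OF pp T[OF X Z] T[OF Y Z] vf_tspace[OF V]]
            I[OF X Z V] I[OF Y Z V] g_add1[OF pp conn_tspace[OF C X Z] conn_tspace[OF C Y Z] vf_tspace[OF V]])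
    qed
    show "nab' X (Y + Z) p = nab' X Y p + nab' X Z p"
    proof (rule g_nondeg_vf[OF pp T[OF X vf_add[OF Y Z]] tspace_add[OF T[OF X Y] T[OF X Z]]])
      fix V assume V: "vf_at N p V"
      show "g p (nab' X (Y + Z) p) (V p) = g p (nab' X Y p + nab' X Z p) (V p)"
        using tensorialD(1)[OF t2[OF X V] Y Z]
        by (simp add: I[OF X vf_add[OF Y Z] V] conn_add2[OF C X Y Z] g_add1[OF pp T[OF X Y] T[OF X Z] vf_tspace[OF V]]
            I[OF X Y V] I[OF X Z V] g_add1[OF pp conn_tspace[OF C X Y] conn_tspace[OF C X Z] vf_tspace[OF V]])
    qed
  next
    fix p X Y f assume X: "vf_at N p X" and Y: "vf_at N p Y" and f: "sf_at N p f"
    note pp = vf_pts[OF X]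
    show "nab' (fscale f X) Y p = tscale (f p) (nab' X Y p)"
    proof (rule g_nondeg_vf[OF pp T[OF vf_scale[OF f X] Y] tspace_scale[OF T[OF X Y]]])
      fix V assume V: "vf_at N p V"
      show "g p (nab' (fscale f X) Y p) (V p) = g p (tscale (f p) (nab' X Y p)) (V p)"
        using tensorialD(2)[OF t1[OF Y V] f X]
        by (simp add: I[OF vf_scale[OF f X] Y V] conn_scale1[OF C X Y f] g_scale1[OF pp T[OF X Y] vf_tspace[OF V]]
            I[OF X Y V] g_scale1[OF pp conn_tspace[OF C X Y] vf_tspace[OF V]] algebra_simps)
    qed
    show "nab' X (fscale f Y) p = tscale (f p) (nab' X Y p) + tscale (lie_deriv N X f p) (Y p)"
    proof (rule g_nondeg_vf[OF pp T[OF X vf_scale[OF f Y]] tspace_add[OF tspace_scale[OF T[OF X Y]] tspace_scale[OF vf_tspace[OF Y]]]])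
      fix V assume V: "vf_at N p V"
      note t = vf_tspace[OF V] conn_tspace[OF C X Y] vf_tspace[OF Y] T[OF X Y]
      show "g p (nab' X (fscale f Y) p) (V p) = g p (tscale (f p) (nab' X Y p) + tscale (lie_deriv N X f p) (Y p)) (V p)"
        using tensorialD(2)[OF t2[OF X V] f Y]
        by (simp add: I[OF X vf_scale[OF f Y] V] conn_scale2[OF C X Y f] g_add1[OF pp] g_scale1[OF pp] t tspace_scale
            I[OF X Y V] algebra_simps)
    qed
  qed (rule V)
qed

end

section \<open>Hermitian manifolds\<close>

text \<open>Kept apart from \<open>herm\<close> because \<open>DJ\<close> has to be available for
  the lifted endomorphism before that is known to be a complex structure;
  \<open>complex_structure_J1\<close> depends on it.\<close>

locale acs = atlas N for N :: "('p, 'i) mfd" +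
  fixes J :: "('p, 'i) endo"
  assumes J_tspace: "p \<in> pts N \<Longrightarrow> u \<in> tspace N p \<Longrightarrow> J p u \<in> tspace N p"
    and J_add: "p \<in> pts N \<Longrightarrow> u \<in> tspace N p \<Longrightarrow> v \<in> tspace N p \<Longrightarrow> J p (u + v) = J p u + J p v"
    and J_scale: "p \<in> pts N \<Longrightarrow> u \<in> tspace N p \<Longrightarrow> J p (tscale c u) = tscale c (J p u)"
    and J_vf: "vf_at N p X \<Longrightarrow> vf_at N p (app J X)"
begin

lemma J_minus: "p \<in> pts N \<Longrightarrow> u \<in> tspace N p \<Longrightarrow> J p (- u) = - J p u"
  using J_scale[of p u "-1"] by (simp add: tscale_minus_one)

lemma J_diff: "p \<in> pts N \<Longrightarrow> u \<in> tspace N p \<Longrightarrow> v \<in> tspace N p \<Longrightarrow> J p (u - v) = J p u - J p v"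
  using J_add[of p u "- v"] J_minus[of p v] tspace_minus[of v N p] by simp

lemma app_apply [simp]: "app J X p = J p (X p)"
  by (simp add: app_def)

lemma tensorial_app: "tensorial N p L \<Longrightarrow> tensorial N p (\<lambda>X. L (app J X))"
proof (rule tensorialI)
  assume L: "tensorial N p L"
  fix X Y assume X: "vf_at N p X" and Y: "vf_at N p Y"
  show "L (app J (X + Y)) = L (app J X) + L (app J Y)"
    by (rule tensorial_pt_add[OF L J_vf[OF vf_add[OF X Y]] J_vf[OF X] J_vf[OF Y]])
      (simp add: J_add vf_pts[OF X] vf_tspace X Y)
  assume "near N p (\<lambda>q. X q = Y q)"
  then have "X p = Y p" using near_point[OF vf_pts[OF X]] by blast
  then show "L (app J X) = L (app J Y)"
    by (intro tensorial_pt[OF L J_vf[OF X] J_vf[OF Y]]) simp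
next
  assume L: "tensorial N p L"
  fix f X assume f: "sf_at N p f" and X: "vf_at N p X"
  have "L (app J (fscale f X)) = L (fscale f (app J X))"
    by (rule tensorial_pt[OF L J_vf[OF vf_scale[OF f X]] vf_scale[OF f J_vf[OF X]]])
      (simp add: J_scale vf_pts[OF X] vf_tspace X)
  then show "L (app J (fscale f X)) = f p * L (app J X)" using tensorialD(2)[OF L f J_vf[OF X]] by simp
qed

text \<open>The covariant derivative of the endomorphism field \<open>J\<close> along
  \<open>X\<close>, applied to \<open>Y\<close>.\<close>

definition DJ :: "('p, 'i) cnx \<Rightarrow> ('p, 'i) cnx" where
  "DJ nab X Y = (\<lambda>p. nab X (app J Y) p - J p (nab X Y p))"

lemma DJ_vf: "connection N nab \<Longrightarrow> vf_at N p X \<Longrightarrow> vf_at N p Y \<Longrightarrow> vf_at N p (DJ nab X Y)"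
  unfolding DJ_def using vf_diff[OF conn_vf[OF _ _ J_vf] J_vf[OF conn_vf], of nab p X Y nab X Y] by simp

lemma DJ_tspace: "connection N nab \<Longrightarrow> vf_at N p X \<Longrightarrow> vf_at N p Y \<Longrightarrow> DJ nab X Y p \<in> tspace N p"
  by (rule vf_tspace[OF DJ_vf])

lemma DJ_tensorial1:
  assumes C: "connection N nab"
  shows "vf_at N p Y \<Longrightarrow> tensorial N p (\<lambda>X. DJ nab X Y p i c)"
proof (rule tensorialI)
  assume Y: "vf_at N p Y"
  note JY = J_vf[OF Y]
  fix X X' assume X: "vf_at N p X" and X': "vf_at N p X'"
  show "DJ nab (X + X') Y p i c = DJ nab X Y p i c + DJ nab X' Y p i c"
    by (simp add: DJ_def conn_add1[OF C X X' Y] conn_add1[OF C X X' JY] J_add[OF vf_pts[OF X]] conn_tspace[OF C] X X' Y)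
  assume "near N p (\<lambda>q. X q = X' q)"
  then have "X p = X' p" using near_point[OF vf_pts[OF X]] by blast
  then show "DJ nab X Y p i c = DJ nab X' Y p i c"
    unfolding DJ_def using conn_pt1[OF C X X' Y] conn_pt1[OF C X X' JY] by simp
next
  assume Y: "vf_at N p Y"
  note JY = J_vf[OF Y]
  fix f X assume f: "sf_at N p f" and X: "vf_at N p X"
  show "DJ nab (fscale f X) Y p i c = f p * DJ nab X Y p i c"
    by (simp add: DJ_def conn_scale1[OF C X Y f] conn_scale1[OF C X JY f] J_scale[OF vf_pts[OF X]]
        conn_tspace[OF C] X Y algebra_simps)
qed

text \<open>The derivative of \<open>f\<close> multiplies \<open>J Y\<close> in both terms, because
  \<open>J\<close> is linear, and cancels.\<close>

lemma DJ_tensorial2: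
  assumes C: "connection N nab"
  shows "vf_at N p X \<Longrightarrow> tensorial N p (\<lambda>Y. DJ nab X Y p i c)"
proof (rule tensorialI)
  assume X: "vf_at N p X"
  note pp = vf_pts[OF X]
  have e: "near N p (\<lambda>q. X q = X q)" by simp
  fix Y Y' assume Y: "vf_at N p Y" and Y': "vf_at N p Y'"
  note JY = J_vf[OF Y] J_vf[OF Y']
  have "nab X (app J (Y + Y')) p = nab X (app J Y + app J Y') p"
  proof (rule conn_cong[OF C X J_vf[OF vf_add[OF Y Y']] e])
    show "near N p (\<lambda>q. app J (Y + Y') q = (app J Y + app J Y') q)"
      using near_pts[OF pp] vf_near_tspace[OF Y] vf_near_tspace[OF Y'] by eventually_elim (simp add: J_add)
  qed
  then show "DJ nab X (Y + Y') p i c = DJ nab X Y p i c + DJ nab X Y' p i c"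
    by (simp add: DJ_def conn_add2[OF C X Y Y'] conn_add2[OF C X JY] J_add[OF pp] conn_tspace[OF C] X Y Y')
  assume n: "near N p (\<lambda>q. Y q = Y' q)"
  then have n': "near N p (\<lambda>q. app J Y q = app J Y' q)" by (rule eventually_mono) simp
  show "DJ nab X Y p i c = DJ nab X Y' p i c"
    unfolding DJ_def conn_cong[OF C X Y e n] conn_cong[OF C X JY(1) e n'] ..
next
  assume X: "vf_at N p X"
  note pp = vf_pts[OF X]
  have e: "near N p (\<lambda>q. X q = X q)" by simp
  fix f Y assume f: "sf_at N p f" and Y: "vf_at N p Y"
  note JY = J_vf[OF Y]
  have "nab X (app J (fscale f Y)) p = nab X (fscale f (app J Y)) p"
  proof (rule conn_cong[OF C X J_vf[OF vf_scale[OF f Y]] e])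
    show "near N p (\<lambda>q. app J (fscale f Y) q = tscale (f q) (app J Y q))"
      using near_pts[OF pp] vf_near_tspace[OF Y] by eventually_elim (simp add: J_scale)
  qed
  then have "nab X (app J (fscale f Y)) p = tscale (f p) (nab X (app J Y) p) + tscale (lie_deriv N X f p) (app J Y p)"
    unfolding conn_scale2[OF C X JY f] .
  then show "DJ nab X (fscale f Y) p i c = f p * DJ nab X Y p i c"
    by (simp add: DJ_def conn_scale2[OF C X Y f] J_add[OF pp] J_scale[OF pp]
        conn_tspace[OF C] X Y tspace_scale vf_tspace algebra_simps)
qed

end

section \<open>The fundamental form and the Chern and Bismut connections\<close>

locale herm = riem N g for N :: "('p, 'i) mfd" and g :: "('p, 'i) metr" +
  fixes J :: "('p, 'i) endo"
  assumes herm: "hermitian N J g"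
begin

lemma J_point:
  assumes p: "p \<in> pts N" and u: "u \<in> tspace N p"
  shows herm_J_tspace: "J p u \<in> tspace N p" and J_J: "J p (J p u) = - u"
    and herm_J_add: "v \<in> tspace N p \<Longrightarrow> J p (u + v) = J p u + J p v"
    and herm_J_scale: "J p (tscale c u) = tscale c (J p u)"
    and J_isom: "v \<in> tspace N p \<Longrightarrow> g p (J p u) (J p v) = g p u v"
proof -
  note h = herm[unfolded hermitian_def, THEN conjunct2, THEN conjunct2]
  note c = h[THEN conjunct1, unfolded complex_structure_def, THEN conjunct1, THEN bspec, THEN bspec, OF p u]
  show "J p u \<in> tspace N p" using c by (rule conjunct1)
  show "J p (J p u) = - u" using c by (elim conjE)
  show "J p (u + v) = J p u + J p v" if "v \<in> tspace N p"
    using c[THEN conjunct2, THEN conjunct2, THEN conjunct1] that by (rule bspec)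
  show "J p (tscale c u) = tscale c (J p u)"
    using c[THEN conjunct2, THEN conjunct2, THEN conjunct2] by (rule spec)
  show "g p (J p u) (J p v) = g p u v" if "v \<in> tspace N p"
    using h[THEN conjunct2, THEN bspec, THEN bspec, OF p u] that by (rule bspec)
qed

lemma herm_J_vf: "vf_at N p X \<Longrightarrow> vf_at N p (app J X)"
proof -
  assume X: "vf_at N p X"
  then obtain W where W: "openin (mtop N) W" "p \<in> W" "X \<in> vfields N W" by (auto simp: vf_at_def)
  from herm[unfolded hermitian_def, THEN conjunct2, THEN conjunct2, THEN conjunct1, unfolded complex_structure_def,
      THEN conjunct2, THEN conjunct1, THEN spec, THEN mp, OF W(1)] W(3)
  have "app J X \<in> vfields N W" by (rule bspec)
  with W show ?thesis by (auto simp: vf_at_def)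
qed

sublocale acs N J
  by unfold_locales (rule herm_J_tspace herm_J_add herm_J_scale herm_J_vf; assumption)+

lemma J_skew: "p \<in> pts N \<Longrightarrow> u \<in> tspace N p \<Longrightarrow> v \<in> tspace N p \<Longrightarrow> g p (J p u) v = - g p u (J p v)"
  using J_isom[of p "J p u" v] J_J[of p u] g_minus1[of p u "J p v"] by (simp add: J_tspace)

abbreviation T3 :: "('p, 'i) vfield \<Rightarrow> ('p, 'i) vfield \<Rightarrow> ('p, 'i) vfield \<Rightarrow> 'p \<Rightarrow> real" where
  "T3 X Y Z p \<equiv> g p (DJ LC X Y p) (Z p)"

lemma T3_tensorial:
  assumes X: "vf_at N p X" and Y: "vf_at N p Y"
  shows T3_tensorial1: "tensorial N p (\<lambda>Z. T3 Z X Y p)"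
    and T3_tensorial2: "tensorial N p (\<lambda>Z. T3 X Z Y p)"
    and T3_tensorial3: "tensorial N p (\<lambda>Z. T3 X Y Z p)"
proof -
  note pp = vf_pts[OF X]
  show "tensorial N p (\<lambda>Z. T3 Z X Y p)"
    by (rule tensorial_ip_left[OF pp vf_tspace[OF Y] DJ_tspace[OF LC_conn _ X] DJ_tensorial1[OF LC_conn X]])
  show "tensorial N p (\<lambda>Z. T3 X Z Y p)"
    by (rule tensorial_ip_left[OF pp vf_tspace[OF Y] DJ_tspace[OF LC_conn X] DJ_tensorial2[OF LC_conn X]])
  show "tensorial N p (\<lambda>Z. T3 X Y Z p)" by (rule tensorial_ip_right[OF pp DJ_tspace[OF LC_conn X Y]])
qed

text \<open>The metric is parallel, so differentiating the fundamental form amounts to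
  differentiating \<open>J\<close>.\<close>

lemma cov_deriv_fund_form:
  assumes Z: "vf_at N p Z" and X: "vf_at N p X" and Y: "vf_at N p Y"
  shows "cov_deriv2 N LC (fund_form J g) Z X Y p = T3 Z X Y p"
proof -
  note pp = vf_pts[OF Z]
  note JX = J_vf[OF X]
  have "lie_deriv N Z (fund_form J g X Y) p = g p (LC Z (app J X) p) (Y p) + g p (J p (X p)) (LC Z Y p)"
    using LC_metric[OF Z JX Y] by (simp add: fund_form_def)
  moreover have "T3 Z X Y p = g p (LC Z (app J X) p) (Y p) - g p (J p (LC Z X p)) (Y p)"
    unfolding DJ_def by (rule g_diff1[OF pp LC_tspace[OF Z JX] J_tspace[OF pp LC_tspace[OF Z X]] vf_tspace[OF Y]])
  ultimately show ?thesis by (simp add: cov_deriv2_def fund_form_def)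
qed

text \<open>For a torsion-free connection the exterior derivative is the cyclic sum of the covariant
  derivative; the brackets are written as differences of covariant derivatives.\<close>

lemma ext_deriv_fund_form:
  assumes X: "vf_at N p X" and Y: "vf_at N p Y" and Z: "vf_at N p Z"
  shows "ext_deriv2 N (fund_form J g) X Y Z p = T3 X Y Z p + T3 Y Z X p + T3 Z X Y p"
proof -
  note pp = vf_pts[OF X]
  have l: "lie_deriv N U (fund_form J g V W) p = g p (LC U (app J V) p) (W p) + g p (J p (V p)) (LC U W p)"
    if "vf_at N p U" "vf_at N p V" "vf_at N p W" for U V W
    using LC_metric[OF that(1) J_vf[OF that(2)] that(3)] by (simp add: fund_form_def)
  have t: "T3 U V W p = g p (LC U (app J V) p) (W p) - g p (J p (LC U V p)) (W p)"
    if "vf_at N p U" "vf_at N p V" "vf_at N p W" for U V W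
    unfolding DJ_def
    by (rule g_diff1[OF pp LC_tspace[OF that(1) J_vf[OF that(2)]] J_tspace[OF pp LC_tspace[OF that(1,2)]] vf_tspace[OF that(3)]])
  \<comment> \<open>Skewness of \<open>J\<close> rewrites the second term so that it matches a term
    of \<open>l\<close> for a cyclically shifted triple, against which it cancels.\<close>
  have b: "fund_form J g (bracket N U V) W p = g p (J p (LC U V p)) (W p) + g p (J p (W p)) (LC V U p)"
    if "vf_at N p U" "vf_at N p V" "vf_at N p W" for U V W
  proof -
    note uv = LC_tspace[OF that(1,2)] and vu = LC_tspace[OF that(2,1)] and w = vf_tspace[OF that(3)]
    have "fund_form J g (bracket N U V) W p = g p (J p (LC U V p)) (W p) - g p (J p (LC V U p)) (W p)"
      using g_diff1[OF pp J_tspace[OF pp uv] J_tspace[OF pp vu] w] J_diff[OF pp uv vu] LC_torsion[OF that(1,2)]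
      by (simp add: fund_form_def)
    then show ?thesis using J_skew[OF pp vu w] g_sym[OF pp vu J_tspace[OF pp w]] by simp
  qed
  show ?thesis
    unfolding ext_deriv2_def l[OF X Y Z] l[OF Y Z X] l[OF Z X Y] t[OF X Y Z] t[OF Y Z X] t[OF Z X Y]
      b[OF X Y Z] b[OF Y Z X] b[OF Z X Y] by simp
qed

lemma ext_deriv_tensorial:
  assumes X: "vf_at N p X" and Y: "vf_at N p Y"
  shows "tensorial N p (\<lambda>Z. ext_deriv2 N (fund_form J g) Z X Y p)"
    and "tensorial N p (\<lambda>Z. ext_deriv2 N (fund_form J g) X Z Y p)"
    and "tensorial N p (\<lambda>Z. ext_deriv2 N (fund_form J g) X Y Z p)"
proof -
  note t = T3_tensorial[OF X Y] T3_tensorial[OF Y X]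
  note a = tensorial_add[OF tensorial_add]
  show "tensorial N p (\<lambda>Z. ext_deriv2 N (fund_form J g) Z X Y p)"
    by (rule tensorial_cong[OF a[OF t(1,3,5)]]) (simp add: ext_deriv_fund_form X Y)
  show "tensorial N p (\<lambda>Z. ext_deriv2 N (fund_form J g) X Z Y p)"
    by (rule tensorial_cong[OF a[OF t(2,4,6)]]) (simp add: ext_deriv_fund_form X Y)
  show "tensorial N p (\<lambda>Z. ext_deriv2 N (fund_form J g) X Y Z p)"
    by (rule tensorial_cong[OF a[OF t(3,5,1)]]) (simp add: ext_deriv_fund_form X Y)
qed

lemma sf_ext_deriv:
  assumes X: "vf_at N p X" and Y: "vf_at N p Y" and Z: "vf_at N p Z"
  shows "sf_at N p (ext_deriv2 N (fund_form J g) X Y Z)"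
proof -
  have "sf_at N p (\<lambda>p. T3 X Y Z p + T3 Y Z X p + T3 Z X Y p)"
    by (intro sf_add sf_ip DJ_vf[OF LC_conn] X Y Z)
  moreover have "near N p (\<lambda>p. T3 X Y Z p + T3 Y Z X p + T3 Z X Y p = ext_deriv2 N (fund_form J g) X Y Z p)"
    using vf_near[OF X] vf_near[OF Y] vf_near[OF Z] by eventually_elim (simp add: ext_deriv_fund_form)
  ultimately show ?thesis by (rule sf_cong)
qed

lemma chern_conn: "connection N (chern N J g)"
  and chern_ip: "vf_at N p X \<Longrightarrow> vf_at N p Y \<Longrightarrow> vf_at N p Z \<Longrightarrow>
    g p (chern N J g X Y p) (Z p) = g p (LC X Y p) (Z p) - 1/2 * ext_deriv2 N (fund_form J g) (app J X) Y Z p"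
proof -
  let ?\<tau> = "\<lambda>X Y Z p. (-1/2) * ext_deriv2 N (fund_form J g) (app J X) Y Z p"
  have t1: "tensorial N p (\<lambda>X. ?\<tau> X Y Z p)" if "vf_at N p Y" "vf_at N p Z" for p Y Z
    by (rule tensorial_cmult[OF tensorial_app[OF ext_deriv_tensorial(1)[OF that]]])
  have t2: "tensorial N p (\<lambda>Y. ?\<tau> X Y Z p)" if "vf_at N p X" "vf_at N p Z" for p X Z
    by (rule tensorial_cmult[OF ext_deriv_tensorial(2)[OF J_vf[OF that(1)] that(2)]])
  have t3: "tensorial N p (\<lambda>Z. ?\<tau> X Y Z p)" if "vf_at N p X" "vf_at N p Y" for p X Y
    by (rule tensorial_cmult[OF ext_deriv_tensorial(3)[OF J_vf[OF that(1)] that(2)]])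
  have s: "sf_at N p (?\<tau> X Y Z)" if "vf_at N p X" "vf_at N p Y" "vf_at N p Z" for p X Y Z
    by (rule sf_cmult[OF sf_ext_deriv[OF J_vf[OF that(1)] that(2,3)]])
  have c: "chern N J g X Y = (\<lambda>p. metric_dual N g p (\<lambda>Z. g p (LC X Y p) (Z p) + ?\<tau> X Y Z p))" for X Y
    by (simp add: chern_def)
  show "connection N (chern N J g)" by (rule dual_connection(1)[OF LC_conn t1 t2 t3 s c])
  show "vf_at N p X \<Longrightarrow> vf_at N p Y \<Longrightarrow> vf_at N p Z \<Longrightarrow>
    g p (chern N J g X Y p) (Z p) = g p (LC X Y p) (Z p) - 1/2 * ext_deriv2 N (fund_form J g) (app J X) Y Z p"
    using dual_connection(2)[OF LC_conn t1 t2 t3 s c, of p X Y Z] by simp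
qed

lemma bismut_conn: "connection N (bismut N J g)"
  and bismut_ip: "vf_at N p X \<Longrightarrow> vf_at N p Y \<Longrightarrow> vf_at N p Z \<Longrightarrow>
    g p (bismut N J g X Y p) (Z p) =
      g p (LC X Y p) (Z p) + 1/2 * ext_deriv2 N (fund_form J g) (app J X) (app J Y) (app J Z) p"
proof -
  let ?\<tau> = "\<lambda>X Y Z p. 1/2 * ext_deriv2 N (fund_form J g) (app J X) (app J Y) (app J Z) p"
  have t1: "tensorial N p (\<lambda>X. ?\<tau> X Y Z p)" if "vf_at N p Y" "vf_at N p Z" for p Y Z
    by (rule tensorial_cmult[OF tensorial_app[OF ext_deriv_tensorial(1)[OF J_vf[OF that(1)] J_vf[OF that(2)]]]])
  have t2: "tensorial N p (\<lambda>Y. ?\<tau> X Y Z p)" if "vf_at N p X" "vf_at N p Z" for p X Z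
    by (rule tensorial_cmult[OF tensorial_app[OF ext_deriv_tensorial(2)[OF J_vf[OF that(1)] J_vf[OF that(2)]]]])
  have t3: "tensorial N p (\<lambda>Z. ?\<tau> X Y Z p)" if "vf_at N p X" "vf_at N p Y" for p X Y
    by (rule tensorial_cmult[OF tensorial_app[OF ext_deriv_tensorial(3)[OF J_vf[OF that(1)] J_vf[OF that(2)]]]])
  have s: "sf_at N p (?\<tau> X Y Z)" if "vf_at N p X" "vf_at N p Y" "vf_at N p Z" for p X Y Z
    by (rule sf_cmult[OF sf_ext_deriv[OF J_vf[OF that(1)] J_vf[OF that(2)] J_vf[OF that(3)]]])
  have c: "bismut N J g X Y = (\<lambda>p. metric_dual N g p (\<lambda>Z. g p (LC X Y p) (Z p) + ?\<tau> X Y Z p))" for X Y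
    by (simp add: bismut_def)
  show "connection N (bismut N J g)" by (rule dual_connection(1)[OF LC_conn t1 t2 t3 s c])
  show "vf_at N p X \<Longrightarrow> vf_at N p Y \<Longrightarrow> vf_at N p Z \<Longrightarrow>
    g p (bismut N J g X Y p) (Z p) =
      g p (LC X Y p) (Z p) + 1/2 * ext_deriv2 N (fund_form J g) (app J X) (app J Y) (app J Z) p"
    using dual_connection(2)[OF LC_conn t1 t2 t3 s c, of p X Y Z] by simp
qed

end

section \<open>The tangent bundle as a manifold\<close>

lemma sum_double: "(\<Sum>a<2 * n. h a) = (\<Sum>a<n. h a) + (\<Sum>a<n. h (n + a))" for h :: "nat \<Rightarrow> 'x :: comm_monoid_add"
proof -
  have "(\<Sum>a<n + n. h a) = (\<Sum>a<n. h a) + (\<Sum>a=n..<n + n. h a)"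
    by (simp add: lessThan_atLeast0 sum.atLeastLessThan_concat)
  also have "(\<Sum>a=n..<n + n. h a) = (\<Sum>a<n. h (n + a))"
    using sum.shift_bounds_nat_ivl[of h 0 n n] by (simp add: lessThan_atLeast0 add.commute)
  finally show ?thesis by (simp add: mult_2)
qed

lemma smooth_on_sum:
  "openin (Euclidean_space n) S \<Longrightarrow> (\<And>i. i \<in> I \<Longrightarrow> smooth_on n S (f i)) \<Longrightarrow> smooth_on n S (\<lambda>x. \<Sum>i\<in>I. f i x)"
  unfolding smooth_on_def by (auto intro: Ck_on_sum)

abbreviation lower :: "nat \<Rightarrow> (nat \<Rightarrow> real) \<Rightarrow> nat \<Rightarrow> real" where
  "lower n \<equiv> tuple n (\<lambda>b x. x b)"

lemma openin_lower:
  assumes "openin (Euclidean_space n) A"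
  shows "openin (Euclidean_space (2 * n)) {x \<in> eucl (2 * n). lower n x \<in> A}"
  unfolding openin_Euclidean_box
proof (intro conjI ballI)
  fix x assume x: "x \<in> {x \<in> eucl (2 * n). lower n x \<in> A}"
  then obtain e where e: "e > 0" "\<And>y. y \<in> eucl n \<Longrightarrow> (\<And>a. a < n \<Longrightarrow> \<bar>y a - lower n x a\<bar> < e) \<Longrightarrow> y \<in> A"
    using openin_EuclideanD[OF assms, of "lower n x"] by blast
  show "\<exists>e>0. \<forall>y\<in>eucl (2 * n). (\<forall>a<2 * n. \<bar>y a - x a\<bar> < e) \<longrightarrow> y \<in> {x \<in> eucl (2 * n). lower n x \<in> A}"
    using e by (intro exI[of _ e]) (auto intro!: e(2) simp: tuple_def eucl_iff)
qed auto

section \<open>Charts and transition maps of the tangent bundle\<close>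

locale tbundle = atlas N for N :: "('a, 'i) tmfd"
begin

abbreviation "TN \<equiv> tangent_bundle N"

lemma TN_simps [simp]: "dim TN = 2 * n" "idx TN = idx N"
  and chart_TN: "chart TN i \<xi> a = (if a < n then chart N i (foot \<xi>) a else if a < 2 * n then vel \<xi> i (a - n) else 0)"
  by (simp_all add: tangent_bundle_def)

lemma dom_TN: "\<xi> \<in> dom TN i \<longleftrightarrow> \<xi> = Tan (foot \<xi>) (vel \<xi>) \<and> foot \<xi> \<in> dom N i \<and> vel \<xi> \<in> tspace N (foot \<xi>)"
  by (auto simp: tangent_bundle_def)

lemma pts_TN: "\<xi> \<in> pts TN \<longleftrightarrow> \<xi> = Tan (foot \<xi>) (vel \<xi>) \<and> foot \<xi> \<in> pts N \<and> vel \<xi> \<in> tspace N (foot \<xi>)"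
  by (auto simp: pts_def dom_TN)

lemma dom_TN_pts: "\<xi> \<in> pts TN \<Longrightarrow> \<xi> \<in> dom TN i \<longleftrightarrow> foot \<xi> \<in> dom N i"
  by (auto simp: pts_TN dom_TN)

lemma chart_TN_eucl: "chart TN i \<xi> \<in> eucl (2 * n)"
  by (simp add: eucl_iff chart_TN)

lemma lower_chart_TN: "i \<in> idx N \<Longrightarrow> foot \<xi> \<in> dom N i \<Longrightarrow> lower n (chart TN i \<xi>) = chart N i (foot \<xi>)"
  using chart_eucl[of i "foot \<xi>"] by (auto simp: fun_eq_iff tuple_def chart_TN eucl_iff)

lemma inj_chart_TN: "i \<in> idx N \<Longrightarrow> inj_on (chart TN i) (dom TN i)"
proof (rule inj_onI)
  fix \<xi> \<eta> assume i: "i \<in> idx N" and \<xi>: "\<xi> \<in> dom TN i" and \<eta>: "\<eta> \<in> dom TN i" and eq: "chart TN i \<xi> = chart TN i \<eta>"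
  have f: "foot \<xi> \<in> dom N i" "foot \<eta> \<in> dom N i" and v: "vel \<xi> \<in> tspace N (foot \<xi>)" "vel \<eta> \<in> tspace N (foot \<eta>)"
    and T: "\<xi> = Tan (foot \<xi>) (vel \<xi>)" "\<eta> = Tan (foot \<eta>) (vel \<eta>)" using \<xi> \<eta> unfolding dom_TN by blast+
  have ff: "foot \<xi> = foot \<eta>"
    using lower_chart_TN[OF i f(1)] lower_chart_TN[OF i f(2)] eq inj_onD[OF inj_chart[OF i] _ f] by simp
  moreover have "vel \<xi> = vel \<eta>"
  proof (rule tspace_eqI[OF v(1) v(2)[folded ff] i f(1)])
    fix a assume "a < n"
    then show "vel \<xi> i a = vel \<eta> i a" using fun_cong[OF eq, of "n + a"] by (simp add: chart_TN)
  qed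
  ultimately show "\<xi> = \<eta>" using T by metis
qed

lemma tspace_with_coords:
  assumes i: "i \<in> idx N" "p \<in> dom N i"
  obtains v where "v \<in> tspace N p" "\<forall>b<n. v i b = y b"
proof (rule that[of "\<Sum>b<n. tscale (y b) (coord_field N i b p)"])
  show "(\<Sum>b<n. tscale (y b) (coord_field N i b p)) \<in> tspace N p"
    using i by (intro tspace_sum tspace_scale coord_field_tspace) auto
  show "\<forall>c<n. (\<Sum>b<n. tscale (y b) (coord_field N i b p)) i c = y c"
    using i by (simp add: fun_sum_apply coord_field_self sum_delta_mult)
qed

text \<open>Every vector of fibre coordinates is attained, by a combination of coordinate vectors.
  The image is thus a full cylinder over the image of \<open>D\<close>, and its openness reduces to
  the base.\<close>

lemma chart_TN_image:
  assumes i: "i \<in> idx N" and D: "D \<subseteq> dom N i"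
  shows "chart TN i ` {\<xi> \<in> dom TN i. foot \<xi> \<in> D} = {x \<in> eucl (2 * n). lower n x \<in> chart N i ` D}"
proof (intro equalityI subsetI)
  fix x assume "x \<in> {x \<in> eucl (2 * n). lower n x \<in> chart N i ` D}"
  then obtain p where x: "x \<in> eucl (2 * n)" "p \<in> D" "lower n x = chart N i p" by auto
  have p: "p \<in> dom N i" using x D by blast
  obtain v where v: "v \<in> tspace N p" "\<forall>b<n. v i b = x (n + b)" by (rule tspace_with_coords[OF i p])
  have "chart TN i (Tan p v) a = x a" for a
    using v(2)[rule_format, of "a - n"] x(1) fun_cong[OF x(3), of a] by (auto simp: chart_TN tuple_def eucl_iff)
  then have "x = chart TN i (Tan p v)" by auto
  moreover have "Tan p v \<in> {\<xi> \<in> dom TN i. foot \<xi> \<in> D}" using v p x by (simp add: dom_TN)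
  ultimately show "x \<in> chart TN i ` {\<xi> \<in> dom TN i. foot \<xi> \<in> D}" by blast
next
  fix x assume "x \<in> chart TN i ` {\<xi> \<in> dom TN i. foot \<xi> \<in> D}"
  then obtain \<xi> where "\<xi> \<in> dom TN i" "foot \<xi> \<in> D" "x = chart TN i \<xi>" by blast
  then show "x \<in> {x \<in> eucl (2 * n). lower n x \<in> chart N i ` D}"
    using lower_chart_TN[OF i, of \<xi>] chart_TN_eucl by (auto simp: dom_TN)
qed

text \<open>The transition map is the base transition map together with its derivative applied to
  the fibre coordinates. It is linear in the latter with smooth coefficients.\<close>

lemma smooth_atlas_TN: "smooth_atlas TN"
  unfolding smooth_atlas_def
proof (intro conjI ballI allI impI)
  fix i assume "i \<in> idx TN"
  then show "inj_on (chart TN i) (dom TN i)" by (simp add: inj_chart_TN)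
next
  fix i j assume "i \<in> idx TN" "j \<in> idx TN"
  then have i: "i \<in> idx N" and j: "j \<in> idx N" by auto
  let ?D = "dom N i \<inter> dom N j" and ?S = "chart TN i ` (dom TN i \<inter> dom TN j)"
  have "dom TN i \<inter> dom TN j = {\<xi> \<in> dom TN i. foot \<xi> \<in> ?D}" by (auto simp: dom_TN)
  then have S: "?S = {x \<in> eucl (2 * n). lower n x \<in> chart N i ` ?D}" using chart_TN_image[OF i, of ?D] by simp
  have oS: "openin (Euclidean_space (2 * n)) ?S" unfolding S by (rule openin_lower[OF open_overlap[OF i j]])
  then show "openin (Euclidean_space (dim TN)) ?S" by simp
  have comp: "smooth_on (2 * n) ?S (\<lambda>x. F (lower n x))" if "smooth_on n (chart N i ` ?D) F" for F
    by (rule smooth_on_compose[OF oS open_overlap[OF i j] _ that]) (auto simp: S smooth_on_coord)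
  fix a assume a: "a < dim TN"
  let ?tr = "\<lambda>c x. chart N j (chart_inv N i x) c"
  have inv: "chart_inv TN i x \<in> dom TN i \<inter> dom TN j" "chart TN i (chart_inv TN i x) = x" if "x \<in> ?S" for x
    using that inj_chart_TN[OF i] by auto
  have low: "lower n x = chart N i (foot (chart_inv TN i x))" if "x \<in> ?S" for x
    using lower_chart_TN[OF i, of "chart_inv TN i x"] inv[OF that] by (auto simp: dom_TN)
  show "smooth_on (dim TN) ?S (\<lambda>x. chart TN j (chart_inv TN i x) a)"
  proof (cases "a < n")
    case True
    have "smooth_on (2 * n) ?S (\<lambda>x. ?tr a (lower n x))" by (rule comp[OF smooth_trans[OF i j True]])
    then have "smooth_on (2 * n) ?S (\<lambda>x. chart TN j (chart_inv TN i x) a)"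
    proof (rule smooth_on_cong[OF oS])
      fix x assume x: "x \<in> ?S"
      then have "foot (chart_inv TN i x) \<in> dom N i" using inv[OF x] by (auto simp: dom_TN)
      then show "?tr a (lower n x) = chart TN j (chart_inv TN i x) a"
        using True low[OF x] i by (simp add: chart_TN)
    qed
    then show ?thesis by simp
  next
    case False
    let ?c = "a - n"
    have c: "?c < n" using a False by simp
    have "smooth_on (2 * n) ?S (\<lambda>x. \<Sum>d<n. pderiv_at d (?tr ?c) (lower n x) * x (n + d))"
      by (intro smooth_on_sum[OF oS] smooth_on_mult[OF oS] comp smooth_on_coord smooth_on_pderiv[OF smooth_trans[OF i j c]]) auto
    then have "smooth_on (2 * n) ?S (\<lambda>x. chart TN j (chart_inv TN i x) a)"
    proof (rule smooth_on_cong[OF oS])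
      fix x assume x: "x \<in> ?S"
      let ?\<xi> = "chart_inv TN i x"
      have \<xi>: "foot ?\<xi> \<in> dom N i" "foot ?\<xi> \<in> dom N j" "vel ?\<xi> \<in> tspace N (foot ?\<xi>)" using inv[OF x] by (auto simp: dom_TN)
      have "x (n + d) = vel ?\<xi> i d" if "d < n" for d
        using fun_cong[OF inv(2)[OF x], of "n + d"] that by (simp add: chart_TN)
      then have "(\<Sum>d<n. pderiv_at d (?tr ?c) (lower n x) * x (n + d)) = (\<Sum>d<n. jac N i j (foot ?\<xi>) ?c d * vel ?\<xi> i d)"
        by (simp add: jac_def low[OF x])
      also have "\<dots> = vel ?\<xi> j ?c" using tspace_trans[OF \<xi>(3) i j \<xi>(1,2) c] by simp
      also have "\<dots> = chart TN j ?\<xi> a" using a False by (simp add: chart_TN)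
      finally show "(\<Sum>d<n. pderiv_at d (?tr ?c) (lower n x) * x (n + d)) = chart TN j ?\<xi> a" .
    qed
    then show ?thesis by simp
  qed
qed

sublocale T: atlas TN
  by unfold_locales (rule smooth_atlas_TN)

section \<open>Functions pulled back from the base, and fibre coordinates\<close>

lemma openin_foot:
  assumes W: "openin (mtop N) W" shows "openin (mtop TN) {\<xi> \<in> pts TN. foot \<xi> \<in> W}"
  unfolding T.openin_mtop
proof (intro conjI ballI)
  fix i assume "i \<in> idx TN"
  then have i: "i \<in> idx N" by simp
  have "{\<xi> \<in> pts TN. foot \<xi> \<in> W} \<inter> dom TN i = {\<xi> \<in> dom TN i. foot \<xi> \<in> W \<inter> dom N i}"
    using i by (auto simp: pts_TN dom_TN intro: dom_pts)
  then show "openin (Euclidean_space (dim TN)) (chart TN i ` ({\<xi> \<in> pts TN. foot \<xi> \<in> W} \<inter> dom TN i))"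
    using W i openin_lower[of n "chart N i ` (W \<inter> dom N i)"] chart_TN_image[OF i, of "W \<inter> dom N i"]
    by (simp add: openin_mtop)
qed auto

lemma foot_pts: "\<xi> \<in> pts TN \<Longrightarrow> foot \<xi> \<in> pts N"
  by (simp add: pts_TN)

lemma vel_tspace: "\<xi> \<in> pts TN \<Longrightarrow> vel \<xi> \<in> tspace N (foot \<xi>)"
  unfolding pts_TN by blast

lemma foot_dom: "\<xi> \<in> dom TN i \<Longrightarrow> foot \<xi> \<in> dom N i"
  unfolding dom_TN by blast

lemma near_foot: "\<xi> \<in> pts TN \<Longrightarrow> near N (foot \<xi>) P \<Longrightarrow> near TN \<xi> (\<lambda>\<eta>. P (foot \<eta>))"
proof -
  assume \<xi>: "\<xi> \<in> pts TN" and P: "near N (foot \<xi>) P"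
  obtain W where W: "openin (mtop N) W" "foot \<xi> \<in> W" "\<forall>q\<in>W. P q"
    using P foot_pts[OF \<xi>] by (rule vf_common_open)
  show ?thesis by (rule T.near_openI[OF openin_foot[OF W(1)]]) (use W \<xi> in auto)
qed

lemma foot_chart_inv:
  assumes i: "i \<in> idx N" and x: "x \<in> chart TN i ` dom TN i"
  shows "foot (chart_inv TN i x) = chart_inv N i (lower n x)"
proof -
  obtain \<xi> where \<xi>: "\<xi> \<in> dom TN i" "x = chart TN i \<xi>" using x by blast
  then show ?thesis using i lower_chart_TN[OF i foot_dom[OF \<xi>(1)]] T.chart_inv_chart[of i \<xi>] foot_dom[OF \<xi>(1)] by simp
qed

lemma sf_foot:
  assumes \<xi>: "\<xi> \<in> pts TN" and f: "sf_at N (foot \<xi>) f"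
  shows "sf_at TN \<xi> (\<lambda>\<eta>. f (foot \<eta>))"
proof -
  obtain i where i: "i \<in> idx N" "foot \<xi> \<in> dom N i" using foot_pts[OF \<xi>] by (rule obtain_chart)
  have \<xi>i: "\<xi> \<in> dom TN i" using dom_TN_pts[OF \<xi>] i by simp
  obtain U where U: "openin (Euclidean_space n) U" "chart N i (foot \<xi>) \<in> U" "U \<subseteq> chart N i ` dom N i"
    "smooth_on n U (\<lambda>x. f (chart_inv N i x))" by (rule sf_chartE[OF i f])
  let ?V = "{x \<in> eucl (2 * n). lower n x \<in> U}"
  have V: "openin (Euclidean_space (2 * n)) ?V" by (rule openin_lower[OF U(1)])
  have "{\<xi> \<in> dom TN i. foot \<xi> \<in> dom N i} = dom TN i" by (auto simp: dom_TN)
  then have sub: "?V \<subseteq> chart TN i ` dom TN i" using chart_TN_image[OF i(1) order_refl] U(3) by auto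
  have "smooth_on (2 * n) ?V (\<lambda>x. f (chart_inv N i (lower n x)))"
    by (rule smooth_on_compose[OF V U(1) _ U(4)]) (auto simp: smooth_on_coord)
  then have "smooth_on (2 * n) ?V (\<lambda>x. f (foot (chart_inv TN i x)))"
    by (rule smooth_on_cong[OF V]) (use sub foot_chart_inv[OF i(1)] in auto)
  moreover have "chart TN i \<xi> \<in> ?V" using U(2) lower_chart_TN[OF i] chart_TN_eucl by simp
  ultimately show ?thesis using V sub T.sf_chart[of i \<xi> "\<lambda>\<eta>. f (foot \<eta>)"] i \<xi>i by auto
qed

lemma pd_foot:
  assumes i: "i \<in> idx N" and \<xi>: "\<xi> \<in> dom TN i" and a: "a < 2 * n"
  shows "pd TN i a (\<lambda>\<eta>. f (foot \<eta>)) \<xi> = (if a < n then pd N i a f (foot \<xi>) else 0)"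
proof -
  let ?F = "\<lambda>x. f (chart_inv N i x)"
  have "pd TN i a (\<lambda>\<eta>. f (foot \<eta>)) \<xi> = pderiv_at a (\<lambda>x. ?F (lower n x)) (chart TN i \<xi>)"
    unfolding pd_def using T.open_chart_image[of i] i \<xi> a foot_chart_inv[OF i]
    by (intro pderiv_at_cong[of "2 * n" "chart TN i ` dom TN i"]) auto
  also have "\<dots> = (if a < n then pd N i a f (foot \<xi>) else 0)"
  proof (cases "a < n")
    case True
    have "lower n (x(a := t)) = (lower n x)(a := t)" for x t using True by (auto simp: tuple_def fun_eq_iff)
    then show ?thesis using True lower_chart_TN[OF i foot_dom[OF \<xi>]]
      by (simp add: pderiv_at_def pd_def chart_TN)
  next
    case False
    have "lower n (x(a := t)) = lower n x" for x t using False by (auto simp: tuple_def fun_eq_iff)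
    then show ?thesis using False by (simp add: pderiv_at_def)
  qed
  finally show ?thesis .
qed

lemma vel_near_chart:
  assumes i: "i \<in> idx N" and \<xi>: "\<xi> \<in> dom TN i" and b: "b < n"
  shows "near TN \<xi> (\<lambda>\<eta>. chart TN i \<eta> (n + b) = vel \<eta> i b)"
  by (rule T.near_openI[OF T.openin_dom, of i]) (use i \<xi> b in \<open>auto simp: chart_TN\<close>)

lemma sf_vel:
  assumes i: "i \<in> idx N" and \<xi>: "\<xi> \<in> dom TN i" and b: "b < n"
  shows "sf_at TN \<xi> (\<lambda>\<eta>. vel \<eta> i b)"
  by (rule T.sf_cong[OF T.sf_chart_coord[of i \<xi> "n + b"] vel_near_chart[OF assms]]) (use i \<xi> in auto)

lemma pd_vel:
  assumes i: "i \<in> idx N" and \<xi>: "\<xi> \<in> dom TN i" and b: "b < n" and a: "a < 2 * n"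
  shows "pd TN i a (\<lambda>\<eta>. vel \<eta> i b) \<xi> = (if a = n + b then 1 else 0)"
proof -
  have "pd TN i a (\<lambda>\<eta>. chart TN i \<eta> (n + b)) \<xi> = pd TN i a (\<lambda>\<eta>. vel \<eta> i b) \<xi>"
    by (rule T.pd_cong) (use i \<xi> a vel_near_chart[OF i \<xi> b] in auto)
  then show ?thesis using T.pd_chart[of i \<xi> a "n + b"] i \<xi> a by simp
qed

lemma pd_TN_sum:
  assumes i: "i \<in> idx N" and \<xi>: "\<xi> \<in> dom TN i" and a: "a < 2 * n" and f: "\<And>d. d \<in> A \<Longrightarrow> sf_at TN \<xi> (f d)"
  shows "pd TN i a (\<lambda>\<eta>. \<Sum>d\<in>A. f d \<eta>) \<xi> = (\<Sum>d\<in>A. pd TN i a (f d) \<xi>)"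
  using f
proof (induction A rule: infinite_finite_induct)
  case (insert d A)
  have "sf_at TN \<xi> (\<lambda>\<eta>. \<Sum>d\<in>A. f d \<eta>)" using insert i \<xi> by (intro T.sf_sum T.dom_pts) auto
  with insert show ?case using T.pd_add(1)[of i \<xi> a "f d" "\<lambda>\<eta>. \<Sum>d\<in>A. f d \<eta>"] i \<xi> a by simp
qed (simp_all add: T.pd_const)

text \<open>The Jacobian is block triangular with the base Jacobian twice on the diagonal. The
  remaining block holds second derivatives of the base transition map, contracted with the velocity;
  the Christoffel terms in the lifts exist to compensate it.\<close>

lemma jac_TN:
  assumes i: "i \<in> idx N" "\<xi> \<in> dom TN i" and j: "j \<in> idx N" "\<xi> \<in> dom TN j" and c: "c < n" and b: "b < n"
  shows "jac TN i j \<xi> c b = jac N i j (foot \<xi>) c b"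
    and "jac TN i j \<xi> c (n + b) = 0"
    and "jac TN i j \<xi> (n + c) b = (\<Sum>d<n. pd N i b (\<lambda>q. jac N i j q c d) (foot \<xi>) * vel \<xi> i d)"
    and "jac TN i j \<xi> (n + c) (n + b) = jac N i j (foot \<xi>) c b"
proof -
  have fi: "foot \<xi> \<in> dom N i" "foot \<xi> \<in> dom N j" using i j foot_dom by auto
  have "jac TN i j \<xi> c b' = pd TN i b' (\<lambda>\<eta>. chart N j (foot \<eta>) c) \<xi>" for b'
    using c by (simp add: jac_pd chart_TN)
  then show "jac TN i j \<xi> c b = jac N i j (foot \<xi>) c b" "jac TN i j \<xi> c (n + b) = 0"
    using b pd_foot[OF i, of _ "\<lambda>q. chart N j q c"] by (simp_all add: jac_pd)
  note \<xi> = T.dom_pts[of i \<xi>]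
  have sj: "sf_at TN \<xi> (\<lambda>\<eta>. jac N i j (foot \<eta>) c d)" if "d < n" for d
    by (rule sf_foot[OF T.dom_pts sf_jac]) (use i j fi that in auto)
  have near: "near TN \<xi> (\<lambda>\<eta>. chart TN j \<eta> (n + c) = (\<Sum>d<n. jac N i j (foot \<eta>) c d * vel \<eta> i d))"
  proof (rule T.near_openI[of "dom TN i \<inter> dom TN j"])
    show "openin (mtop TN) (dom TN i \<inter> dom TN j)" using T.openin_dom[of i] T.openin_dom[of j] i j by auto
    fix \<eta> assume "\<eta> \<in> dom TN i \<inter> dom TN j"
    then show "chart TN j \<eta> (n + c) = (\<Sum>d<n. jac N i j (foot \<eta>) c d * vel \<eta> i d)"
      using i j c by (simp add: chart_TN dom_TN tspace_trans[of "vel \<eta>" N "foot \<eta>" i j])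
  qed (use i j in auto)
  have J: "jac TN i j \<xi> (n + c) b' =
      (\<Sum>d<n. pd TN i b' (\<lambda>\<eta>. jac N i j (foot \<eta>) c d) \<xi> * vel \<xi> i d + jac N i j (foot \<xi>) c d * (if b' = n + d then 1 else 0))"
    if b': "b' < 2 * n" for b'
  proof -
    have "jac TN i j \<xi> (n + c) b' = pd TN i b' (\<lambda>\<eta>. \<Sum>d<n. jac N i j (foot \<eta>) c d * vel \<eta> i d) \<xi>"
      unfolding jac_pd[of TN] by (rule T.pd_cong) (use i b' near in auto)
    also have "\<dots> = (\<Sum>d<n. pd TN i b' (\<lambda>\<eta>. jac N i j (foot \<eta>) c d * vel \<eta> i d) \<xi>)"
      by (rule pd_TN_sum[OF i b'], rule T.sf_mult) (use i sj sf_vel[OF i] in auto)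
    also have "\<dots> = (\<Sum>d<n. pd TN i b' (\<lambda>\<eta>. jac N i j (foot \<eta>) c d) \<xi> * vel \<xi> i d +
        jac N i j (foot \<xi>) c d * (if b' = n + d then 1 else 0))"
    proof (intro sum.cong refl)
      fix d assume "d \<in> {..<n}"
      then show "pd TN i b' (\<lambda>\<eta>. jac N i j (foot \<eta>) c d * vel \<eta> i d) \<xi> =
          pd TN i b' (\<lambda>\<eta>. jac N i j (foot \<eta>) c d) \<xi> * vel \<xi> i d + jac N i j (foot \<xi>) c d * (if b' = n + d then 1 else 0)"
        using T.pd_add(2)[of i \<xi> b' "\<lambda>\<eta>. jac N i j (foot \<eta>) c d" "\<lambda>\<eta>. vel \<eta> i d"] i b' sj sf_vel[OF i] pd_vel[OF i]
        by simp
    qed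
    finally show ?thesis .
  qed
  show "jac TN i j \<xi> (n + c) b = (\<Sum>d<n. pd N i b (\<lambda>q. jac N i j q c d) (foot \<xi>) * vel \<xi> i d)"
    using J[of b] b pd_foot[OF i, of b "\<lambda>q. jac N i j q c _"] by simp
  show "jac TN i j \<xi> (n + c) (n + b) = jac N i j (foot \<xi>) c b"
    using J[of "n + b"] b pd_foot[OF i, of "n + b" "\<lambda>q. jac N i j q c _"] by (simp add: sum_delta_mult)
qed

text \<open>Points over different feet are separated below. Points over the same foot lie in a
  common chart, differ in some coordinate there, and are separated by the midpoint \<open>m\<close>
  of its two values.\<close>

lemma Hausdorff_TN:
  assumes H: "Hausdorff_space (mtop N)" shows "Hausdorff_space (mtop TN)"
  unfolding Hausdorff_space_def
proof (intro allI impI)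
  fix \<xi> \<eta> assume "\<xi> \<in> topspace (mtop TN) \<and> \<eta> \<in> topspace (mtop TN) \<and> \<xi> \<noteq> \<eta>"
  then have \<xi>: "\<xi> \<in> pts TN" and \<eta>: "\<eta> \<in> pts TN" and ne: "\<xi> \<noteq> \<eta>" by (auto simp: T.topspace_mtop)
  show "\<exists>U V. openin (mtop TN) U \<and> openin (mtop TN) V \<and> \<xi> \<in> U \<and> \<eta> \<in> V \<and> disjnt U V"
  proof (cases "foot \<xi> = foot \<eta>")
    case False
    then obtain U V where "openin (mtop N) U" "openin (mtop N) V" "foot \<xi> \<in> U" "foot \<eta> \<in> V" "disjnt U V"
      using H foot_pts[OF \<xi>] foot_pts[OF \<eta>] unfolding Hausdorff_space_def topspace_mtop by blast
    then show ?thesis using \<xi> \<eta> openin_foot[of U] openin_foot[of V]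
      by (intro exI[of _ "{\<zeta> \<in> pts TN. foot \<zeta> \<in> U}"] exI[of _ "{\<zeta> \<in> pts TN. foot \<zeta> \<in> V}"]) (auto simp: disjnt_iff)
  next
    case True
    obtain i where i: "i \<in> idx N" "foot \<xi> \<in> dom N i" using foot_pts[OF \<xi>] by (rule obtain_chart)
    have d: "\<xi> \<in> dom TN i" "\<eta> \<in> dom TN i" using i True dom_TN_pts[OF \<xi>] dom_TN_pts[OF \<eta>] by auto
    have "chart TN i \<xi> \<noteq> chart TN i \<eta>" using inj_onD[OF inj_chart_TN[OF i(1)] _ d] ne by blast
    then obtain a where a: "chart TN i \<xi> a \<noteq> chart TN i \<eta> a" by blast
    define m where "m = (chart TN i \<xi> a + chart TN i \<eta> a) / 2"
    have o: "openin (Euclidean_space (2 * n)) {x \<in> eucl (2 * n). x a \<in> B}" if "open B" for B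
    proof -
      have "open ((\<lambda>x :: nat \<Rightarrow> real. x a) -` B)"
        by (rule open_vimage[OF that continuous_on_product_coordinates])
      then show ?thesis unfolding openin_Euclidean_open
        by (intro exI[of _ "(\<lambda>x. x a) -` B"]) auto
    qed
    have P: "openin (mtop TN) {\<zeta> \<in> dom TN i. chart TN i \<zeta> a \<in> B}" if "open B" for B
    proof -
      have "{\<zeta> \<in> dom TN i. chart TN i \<zeta> a \<in> B} = {\<zeta> \<in> dom TN i. chart TN i \<zeta> \<in> {x \<in> eucl (2 * n). x a \<in> B}}"
        using chart_TN_eucl by auto
      then show ?thesis using T.openin_chart_preimage[of i "{x \<in> eucl (2 * n). x a \<in> B}"] i o[OF that] by simp
    qed
    let ?U = "{\<zeta> \<in> dom TN i. chart TN i \<zeta> a \<in> {..<m}}" and ?V = "{\<zeta> \<in> dom TN i. chart TN i \<zeta> a \<in> {m<..}}"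
    have UV: "openin (mtop TN) ?U" "openin (mtop TN) ?V" "disjnt ?U ?V"
      using P[of "{..<m}"] P[of "{m<..}"] by (auto simp: disjnt_iff)
    consider "chart TN i \<xi> a < m" "m < chart TN i \<eta> a" | "chart TN i \<eta> a < m" "m < chart TN i \<xi> a"
      using a unfolding m_def by (cases "chart TN i \<xi> a < chart TN i \<eta> a") auto
    then show ?thesis
    proof cases
      case 1
      then show ?thesis using UV d by (intro exI[of _ ?U] exI[of _ ?V]) auto
    next
      case 2
      then show ?thesis using UV d by (intro exI[of _ ?V] exI[of _ ?U]) (auto simp: disjnt_sym)
    qed
  qed
qed

text \<open>The atlas may be uncountable. The Lindelof property of the base yields countably many
  charts that still cover it, and a countable basis of the space of sequences is pulled back through
  these.\<close>

lemma second_countable_TN: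
  assumes S: "second_countable (mtop N)" shows "second_countable (mtop TN)"
proof -
  have "Lindelof_space (mtop N)" by (rule second_countable_imp_Lindelof_space[OF S])
  moreover have "(\<forall>U \<in> dom N ` idx N. openin (mtop N) U) \<and> \<Union>(dom N ` idx N) = topspace (mtop N)"
    by (auto simp: openin_dom topspace_mtop pts_def)
  ultimately obtain \<V> where \<V>: "countable \<V>" "\<V> \<subseteq> dom N ` idx N" "\<Union>\<V> = pts N"
    unfolding Lindelof_space_def topspace_mtop by meson
  then obtain I where I: "countable I" "I \<subseteq> idx N" "\<V> = dom N ` I" by (meson countable_subset_image)
  obtain B :: "(nat \<Rightarrow> real) set set" where B: "countable B" "topological_basis B"
    using ex_countable_basis by blast
  let ?V = "\<lambda>i b. {\<zeta> \<in> dom TN i. chart TN i \<zeta> \<in> b}"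
  show ?thesis
    unfolding second_countable_def
  proof (intro exI[of _ "(\<lambda>(i, b). ?V i b) ` (I \<times> B)"] conjI)
    show "countable ((\<lambda>(i, b). ?V i b) ` (I \<times> B))" using I(1) B(1) by auto
    show "\<forall>V\<in>(\<lambda>(i, b). ?V i b) ` (I \<times> B). openin (mtop TN) V"
    proof clarify
      fix i b assume i: "i \<in> I" and b: "b \<in> B"
      have "openin (Euclidean_space (2 * n)) (b \<inter> eucl (2 * n))"
        using topological_basis_open[OF B(2) b] by (auto simp: openin_Euclidean_open)
      from T.openin_chart_preimage[of i "b \<inter> eucl (2 * n)"] this i I(2)
      have "openin (mtop TN) {\<zeta> \<in> dom TN i. chart TN i \<zeta> \<in> b \<inter> eucl (2 * n)}" by auto
      moreover have "{\<zeta> \<in> dom TN i. chart TN i \<zeta> \<in> b \<inter> eucl (2 * n)} = ?V i b" using chart_TN_eucl by blast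
      ultimately show "openin (mtop TN) (?V i b)" by simp
    qed
    show "\<forall>U \<xi>. openin (mtop TN) U \<and> \<xi> \<in> U \<longrightarrow> (\<exists>V\<in>(\<lambda>(i, b). ?V i b) ` (I \<times> B). \<xi> \<in> V \<and> V \<subseteq> U)"
    proof (intro allI impI, elim conjE)
      fix U \<xi> assume U: "openin (mtop TN) U" and \<xi>U: "\<xi> \<in> U"
      have \<xi>: "\<xi> \<in> pts TN" using T.open_pts[OF U \<xi>U] .
      have "foot \<xi> \<in> \<Union>(dom N ` I)" using foot_pts[OF \<xi>] \<V>(3) I(3) by simp
      then obtain i where i: "i \<in> I" "foot \<xi> \<in> dom N i" by blast
      then have ii: "i \<in> idx N" using I(2) by blast
      have \<xi>i: "\<xi> \<in> dom TN i" using dom_TN_pts[OF \<xi>] i by simp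
      have "openin (Euclidean_space (2 * n)) (chart TN i ` (U \<inter> dom TN i))" using U ii by (auto simp: T.openin_mtop)
      then obtain A where A: "open A" "chart TN i ` (U \<inter> dom TN i) = A \<inter> eucl (2 * n)" by (auto simp: openin_Euclidean_open)
      have "chart TN i \<xi> \<in> A" using A(2) \<xi>i \<xi>U by blast
      then obtain b where b: "b \<in> B" "chart TN i \<xi> \<in> b" "b \<subseteq> A" by (rule topological_basisE[OF B(2) A(1)])
      have "?V i b \<subseteq> U"
      proof
        fix \<zeta> assume \<zeta>: "\<zeta> \<in> ?V i b"
        then have "chart TN i \<zeta> \<in> chart TN i ` (U \<inter> dom TN i)" unfolding A(2) using b(3) chart_TN_eucl by blast
        then obtain \<zeta>' where "\<zeta>' \<in> U" "\<zeta>' \<in> dom TN i" "chart TN i \<zeta> = chart TN i \<zeta>'" by blast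
        then show "\<zeta> \<in> U" using inj_onD[OF inj_chart_TN[OF ii], of \<zeta> \<zeta>'] \<zeta> by blast
      qed
      then show "\<exists>V\<in>(\<lambda>(i, b). ?V i b) ` (I \<times> B). \<xi> \<in> V \<and> V \<subseteq> U"
        using b \<xi>i i by (intro bexI[of _ "?V i b"]) auto
    qed
  qed
qed

lemma smooth_manifold_TN: "smooth_manifold N \<Longrightarrow> smooth_manifold TN"
  by (simp add: smooth_manifold_def smooth_atlas_TN Hausdorff_TN second_countable_TN)

end

section \<open>Horizontal and vertical lifts\<close>

lemma lift_linear:
  shows hpart_add: "hpart N (u + v) = hpart N u + hpart N v"
    and hpart_scale: "hpart N (tscale c u) = tscale c (hpart N u)"
    and vpart_add: "vpart N nab \<xi> (u + v) = vpart N nab \<xi> u + vpart N nab \<xi> v"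
    and vpart_scale: "vpart N nab \<xi> (tscale c u) = tscale c (vpart N nab \<xi> u)"
    and hlift_add: "hlift N nab \<xi> (u + v) = hlift N nab \<xi> u + hlift N nab \<xi> v"
    and hlift_scale: "hlift N nab \<xi> (tscale c u) = tscale c (hlift N nab \<xi> u)"
    and vlift_add: "vlift N \<xi> (u + v) = vlift N \<xi> u + vlift N \<xi> v"
    and vlift_scale: "vlift N \<xi> (tscale c u) = tscale c (vlift N \<xi> u)"
  by (auto simp: fun_eq_iff hpart_def vpart_def hlift_def vlift_def algebra_simps sum.distrib sum_distrib_left)

lemma lift_minus:
  shows hlift_minus: "hlift N nab \<xi> (- u) = - hlift N nab \<xi> u"
    and vlift_minus: "vlift N \<xi> (- u) = - vlift N \<xi> u"
    and hlift_diff: "hlift N nab \<xi> (u - v) = hlift N nab \<xi> u - hlift N nab \<xi> v"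
    and vlift_diff: "vlift N \<xi> (u - v) = vlift N \<xi> u - vlift N \<xi> v"
proof -
  show m: "hlift N nab \<xi> (- u) = - hlift N nab \<xi> u" "vlift N \<xi> (- u) = - vlift N \<xi> u" for u
    using hlift_scale[of N nab \<xi> "-1" u] vlift_scale[of N \<xi> "-1" u] by (simp_all add: tscale_minus_one)
  show "hlift N nab \<xi> (u - v) = hlift N nab \<xi> u - hlift N nab \<xi> v" "vlift N \<xi> (u - v) = vlift N \<xi> u - vlift N \<xi> v"
    using hlift_add[of N nab \<xi> u "- v"] vlift_add[of N \<xi> u "- v"] m[of v] by simp_all
qed

context atlas
begin

lemma conn_field_sum:
  assumes C: "connection N nab" and X: "vf_at N p X" and F: "\<And>a. a \<in> A \<Longrightarrow> vf_at N p (F a)"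
  shows "nab X (\<lambda>q. \<Sum>a\<in>A. F a q) p = (\<Sum>a\<in>A. nab X (F a) p)"
  using F
proof (induction A rule: infinite_finite_induct)
  case (insert a A)
  have v: "vf_at N p (\<lambda>q. \<Sum>a\<in>A. F a q)" using insert by (intro vf_sum[OF vf_pts[OF X]]) auto
  have "nab X (\<lambda>q. \<Sum>a\<in>A. F a q) p = (\<Sum>a\<in>A. nab X (F a) p)" using insert by simp
  then show ?case
    using conn_plus2[OF C X _ v, of "F a"] insert.prems by (simp only: sum.insert[OF insert.hyps(1,2)] insert_iff simp_thms)
qed (simp_all add: conn_zero2[OF C X])

end

section \<open>Christoffel symbols and their transformation\<close>

locale tconn = tbundle N for N :: "('a, 'i) tmfd" +
  fixes nab :: "('a, 'i) tcnx"
  assumes C: "connection N nab"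
begin

text \<open>The Christoffel contraction: the part of order zero of the covariant derivative of
  \<open>s\<close> along \<open>v\<close>, as component \<open>c\<close> in chart
  \<open>i\<close>.\<close>

abbreviation "con i p v s c \<equiv> (\<Sum>a<n. \<Sum>b<n. christoffel N nab i p c a b * v i a * s i b)"

lemma sf_christoffel:
  assumes i: "i \<in> idx N" "p \<in> dom N i" and a: "a < n" and b: "b < n"
  shows "sf_at N p (\<lambda>q. christoffel N nab i q c a b)"
  unfolding christoffel_def by (rule vf_comp[OF conn_vf[OF C vf_coord[OF i a] vf_coord[OF i b]] i])

lemma nab_coord:
  assumes i: "i \<in> idx N" "p \<in> dom N i" and V: "vf_at N p V" and b: "b < n"
  shows "(\<Sum>a<n. christoffel N nab i p c a b * V p i a) = nab V (coord_field N i b) p i c"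
  using tensorial_expand[OF conn_tensorial1[OF C vf_coord[OF i b]] i V, of i c]
  by (simp add: christoffel_def mult.commute)

lemma con_nab:
  assumes i: "i \<in> idx N" "p \<in> dom N i" and V: "vf_at N p V"
  shows "con i p (V p) s c = (\<Sum>b<n. nab V (coord_field N i b) p i c * s i b)"
  using nab_coord[OF i V, of _ c] by (subst sum.swap) (simp add: sum_distrib_right[symmetric])

lemma nab_chart:
  assumes i: "i \<in> idx N" "p \<in> dom N i" and V: "vf_at N p V" and U: "vf_at N p U" and c: "c < n"
  shows "nab V U p i c = lie_deriv N V (\<lambda>q. U q i c) p + con i p (V p) (U p) c"
proof -
  let ?F = "\<lambda>b. fscale (\<lambda>q. U q i b) (coord_field N i b)"
  have F: "vf_at N p (?F b)" if "b < n" for b by (rule vf_scale[OF vf_comp[OF U i] vf_coord[OF i that]])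
  have "nab V U p = nab V (\<lambda>q. \<Sum>b<n. ?F b q) p"
  proof (rule conn_cong[OF C V U])
    show "near N p (\<lambda>q. U q = (\<Sum>b<n. ?F b q))"
      using near_dom[OF i] vf_near_tspace[OF U] by eventually_elim (rule tspace_expand[OF _ i(1)])
  qed simp
  also have "\<dots> = (\<Sum>b<n. nab V (?F b) p)" using F by (intro conn_field_sum[OF C V]) auto
  also have "\<dots> = (\<Sum>b<n. tscale (U p i b) (nab V (coord_field N i b) p) + tscale (lie_deriv N V (\<lambda>q. U q i b) p) (coord_field N i b p))"
    by (intro sum.cong refl conn_scale2[OF C V vf_coord[OF i] vf_comp[OF U i]]) simp
  finally have "nab V U p i c = (\<Sum>b<n. U p i b * nab V (coord_field N i b) p i c + lie_deriv N V (\<lambda>q. U q i b) p * (if c = b then 1 else 0))"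
    using i by (simp add: fun_sum_apply coord_field_self)
  then show ?thesis unfolding con_nab[OF i V] using c by (simp add: sum.distrib sum_delta_mult mult.commute)
qed

text \<open>The inhomogeneous transformation law of Christoffel symbols. It is read off by computing
  \<open>nab V U\<close> in both charts for a field \<open>U\<close> with constant components in
  chart \<open>i\<close>: there only the Christoffel term remains, while in chart \<open>j\<close>
  the Jacobian is differentiated.\<close>

lemma con_trans:
  assumes i: "i \<in> idx N" "p \<in> dom N i" and j: "j \<in> idx N" "p \<in> dom N j" and v: "v \<in> tspace N p" and s: "s \<in> tspace N p"
    and c: "c < n"
  shows "con j p v s c = (\<Sum>d<n. jac N i j p c d * con i p v s d)
    - (\<Sum>d<n. (\<Sum>b<n. v i b * pd N i b (\<lambda>q. jac N i j q c d) p) * s i d)"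
proof -
  note pp = dom_pts[OF i]
  obtain V where V: "vf_at N p V" "V p = v" using pp v by (rule vf_extend)
  define U where "U = (\<lambda>q. \<Sum>d<n. tscale (s i d) (coord_field N i d q))"
  have vU: "vf_at N p U" unfolding U_def using i by (intro vf_sum[OF pp] vf_cscale vf_coord) auto
  have Up: "U p = s" unfolding U_def by (rule tspace_expand[OF s i, symmetric])
  have "lie_deriv N V (\<lambda>q. s i c) p = lie_deriv N V (\<lambda>q. U q i c) p" if "c < n" for c
  proof (rule lie_cong[where Y = V, OF pp V(1) sf_const[OF pp] _ refl])
    show "near N p (\<lambda>q. s i c = U q i c)"
      using near_dom[OF i] by eventually_elim (use i that in \<open>simp add: U_def fun_sum_apply coord_field_self sum_delta_mult\<close>)
  qed
  then have Li: "nab V U p i c = con i p v s c" if "c < n" for c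
    using nab_chart[OF i V(1) vU that] that Up V(2) lie_const[OF pp V(1)] by simp
  have sj: "sf_at N p (\<lambda>q. jac N i j q c d)" if "d < n" for d by (rule sf_jac[OF i j that])
  have "lie_deriv N V (\<lambda>q. U q j c) p = lie_deriv N V (\<lambda>q. \<Sum>d<n. s i d * jac N i j q c d) p"
  proof (rule lie_cong[where Y = V, OF pp V(1) vf_comp[OF vU j] _ refl])
    show "near N p (\<lambda>q. U q j c = (\<Sum>d<n. s i d * jac N i j q c d))"
      using near_dom[OF j] by eventually_elim (use j c in \<open>simp add: U_def fun_sum_apply coord_field_def\<close>)
  qed
  also have "\<dots> = (\<Sum>d<n. lie_deriv N V (\<lambda>q. s i d * jac N i j q c d) p)"
    by (rule lie_sum[OF pp V(1)], rule sf_cmult) (use sj in auto)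
  also have "\<dots> = (\<Sum>d<n. (\<Sum>b<n. v i b * pd N i b (\<lambda>q. jac N i j q c d) p) * s i d)"
    using sj by (intro sum.cong refl) (simp add: lie_cmult[OF V(1)] lie_chart_vf[OF i V(1)] V(2))
  finally have "nab V U p j c = (\<Sum>d<n. (\<Sum>b<n. v i b * pd N i b (\<lambda>q. jac N i j q c d) p) * s i d) + con j p v s c"
    using nab_chart[OF j V(1) vU c] Up V(2) by simp
  moreover have "nab V U p j c = (\<Sum>d<n. jac N i j p c d * con i p v s d)"
    using tspace_trans[OF conn_tspace[OF C V(1) vU] i(1) j(1) i(2) j(2) c] Li by simp
  ultimately show ?thesis by simp
qed

section \<open>Tangent vectors of the tangent bundle and their splitting\<close>

lemma tspace_TN_I:
  assumes \<xi>: "\<xi> \<in> pts TN"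
    and h: "\<And>i j c. i \<in> idx N \<Longrightarrow> j \<in> idx N \<Longrightarrow> foot \<xi> \<in> dom N i \<Longrightarrow> foot \<xi> \<in> dom N j \<Longrightarrow> c < n \<Longrightarrow>
      w j c = (\<Sum>b<n. jac N i j (foot \<xi>) c b * w i b)"
    and v: "\<And>i j c. i \<in> idx N \<Longrightarrow> j \<in> idx N \<Longrightarrow> foot \<xi> \<in> dom N i \<Longrightarrow> foot \<xi> \<in> dom N j \<Longrightarrow> c < n \<Longrightarrow>
      w j (n + c) = (\<Sum>d<n. (\<Sum>b<n. w i b * pd N i b (\<lambda>q. jac N i j q c d) (foot \<xi>)) * vel \<xi> i d)
        + (\<Sum>b<n. jac N i j (foot \<xi>) c b * w i (n + b))"
    and o: "\<And>i a. i \<in> idx N \<longrightarrow> foot \<xi> \<in> dom N i \<longrightarrow> \<not> a < 2 * n \<Longrightarrow> w i a = 0"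
  shows "w \<in> tspace TN \<xi>"
proof (rule tspaceI)
  fix i j a assume ij: "i \<in> idx TN" "j \<in> idx TN" "\<xi> \<in> dom TN i" "\<xi> \<in> dom TN j" and a: "a < dim TN"
  then have i: "i \<in> idx N" "\<xi> \<in> dom TN i" "foot \<xi> \<in> dom N i" and j: "j \<in> idx N" "\<xi> \<in> dom TN j" "foot \<xi> \<in> dom N j"
    using foot_dom by auto
  note jT = jac_TN[OF i(1,2) j(1,2)]
  show "w j a = (\<Sum>b<dim TN. jac TN i j \<xi> a b * w i b)"
  proof (cases "a < n")
    case True
    then show ?thesis using h[OF i(1) j(1) i(3) j(3) True] by (simp add: sum_double jT)
  next
    case False
    then have ac: "a = n + (a - n)" "a - n < n" using a by auto
    let ?c = "a - n"
    have "(\<Sum>b<n. (\<Sum>d<n. pd N i b (\<lambda>q. jac N i j q ?c d) (foot \<xi>) * vel \<xi> i d) * w i b) =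
        (\<Sum>d<n. (\<Sum>b<n. w i b * pd N i b (\<lambda>q. jac N i j q ?c d) (foot \<xi>)) * vel \<xi> i d)"
      unfolding sum_distrib_right by (subst sum.swap) (simp add: mult_ac)
    then have "w j (n + ?c) = (\<Sum>b<2 * n. jac TN i j \<xi> (n + ?c) b * w i b)"
      using v[OF i(1) j(1) i(3) j(3) ac(2)] ac(2) by (simp add: sum_double jT del: add_diff_inverse_nat le_add_diff_inverse)
    then show ?thesis using ac(1) by simp
  qed
next
  fix i a assume "i \<in> idx TN \<longrightarrow> \<xi> \<in> dom TN i \<longrightarrow> \<not> a < dim TN"
  then show "w i a = 0" by (intro o) (auto simp: dom_TN_pts[OF \<xi>])
qed

lemma tspace_TN_D:
  assumes w: "w \<in> tspace TN \<xi>" and \<xi>: "\<xi> \<in> pts TN"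
    and i: "i \<in> idx N" "foot \<xi> \<in> dom N i" and j: "j \<in> idx N" "foot \<xi> \<in> dom N j" and c: "c < n"
  shows "w j c = (\<Sum>b<n. jac N i j (foot \<xi>) c b * w i b)"
    and "w j (n + c) = (\<Sum>d<n. (\<Sum>b<n. w i b * pd N i b (\<lambda>q. jac N i j q c d) (foot \<xi>)) * vel \<xi> i d)
        + (\<Sum>b<n. jac N i j (foot \<xi>) c b * w i (n + b))"
proof -
  have d: "\<xi> \<in> dom TN i" "\<xi> \<in> dom TN j" using i j dom_TN_pts[OF \<xi>] by auto
  note jT = jac_TN[OF i(1) d(1) j(1) d(2)]
  have t: "w j a = (\<Sum>b<2 * n. jac TN i j \<xi> a b * w i b)" if "a < 2 * n" for a
    using tspace_trans[OF w, of i j a] i j d that by simp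
  show "w j c = (\<Sum>b<n. jac N i j (foot \<xi>) c b * w i b)"
    using t[of c] c by (simp add: sum_double jT)
  have "(\<Sum>b<n. (\<Sum>d<n. pd N i b (\<lambda>q. jac N i j q c d) (foot \<xi>) * vel \<xi> i d) * w i b) =
        (\<Sum>d<n. (\<Sum>b<n. w i b * pd N i b (\<lambda>q. jac N i j q c d) (foot \<xi>)) * vel \<xi> i d)"
    unfolding sum_distrib_right by (subst sum.swap) (simp add: mult_ac)
  then show "w j (n + c) = (\<Sum>d<n. (\<Sum>b<n. w i b * pd N i b (\<lambda>q. jac N i j q c d) (foot \<xi>)) * vel \<xi> i d)
        + (\<Sum>b<n. jac N i j (foot \<xi>) c b * w i (n + b))"
    using t[of "n + c"] c by (simp add: sum_double jT)
qed

lemma tspace_TN_outside: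
  "w \<in> tspace TN \<xi> \<Longrightarrow> \<xi> \<in> pts TN \<Longrightarrow> \<not> (i \<in> idx N \<and> foot \<xi> \<in> dom N i \<and> a < 2 * n) \<Longrightarrow> w i a = 0"
  using tspace_outside[of w TN \<xi> i a] dom_TN_pts[of \<xi> i] by auto

lemma hpart_tspace:
  assumes w: "w \<in> tspace TN \<xi>" and \<xi>: "\<xi> \<in> pts TN" shows "hpart N w \<in> tspace N (foot \<xi>)"
proof (rule tspaceI)
  fix i j a assume ij: "i \<in> idx N" "j \<in> idx N" "foot \<xi> \<in> dom N i" "foot \<xi> \<in> dom N j" "a < n"
  then show "hpart N w j a = (\<Sum>b<n. jac N i j (foot \<xi>) a b * hpart N w i b)"
    using tspace_TN_D(1)[OF w \<xi>, of i j a] by (simp add: hpart_def)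
next
  fix i a assume "i \<in> idx N \<longrightarrow> foot \<xi> \<in> dom N i \<longrightarrow> \<not> a < n"
  then show "hpart N w i a = 0" using tspace_TN_outside[OF w \<xi>, of i a] by (auto simp: hpart_def)
qed

lemma vpart_apply: "c < n \<Longrightarrow> vpart N nab \<xi> w i c = w i (n + c) + con i (foot \<xi>) w (vel \<xi>) c"
  by (simp add: vpart_def)

text \<open>The second derivatives of the transition map in the fibre components cancel against the
  inhomogeneous term of \<open>con_trans\<close>. The same cancellation makes \<open>hlift\<close>
  well defined.\<close>

lemma vpart_tspace:
  assumes w: "w \<in> tspace TN \<xi>" and \<xi>: "\<xi> \<in> pts TN" shows "vpart N nab \<xi> w \<in> tspace N (foot \<xi>)"
proof (rule tspaceI)
  fix i j c assume i: "i \<in> idx N" and j: "j \<in> idx N" and d: "foot \<xi> \<in> dom N i" "foot \<xi> \<in> dom N j" and c: "c < n"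
  have "con j (foot \<xi>) w (vel \<xi>) c = (\<Sum>d<n. jac N i j (foot \<xi>) c d * con i (foot \<xi>) w (vel \<xi>) d)
    - (\<Sum>d<n. (\<Sum>b<n. w i b * pd N i b (\<lambda>q. jac N i j q c d) (foot \<xi>)) * vel \<xi> i d)"
    using con_trans[OF i d(1) j d(2) hpart_tspace[OF w \<xi>] vel_tspace[OF \<xi>] c] by (simp add: hpart_def)
  then show "vpart N nab \<xi> w j c = (\<Sum>b<n. jac N i j (foot \<xi>) c b * vpart N nab \<xi> w i b)"
    using tspace_TN_D(2)[OF w \<xi> i d(1) j d(2) c] c by (simp add: vpart_apply distrib_left sum.distrib)
next
  fix i a assume h: "i \<in> idx N \<longrightarrow> foot \<xi> \<in> dom N i \<longrightarrow> \<not> a < n"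
  show "vpart N nab \<xi> w i a = 0"
  proof (cases "a < n")
    case True
    then have "w i b = 0" for b using h tspace_TN_outside[OF w \<xi>, of i b] by auto
    with True show ?thesis by (simp add: vpart_apply)
  qed (simp add: vpart_def)
qed

lemma vlift_tspace:
  assumes v: "v \<in> tspace N (foot \<xi>)" and \<xi>: "\<xi> \<in> pts TN" shows "vlift N \<xi> v \<in> tspace TN \<xi>"
proof (rule tspace_TN_I[OF \<xi>])
  fix i j c assume ij: "i \<in> idx N" "j \<in> idx N" "foot \<xi> \<in> dom N i" "foot \<xi> \<in> dom N j" "c < n"
  show "vlift N \<xi> v j c = (\<Sum>b<n. jac N i j (foot \<xi>) c b * vlift N \<xi> v i b)" using ij by (simp add: vlift_def)
  show "vlift N \<xi> v j (n + c) = (\<Sum>d<n. (\<Sum>b<n. vlift N \<xi> v i b * pd N i b (\<lambda>q. jac N i j q c d) (foot \<xi>)) * vel \<xi> i d)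
        + (\<Sum>b<n. jac N i j (foot \<xi>) c b * vlift N \<xi> v i (n + b))"
    using tspace_trans[OF v, of i j c] ij by (simp add: vlift_def)
next
  fix i a assume "i \<in> idx N \<longrightarrow> foot \<xi> \<in> dom N i \<longrightarrow> \<not> a < 2 * n"
  then show "vlift N \<xi> v i a = 0" using tspace_outside[OF v, of i "a - n"] by (auto simp: vlift_def)
qed

lemma hlift_apply:
  "c < n \<Longrightarrow> hlift N nab \<xi> v i c = v i c"
  "c < n \<Longrightarrow> hlift N nab \<xi> v i (n + c) = - con i (foot \<xi>) v (vel \<xi>) c"
  by (simp_all add: hlift_def)

lemma vlift_apply: "c < n \<Longrightarrow> vlift N \<xi> v i c = 0" "c < n \<Longrightarrow> vlift N \<xi> v i (n + c) = v i c"
  by (simp_all add: vlift_def)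

lemma hlift_tspace:
  assumes v: "v \<in> tspace N (foot \<xi>)" and \<xi>: "\<xi> \<in> pts TN" shows "hlift N nab \<xi> v \<in> tspace TN \<xi>"
proof (rule tspace_TN_I[OF \<xi>])
  fix i j c assume i: "i \<in> idx N" and j: "j \<in> idx N" and d: "foot \<xi> \<in> dom N i" "foot \<xi> \<in> dom N j" and c: "c < n"
  show "hlift N nab \<xi> v j c = (\<Sum>b<n. jac N i j (foot \<xi>) c b * hlift N nab \<xi> v i b)"
    using tspace_trans[OF v i j d c] c by (simp add: hlift_apply)
  show "hlift N nab \<xi> v j (n + c) = (\<Sum>d<n. (\<Sum>b<n. hlift N nab \<xi> v i b * pd N i b (\<lambda>q. jac N i j q c d) (foot \<xi>)) * vel \<xi> i d)
        + (\<Sum>b<n. jac N i j (foot \<xi>) c b * hlift N nab \<xi> v i (n + b))"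
    using con_trans[OF i d(1) j d(2) v vel_tspace[OF \<xi>] c] c by (simp add: hlift_apply sum_negf)
next
  fix i a assume h: "i \<in> idx N \<longrightarrow> foot \<xi> \<in> dom N i \<longrightarrow> \<not> a < 2 * n"
  show "hlift N nab \<xi> v i a = 0"
  proof (cases "a < 2 * n")
    case True
    then have "v i b = 0" for b using h tspace_outside[OF v, of i b] by auto
    then show ?thesis by (simp add: hlift_def)
  qed (simp add: hlift_def)
qed

lemma lift_decomp:
  assumes w: "w \<in> tspace TN \<xi>" and \<xi>: "\<xi> \<in> pts TN"
  shows "w = hlift N nab \<xi> (hpart N w) + vlift N \<xi> (vpart N nab \<xi> w)"
proof (intro ext)
  fix i a
  consider "a < n" | "n \<le> a" "a < 2 * n" | "\<not> a < 2 * n" by linarith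
  then show "w i a = (hlift N nab \<xi> (hpart N w) + vlift N \<xi> (vpart N nab \<xi> w)) i a"
  proof cases
    case 2
    then obtain c where "a = n + c" "c < n" using le_Suc_ex by fastforce
    then show ?thesis by (simp add: hlift_apply vlift_apply vpart_apply hpart_def)
  qed (use tspace_TN_outside[OF w \<xi>, of i a] in \<open>auto simp: hlift_def vlift_def hpart_def\<close>)
qed

text \<open>Sections of the pullback of the tangent bundle along the projection.\<close>

definition sec :: "('a, 'i) tpoint \<Rightarrow> (('a, 'i) tpoint \<Rightarrow> 'i tvec) \<Rightarrow> bool" where
  "sec \<xi> s \<longleftrightarrow> \<xi> \<in> pts TN \<and> near TN \<xi> (\<lambda>\<eta>. s \<eta> \<in> tspace N (foot \<eta>)) \<and>
     (\<forall>i\<in>idx N. foot \<xi> \<in> dom N i \<longrightarrow> (\<forall>c<n. sf_at TN \<xi> (\<lambda>\<eta>. s \<eta> i c)))"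

lemma secD:
  assumes "sec \<xi> s"
  shows sec_pts: "\<xi> \<in> pts TN" and sec_near: "near TN \<xi> (\<lambda>\<eta>. s \<eta> \<in> tspace N (foot \<eta>))"
    and sec_sf: "i \<in> idx N \<Longrightarrow> foot \<xi> \<in> dom N i \<Longrightarrow> c < n \<Longrightarrow> sf_at TN \<xi> (\<lambda>\<eta>. s \<eta> i c)"
    and sec_tspace: "s \<xi> \<in> tspace N (foot \<xi>)"
  using assms T.near_point[of \<xi>] unfolding sec_def by blast+

lemma near_TN_dom:
  assumes \<xi>: "\<xi> \<in> pts TN" and i: "i \<in> idx N" "foot \<xi> \<in> dom N i"
  shows "near TN \<xi> (\<lambda>\<eta>. \<eta> \<in> dom TN i \<and> \<eta> \<in> pts TN \<and> foot \<eta> \<in> dom N i)"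
  by (rule T.near_openI[OF T.openin_dom[of i]])
    (use i dom_TN_pts[OF \<xi>] foot_dom T.dom_pts in auto)

lemma near_TN_pts: "\<xi> \<in> pts TN \<Longrightarrow> near TN \<xi> (\<lambda>\<eta>. \<eta> \<in> pts TN)"
  by (rule T.near_openI[OF T.openin_pts])

lemma sec_foot: "\<xi> \<in> pts TN \<Longrightarrow> vf_at N (foot \<xi>) X \<Longrightarrow> sec \<xi> (\<lambda>\<eta>. X (foot \<eta>))"
  unfolding sec_def
proof (intro conjI ballI impI allI)
  assume \<xi>: "\<xi> \<in> pts TN" and X: "vf_at N (foot \<xi>) X"
  show "near TN \<xi> (\<lambda>\<eta>. X (foot \<eta>) \<in> tspace N (foot \<eta>))" by (rule near_foot[OF \<xi> vf_near_tspace[OF X]])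
  fix i c assume "i \<in> idx N" "foot \<xi> \<in> dom N i"
  then show "sf_at TN \<xi> (\<lambda>\<eta>. X (foot \<eta>) i c)" by (intro sf_foot[OF \<xi> vf_comp[OF X]])
qed

lemma sec_hpart:
  assumes A: "vf_at TN \<xi> A" shows "sec \<xi> (\<lambda>\<eta>. hpart N (A \<eta>))"
  unfolding sec_def
proof (intro conjI ballI impI allI)
  show \<xi>: "\<xi> \<in> pts TN" by (rule T.vf_pts[OF A])
  show "near TN \<xi> (\<lambda>\<eta>. hpart N (A \<eta>) \<in> tspace N (foot \<eta>))"
    using T.vf_near_tspace[OF A] near_TN_pts[OF \<xi>] by eventually_elim (rule hpart_tspace)
  fix i c assume i: "i \<in> idx N" "foot \<xi> \<in> dom N i" and c: "c < n"
  have "sf_at TN \<xi> (\<lambda>\<eta>. A \<eta> i c)" by (rule T.vf_comp[OF A]) (use i dom_TN_pts[OF \<xi>] in auto)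
  then show "sf_at TN \<xi> (\<lambda>\<eta>. hpart N (A \<eta>) i c)" using c by (simp add: hpart_def)
qed

lemma sf_con:
  assumes \<xi>: "\<xi> \<in> pts TN" and i: "i \<in> idx N" "foot \<xi> \<in> dom N i"
    and s: "\<And>c. c < n \<Longrightarrow> sf_at TN \<xi> (\<lambda>\<eta>. s \<eta> i c)" and t: "\<And>c. c < n \<Longrightarrow> sf_at TN \<xi> (\<lambda>\<eta>. t \<eta> i c)"
  shows "sf_at TN \<xi> (\<lambda>\<eta>. con i (foot \<eta>) (s \<eta>) (t \<eta>) c)"
proof (rule T.sf_sum[OF \<xi>], rule T.sf_sum[OF \<xi>])
  fix a b assume "a \<in> {..<n}" "b \<in> {..<n}"
  then show "sf_at TN \<xi> (\<lambda>\<eta>. christoffel N nab i (foot \<eta>) c a b * s \<eta> i a * t \<eta> i b)"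
    using T.sf_mult[OF T.sf_mult[OF sf_foot[OF \<xi> sf_christoffel[OF i]] s] t] by simp
qed

lemma sec_vpart:
  assumes A: "vf_at TN \<xi> A" shows "sec \<xi> (\<lambda>\<eta>. vpart N nab \<eta> (A \<eta>))"
  unfolding sec_def
proof (intro conjI ballI impI allI)
  show \<xi>: "\<xi> \<in> pts TN" by (rule T.vf_pts[OF A])
  show "near TN \<xi> (\<lambda>\<eta>. vpart N nab \<eta> (A \<eta>) \<in> tspace N (foot \<eta>))"
    using T.vf_near_tspace[OF A] near_TN_pts[OF \<xi>] by eventually_elim (rule vpart_tspace)
  fix i c assume i: "i \<in> idx N" "foot \<xi> \<in> dom N i" and c: "c < n"
  have d: "\<xi> \<in> dom TN i" using i dom_TN_pts[OF \<xi>] by simp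
  have Ai: "sf_at TN \<xi> (\<lambda>\<eta>. A \<eta> i c)" for c by (rule T.vf_comp[OF A]) (use i d in auto)
  show "sf_at TN \<xi> (\<lambda>\<eta>. vpart N nab \<eta> (A \<eta>) i c)"
    unfolding vpart_apply[OF c] by (rule T.sf_add[OF Ai sf_con[where s = A and t = vel, OF \<xi> i Ai sf_vel[OF i(1) d]]])
qed

lemma vf_hlift:
  assumes s: "sec \<xi> s" shows "vf_at TN \<xi> (\<lambda>\<eta>. hlift N nab \<eta> (s \<eta>))"
proof -
  note \<xi> = sec_pts[OF s]
  obtain i where i: "i \<in> idx N" "foot \<xi> \<in> dom N i" using foot_pts[OF \<xi>] by (rule obtain_chart)
  have d: "\<xi> \<in> dom TN i" using i dom_TN_pts[OF \<xi>] by simp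
  show ?thesis
  proof (rule T.vf_atI[of i])
    show "near TN \<xi> (\<lambda>\<eta>. hlift N nab \<eta> (s \<eta>) \<in> tspace TN \<eta>)"
      using sec_near[OF s] near_TN_pts[OF \<xi>] by eventually_elim (rule hlift_tspace)
    fix a assume "a < dim TN"
    then consider "a < n" | c where "a = n + c" "c < n" using le_Suc_ex[of n a] by (cases "a < n") auto
    then show "sf_at TN \<xi> (\<lambda>\<eta>. hlift N nab \<eta> (s \<eta>) i a)"
    proof cases
      case 1
      then show ?thesis using sec_sf[OF s i 1] by (simp add: hlift_apply)
    next
      case 2
      then show ?thesis
        using T.sf_minus[OF sf_con[where s = s and t = vel and c = c, OF \<xi> i sec_sf[OF s i] sf_vel[OF i(1) d]]] by (simp add: hlift_apply)
    qed
  qed (use i d in auto)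
qed

lemma vf_vlift:
  assumes s: "sec \<xi> s" shows "vf_at TN \<xi> (\<lambda>\<eta>. vlift N \<eta> (s \<eta>))"
proof -
  note \<xi> = sec_pts[OF s]
  obtain i where i: "i \<in> idx N" "foot \<xi> \<in> dom N i" using foot_pts[OF \<xi>] by (rule obtain_chart)
  have d: "\<xi> \<in> dom TN i" using i dom_TN_pts[OF \<xi>] by simp
  show ?thesis
  proof (rule T.vf_atI[of i])
    show "near TN \<xi> (\<lambda>\<eta>. vlift N \<eta> (s \<eta>) \<in> tspace TN \<eta>)"
      using sec_near[OF s] near_TN_pts[OF \<xi>] by eventually_elim (rule vlift_tspace)
    fix a assume "a < dim TN"
    then consider "a < n" | c where "a = n + c" "c < n" using le_Suc_ex[of n a] by (cases "a < n") auto
    then show "sf_at TN \<xi> (\<lambda>\<eta>. vlift N \<eta> (s \<eta>) i a)"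
      by cases (use sec_sf[OF s i] in \<open>simp_all add: vlift_apply T.sf_const[OF \<xi>]\<close>)
  qed (use i d in auto)
qed

text \<open>The pullback of the connection to these sections.\<close>

definition npi :: "(('a, 'i) tpoint, 'i) vfield \<Rightarrow> (('a, 'i) tpoint \<Rightarrow> 'i tvec) \<Rightarrow> ('a, 'i) tpoint \<Rightarrow> 'i tvec" where
  "npi A s \<xi> = (\<lambda>i c. if i \<in> idx N \<and> foot \<xi> \<in> dom N i \<and> c < n
     then lie_deriv TN A (\<lambda>\<eta>. s \<eta> i c) \<xi> + con i (foot \<xi>) (A \<xi>) (s \<xi>) c else 0)"

lemma lie_foot_chart:
  assumes \<xi>: "\<xi> \<in> pts TN" and i: "i \<in> idx N" "foot \<xi> \<in> dom N i" and A: "vf_at TN \<xi> A" and f: "sf_at N (foot \<xi>) f"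
  shows "lie_deriv TN A (\<lambda>\<eta>. f (foot \<eta>)) \<xi> = (\<Sum>a<n. A \<xi> i a * pd N i a f (foot \<xi>))"
proof -
  have d: "\<xi> \<in> dom TN i" using i dom_TN_pts[OF \<xi>] by simp
  have "lie_deriv TN A (\<lambda>\<eta>. f (foot \<eta>)) \<xi> = (\<Sum>a<2 * n. A \<xi> i a * pd TN i a (\<lambda>\<eta>. f (foot \<eta>)) \<xi>)"
    using T.lie_chart_vf[of i \<xi> A "\<lambda>\<eta>. f (foot \<eta>)"] i d A sf_foot[OF \<xi> f] by simp
  then show ?thesis by (simp add: sum_double pd_foot[OF i(1) d])
qed

lemma lie_foot:
  assumes A: "vf_at TN \<xi> A" and X: "vf_at N (foot \<xi>) X" and eq: "hpart N (A \<xi>) = X (foot \<xi>)" and f: "sf_at N (foot \<xi>) f"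
  shows "lie_deriv TN A (\<lambda>\<eta>. f (foot \<eta>)) \<xi> = lie_deriv N X f (foot \<xi>)"
proof -
  note \<xi> = T.vf_pts[OF A]
  obtain i where i: "i \<in> idx N" "foot \<xi> \<in> dom N i" using foot_pts[OF \<xi>] by (rule obtain_chart)
  have "A \<xi> i a = X (foot \<xi>) i a" if "a < n" for a using fun_cong[OF fun_cong[OF eq], of i a] that by (simp add: hpart_def)
  then show ?thesis by (simp add: lie_foot_chart[OF \<xi> i A f] lie_chart_vf[OF i X f])
qed

text \<open>Differentiating the Jacobian in the change of charts for \<open>s\<close> gives the term
  that \<open>con_trans\<close> subtracts.\<close>

lemma npi_tspace:
  assumes A: "vf_at TN \<xi> A" and s: "sec \<xi> s" shows "npi A s \<xi> \<in> tspace N (foot \<xi>)"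
proof (rule tspaceI)
  note \<xi> = sec_pts[OF s]
  fix i j c assume i: "i \<in> idx N" and j: "j \<in> idx N" and d: "foot \<xi> \<in> dom N i" "foot \<xi> \<in> dom N j" and c: "c < n"
  have sj: "sf_at TN \<xi> (\<lambda>\<eta>. jac N i j (foot \<eta>) c d')" if "d' < n" for d'
    by (rule sf_foot[OF \<xi> sf_jac[OF i d(1) j d(2) that]])
  note si = sec_sf[OF s i d(1)]
  have "lie_deriv TN A (\<lambda>\<eta>. s \<eta> j c) \<xi> = lie_deriv TN A (\<lambda>\<eta>. \<Sum>d<n. jac N i j (foot \<eta>) c d * s \<eta> i d) \<xi>"
  proof (rule T.lie_cong[where Y = A, OF \<xi> A sec_sf[OF s j d(2) c] _ refl])
    show "near TN \<xi> (\<lambda>\<eta>. s \<eta> j c = (\<Sum>d<n. jac N i j (foot \<eta>) c d * s \<eta> i d))"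
      using sec_near[OF s] near_TN_dom[OF \<xi> i d(1)] near_TN_dom[OF \<xi> j d(2)]
    proof eventually_elim
      case (elim \<eta>)
      then show ?case using tspace_trans[OF elim(1) i j _ _ c] by simp
    qed
  qed
  also have "\<dots> = (\<Sum>d<n. lie_deriv TN A (\<lambda>\<eta>. jac N i j (foot \<eta>) c d * s \<eta> i d) \<xi>)"
    by (rule T.lie_sum[OF \<xi> A], rule T.sf_mult) (use sj si in auto)
  also have "\<dots> = (\<Sum>d'<n. (\<Sum>b<n. A \<xi> i b * pd N i b (\<lambda>q. jac N i j q c d') (foot \<xi>)) * s \<xi> i d'
      + jac N i j (foot \<xi>) c d' * lie_deriv TN A (\<lambda>\<eta>. s \<eta> i d') \<xi>)"
  proof (intro sum.cong refl)
    fix d' assume "d' \<in> {..<n}"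
    then have d': "d' < n" by simp
    show "lie_deriv TN A (\<lambda>\<eta>. jac N i j (foot \<eta>) c d' * s \<eta> i d') \<xi> =
        (\<Sum>b<n. A \<xi> i b * pd N i b (\<lambda>q. jac N i j q c d') (foot \<xi>)) * s \<xi> i d'
        + jac N i j (foot \<xi>) c d' * lie_deriv TN A (\<lambda>\<eta>. s \<eta> i d') \<xi>"
      using T.lie_add(2)[OF A sj[OF d'] si[OF d']] lie_foot_chart[OF \<xi> i d(1) A sf_jac[OF i d(1) j d(2) d']] by simp
  qed
  finally have L: "lie_deriv TN A (\<lambda>\<eta>. s \<eta> j c) \<xi> = \<dots>" .
  have "con j (foot \<xi>) (A \<xi>) (s \<xi>) c = (\<Sum>d<n. jac N i j (foot \<xi>) c d * con i (foot \<xi>) (A \<xi>) (s \<xi>) d)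
    - (\<Sum>d<n. (\<Sum>b<n. A \<xi> i b * pd N i b (\<lambda>q. jac N i j q c d) (foot \<xi>)) * s \<xi> i d)"
    using con_trans[OF i d(1) j d(2) hpart_tspace[OF T.vf_tspace[OF A] \<xi>] sec_tspace[OF s] c] by (simp add: hpart_def)
  then show "npi A s \<xi> j c = (\<Sum>b<n. jac N i j (foot \<xi>) c b * npi A s \<xi> i b)"
    using i j d c L by (simp add: npi_def distrib_left sum.distrib)
qed (auto simp: npi_def)

lemma sec_npi:
  assumes A: "vf_at TN \<xi> A" and s: "sec \<xi> s" shows "sec \<xi> (npi A s)"
  unfolding sec_def
proof (intro conjI ballI impI allI)
  note \<xi> = sec_pts[OF s]
  show "\<xi> \<in> pts TN" by (rule \<xi>)
  \<comment> \<open>\<open>sec \<xi> s\<close> grants smooth components only in charts around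
    \<open>foot \<xi>\<close>. A nearby point may lie in further charts, which are reached from
    chart \<open>i\<close> through the Jacobian.\<close>
  have "near TN \<xi> (\<lambda>\<eta>. sec \<eta> s)"
  proof -
    obtain i where i: "i \<in> idx N" "foot \<xi> \<in> dom N i" using foot_pts[OF \<xi>] by (rule obtain_chart)
    have "near TN \<xi> (\<lambda>\<eta>. \<forall>c\<in>{..<n}. sf_at TN \<eta> (\<lambda>\<zeta>. s \<zeta> i c))"
      by (intro eventually_ball_finite) (auto intro: T.sf_near sec_sf[OF s i])
    then show ?thesis using near_TN_dom[OF \<xi> i] near_near[OF sec_near[OF s]]
    proof eventually_elim
      case (elim \<eta>)
      then have \<eta>: "\<eta> \<in> pts TN" "foot \<eta> \<in> dom N i" by auto
      show ?case unfolding sec_def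
      proof (intro conjI ballI impI allI)
        show "\<eta> \<in> pts TN" by (rule \<eta>)
        show n: "near TN \<eta> (\<lambda>\<eta>. s \<eta> \<in> tspace N (foot \<eta>))" by (rule elim)
        fix j c assume j: "j \<in> idx N" "foot \<eta> \<in> dom N j" and c: "c < n"
        have "sf_at TN \<eta> (\<lambda>\<zeta>. \<Sum>d<n. jac N i j (foot \<zeta>) c d * s \<zeta> i d)"
          by (rule T.sf_sum[OF \<eta>(1)], rule T.sf_mult[OF sf_foot[OF \<eta>(1) sf_jac[OF i(1) \<eta>(2) j]]]) (use elim in auto)
        moreover have "near TN \<eta> (\<lambda>\<zeta>. (\<Sum>d<n. jac N i j (foot \<zeta>) c d * s \<zeta> i d) = s \<zeta> j c)"
          using n near_TN_dom[OF \<eta>(1) i(1) \<eta>(2)] near_TN_dom[OF \<eta>(1) j]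
        proof eventually_elim
          case (elim \<zeta>)
          then show ?case using tspace_trans[OF elim(1) i(1) j(1) _ _ c] by simp
        qed
        ultimately show "sf_at TN \<eta> (\<lambda>\<zeta>. s \<zeta> j c)" by (rule T.sf_cong)
      qed
    qed
  qed
  then show "near TN \<xi> (\<lambda>\<eta>. npi A s \<eta> \<in> tspace N (foot \<eta>))"
    using T.vf_near[OF A] by eventually_elim (rule npi_tspace)
  fix i c assume i: "i \<in> idx N" "foot \<xi> \<in> dom N i" and c: "c < n"
  have d: "\<xi> \<in> dom TN i" using i dom_TN_pts[OF \<xi>] by simp
  have Ai: "sf_at TN \<xi> (\<lambda>\<eta>. A \<eta> i c)" for c by (rule T.vf_comp[OF A]) (use i d in auto)
  have "sf_at TN \<xi> (\<lambda>\<eta>. lie_deriv TN A (\<lambda>\<eta>. s \<eta> i c) \<eta> + con i (foot \<eta>) (A \<eta>) (s \<eta>) c)"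
    by (rule T.sf_add[OF T.sf_lie[OF A sec_sf[OF s i c]] sf_con[where s = A and t = s, OF \<xi> i Ai sec_sf[OF s i]]])
  moreover have "near TN \<xi> (\<lambda>\<eta>. lie_deriv TN A (\<lambda>\<eta>. s \<eta> i c) \<eta> + con i (foot \<eta>) (A \<eta>) (s \<eta>) c = npi A s \<eta> i c)"
    using near_TN_dom[OF \<xi> i] by eventually_elim (use i c in \<open>simp add: npi_def\<close>)
  ultimately show "sf_at TN \<xi> (\<lambda>\<eta>. npi A s \<eta> i c)" by (rule T.sf_cong)
qed

lemma npi_cong:
  assumes A: "vf_at TN \<xi> A" and s: "sec \<xi> s" and AA: "A \<xi> = A' \<xi>" and ss: "near TN \<xi> (\<lambda>\<eta>. s \<eta> = s' \<eta>)"
  shows "npi A s \<xi> = npi A' s' \<xi>"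
proof (intro ext)
  fix i c
  note \<xi> = sec_pts[OF s]
  have eq: "s \<xi> = s' \<xi>" by (rule T.near_point[OF \<xi> ss])
  show "npi A s \<xi> i c = npi A' s' \<xi> i c"
  proof (cases "i \<in> idx N \<and> foot \<xi> \<in> dom N i \<and> c < n")
    case True
    have "lie_deriv TN A (\<lambda>\<eta>. s \<eta> i c) \<xi> = lie_deriv TN A' (\<lambda>\<eta>. s' \<eta> i c) \<xi>"
      by (rule T.lie_cong[where Y = A', OF \<xi> A sec_sf[OF s] _ AA]) (use True ss in \<open>auto elim: eventually_mono\<close>)
    with True show ?thesis by (simp add: npi_def eq AA)
  qed (auto simp: npi_def)
qed

lemma npi_linear:
  assumes A: "vf_at TN \<xi> A" and s: "sec \<xi> s"
  shows npi_add1: "vf_at TN \<xi> B \<Longrightarrow> npi (A + B) s \<xi> = npi A s \<xi> + npi B s \<xi>"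
    and npi_scale1: "npi (fscale f A) s \<xi> = tscale (f \<xi>) (npi A s \<xi>)"
    and npi_add2: "sec \<xi> t \<Longrightarrow> npi A (\<lambda>\<eta>. s \<eta> + t \<eta>) \<xi> = npi A s \<xi> + npi A t \<xi>"
    and npi_scale2: "sf_at TN \<xi> f \<Longrightarrow>
      npi A (\<lambda>\<eta>. tscale (f \<eta>) (s \<eta>)) \<xi> = tscale (f \<xi>) (npi A s \<xi>) + tscale (lie_deriv TN A f \<xi>) (s \<xi>)"
    and npi_zero: "npi A (\<lambda>\<eta>. 0) \<xi> = 0"
proof -
  note \<xi> = sec_pts[OF s] and si = sec_sf[OF s]
  note lf = T.lie_fields(1,2)[OF si A]
  show "npi (A + B) s \<xi> = npi A s \<xi> + npi B s \<xi>" if "vf_at TN \<xi> B"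
    using lf(1)[OF _ _ _ that] by (auto simp: fun_eq_iff npi_def algebra_simps sum.distrib)
  show "npi (fscale f A) s \<xi> = tscale (f \<xi>) (npi A s \<xi>)"
    using lf(2)[OF _ _ _ A] by (auto simp: fun_eq_iff npi_def algebra_simps sum_distrib_left)
  show "npi A (\<lambda>\<eta>. s \<eta> + t \<eta>) \<xi> = npi A s \<xi> + npi A t \<xi>" if t: "sec \<xi> t"
    using T.lie_add(1)[OF A si sec_sf[OF t]] by (auto simp: fun_eq_iff npi_def algebra_simps sum.distrib)
  show "npi A (\<lambda>\<eta>. tscale (f \<eta>) (s \<eta>)) \<xi> = tscale (f \<xi>) (npi A s \<xi>) + tscale (lie_deriv TN A f \<xi>) (s \<xi>)" if f: "sf_at TN \<xi> f"
  proof (intro ext)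
    fix i c
    show "npi A (\<lambda>\<eta>. tscale (f \<eta>) (s \<eta>)) \<xi> i c = (tscale (f \<xi>) (npi A s \<xi>) + tscale (lie_deriv TN A f \<xi>) (s \<xi>)) i c"
    proof (cases "i \<in> idx N \<and> foot \<xi> \<in> dom N i \<and> c < n")
      case True
      then show ?thesis using T.lie_add(2)[OF A f si] by (simp add: npi_def algebra_simps sum_distrib_left)
    next
      case False
      then show ?thesis using tspace_outside[OF sec_tspace[OF s], of i c] by (auto simp: npi_def)
    qed
  qed
  show "npi A (\<lambda>\<eta>. 0) \<xi> = 0" using T.lie_const[OF \<xi> A] by (auto simp: fun_eq_iff npi_def)
qed

text \<open>On sections coming from the base the pullback connection sees only the projection of
  \<open>A\<close>. This turns statements about lifts into statements about
  \<open>nab\<close>.\<close>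

lemma npi_foot:
  assumes A: "vf_at TN \<xi> A" and X: "vf_at N (foot \<xi>) X" and Y: "vf_at N (foot \<xi>) Y" and eq: "hpart N (A \<xi>) = X (foot \<xi>)"
  shows "npi A (\<lambda>\<eta>. Y (foot \<eta>)) \<xi> = nab X Y (foot \<xi>)"
proof -
  note \<xi> = T.vf_pts[OF A]
  obtain i where i: "i \<in> idx N" "foot \<xi> \<in> dom N i" using foot_pts[OF \<xi>] by (rule obtain_chart)
  have AX: "A \<xi> i a = X (foot \<xi>) i a" if "a < n" for a using fun_cong[OF fun_cong[OF eq], of i a] that by (simp add: hpart_def)
  show ?thesis
  proof (rule tspace_eqI[OF npi_tspace[OF A sec_foot[OF \<xi> Y]] conn_tspace[OF C X Y] i])
    fix c assume c: "c < n"
    show "npi A (\<lambda>\<eta>. Y (foot \<eta>)) \<xi> i c = nab X Y (foot \<xi>) i c"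
      using i c by (simp add: npi_def nab_chart[OF i X Y c] lie_foot[OF A X eq vf_comp[OF Y i]] AX)
  qed
qed

lemma vf_hl: "\<xi> \<in> pts TN \<Longrightarrow> vf_at N (foot \<xi>) X \<Longrightarrow> vf_at TN \<xi> (hlift_field N nab X)"
  and vf_vl: "\<xi> \<in> pts TN \<Longrightarrow> vf_at N (foot \<xi>) X \<Longrightarrow> vf_at TN \<xi> (vlift_field N X)"
  unfolding hlift_field_def vlift_field_def by (rule vf_hlift vf_vlift, rule sec_foot; assumption)+

lemma parts_fields:
  assumes "X (foot \<xi>) \<in> tspace N (foot \<xi>)"
  shows "hpart N (hlift_field N nab X \<xi>) = X (foot \<xi>)" "vpart N nab \<xi> (hlift_field N nab X \<xi>) = 0"
    "hpart N (vlift_field N X \<xi>) = 0" "vpart N nab \<xi> (vlift_field N X \<xi>) = X (foot \<xi>)"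
  using assms by (simp_all add: hlift_field_def vlift_field_def hpart_hlift vpart_hlift hpart_vlift vpart_vlift)

text \<open>\<open>lift_cnx\<close> is a choice, so a witness is needed. The splitting identifies
  the tangent spaces of the bundle with two copies of the base tangent space, and the witness lets
  the pullback connection act on both.\<close>

lemma lift_cnx_exists: "\<exists>nab1. is_lift_cnx N nab nab1"
proof
  define nab1 where "nab1 A B = (\<lambda>\<xi>. hlift N nab \<xi> (npi A (\<lambda>\<eta>. hpart N (B \<eta>)) \<xi>)
      + vlift N \<xi> (npi A (\<lambda>\<eta>. vpart N nab \<eta> (B \<eta>)) \<xi>))" for A B
  have "connection TN nab1"
  proof (rule T.connectionI)
    fix \<xi> A B assume A: "vf_at TN \<xi> A" and B: "vf_at TN \<xi> B"
    note H = sec_hpart[OF B] and V = sec_vpart[OF B]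
    show "vf_at TN \<xi> (nab1 A B)"
      unfolding nab1_def by (rule T.vf_add'[OF vf_hlift[OF sec_npi[OF A H]] vf_vlift[OF sec_npi[OF A V]]])
    fix f assume f: "sf_at TN \<xi> f"
    show "nab1 (fscale f A) B \<xi> = tscale (f \<xi>) (nab1 A B \<xi>)"
      by (simp add: nab1_def npi_scale1[OF A H] npi_scale1[OF A V] hlift_scale vlift_scale tscale_add_right)
    \<comment> \<open>The Leibniz terms of the two parts reassemble to a multiple of
      \<open>B \<xi>\<close>.\<close>
    have "hlift N nab \<xi> (hpart N (B \<xi>)) + vlift N \<xi> (vpart N nab \<xi> (B \<xi>)) = B \<xi>"
      using lift_decomp[OF T.vf_tspace[OF B] T.vf_pts[OF B]] by simp
    then have "tscale c (hlift N nab \<xi> (hpart N (B \<xi>))) + tscale c (vlift N \<xi> (vpart N nab \<xi> (B \<xi>))) = tscale c (B \<xi>)" for c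
      by (simp add: tscale_add_right[symmetric])
    then show "nab1 A (fscale f B) \<xi> = tscale (f \<xi>) (nab1 A B \<xi>) + tscale (lie_deriv TN A f \<xi>) (B \<xi>)"
      by (simp add: nab1_def hpart_scale vpart_scale npi_scale2[OF A H f] npi_scale2[OF A V f]
          hlift_scale vlift_scale hlift_add vlift_add tscale_add_right add_ac)
  next
    fix \<xi> A B A' B' assume A: "vf_at TN \<xi> A" and B: "vf_at TN \<xi> B"
      and AA: "near TN \<xi> (\<lambda>\<eta>. A \<eta> = A' \<eta>)" and BB: "near TN \<xi> (\<lambda>\<eta>. B \<eta> = B' \<eta>)"
    note eq = T.near_point[OF T.vf_pts[OF A] AA]
    have "npi A (\<lambda>\<eta>. hpart N (B \<eta>)) \<xi> = npi A' (\<lambda>\<eta>. hpart N (B' \<eta>)) \<xi>"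
      by (rule npi_cong[where A' = A', OF A sec_hpart[OF B] eq]) (use BB in \<open>auto elim: eventually_mono\<close>)
    moreover have "npi A (\<lambda>\<eta>. vpart N nab \<eta> (B \<eta>)) \<xi> = npi A' (\<lambda>\<eta>. vpart N nab \<eta> (B' \<eta>)) \<xi>"
      by (rule npi_cong[where A' = A', OF A sec_vpart[OF B] eq]) (use BB in \<open>auto elim: eventually_mono\<close>)
    ultimately show "nab1 A B \<xi> = nab1 A' B' \<xi>" by (simp add: nab1_def)
  next
    fix \<xi> A B D assume A: "vf_at TN \<xi> A" and B: "vf_at TN \<xi> B" and D: "vf_at TN \<xi> D"
    show "nab1 (A + B) D \<xi> = nab1 A D \<xi> + nab1 B D \<xi>"
      by (simp add: nab1_def npi_add1[OF A sec_hpart[OF D] B] npi_add1[OF A sec_vpart[OF D] B] hlift_add vlift_add add_ac)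
    show "nab1 A (B + D) \<xi> = nab1 A B \<xi> + nab1 A D \<xi>"
      by (simp add: nab1_def hpart_add vpart_add npi_add2[OF A sec_hpart[OF B] sec_hpart[OF D]]
          npi_add2[OF A sec_vpart[OF B] sec_vpart[OF D]] hlift_add vlift_add add_ac)
  qed
  moreover have "nab1 (hlift_field N nab X) (hlift_field N nab Y) \<xi> = hlift_field N nab (nab X Y) \<xi> \<and>
          nab1 (hlift_field N nab X) (vlift_field N Y) \<xi> = vlift_field N (nab X Y) \<xi> \<and>
          nab1 (vlift_field N X) (hlift_field N nab Y) \<xi> = 0 \<and>
          nab1 (vlift_field N X) (vlift_field N Y) \<xi> = 0"
    if W: "openin (mtop N) W" and XY: "X \<in> vfields N W" "Y \<in> vfields N W" and \<xi>: "\<xi> \<in> pts TN" "foot \<xi> \<in> W" for W X Y \<xi>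
  proof -
    have X: "vf_at N (foot \<xi>) X" and Y: "vf_at N (foot \<xi>) Y" using W XY \<xi> by (auto simp: vf_at_def)
    let ?h = "hlift_field N nab" and ?v = "vlift_field N"
    note vh = vf_hl[OF \<xi>(1)] and vv = vf_vl[OF \<xi>(1)]
    have near: "near TN \<xi> (\<lambda>\<eta>. Y (foot \<eta>) \<in> tspace N (foot \<eta>))" by (rule near_foot[OF \<xi>(1) vf_near_tspace[OF Y]])
    have hh: "npi A (\<lambda>\<eta>. hpart N (?h Y \<eta>)) \<xi> = npi A (\<lambda>\<eta>. Y (foot \<eta>)) \<xi>"
      and vh': "npi A (\<lambda>\<eta>. vpart N nab \<eta> (?h Y \<eta>)) \<xi> = 0"
      and hv: "npi A (\<lambda>\<eta>. hpart N (?v Y \<eta>)) \<xi> = 0"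
      and vv': "npi A (\<lambda>\<eta>. vpart N nab \<eta> (?v Y \<eta>)) \<xi> = npi A (\<lambda>\<eta>. Y (foot \<eta>)) \<xi>" if A: "vf_at TN \<xi> A" for A
    proof -
      show "npi A (\<lambda>\<eta>. hpart N (?h Y \<eta>)) \<xi> = npi A (\<lambda>\<eta>. Y (foot \<eta>)) \<xi>"
        by (rule npi_cong[where A' = A, OF A sec_hpart[OF vh[OF Y]] refl]) (rule eventually_mono[OF near], rule parts_fields, assumption)
      show "npi A (\<lambda>\<eta>. vpart N nab \<eta> (?v Y \<eta>)) \<xi> = npi A (\<lambda>\<eta>. Y (foot \<eta>)) \<xi>"
        by (rule npi_cong[where A' = A, OF A sec_vpart[OF vv[OF Y]] refl]) (rule eventually_mono[OF near], rule parts_fields, assumption)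
      note z = npi_zero[OF A sec_hpart[OF A]]
      have "npi A (\<lambda>\<eta>. vpart N nab \<eta> (?h Y \<eta>)) \<xi> = npi A (\<lambda>\<eta>. 0) \<xi>"
        by (rule npi_cong[where A' = A, OF A sec_vpart[OF vh[OF Y]] refl]) (rule eventually_mono[OF near], rule parts_fields, assumption)
      then show "npi A (\<lambda>\<eta>. vpart N nab \<eta> (?h Y \<eta>)) \<xi> = 0" using z by simp
      have "npi A (\<lambda>\<eta>. hpart N (?v Y \<eta>)) \<xi> = npi A (\<lambda>\<eta>. 0) \<xi>"
        by (rule npi_cong[where A' = A, OF A sec_hpart[OF vv[OF Y]] refl]) (rule eventually_mono[OF near], rule parts_fields, assumption)
      then show "npi A (\<lambda>\<eta>. hpart N (?v Y \<eta>)) \<xi> = 0" using z by simp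
    qed
    note pf = parts_fields[of X \<xi>, OF vf_tspace[OF X]]
    have fh: "npi (?h X) (\<lambda>\<eta>. Y (foot \<eta>)) \<xi> = nab X Y (foot \<xi>)" by (rule npi_foot[OF vh[OF X] X Y pf(1)])
    note z = vf_zero[OF foot_pts[OF \<xi>(1)]]
    \<comment> \<open>A vertical field projects to the zero field, so it differentiates sections
      from the base to zero.\<close>
    have "npi (?v X) (\<lambda>\<eta>. Y (foot \<eta>)) \<xi> = nab (\<lambda>q. 0) Y (foot \<xi>)"
      by (rule npi_foot[OF vv[OF X] z Y]) (use pf(3) in simp)
    also have "\<dots> = 0" using conn_cscale1[OF C z Y, of 0] by simp
    finally have fv: "npi (?v X) (\<lambda>\<eta>. Y (foot \<eta>)) \<xi> = 0" .
    show ?thesis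
      unfolding nab1_def hh[OF vh[OF X]] vh'[OF vh[OF X]] hv[OF vh[OF X]] vv'[OF vh[OF X]]
        hh[OF vv[OF X]] vh'[OF vv[OF X]] hv[OF vv[OF X]] vv'[OF vv[OF X]] fh fv
      by (simp add: hlift_zero vlift_zero hlift_field_def vlift_field_def)
  qed
  ultimately show "is_lift_cnx N nab nab1" unfolding is_lift_cnx_def by blast
qed

end

section \<open>The Hermitian structure of the tangent bundle\<close>

locale aff = tconn N nab + riem N g
  for N :: "('a, 'i) tmfd" and nab :: "('a, 'i) tcnx" and g :: "('a, 'i) tmetr" +
  assumes smooth_manifold: "smooth_manifold N" and flat: "flat N nab" and torsion_free: "torsion_free N nab"
begin

abbreviation "hl \<equiv> hlift_field N nab"
abbreviation "vl \<equiv> vlift_field N"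
abbreviation "L \<equiv> lift_cnx N nab"
abbreviation "g1 \<equiv> lift_metric N nab g"
abbreviation "J1 \<equiv> lift_J N nab"

section \<open>The lifted connection on lifts\<close>

lemma lift_cnx_spec: "is_lift_cnx N nab L"
  unfolding lift_cnx_def by (rule someI_ex[OF lift_cnx_exists])

lemma L_conn: "connection TN L"
  using lift_cnx_spec by (simp add: is_lift_cnx_def)

lemma L_lifts:
  assumes \<xi>: "\<xi> \<in> pts TN" and X: "vf_at N (foot \<xi>) X" and Y: "vf_at N (foot \<xi>) Y"
  shows L_hh: "L (hl X) (hl Y) \<xi> = hl (nab X Y) \<xi>" and L_hv: "L (hl X) (vl Y) \<xi> = vl (nab X Y) \<xi>"
    and L_vh: "L (vl X) (hl Y) \<xi> = 0" and L_vv: "L (vl X) (vl Y) \<xi> = 0"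
proof -
  have "near N (foot \<xi>) (\<lambda>q. vf_at N q X \<and> vf_at N q Y)" by (intro eventually_conj vf_near X Y)
  then obtain W where W: "openin (mtop N) W" "foot \<xi> \<in> W" "\<forall>q\<in>W. vf_at N q X \<and> vf_at N q Y"
    using vf_pts[OF X] by (rule vf_common_open)
  then have "X \<in> vfields N W" "Y \<in> vfields N W" by (auto simp: vfields_iff)
  from lift_cnx_spec[unfolded is_lift_cnx_def, THEN conjunct2, THEN spec, THEN mp, OF W(1), THEN bspec, OF this(1),
      THEN bspec, OF this(2), THEN bspec, OF \<xi>, THEN mp, OF W(2)]
  show "L (hl X) (hl Y) \<xi> = hl (nab X Y) \<xi>" "L (hl X) (vl Y) \<xi> = vl (nab X Y) \<xi>"
    "L (vl X) (hl Y) \<xi> = 0" "L (vl X) (vl Y) \<xi> = 0" by simp_all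
qed

text \<open>The flag selects the horizontal or the vertical lift, so that claims about all
  combinations of lifts become one statement followed by case splits.\<close>

definition lf :: "bool \<Rightarrow> (('a, 'i) tpoint, 'i) vfield \<Rightarrow> (('a, 'i) tpoint, 'i) vfield" where
  "lf t X = (if t then hl X else vl X)"

lemma vf_lf: "\<xi> \<in> pts TN \<Longrightarrow> vf_at N (foot \<xi>) X \<Longrightarrow> vf_at TN \<xi> (lf t X)"
  by (simp add: lf_def vf_hl vf_vl)

lemma L_lf:
  assumes "\<xi> \<in> pts TN" "vf_at N (foot \<xi>) X" "vf_at N (foot \<xi>) Y"
  shows "L (hl X) (lf t Y) \<xi> = lf t (nab X Y) \<xi>" "L (vl X) (lf t Y) \<xi> = 0"
  using L_lifts[OF assms] by (simp_all add: lf_def)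

lemma near_foot_vf: "\<xi> \<in> pts TN \<Longrightarrow> vf_at N (foot \<xi>) X \<Longrightarrow> near TN \<xi> (\<lambda>\<eta>. \<eta> \<in> pts TN \<and> vf_at N (foot \<eta>) X)"
  by (intro eventually_conj near_TN_pts near_foot vf_near)

lemma near_L_lf:
  assumes \<xi>: "\<xi> \<in> pts TN" and X: "vf_at N (foot \<xi>) X" and Y: "vf_at N (foot \<xi>) Y"
  shows "near TN \<xi> (\<lambda>\<eta>. L (hl X) (lf t Y) \<eta> = lf t (nab X Y) \<eta>)" "near TN \<xi> (\<lambda>\<eta>. L (vl X) (lf t Y) \<eta> = 0)"
proof -
  show "near TN \<xi> (\<lambda>\<eta>. L (hl X) (lf t Y) \<eta> = lf t (nab X Y) \<eta>)"
    using near_foot_vf[OF \<xi> X] near_foot_vf[OF \<xi> Y] by eventually_elim (auto intro: L_lf)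
  show "near TN \<xi> (\<lambda>\<eta>. L (vl X) (lf t Y) \<eta> = 0)"
    using near_foot_vf[OF \<xi> X] near_foot_vf[OF \<xi> Y] by eventually_elim (auto intro: L_lf)
qed

lemma lift_field_pt:
  "hl X \<xi> = hlift N nab \<xi> (X (foot \<xi>))" "vl X \<xi> = vlift N \<xi> (X (foot \<xi>))"
  by (simp_all add: hlift_field_def vlift_field_def)

lemma lf_zero: "X (foot \<xi>) = 0 \<Longrightarrow> lf t X \<xi> = 0"
  by (simp add: lf_def lift_field_pt hlift_zero vlift_zero)

lemma lie_hl:
  assumes \<xi>: "\<xi> \<in> pts TN" and X: "vf_at N (foot \<xi>) X" and f: "sf_at N (foot \<xi>) f"
  shows "lie_deriv TN (hl X) (\<lambda>\<eta>. f (foot \<eta>)) \<xi> = lie_deriv N X f (foot \<xi>)"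
    and "lie_deriv TN (vl X) (\<lambda>\<eta>. f (foot \<eta>)) \<xi> = 0"
proof -
  note pf = parts_fields[of X \<xi>, OF vf_tspace[OF X]]
  show "lie_deriv TN (hl X) (\<lambda>\<eta>. f (foot \<eta>)) \<xi> = lie_deriv N X f (foot \<xi>)"
    by (rule lie_foot[OF vf_hl[OF \<xi> X] X pf(1) f])
  have "lie_deriv TN (vl X) (\<lambda>\<eta>. f (foot \<eta>)) \<xi> = lie_deriv N (\<lambda>q. 0) f (foot \<xi>)"
    by (rule lie_foot[OF vf_vl[OF \<xi> X] vf_zero[OF foot_pts[OF \<xi>]] _ f]) (rule pf(3))
  then show "lie_deriv TN (vl X) (\<lambda>\<eta>. f (foot \<eta>)) \<xi> = 0" using lie_zero_field[OF f, of "\<lambda>q. 0"] by simp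
qed

section \<open>Brackets of lifts\<close>

lemma lie_vel:
  assumes A: "vf_at TN \<xi> A" and i: "i \<in> idx N" "foot \<xi> \<in> dom N i" and b: "b < n"
  shows "lie_deriv TN A (\<lambda>\<eta>. vel \<eta> i b) \<xi> = A \<xi> i (n + b)"
proof -
  have d: "\<xi> \<in> dom TN i" using i dom_TN_pts[OF T.vf_pts[OF A]] by simp
  have "lie_deriv TN A (\<lambda>\<eta>. vel \<eta> i b) \<xi> = (\<Sum>a<2 * n. A \<xi> i a * (if a = n + b then 1 else 0))"
    using T.lie_chart_vf[of i \<xi> A "\<lambda>\<eta>. vel \<eta> i b"] i d A sf_vel[OF i(1) d b] pd_vel[OF i(1) d b] by simp
  then show ?thesis using b by (simp add: sum_delta_mult)
qed

lemma hl_vert: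
  assumes \<xi>: "\<xi> \<in> pts TN" and i: "i \<in> idx N" "foot \<xi> \<in> dom N i" and X: "vf_at N (foot \<xi>) X" and c: "c < n"
  shows "hl X \<xi> i (n + c) = - (\<Sum>b<n. nab X (coord_field N i b) (foot \<xi>) i c * vel \<xi> i b)"
  using c con_nab[where s = "vel \<xi>" and c = c, OF i X] by (simp add: lift_field_pt hlift_apply)

text \<open>The fibre components of a horizontal lift are linear in the velocity, with coefficients
  from the base; the product rule differentiates coefficients and velocity separately.\<close>

lemma lie_hl_vert:
  assumes A: "vf_at TN \<xi> A" and i: "i \<in> idx N" "foot \<xi> \<in> dom N i" and X: "vf_at N (foot \<xi>) X" and c: "c < n"
  shows "lie_deriv TN A (\<lambda>\<eta>. hl X \<eta> i (n + c)) \<xi> =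
    - (\<Sum>b<n. lie_deriv TN A (\<lambda>\<eta>. nab X (coord_field N i b) (foot \<eta>) i c) \<xi> * vel \<xi> i b
        + nab X (coord_field N i b) (foot \<xi>) i c * A \<xi> i (n + b))"
proof -
  note \<xi> = T.vf_pts[OF A]
  have d: "\<xi> \<in> dom TN i" using i dom_TN_pts[OF \<xi>] by simp
  let ?w = "\<lambda>b \<eta>. nab X (coord_field N i b) (foot \<eta>) i c"
  have w: "sf_at TN \<xi> (?w b)" if "b < n" for b
    by (rule sf_foot[OF \<xi> vf_comp[OF conn_vf[OF C X vf_coord[OF i that]] i]])
  have v: "sf_at TN \<xi> (\<lambda>\<eta>. vel \<eta> i b)" if "b < n" for b by (rule sf_vel[OF i(1) d that])
  have wv: "sf_at TN \<xi> (\<lambda>\<eta>. ?w b \<eta> * vel \<eta> i b)" if "b < n" for b by (rule T.sf_mult[OF w[OF that] v[OF that]])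
  have s: "sf_at TN \<xi> (\<lambda>\<eta>. \<Sum>b<n. ?w b \<eta> * vel \<eta> i b)" by (rule T.sf_sum[OF \<xi>]) (use wv in auto)
  have "lie_deriv TN A (\<lambda>\<eta>. - (\<Sum>b<n. ?w b \<eta> * vel \<eta> i b)) \<xi> = lie_deriv TN A (\<lambda>\<eta>. hl X \<eta> i (n + c)) \<xi>"
  proof (rule T.lie_cong[where Y = A, OF \<xi> A T.sf_minus[OF s] _ refl])
    show "near TN \<xi> (\<lambda>\<eta>. - (\<Sum>b<n. ?w b \<eta> * vel \<eta> i b) = hl X \<eta> i (n + c))"
      using near_foot_vf[OF \<xi> X] near_TN_dom[OF \<xi> i] by eventually_elim (simp add: hl_vert[OF _ i(1) _ _ c])
  qed
  then have "lie_deriv TN A (\<lambda>\<eta>. hl X \<eta> i (n + c)) \<xi> = - (\<Sum>b<n. lie_deriv TN A (\<lambda>\<eta>. ?w b \<eta> * vel \<eta> i b) \<xi>)"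
    using T.lie_minus[OF A s] T.lie_sum[OF \<xi> A, of "{..<n}" "\<lambda>b \<eta>. ?w b \<eta> * vel \<eta> i b"] wv by simp
  also have "(\<Sum>b<n. lie_deriv TN A (\<lambda>\<eta>. ?w b \<eta> * vel \<eta> i b) \<xi>) =
      (\<Sum>b<n. lie_deriv TN A (?w b) \<xi> * vel \<xi> i b + ?w b \<xi> * A \<xi> i (n + b))"
  proof (intro sum.cong refl)
    fix b assume "b \<in> {..<n}"
    then have b: "b < n" by simp
    show "lie_deriv TN A (\<lambda>\<eta>. ?w b \<eta> * vel \<eta> i b) \<xi> = lie_deriv TN A (?w b) \<xi> * vel \<xi> i b + ?w b \<xi> * A \<xi> i (n + b)"
      using T.lie_add(2)[OF A w[OF b] v[OF b]] lie_vel[OF A i b] by simp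
  qed
  finally show ?thesis .
qed

lemma TN_index_cases:
  assumes "a < dim TN"
  obtains "a < n" | c where "a = n + c" "c < n"
  using assms le_Suc_ex[of n a] by (cases "a < n") auto

lemma TN_chart_eqI:
  assumes \<xi>: "\<xi> \<in> pts TN" and i: "i \<in> idx N" "foot \<xi> \<in> dom N i" and uv: "u \<in> tspace TN \<xi>" "v \<in> tspace TN \<xi>"
    and h: "\<And>c. c < n \<Longrightarrow> u i c = v i c" and w: "\<And>c. c < n \<Longrightarrow> u i (n + c) = v i (n + c)"
  shows "u = v"
proof (rule tspace_eqI[OF uv, of i])
  fix a assume "a < dim TN"
  then show "u i a = v i a" by (rule TN_index_cases) (auto simp: h w)
qed (use i dom_TN_pts[OF \<xi>] in auto)

lemma bracket_TN_comp:
  assumes i: "i \<in> idx N" "foot \<xi> \<in> dom N i" and A: "vf_at TN \<xi> A" and B: "vf_at TN \<xi> B" and a: "a < 2 * n"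
  shows "bracket TN A B \<xi> i a = lie_deriv TN A (\<lambda>\<eta>. B \<eta> i a) \<xi> - lie_deriv TN B (\<lambda>\<eta>. A \<eta> i a) \<xi>"
  using T.bracket_comp[of i \<xi> a A B] i a A B dom_TN_pts[OF T.vf_pts[OF A]] by simp

lemma lift_field_comp:
  "c < n \<Longrightarrow> hl X \<eta> i c = X (foot \<eta>) i c"
  "c < n \<Longrightarrow> vl X \<eta> i c = 0"
  "c < n \<Longrightarrow> vl X \<eta> i (n + c) = X (foot \<eta>) i c"
  by (simp_all add: lift_field_pt hlift_apply vlift_apply)

text \<open>The base components are immediate. In the fibre components, the mixed bracket combines
  the derivative of \<open>Y\<close> with the Christoffel term to \<open>nab X Y\<close>, while the
  bracket of two horizontal lifts agrees with the lift of the bracket exactly because the curvature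
  vanishes.\<close>

lemma bracket_lifts:
  assumes \<xi>: "\<xi> \<in> pts TN" and X: "vf_at N (foot \<xi>) X" and Y: "vf_at N (foot \<xi>) Y"
  shows bracket_vv: "bracket TN (vl X) (vl Y) \<xi> = 0"
    and bracket_hv: "bracket TN (hl X) (vl Y) \<xi> = vl (nab X Y) \<xi>"
    and bracket_hh: "bracket TN (hl X) (hl Y) \<xi> = hl (bracket N X Y) \<xi>"
proof -
  obtain i where i: "i \<in> idx N" "foot \<xi> \<in> dom N i" using foot_pts[OF \<xi>] by (rule obtain_chart)
  note hX = vf_hl[OF \<xi> X] and hY = vf_hl[OF \<xi> Y] and vX = vf_vl[OF \<xi> X] and vY = vf_vl[OF \<xi> Y]
  note Xi = vf_comp[OF X i] and Yi = vf_comp[OF Y i]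
  note B = bracket_TN_comp[OF i]
  note z = T.lie_const[OF \<xi>]
  note lX = lie_hl[OF \<xi> X Yi] and lY = lie_hl[OF \<xi> Y Xi]
  note nXY = conn_vf[OF C X Y]
  show "bracket TN (vl X) (vl Y) \<xi> = 0"
    by (rule TN_chart_eqI[OF \<xi> i T.bracket_tspace[OF vX vY] tspace_zero])
      (simp_all add: B vX vY lift_field_comp z lX lY)
  show "bracket TN (hl X) (vl Y) \<xi> = vl (nab X Y) \<xi>"
  proof (rule TN_chart_eqI[OF \<xi> i T.bracket_tspace[OF hX vY] T.vf_tspace[OF vf_vl[OF \<xi> nXY]]])
    fix c assume c: "c < n"
    show "bracket TN (hl X) (vl Y) \<xi> i c = vl (nab X Y) \<xi> i c"
      using c by (simp add: B hX vY lift_field_comp z lY lift_field_comp)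
    have w: "sf_at N (foot \<xi>) (\<lambda>q. nab X (coord_field N i b) q i c)" if "b < n" for b
      by (rule vf_comp[OF conn_vf[OF C X vf_coord[OF i that]] i])
    have "lie_deriv TN (vl Y) (\<lambda>\<eta>. hl X \<eta> i (n + c)) \<xi> = - (\<Sum>b<n. nab X (coord_field N i b) (foot \<xi>) i c * Y (foot \<xi>) i b)"
      unfolding lie_hl_vert[OF vY i X c]
      by (intro arg_cong[of _ _ uminus] sum.cong refl) (simp add: lie_hl(2)[OF \<xi> Y w] lift_field_comp)
    then show "bracket TN (hl X) (vl Y) \<xi> i (n + c) = vl (nab X Y) \<xi> i (n + c)"
      using c nab_chart[OF i X Y c] con_nab[where s = "Y (foot \<xi>)" and c = c, OF i X]
      by (simp add: B hX vY lift_field_comp lX lift_field_comp)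
  qed
  note bXY = vf_bracket[OF X Y]
  show "bracket TN (hl X) (hl Y) \<xi> = hl (bracket N X Y) \<xi>"
  proof (rule TN_chart_eqI[OF \<xi> i T.bracket_tspace[OF hX hY] T.vf_tspace[OF vf_hl[OF \<xi> bXY]]])
    fix c assume c: "c < n"
    show "bracket TN (hl X) (hl Y) \<xi> i c = hl (bracket N X Y) \<xi> i c"
      using c by (simp add: B hX hY lift_field_comp lX lY bracket_comp[OF i c X Y])
    \<comment> \<open>The matrix of \<open>nab Z\<close> in the coordinate frame of chart
      \<open>i\<close>.\<close>
    define w where "w Z c b = (\<lambda>q. nab Z (coord_field N i b) q i c)" for Z c b
    let ?u = "vel \<xi> i" and ?p = "foot \<xi>"
    have ws: "sf_at N ?p (w Z c b)" if "vf_at N ?p Z" "b < n" for Z c b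
      unfolding w_def by (rule vf_comp[OF conn_vf[OF C that(1) vf_coord[OF i that(2)]] i])
    have hv: "hl Z \<xi> i (n + b) = - (\<Sum>e<n. w Z b e ?p * ?u e)" if "vf_at N ?p Z" "b < n" for Z b
      using hl_vert[OF \<xi> i that] by (simp add: w_def)
    have l: "lie_deriv TN (hl Z) (\<lambda>\<eta>. hl V \<eta> i (n + c)) \<xi> =
        - (\<Sum>e<n. lie_deriv N Z (w V c e) ?p * ?u e) + (\<Sum>e<n. (\<Sum>b<n. w V c b ?p * w Z b e ?p) * ?u e)"
      if Z: "vf_at N ?p Z" and V: "vf_at N ?p V" for Z V
    proof -
      have "lie_deriv TN (hl Z) (\<lambda>\<eta>. hl V \<eta> i (n + c)) \<xi> =
          - (\<Sum>b<n. lie_deriv TN (hl Z) (\<lambda>\<eta>. w V c b (foot \<eta>)) \<xi> * ?u b + w V c b ?p * hl Z \<xi> i (n + b))"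
        using lie_hl_vert[OF vf_hl[OF \<xi> Z] i V c] by (simp add: w_def)
      also have "\<dots> = - (\<Sum>b<n. lie_deriv N Z (w V c b) ?p * ?u b - (\<Sum>e<n. w V c b ?p * w Z b e ?p * ?u e))"
        by (intro arg_cong[of _ _ uminus] sum.cong refl)
          (simp add: lie_hl(1)[OF \<xi> Z ws[OF V]] hv[OF Z] sum_distrib_left mult.assoc)
      also have "\<dots> = - (\<Sum>b<n. lie_deriv N Z (w V c b) ?p * ?u b) + (\<Sum>b<n. \<Sum>e<n. w V c b ?p * w Z b e ?p * ?u e)"
        by (simp add: sum_subtractf)
      also have "(\<Sum>b<n. \<Sum>e<n. w V c b ?p * w Z b e ?p * ?u e) = (\<Sum>e<n. (\<Sum>b<n. w V c b ?p * w Z b e ?p) * ?u e)"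
        by (subst sum.swap) (simp add: sum_distrib_right)
      finally show ?thesis .
    qed
    have nn: "nab Z (nab V (coord_field N i e)) ?p i c = lie_deriv N Z (w V c e) ?p + (\<Sum>b<n. w Z c b ?p * w V b e ?p)"
      if Z: "vf_at N ?p Z" and V: "vf_at N ?p V" and e: "e < n" for Z V e
      using nab_chart[OF i Z conn_vf[OF C V vf_coord[OF i e]] c] con_nab[where s = "nab V (coord_field N i e) ?p" and c = c, OF i Z]
      by (simp add: w_def)
    \<comment> \<open>Flatness as the structure equation for connection matrices.\<close>
    have fl: "w (bracket N X Y) c e ?p = lie_deriv N X (w Y c e) ?p + (\<Sum>b<n. w X c b ?p * w Y b e ?p)
        - (lie_deriv N Y (w X c e) ?p + (\<Sum>b<n. w Y c b ?p * w X b e ?p))" if e: "e < n" for e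
    proof -
      have "curvature N nab X Y (coord_field N i e) ?p i c = 0"
        using flat flat_iff[of nab] X Y vf_coord[OF i e] by simp
      then show ?thesis using nn[OF X Y e] nn[OF Y X e] by (simp add: curvature_apply w_def)
    qed
    have "bracket TN (hl X) (hl Y) \<xi> i (n + c) = lie_deriv TN (hl X) (\<lambda>\<eta>. hl Y \<eta> i (n + c)) \<xi>
        - lie_deriv TN (hl Y) (\<lambda>\<eta>. hl X \<eta> i (n + c)) \<xi>"
      using c by (simp add: B hX hY)
    also have "\<dots> = - (\<Sum>e<n. w (bracket N X Y) c e ?p * ?u e)"
      unfolding l[OF X Y] l[OF Y X]
      by (simp add: fl left_diff_distrib distrib_right sum_subtractf sum.distrib)
    also have "\<dots> = hl (bracket N X Y) \<xi> i (n + c)" using hv[OF bXY c] by simp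
    finally show "bracket TN (hl X) (hl Y) \<xi> i (n + c) = hl (bracket N X Y) \<xi> i (n + c)" .
  qed
qed

text \<open>At \<open>\<xi>\<close> every field is the sum of a horizontal and a vertical lift, and
  a tensorial expression sees only its value there. Expressions with several arguments are treated
  one slot at a time.\<close>

lemma tensorial_lifts:
  assumes F: "tensorial TN \<xi> F" and A: "vf_at TN \<xi> A"
    and z: "\<And>t X. vf_at N (foot \<xi>) X \<Longrightarrow> F (lf t X) = 0"
  shows "F A = 0"
proof -
  note \<xi> = T.vf_pts[OF A]
  obtain X where X: "vf_at N (foot \<xi>) X" "X (foot \<xi>) = hpart N (A \<xi>)"
    using foot_pts[OF \<xi>] hpart_tspace[OF T.vf_tspace[OF A] \<xi>] by (rule vf_extend)
  obtain Y where Y: "vf_at N (foot \<xi>) Y" "Y (foot \<xi>) = vpart N nab \<xi> (A \<xi>)"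
    using foot_pts[OF \<xi>] vpart_tspace[OF T.vf_tspace[OF A] \<xi>] by (rule vf_extend)
  have "A \<xi> = hl X \<xi> + vl Y \<xi>" using lift_decomp[OF T.vf_tspace[OF A] \<xi>] X Y by (simp add: lift_field_pt)
  from T.tensorial_pt_add[OF F A vf_hl[OF \<xi> X(1)] vf_vl[OF \<xi> Y(1)] this]
  show ?thesis using z[OF X(1), of True] z[OF Y(1), of False] by (simp add: lf_def)
qed

lemma nab_torsion: "vf_at N p X \<Longrightarrow> vf_at N p Y \<Longrightarrow> nab X Y p - nab Y X p = bracket N X Y p"
  using torsion_free torsion_free_iff[of nab] by simp

text \<open>On lifts the torsion is the lift of the base torsion or cancels by
  \<open>bracket_lifts\<close>. Antisymmetry allows tensoriality in the first slot to serve for the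
  second.\<close>

lemma torsion_free_L: "torsion_free TN L"
  unfolding T.torsion_free_iff
proof (intro allI impI)
  fix \<xi> A B assume A: "vf_at TN \<xi> A" and B: "vf_at TN \<xi> B"
  note \<xi> = T.vf_pts[OF A]
  have anti: "(L A B \<xi> - L B A \<xi> - bracket TN A B \<xi>) i c = - (L B A \<xi> - L A B \<xi> - bracket TN B A \<xi>) i c" for A B i c
    using T.bracket_antisym[of A B \<xi>] by simp
  have ll: "L (lf t X) (lf t' Y) \<xi> - L (lf t' Y) (lf t X) \<xi> - bracket TN (lf t X) (lf t' Y) \<xi> = 0"
    if X: "vf_at N (foot \<xi>) X" and Y: "vf_at N (foot \<xi>) Y" for t t' X Y
    using nab_torsion[OF X Y] T.bracket_antisym[of "vl X" "hl Y" \<xi>]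
    by (cases t; cases t') (auto simp: lf_def L_lifts[OF \<xi> X Y] L_lifts[OF \<xi> Y X] bracket_lifts[OF \<xi> X Y]
        bracket_lifts[OF \<xi> Y X] lift_field_pt hlift_diff[symmetric])
  have lB: "(L (lf t X) B \<xi> - L B (lf t X) \<xi> - bracket TN (lf t X) B \<xi>) i c = 0" if X: "vf_at N (foot \<xi>) X" for t X i c
  proof -
    have "(L B (lf t X) \<xi> - L (lf t X) B \<xi> - bracket TN B (lf t X) \<xi>) i c = 0"
      by (rule tensorial_lifts[OF T.torsion_tensorial[OF L_conn vf_lf[OF \<xi> X]] B]) (use ll[OF _ X] in simp)
    then show ?thesis using anti[of "lf t X" B i c] by simp
  qed
  have "(L A B \<xi> - L B A \<xi> - bracket TN A B \<xi>) i c = 0" for i c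
    by (rule tensorial_lifts[OF T.torsion_tensorial[OF L_conn B] A]) (rule lB)
  then show "L A B \<xi> - L B A \<xi> = bracket TN A B \<xi>" by (intro ext) simp
qed

text \<open>For two horizontal lifts the curvature is the lift of the base curvature. As soon as a
  vertical lift occurs, each term contains a derivative of a lift along a vertical lift, which is
  zero near the point, or a vanishing bracket.\<close>

lemma flat_L: "flat TN L"
  unfolding T.flat_iff
proof (intro allI impI)
  fix \<xi> A B D assume A: "vf_at TN \<xi> A" and B: "vf_at TN \<xi> B" and D: "vf_at TN \<xi> D"
  note \<xi> = T.vf_pts[OF A]
  note vlf = vf_lf[OF \<xi>]
  have e: "near TN \<xi> (\<lambda>\<eta>. X \<eta> = X \<eta>)" for X :: "(('a, 'i) tpoint, 'i) vfield" by simp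
  have hh: "curvature TN L (hl X) (hl Y) (lf t Z) \<xi> = 0"
    if X: "vf_at N (foot \<xi>) X" and Y: "vf_at N (foot \<xi>) Y" and Z: "vf_at N (foot \<xi>) Z" for X Y Z t
  proof -
    have 1: "L (hl U) (L (hl V) (lf t Z)) \<xi> = lf t (nab U (nab V Z)) \<xi>"
      if U: "vf_at N (foot \<xi>) U" and V: "vf_at N (foot \<xi>) V" for U V
      using T.conn_cong[OF L_conn vf_hl[OF \<xi> U] T.conn_vf[OF L_conn vf_hl[OF \<xi> V] vlf[OF Z]] e near_L_lf(1)[OF \<xi> V Z]]
        L_lf(1)[OF \<xi> U conn_vf[OF C V Z]] by simp
    have 2: "L (bracket TN (hl X) (hl Y)) (lf t Z) \<xi> = lf t (nab (bracket N X Y) Z) \<xi>"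
      using T.conn_pt1[OF L_conn T.vf_bracket[OF vf_hl[OF \<xi> X] vf_hl[OF \<xi> Y]] vf_hl[OF \<xi> vf_bracket[OF X Y]] vlf[OF Z]
          bracket_hh[OF \<xi> X Y]] L_lf(1)[OF \<xi> vf_bracket[OF X Y] Z] by simp
    have "curvature TN L (hl X) (hl Y) (lf t Z) \<xi> = lf t (curvature N nab X Y Z) \<xi>"
      unfolding T.curvature_apply 1[OF X Y] 1[OF Y X] 2
      by (simp add: lf_def lift_field_pt curvature_apply hlift_add vlift_add hlift_diff vlift_diff)
    moreover have "curvature N nab X Y Z (foot \<xi>) = 0" using flat flat_iff[of nab] X Y Z by simp
    ultimately show ?thesis by (simp add: lf_zero)
  qed
  have 0: "L U (L (vl V) (lf t Z)) \<xi> = 0" if U: "vf_at TN \<xi> U" and V: "vf_at N (foot \<xi>) V" and Z: "vf_at N (foot \<xi>) Z" for U V Z t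
    by (rule T.conn_zero2[OF L_conn U near_L_lf(2)[OF \<xi> V Z]])
  have hv: "curvature TN L (hl X) (vl Y) (lf t Z) \<xi> = 0"
    if X: "vf_at N (foot \<xi>) X" and Y: "vf_at N (foot \<xi>) Y" and Z: "vf_at N (foot \<xi>) Z" for X Y Z t
  proof -
    have "L (vl Y) (L (hl X) (lf t Z)) \<xi> = L (vl Y) (lf t (nab X Z)) \<xi>"
      by (rule T.conn_cong[OF L_conn vf_vl[OF \<xi> Y] T.conn_vf[OF L_conn vf_hl[OF \<xi> X] vlf[OF Z]] e near_L_lf(1)[OF \<xi> X Z]])
    also have "\<dots> = 0" by (rule L_lf(2)[OF \<xi> Y conn_vf[OF C X Z]])
    finally have 1: "L (vl Y) (L (hl X) (lf t Z)) \<xi> = 0" .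
    have "L (bracket TN (hl X) (vl Y)) (lf t Z) \<xi> = L (vl (nab X Y)) (lf t Z) \<xi>"
      by (rule T.conn_pt1[OF L_conn T.vf_bracket[OF vf_hl[OF \<xi> X] vf_vl[OF \<xi> Y]] vf_vl[OF \<xi> conn_vf[OF C X Y]] vlf[OF Z]
          bracket_hv[OF \<xi> X Y]])
    also have "\<dots> = 0" by (rule L_lf(2)[OF \<xi> conn_vf[OF C X Y] Z])
    finally show ?thesis by (simp add: T.curvature_apply 1 0[OF vf_hl[OF \<xi> X] Y Z])
  qed
  have vv: "curvature TN L (vl X) (vl Y) (lf t Z) \<xi> = 0"
    if X: "vf_at N (foot \<xi>) X" and Y: "vf_at N (foot \<xi>) Y" and Z: "vf_at N (foot \<xi>) Z" for X Y Z t
  proof -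
    note z = T.vf_zero[OF \<xi>]
    have "L (bracket TN (vl X) (vl Y)) (lf t Z) \<xi> = L (\<lambda>q. 0) (lf t Z) \<xi>"
      by (rule T.conn_pt1[OF L_conn T.vf_bracket[OF vf_vl[OF \<xi> X] vf_vl[OF \<xi> Y]] z vlf[OF Z]]) (rule bracket_vv[OF \<xi> X Y])
    also have "\<dots> = 0" using T.conn_cscale1[OF L_conn z vlf[OF Z], of 0] by simp
    finally show ?thesis by (simp add: T.curvature_apply 0[OF vf_vl[OF \<xi> X] Y Z] 0[OF vf_vl[OF \<xi> Y] X Z])
  qed
  have lll: "curvature TN L (lf t X) (lf t' Y) (lf t'' Z) \<xi> = 0"
    if X: "vf_at N (foot \<xi>) X" and Y: "vf_at N (foot \<xi>) Y" and Z: "vf_at N (foot \<xi>) Z" for t t' t'' X Y Z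
    using hh[OF X Y Z, of t''] hv[OF X Y Z, of t''] vv[OF X Y Z, of t''] hv[OF Y X Z, of t'']
      T.curvature_antisym[OF L_conn vf_vl[OF \<xi> X] vf_hl[OF \<xi> Y] vlf[OF Z], of t'']
    by (cases t; cases t') (simp_all add: lf_def)
  have "curvature TN L (lf t X) (lf t' Y) D \<xi> i c = 0"
    if X: "vf_at N (foot \<xi>) X" and Y: "vf_at N (foot \<xi>) Y" for t t' X Y i c
    by (rule tensorial_lifts[OF T.curvature_tensorial3[OF L_conn vlf[OF X] vlf[OF Y]] D]) (simp add: lll[OF X Y])
  then have "curvature TN L (lf t X) B D \<xi> i c = 0" if X: "vf_at N (foot \<xi>) X" for t X i c
    using X by (intro tensorial_lifts[OF T.curvature_tensorial2[OF L_conn vlf[OF X] D] B])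
  then have "curvature TN L A B D \<xi> i c = 0" for i c
    by (rule tensorial_lifts[OF T.curvature_tensorial1[OF L_conn B D] A])
  then show "curvature TN L A B D \<xi> = 0" by (intro ext) simp
qed

text \<open>\<open>riemannian\<close> promises smoothness only for fields on the base. Sections
  along the projection are expanded in a coordinate frame to reduce to that case.\<close>

lemma sec_ip:
  assumes s: "sec \<xi> s" and t: "sec \<xi> t"
  shows "sf_at TN \<xi> (\<lambda>\<eta>. g (foot \<eta>) (s \<eta>) (t \<eta>))"
proof -
  note \<xi> = sec_pts[OF s]
  obtain i where i: "i \<in> idx N" "foot \<xi> \<in> dom N i" using foot_pts[OF \<xi>] by (rule obtain_chart)
  let ?e = "\<lambda>a. coord_field N i a"
  have "sf_at TN \<xi> (\<lambda>\<eta>. \<Sum>a<n. \<Sum>b<n. s \<eta> i a * (t \<eta> i b * g (foot \<eta>) (?e a (foot \<eta>)) (?e b (foot \<eta>))))"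
  proof (rule T.sf_sum[OF \<xi>], rule T.sf_sum[OF \<xi>])
    fix a b assume "a \<in> {..<n}" "b \<in> {..<n}"
    then have a: "a < n" and b: "b < n" by auto
    show "sf_at TN \<xi> (\<lambda>\<eta>. s \<eta> i a * (t \<eta> i b * g (foot \<eta>) (?e a (foot \<eta>)) (?e b (foot \<eta>))))"
      by (rule T.sf_mult[OF sec_sf[OF s i a] T.sf_mult[OF sec_sf[OF t i b] sf_foot[OF \<xi> sf_ip[OF vf_coord[OF i a] vf_coord[OF i b]]]]])
  qed
  moreover have "near TN \<xi> (\<lambda>\<eta>. (\<Sum>a<n. \<Sum>b<n. s \<eta> i a * (t \<eta> i b * g (foot \<eta>) (?e a (foot \<eta>)) (?e b (foot \<eta>)))) =
      g (foot \<eta>) (s \<eta>) (t \<eta>))"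
    using sec_near[OF s] sec_near[OF t] near_TN_dom[OF \<xi> i]
  proof eventually_elim
    case (elim \<eta>)
    let ?q = "foot \<eta>"
    have q: "?q \<in> dom N i" "?q \<in> pts N" using elim dom_pts[OF i(1)] by auto
    have eT: "?e a ?q \<in> tspace N ?q" if "a < n" for a by (rule coord_field_tspace[OF i(1) q(1) that])
    have "g ?q (s \<eta>) (t \<eta>) = g ?q (\<Sum>a<n. tscale (s \<eta> i a) (?e a ?q)) (t \<eta>)"
      using tspace_expand[OF elim(1) i(1) q(1)] by simp
    also have "\<dots> = (\<Sum>a<n. g ?q (tscale (s \<eta> i a) (?e a ?q)) (t \<eta>))"
      using eT by (intro g_sum1[OF q(2) elim(2)] tspace_scale) auto
    also have "\<dots> = (\<Sum>a<n. \<Sum>b<n. s \<eta> i a * (t \<eta> i b * g ?q (?e a ?q) (?e b ?q)))"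
    proof (intro sum.cong refl)
      fix a assume "a \<in> {..<n}"
      then have a: "?e a ?q \<in> tspace N ?q" by (simp add: eT)
      have "g ?q (?e a ?q) (t \<eta>) = g ?q (?e a ?q) (\<Sum>b<n. tscale (t \<eta> i b) (?e b ?q))"
        using tspace_expand[OF elim(2) i(1) q(1)] by simp
      also have "\<dots> = (\<Sum>b<n. g ?q (?e a ?q) (tscale (t \<eta> i b) (?e b ?q)))"
        using eT by (intro g_sum2[OF q(2) a] tspace_scale) auto
      also have "\<dots> = (\<Sum>b<n. t \<eta> i b * g ?q (?e a ?q) (?e b ?q))"
        by (intro sum.cong refl g_scale2[OF q(2) a eT]) simp
      finally show "g ?q (tscale (s \<eta> i a) (?e a ?q)) (t \<eta>) = (\<Sum>b<n. s \<eta> i a * (t \<eta> i b * g ?q (?e a ?q) (?e b ?q)))"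
        by (simp add: g_scale1[OF q(2) a elim(2)] sum_distrib_left)
    qed
    finally show ?case by simp
  qed
  ultimately show ?thesis by (rule T.sf_cong)
qed

section \<open>The lifted metric and complex structure\<close>

lemma riemannian_g1: "riemannian TN g1"
  unfolding riemannian_def
proof (intro conjI ballI allI impI)
  fix \<xi> u v assume \<xi>: "\<xi> \<in> pts TN" and u: "u \<in> tspace TN \<xi>" and v: "v \<in> tspace TN \<xi>"
  note p = foot_pts[OF \<xi>]
  note hu = hpart_tspace[OF u \<xi>] and vu = vpart_tspace[OF u \<xi>] and hv = hpart_tspace[OF v \<xi>] and vv = vpart_tspace[OF v \<xi>]
  show "g1 \<xi> u v = g1 \<xi> v u" by (simp add: lift_metric_def g_sym[OF p hu hv] g_sym[OF p vu vv])
  show "g1 \<xi> (tscale c u) v = c * g1 \<xi> u v" for c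
    by (simp add: lift_metric_def hpart_scale vpart_scale g_scale1[OF p hu hv] g_scale1[OF p vu vv] distrib_left)
  show "g1 \<xi> (u + v) w = g1 \<xi> u w + g1 \<xi> v w" if w: "w \<in> tspace TN \<xi>" for w
    by (simp add: lift_metric_def hpart_add vpart_add g_add1[OF p hu hv hpart_tspace[OF w \<xi>]] g_add1[OF p vu vv vpart_tspace[OF w \<xi>]])
  show "g1 \<xi> u u > 0" if "u \<noteq> 0"
  proof -
    have ge: "g (foot \<xi>) x x \<ge> 0" if x: "x \<in> tspace N (foot \<xi>)" for x
      using g_pos[OF p x x] g_zero1[OF p x x] by (cases "x = 0") auto
    have "hpart N u \<noteq> 0 \<or> vpart N nab \<xi> u \<noteq> 0"
      using lift_decomp[OF u \<xi>] that by (auto simp: hlift_zero vlift_zero)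
    then show ?thesis using g_pos[OF p hu hu] g_pos[OF p vu vu] ge[OF hu] ge[OF vu] by (fastforce simp: lift_metric_def)
  qed
next
  fix W A B assume W: "openin (mtop TN) W" and A: "A \<in> vfields TN W" and B: "B \<in> vfields TN W"
  show "smooth_fun TN W (\<lambda>\<xi>. g1 \<xi> (A \<xi>) (B \<xi>))"
    unfolding T.smooth_fun_iff[OF W]
  proof
    fix \<xi> assume "\<xi> \<in> W"
    then have A: "vf_at TN \<xi> A" and B: "vf_at TN \<xi> B" using A B W by (auto simp: vf_at_def)
    show "sf_at TN \<xi> (\<lambda>\<xi>. g1 \<xi> (A \<xi>) (B \<xi>))"
      unfolding lift_metric_def
      by (rule T.sf_add[OF sec_ip[OF sec_hpart[OF A] sec_hpart[OF B]] sec_ip[OF sec_vpart[OF A] sec_vpart[OF B]]])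
  qed
qed

lemma J1_parts:
  assumes \<xi>: "\<xi> \<in> pts TN" and w: "w \<in> tspace TN \<xi>"
  shows "J1 \<xi> w \<in> tspace TN \<xi>" "hpart N (J1 \<xi> w) = - vpart N nab \<xi> w" "vpart N nab \<xi> (J1 \<xi> w) = hpart N w"
proof -
  note h = hpart_tspace[OF w \<xi>] and v = vpart_tspace[OF w \<xi>]
  show "J1 \<xi> w \<in> tspace TN \<xi>"
    unfolding lift_J_def by (rule tspace_diff[OF vlift_tspace[OF h \<xi>] hlift_tspace[OF v \<xi>]])
  have eq: "J1 \<xi> w = vlift N \<xi> (hpart N w) + hlift N nab \<xi> (- vpart N nab \<xi> w)"
    by (simp add: lift_J_def hlift_minus)
  show "hpart N (J1 \<xi> w) = - vpart N nab \<xi> w"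
    unfolding eq hpart_add hpart_vlift hpart_hlift[OF tspace_minus[OF v]] by simp
  show "vpart N nab \<xi> (J1 \<xi> w) = hpart N w"
    unfolding eq vpart_add vpart_hlift vpart_vlift[OF h] by simp
qed

lemma vf_J1: "vf_at TN \<xi> A \<Longrightarrow> vf_at TN \<xi> (app J1 A)"
  unfolding app_def lift_J_def
  by (rule T.vf_diff[OF vf_vlift[OF sec_hpart] vf_hlift[OF sec_vpart]])

sublocale TJ: acs TN J1
proof unfold_locales
  fix \<xi> u v c assume \<xi>: "\<xi> \<in> pts TN" and u: "u \<in> tspace TN \<xi>"
  show "J1 \<xi> u \<in> tspace TN \<xi>" by (rule J1_parts(1)[OF \<xi> u])
  show "J1 \<xi> (u + v) = J1 \<xi> u + J1 \<xi> v"
    by (simp add: lift_J_def hpart_add vpart_add hlift_add vlift_add)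
  show "J1 \<xi> (tscale c u) = tscale c (J1 \<xi> u)"
    by (simp add: lift_J_def hpart_scale vpart_scale hlift_scale vlift_scale tscale_diff_right)
qed (rule vf_J1)

lemma near_J1_lifts:
  assumes \<xi>: "\<xi> \<in> pts TN" and X: "vf_at N (foot \<xi>) X"
  shows "near TN \<xi> (\<lambda>\<eta>. app J1 (hl X) \<eta> = vl X \<eta>)" "near TN \<xi> (\<lambda>\<eta>. app J1 (vl X) \<eta> = - hl X \<eta>)"
proof -
  have n: "near TN \<xi> (\<lambda>\<eta>. X (foot \<eta>) \<in> tspace N (foot \<eta>))" by (rule near_foot[OF \<xi> vf_near_tspace[OF X]])
  show "near TN \<xi> (\<lambda>\<eta>. app J1 (hl X) \<eta> = vl X \<eta>)"
    using n by eventually_elim (simp add: lift_field_pt lift_J_hlift)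
  show "near TN \<xi> (\<lambda>\<eta>. app J1 (vl X) \<eta> = - hl X \<eta>)"
    using n by eventually_elim (simp add: lift_field_pt lift_J_vlift)
qed

lemma J1_lifts:
  assumes "X (foot \<xi>) \<in> tspace N (foot \<xi>)"
  shows "J1 \<xi> (hl X \<xi>) = vl X \<xi>" "J1 \<xi> (vl X \<xi>) = - hl X \<xi>"
  using assms by (simp_all add: lift_field_pt lift_J_hlift lift_J_vlift)

lemma conn_J1_lifts:
  assumes Cn: "connection TN nb" and A: "vf_at TN \<xi> A" and X: "vf_at N (foot \<xi>) X"
  shows "nb A (app J1 (hl X)) \<xi> = nb A (vl X) \<xi>" "nb A (app J1 (vl X)) \<xi> = - nb A (hl X) \<xi>"
proof -
  note \<xi> = T.vf_pts[OF A]
  have e: "near TN \<xi> (\<lambda>\<eta>. A \<eta> = A \<eta>)" by simp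
  show "nb A (app J1 (hl X)) \<xi> = nb A (vl X) \<xi>"
    by (rule T.conn_cong[OF Cn A vf_J1[OF vf_hl[OF \<xi> X]] e near_J1_lifts(1)[OF \<xi> X]])
  have "nb A (app J1 (vl X)) \<xi> = nb A (\<lambda>\<eta>. - hl X \<eta>) \<xi>"
    by (rule T.conn_cong[OF Cn A vf_J1[OF vf_vl[OF \<xi> X]] e near_J1_lifts(2)[OF \<xi> X]])
  then show "nb A (app J1 (vl X)) \<xi> = - nb A (hl X) \<xi>" using T.conn_minus2[OF Cn A vf_hl[OF \<xi> X]] by simp
qed

text \<open>The lifted connection treats the horizontal and the vertical lift of a field alike, so
  it commutes with the exchange of the two.\<close>

lemma DJ_L:
  assumes A: "vf_at TN \<xi> A" and B: "vf_at TN \<xi> B"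
  shows "L A (app J1 B) \<xi> = J1 \<xi> (L A B \<xi>)"
proof -
  note \<xi> = T.vf_pts[OF A]
  have J0: "J1 \<xi> 0 = 0" using TJ.J_scale[OF \<xi> tspace_zero, of 0] by simp
  have ll: "TJ.DJ L (lf t X) (lf t' Y) \<xi> = 0" if X: "vf_at N (foot \<xi>) X" and Y: "vf_at N (foot \<xi>) Y" for t t' X Y
    by (cases t; cases t') (simp_all add: TJ.DJ_def lf_def conn_J1_lifts[OF L_conn vf_hl[OF \<xi> X] Y] conn_J1_lifts[OF L_conn vf_vl[OF \<xi> X] Y]
        L_lifts[OF \<xi> X Y] J1_lifts conn_tspace[OF C X Y] J0)
  have "TJ.DJ L (lf t X) B \<xi> i c = 0" if X: "vf_at N (foot \<xi>) X" for t X i c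
    by (rule tensorial_lifts[OF TJ.DJ_tensorial2[OF L_conn vf_lf[OF \<xi> X]] B]) (simp add: ll[OF X])
  then have "TJ.DJ L A B \<xi> i c = 0" for i c
    by (rule tensorial_lifts[OF TJ.DJ_tensorial1[OF L_conn B] A])
  then have "TJ.DJ L A B \<xi> = 0" by (intro ext) simp
  then show ?thesis by (simp add: TJ.DJ_def)
qed

text \<open>The lifted connection is torsion-free and makes \<open>J\<^sub>1\<close> parallel, so the Nijenhuis tensor vanishes.\<close>

lemma complex_structure_J1: "complex_structure TN J1"
proof -
  have JJ: "J1 \<xi> (J1 \<xi> u) = - u" if \<xi>: "\<xi> \<in> pts TN" and u: "u \<in> tspace TN \<xi>" for \<xi> u
  proof -
    have "J1 \<xi> (J1 \<xi> u) = - (hlift N nab \<xi> (hpart N u) + vlift N \<xi> (vpart N nab \<xi> u))"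
      unfolding lift_J_def[of N nab \<xi> "J1 \<xi> u"] J1_parts(2,3)[OF \<xi> u] by (simp add: vlift_minus)
    then show ?thesis using lift_decomp[OF u \<xi>] by simp
  qed
  have nij: "bracket TN (app J1 X) (app J1 Y) \<xi> - bracket TN X Y \<xi>
      - J1 \<xi> (bracket TN (app J1 X) Y \<xi> + bracket TN X (app J1 Y) \<xi>) = 0"
    if X: "vf_at TN \<xi> X" and Y: "vf_at TN \<xi> Y" for \<xi> X Y
  proof -
    note \<xi> = T.vf_pts[OF X]
    note JX = vf_J1[OF X] and JY = vf_J1[OF Y]
    have b: "bracket TN A B \<xi> = L A B \<xi> - L B A \<xi>" if "vf_at TN \<xi> A" "vf_at TN \<xi> B" for A B
      using torsion_free_L T.torsion_free_iff[of L] that by simp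
    note t = T.conn_tspace[OF L_conn]
    note ts = t[OF JX Y] t[OF JY X] t[OF X Y] t[OF Y X]
    show ?thesis
      unfolding b[OF JX JY] b[OF X Y] b[OF JX Y] b[OF X JY] DJ_L[OF JX Y] DJ_L[OF JY X] DJ_L[OF X Y] DJ_L[OF Y X]
      by (simp add: TJ.J_add[OF \<xi>] TJ.J_diff[OF \<xi>] TJ.J_tspace[OF \<xi>] tspace_diff tspace_add ts JJ[OF \<xi>])
  qed
  show ?thesis
    unfolding complex_structure_def
  proof (intro conjI ballI allI impI)
    fix \<xi> u assume \<xi>: "\<xi> \<in> pts TN" and u: "u \<in> tspace TN \<xi>"
    show "J1 \<xi> u \<in> tspace TN \<xi>" by (rule J1_parts(1)[OF \<xi> u])
    show "J1 \<xi> (J1 \<xi> u) = - u" by (rule JJ[OF \<xi> u])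
    show "J1 \<xi> (u + v) = J1 \<xi> u + J1 \<xi> v" if "v \<in> tspace TN \<xi>" for v by (rule TJ.J_add[OF \<xi> u that])
    show "J1 \<xi> (tscale c u) = tscale c (J1 \<xi> u)" for c by (rule TJ.J_scale[OF \<xi> u])
  next
    fix W X assume W: "openin (mtop TN) W" and "X \<in> vfields TN W"
    then show "app J1 X \<in> vfields TN W" using vf_J1 by (simp add: T.vfields_iff[OF W])
  next
    fix W X Y \<xi> assume W: "openin (mtop TN) W" and "X \<in> vfields TN W" "Y \<in> vfields TN W" "\<xi> \<in> W"
    then show "bracket TN (app J1 X) (app J1 Y) \<xi> - bracket TN X Y \<xi>
      - J1 \<xi> (bracket TN (app J1 X) Y \<xi> + bracket TN X (app J1 Y) \<xi>) = 0"
      by (intro nij) (auto simp: T.vfields_iff[OF W])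
  qed
qed

lemma hermitian_TN: "hermitian TN J1 g1"
  unfolding hermitian_def
proof (intro conjI ballI)
  fix \<xi> u v assume \<xi>: "\<xi> \<in> pts TN" and u: "u \<in> tspace TN \<xi>" and v: "v \<in> tspace TN \<xi>"
  note p = foot_pts[OF \<xi>] and vu = vpart_tspace[OF u \<xi>] and vv = vpart_tspace[OF v \<xi>]
  show "g1 \<xi> (J1 \<xi> u) (J1 \<xi> v) = g1 \<xi> u v"
    unfolding lift_metric_def J1_parts(2,3)[OF \<xi> u] J1_parts(2,3)[OF \<xi> v]
    using g_minus1[OF p vu tspace_minus[OF vv]] g_minus2[OF p vu vv] by simp
qed (rule smooth_manifold_TN[OF smooth_manifold] riemannian_g1 complex_structure_J1)+

lemma affine_riemann_TN: "affine_riemann TN L g1"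
  unfolding affine_riemann_def
  using smooth_manifold_TN[OF smooth_manifold] riemannian_g1 L_conn flat_L torsion_free_L by blast

end

section \<open>The difference tensor\<close>

context atlas
begin

lemma tensor_eq_iff:
  "tensor_eq N \<alpha> \<beta> \<longleftrightarrow> (\<forall>p X Y. vf_at N p X \<longrightarrow> vf_at N p Y \<longrightarrow> \<alpha> X Y p = \<beta> X Y p)" (is "?L \<longleftrightarrow> ?R")
proof
  assume L: ?L
  show ?R
  proof (intro allI impI)
    fix p X Y assume X: "vf_at N p X" and Y: "vf_at N p Y"
    have "near N p (\<lambda>q. vf_at N q X \<and> vf_at N q Y)" by (intro eventually_conj vf_near X Y)
    then obtain W where "openin (mtop N) W" "p \<in> W" "\<forall>q\<in>W. vf_at N q X \<and> vf_at N q Y"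
      using vf_pts[OF X] by (rule vf_common_open)
    with L show "\<alpha> X Y p = \<beta> X Y p" unfolding tensor_eq_def by (auto simp: vfields_iff)
  qed
qed (auto simp: tensor_eq_def vfields_iff)

end

context riem
begin

end

context aff
begin

abbreviation "gm \<equiv> gam N nab g"
abbreviation "gs \<equiv> gam_star N nab g"

lemma gm_apply: "gm X Y p = LC X Y p - nab X Y p"
  by (simp add: gam_def)

lemma LC_gm: "LC X Y p = nab X Y p + gm X Y p"
  by (simp add: gm_apply)

lemma gm_vf: "vf_at N p X \<Longrightarrow> vf_at N p Y \<Longrightarrow> vf_at N p (gm X Y)"
  unfolding gam_def by (rule vf_diff'[OF LC_vf conn_vf[OF C]])

lemma gm_tspace: "vf_at N p X \<Longrightarrow> vf_at N p Y \<Longrightarrow> gm X Y p \<in> tspace N p"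
  by (rule vf_tspace[OF gm_vf])

lemma gm_sym: "vf_at N p X \<Longrightarrow> vf_at N p Y \<Longrightarrow> gm X Y p = gm Y X p"
  using LC_torsion[of p X Y] nab_torsion[of p X Y] by (simp add: gm_apply algebra_simps)

lemma gm_tensorial1: "vf_at N p Y \<Longrightarrow> tensorial N p (\<lambda>X. gm X Y p i c)"
  using tensorial_diff[OF conn_tensorial1[OF LC_conn] conn_tensorial1[OF C], of p Y Y i c i c] by (simp add: gm_apply)

lemma gm_tensorial2: "vf_at N p X \<Longrightarrow> tensorial N p (\<lambda>Y. gm X Y p i c)"
  by (rule tensorial_cong[OF gm_tensorial1]) (auto simp: gm_sym)

definition c3 :: "(('a, 'i) tpoint, 'i) vfield \<Rightarrow> (('a, 'i) tpoint, 'i) vfield \<Rightarrow> (('a, 'i) tpoint, 'i) vfield \<Rightarrow> ('a, 'i) tpoint \<Rightarrow> real" where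
  "c3 X Y Z p = g p (gm X Y p) (Z p)"

lemma c3_sym: "vf_at N p X \<Longrightarrow> vf_at N p Y \<Longrightarrow> c3 X Y Z p = c3 Y X Z p"
  by (simp add: c3_def gm_sym[of p X Y])

lemma c3_tensorial:
  assumes X: "vf_at N p X" and Y: "vf_at N p Y"
  shows "tensorial N p (\<lambda>Z. c3 Z X Y p)" "tensorial N p (\<lambda>Z. c3 X Z Y p)" "tensorial N p (\<lambda>Z. c3 X Y Z p)"
proof -
  note p = vf_pts[OF X]
  show "tensorial N p (\<lambda>Z. c3 Z X Y p)"
    unfolding c3_def by (rule tensorial_ip_left[OF p vf_tspace[OF Y] gm_tspace[OF _ X] gm_tensorial1[OF X]])
  show "tensorial N p (\<lambda>Z. c3 X Z Y p)"
    unfolding c3_def by (rule tensorial_ip_left[OF p vf_tspace[OF Y] gm_tspace[OF X] gm_tensorial2[OF X]])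
  show "tensorial N p (\<lambda>Z. c3 X Y Z p)" unfolding c3_def by (rule tensorial_ip_right[OF p gm_tspace[OF X Y]])
qed

lemma gs_L_tensorial: "vf_at N p X \<Longrightarrow> vf_at N p Y \<Longrightarrow> tensorial N p (\<lambda>Z. g p (Y p) (gm X Z p))"
  by (rule tensorial_cong[OF c3_tensorial(2)[of p X Y]]) (auto simp: c3_def g_sym vf_pts vf_tspace gm_tspace)

lemma gs_spec:
  assumes X: "vf_at N p X" and Y: "vf_at N p Y"
  shows gs_tspace: "gs X Y p \<in> tspace N p" and gs_ip: "vf_at N p Z \<Longrightarrow> g p (gs X Y p) (Z p) = c3 X Z Y p"
    and gs_vf: "vf_at N p (gs X Y)"
proof -
  note m = metric_dual_spec[OF vf_pts[OF X] gs_L_tensorial[OF X Y]]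
  show "gs X Y p \<in> tspace N p" using m(1) by (simp add: gam_star_def)
  show "g p (gs X Y p) (Z p) = c3 X Z Y p" if Z: "vf_at N p Z"
    using m(2)[OF Z] g_sym[OF vf_pts[OF X] vf_tspace[OF Y] gm_tspace[OF X Z]] by (simp add: gam_star_def c3_def)
  show "vf_at N p (gs X Y)"
    unfolding gam_star_def
  proof (rule vf_metric_dual[OF vf_pts[OF X]])
    show "near N p (\<lambda>q. tensorial N q (\<lambda>Z. g q (Y q) (gm X Z q)))"
      using vf_near[OF X] vf_near[OF Y] by eventually_elim (rule gs_L_tensorial)
    show "sf_at N p (\<lambda>q. g q (Y q) (gm X Z q))" if "vf_at N p Z" for Z by (rule sf_ip[OF Y gm_vf[OF X that]])
  qed
qed

text \<open>The self-adjoint part of the endomorphism \<gamma> X.\<close>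

definition SS :: "(('a, 'i) tpoint, 'i) cnx" where
  "SS X Y = (\<lambda>q. tscale (1/2) (gm X Y q + gs X Y q))"

text \<open>The adjoint tensor symmetrised in its two arguments. It appears where two vertical lifts
  commute and the derivative must be symmetric.\<close>

definition gs2 :: "(('a, 'i) tpoint, 'i) cnx" where
  "gs2 X Y = (\<lambda>q. tscale (1/2) (gs X Y q + gs Y X q))"

lemma SS_vf: "vf_at N p X \<Longrightarrow> vf_at N p Y \<Longrightarrow> vf_at N p (SS X Y)"
  unfolding SS_def by (rule vf_cscale[OF vf_add'[OF gm_vf gs_vf]])

lemma gs2_vf: "vf_at N p X \<Longrightarrow> vf_at N p Y \<Longrightarrow> vf_at N p (gs2 X Y)"
  unfolding gs2_def by (rule vf_cscale[OF vf_add'[OF gs_vf gs_vf]])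

lemma SS_ip:
  assumes X: "vf_at N p X" and Y: "vf_at N p Y" and Z: "vf_at N p Z"
  shows "g p (SS X Y p) (Z p) = (c3 X Y Z p + c3 X Z Y p) / 2"
    and "g p (gs2 X Y p) (Z p) = (c3 X Z Y p + c3 Y Z X p) / 2"
  using g_scale1[OF vf_pts[OF X] tspace_add[OF gm_tspace[OF X Y] gs_tspace[OF X Y]] vf_tspace[OF Z]]
    g_add1[OF vf_pts[OF X] gm_tspace[OF X Y] gs_tspace[OF X Y] vf_tspace[OF Z]]
    g_scale1[OF vf_pts[OF X] tspace_add[OF gs_tspace[OF X Y] gs_tspace[OF Y X]] vf_tspace[OF Z]]
    g_add1[OF vf_pts[OF X] gs_tspace[OF X Y] gs_tspace[OF Y X] vf_tspace[OF Z]]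
    gs_ip[OF X Y Z] gs_ip[OF Y X Z]
  by (simp_all add: SS_def gs2_def c3_def)

section \<open>The Levi-Civita connection of the lifted metric\<close>

sublocale TH: herm TN g1 J1
  by unfold_locales (rule riemannian_g1 hermitian_TN)+

lemma g1_lifts:
  assumes \<xi>: "\<xi> \<in> pts TN" and X: "vf_at N (foot \<xi>) X" and Y: "vf_at N (foot \<xi>) Y"
  shows "g1 \<xi> (hl X \<xi>) (hl Y \<xi>) = g (foot \<xi>) (X (foot \<xi>)) (Y (foot \<xi>))"
    "g1 \<xi> (vl X \<xi>) (vl Y \<xi>) = g (foot \<xi>) (X (foot \<xi>)) (Y (foot \<xi>))"
    "g1 \<xi> (hl X \<xi>) (vl Y \<xi>) = 0" "g1 \<xi> (vl X \<xi>) (hl Y \<xi>) = 0"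
  using lift_metric_lifts[OF riem foot_pts[OF \<xi>] vf_tspace[OF X] vf_tspace[OF Y], of nab]
    lift_metric_lifts(3)[OF riem foot_pts[OF \<xi>] vf_tspace[OF Y] vf_tspace[OF X], of nab]
    TH.g_sym[OF \<xi> T.vf_tspace[OF vf_vl[OF \<xi> X]] T.vf_tspace[OF vf_hl[OF \<xi> Y]]]
  by (simp_all add: lift_field_pt)

lemma lie_g1_lifts:
  assumes A: "vf_at TN \<xi> A" and Y: "vf_at N (foot \<xi>) Y" and Z: "vf_at N (foot \<xi>) Z"
  shows "lie_deriv TN A (\<lambda>\<eta>. g1 \<eta> (hl Y \<eta>) (hl Z \<eta>)) \<xi> = lie_deriv TN A (\<lambda>\<eta>. (\<lambda>q. g q (Y q) (Z q)) (foot \<eta>)) \<xi>"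
    and "lie_deriv TN A (\<lambda>\<eta>. g1 \<eta> (vl Y \<eta>) (vl Z \<eta>)) \<xi> = lie_deriv TN A (\<lambda>\<eta>. (\<lambda>q. g q (Y q) (Z q)) (foot \<eta>)) \<xi>"
    and "lie_deriv TN A (\<lambda>\<eta>. g1 \<eta> (hl Y \<eta>) (vl Z \<eta>)) \<xi> = 0"
    and "lie_deriv TN A (\<lambda>\<eta>. g1 \<eta> (vl Y \<eta>) (hl Z \<eta>)) \<xi> = 0"
proof -
  note \<xi> = T.vf_pts[OF A]
  note cg = T.lie_cong[where Y = A, OF \<xi> A TH.sf_ip _ refl]
  note v = vf_hl[OF \<xi> Y] vf_vl[OF \<xi> Y] vf_hl[OF \<xi> Z] vf_vl[OF \<xi> Z]
  note n = near_foot_vf[OF \<xi> Y] near_foot_vf[OF \<xi> Z]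
  show "lie_deriv TN A (\<lambda>\<eta>. g1 \<eta> (hl Y \<eta>) (hl Z \<eta>)) \<xi> = lie_deriv TN A (\<lambda>\<eta>. (\<lambda>q. g q (Y q) (Z q)) (foot \<eta>)) \<xi>"
    by (rule cg[OF v(1,3)]) (use n in eventually_elim, simp add: g1_lifts)
  show "lie_deriv TN A (\<lambda>\<eta>. g1 \<eta> (vl Y \<eta>) (vl Z \<eta>)) \<xi> = lie_deriv TN A (\<lambda>\<eta>. (\<lambda>q. g q (Y q) (Z q)) (foot \<eta>)) \<xi>"
    by (rule cg[OF v(2,4)]) (use n in eventually_elim, simp add: g1_lifts)
  have "lie_deriv TN A (\<lambda>\<eta>. g1 \<eta> (hl Y \<eta>) (vl Z \<eta>)) \<xi> = lie_deriv TN A (\<lambda>\<eta>. 0) \<xi>"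
    by (rule cg[OF v(1,4)]) (use n in eventually_elim, simp add: g1_lifts)
  then show "lie_deriv TN A (\<lambda>\<eta>. g1 \<eta> (hl Y \<eta>) (vl Z \<eta>)) \<xi> = 0" using T.lie_const[OF \<xi> A] by simp
  have "lie_deriv TN A (\<lambda>\<eta>. g1 \<eta> (vl Y \<eta>) (hl Z \<eta>)) \<xi> = lie_deriv TN A (\<lambda>\<eta>. 0) \<xi>"
    by (rule cg[OF v(2,3)]) (use n in eventually_elim, simp add: g1_lifts)
  then show "lie_deriv TN A (\<lambda>\<eta>. g1 \<eta> (vl Y \<eta>) (hl Z \<eta>)) \<xi> = 0" using T.lie_const[OF \<xi> A] by simp
qed

lemma g1_eqI:
  assumes \<xi>: "\<xi> \<in> pts TN" and u: "u \<in> tspace TN \<xi>" and v: "v \<in> tspace TN \<xi>"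
    and eq: "\<And>Z. vf_at N (foot \<xi>) Z \<Longrightarrow> g1 \<xi> u (hl Z \<xi>) = g1 \<xi> v (hl Z \<xi>)"
      "\<And>Z. vf_at N (foot \<xi>) Z \<Longrightarrow> g1 \<xi> u (vl Z \<xi>) = g1 \<xi> v (vl Z \<xi>)"
  shows "u = v"
proof (rule TH.g_nondeg_vf[OF \<xi> u v])
  fix Z assume Z: "vf_at TN \<xi> Z"
  have "g1 \<xi> u (Z \<xi>) - g1 \<xi> v (Z \<xi>) = 0"
    by (rule tensorial_lifts[OF T.tensorial_diff[OF TH.tensorial_ip_right[OF \<xi> u] TH.tensorial_ip_right[OF \<xi> v]] Z])
      (simp add: lf_def eq)
  then show "g1 \<xi> u (Z \<xi>) = g1 \<xi> v (Z \<xi>)" by simp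
qed

lemma g1_minus:
  "\<xi> \<in> pts TN \<Longrightarrow> vf_at N (foot \<xi>) X \<Longrightarrow> w \<in> tspace TN \<xi> \<Longrightarrow> g1 \<xi> (- hl X \<xi>) w = - g1 \<xi> (hl X \<xi>) w"
  "\<xi> \<in> pts TN \<Longrightarrow> vf_at N (foot \<xi>) X \<Longrightarrow> w \<in> tspace TN \<xi> \<Longrightarrow> g1 \<xi> (- vl X \<xi>) w = - g1 \<xi> (vl X \<xi>) w"
  by (rule TH.g_minus1; simp add: T.vf_tspace vf_hl vf_vl)+

abbreviation "D1 \<equiv> TH.LC"

lemma LC_ip:
  assumes X: "vf_at N p X" and Y: "vf_at N p Y" and Z: "vf_at N p Z"
  shows "g p (LC X Y p) (Z p) = g p (nab X Y p) (Z p) + c3 X Y Z p"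
  unfolding c3_def LC_gm by (rule g_add1[OF vf_pts[OF X] conn_tspace[OF C X Y] gm_tspace[OF X Y] vf_tspace[OF Z]])

lemma lie_g_c3:
  assumes X: "vf_at N p X" and Y: "vf_at N p Y" and Z: "vf_at N p Z"
  shows "lie_deriv N X (\<lambda>q. g q (Y q) (Z q)) p = g p (nab X Y p) (Z p) + c3 X Y Z p + g p (nab X Z p) (Y p) + c3 X Z Y p"
  using LC_metric[OF X Y Z] LC_ip[OF X Y Z] LC_ip[OF X Z Y] g_sym[OF vf_pts[OF X] vf_tspace[OF Y] LC_tspace[OF X Z]] by simp

text \<open>A metric connection: metric compatibility determines only the self-adjoint part of what
  is added to \<open>nab\<close>, and here nothing else is added. Unlike the Levi-Civita connection
  it may have torsion.\<close>

definition nS :: "(('a, 'i) tpoint, 'i) cnx" where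
  "nS X Y = (\<lambda>q. nab X Y q + SS X Y q)"

lemma nS_vf: "vf_at N p X \<Longrightarrow> vf_at N p Y \<Longrightarrow> vf_at N p (nS X Y)"
  unfolding nS_def by (rule vf_add'[OF conn_vf[OF C] SS_vf])

lemma nS_ip:
  assumes X: "vf_at N p X" and Y: "vf_at N p Y" and Z: "vf_at N p Z"
  shows "g p (nS X Y p) (Z p) = g p (nab X Y p) (Z p) + (c3 X Y Z p + c3 X Z Y p) / 2"
  unfolding nS_def using SS_ip(1)[OF X Y Z]
    g_add1[OF vf_pts[OF X] conn_tspace[OF C X Y] vf_tspace[OF SS_vf[OF X Y]] vf_tspace[OF Z]] by simp

lemma bracket_vh:
  "\<xi> \<in> pts TN \<Longrightarrow> vf_at N (foot \<xi>) X \<Longrightarrow> vf_at N (foot \<xi>) Y \<Longrightarrow> bracket TN (vl X) (hl Y) \<xi> = - vl (nab Y X) \<xi>"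
  using T.bracket_antisym[of "vl X" "hl Y" \<xi>] bracket_hv[of \<xi> Y X] by simp

text \<open>The Koszul formula on lifts. Inner products of lifts are constant or pulled back from
  the base, so vertical fields annihilate them, and the brackets are known.\<close>

lemma D1_lifts:
  assumes \<xi>: "\<xi> \<in> pts TN" and X: "vf_at N (foot \<xi>) X" and Y: "vf_at N (foot \<xi>) Y"
  shows D1_hh: "D1 (hl X) (hl Y) \<xi> = hl (LC X Y) \<xi>"
    and D1_hv: "D1 (hl X) (vl Y) \<xi> = vl (nS X Y) \<xi>"
    and D1_vh: "D1 (vl X) (hl Y) \<xi> = vl (SS Y X) \<xi>"
    and D1_vv: "D1 (vl X) (vl Y) \<xi> = - hl (gs2 X Y) \<xi>"
proof -
  let ?p = "foot \<xi>"
  note v = vf_hl[OF \<xi>] vf_vl[OF \<xi>]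
  note t = T.vf_tspace[OF v(1)] T.vf_tspace[OF v(2)]
  note D = TH.LC_tspace
  have K: "2 * g1 \<xi> (D1 A B \<xi>) (Z \<xi>) = koszul TN g1 A B Z \<xi>"
    if "vf_at TN \<xi> A" "vf_at TN \<xi> B" "vf_at TN \<xi> Z" for A B Z by (rule TH.LC_koszul[OF that])
  have lh: "lie_deriv TN (hl U) (\<lambda>\<eta>. g (foot \<eta>) (V (foot \<eta>)) (W (foot \<eta>))) \<xi> = lie_deriv N U (\<lambda>q. g q (V q) (W q)) ?p"
    and lv: "lie_deriv TN (vl U) (\<lambda>\<eta>. g (foot \<eta>) (V (foot \<eta>)) (W (foot \<eta>))) \<xi> = 0"
    if "vf_at N ?p U" "vf_at N ?p V" "vf_at N ?p W" for U V W
    using lie_hl[OF \<xi> that(1) sf_ip[OF that(2,3)]] by auto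
  have z: "g1 \<xi> 0 w = 0" if "w \<in> tspace TN \<xi>" for w by (rule TH.g_zero1[OF \<xi> that that])
  note r = koszul_def lie_g1_lifts lh lv bracket_lifts[OF \<xi>] bracket_vh[OF \<xi>] g1_lifts[OF \<xi>] g1_minus[OF \<xi>]
    vf_bracket conn_vf[OF C] X Y v t z
  show hh: "D1 (hl X) (hl Y) \<xi> = hl (LC X Y) \<xi>"
  proof (rule g1_eqI[OF \<xi> D[OF v(1)[OF X] v(1)[OF Y]] t(1)[OF LC_vf[OF X Y]]])
    fix Z assume Z: "vf_at N ?p Z"
    show "g1 \<xi> (D1 (hl X) (hl Y) \<xi>) (hl Z \<xi>) = g1 \<xi> (hl (LC X Y) \<xi>) (hl Z \<xi>)"
      using K[OF v(1)[OF X] v(1)[OF Y] v(1)[OF Z]] LC_koszul[OF X Y Z] g1_lifts(1)[OF \<xi> LC_vf[OF X Y] Z]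
      by (simp add: r Z)
    show "g1 \<xi> (D1 (hl X) (hl Y) \<xi>) (vl Z \<xi>) = g1 \<xi> (hl (LC X Y) \<xi>) (vl Z \<xi>)"
      using K[OF v(1)[OF X] v(1)[OF Y] v(2)[OF Z]] g1_lifts(3)[OF \<xi> LC_vf[OF X Y] Z] by (simp add: r Z)
  qed
  have hv: "D1 (hl X) (vl Y) \<xi> = vl (nS X Y) \<xi>" if X: "vf_at N ?p X" and Y: "vf_at N ?p Y" for X Y
  proof (rule g1_eqI[OF \<xi> D[OF v(1)[OF X] v(2)[OF Y]] t(2)[OF nS_vf[OF X Y]]])
    fix Z assume Z: "vf_at N ?p Z"
    show "g1 \<xi> (D1 (hl X) (vl Y) \<xi>) (hl Z \<xi>) = g1 \<xi> (vl (nS X Y) \<xi>) (hl Z \<xi>)"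
      using K[OF v(1)[OF X] v(2)[OF Y] v(1)[OF Z]] g1_lifts(4)[OF \<xi> nS_vf[OF X Y] Z] by (simp add: r X Y Z)
    show "g1 \<xi> (D1 (hl X) (vl Y) \<xi>) (vl Z \<xi>) = g1 \<xi> (vl (nS X Y) \<xi>) (vl Z \<xi>)"
    proof -
      have k: "koszul TN g1 (hl X) (vl Y) (vl Z) \<xi> = lie_deriv N X (\<lambda>q. g q (Y q) (Z q)) ?p
          + g ?p (nab X Y ?p) (Z ?p) - g ?p (nab X Z ?p) (Y ?p)" by (simp add: r X Y Z)
      \<comment> \<open>With the derivative \<open>l\<close> of the metric expressed through
        \<open>nab\<close> and \<open>c3\<close>, the terms \<open>B\<close> cancel and half of
        \<open>c + d\<close> remains.\<close>
      have ar: "G = A + (c + d) / 2" if "2 * G = K" "K = l + A - B" "l = A + c + B + d" for G A B K l c d :: real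
        using that by (simp add: field_simps)
      show ?thesis
        unfolding g1_lifts(2)[OF \<xi> nS_vf[OF X Y] Z] nS_ip[OF X Y Z]
        by (rule ar[OF K[OF v(1)[OF X] v(2)[OF Y] v(2)[OF Z]] k lie_g_c3[OF X Y Z]])
    qed
  qed
  show "D1 (hl X) (vl Y) \<xi> = vl (nS X Y) \<xi>" by (rule hv[OF X Y])
  \<comment> \<open>Torsion-freeness derives this case from the previous one: the bracket removes
    \<open>nab\<close> and leaves \<open>SS\<close>.\<close>
  have "D1 (vl X) (hl Y) \<xi> = D1 (hl Y) (vl X) \<xi> + bracket TN (vl X) (hl Y) \<xi>"
    using TH.LC_torsion[OF v(2)[OF X] v(1)[OF Y]] by (simp add: algebra_simps)
  also have "\<dots> = vl (nS Y X) \<xi> - vl (nab Y X) \<xi>" unfolding hv[OF Y X] bracket_vh[OF \<xi> X Y] by simp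
  also have "\<dots> = vl (SS Y X) \<xi>" by (simp add: lift_field_pt nS_def vlift_add)
  finally show "D1 (vl X) (hl Y) \<xi> = vl (SS Y X) \<xi>" .
  show "D1 (vl X) (vl Y) \<xi> = - hl (gs2 X Y) \<xi>"
  proof (rule g1_eqI[OF \<xi> D[OF v(2)[OF X] v(2)[OF Y]] tspace_minus[OF t(1)[OF gs2_vf[OF X Y]]]])
    fix Z assume Z: "vf_at N ?p Z"
    show "g1 \<xi> (D1 (vl X) (vl Y) \<xi>) (hl Z \<xi>) = g1 \<xi> (- hl (gs2 X Y) \<xi>) (hl Z \<xi>)"
    proof -
      have k: "koszul TN g1 (vl X) (vl Y) (hl Z) \<xi> = - lie_deriv N Z (\<lambda>q. g q (X q) (Y q)) ?p
          + g ?p (nab Z X ?p) (Y ?p) + g ?p (nab Z Y ?p) (X ?p)" by (simp add: r Z)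
      have ar: "G = - ((c + d) / 2)" if "2 * G = K" "K = - l + A + B" "l = A + c + B + d" for G A B K l c d :: real
        using that by (simp add: field_simps)
      show ?thesis
        unfolding g1_minus(1)[OF \<xi> gs2_vf[OF X Y] t(1)[OF Z]] g1_lifts(1)[OF \<xi> gs2_vf[OF X Y] Z] SS_ip(2)[OF X Y Z]
          c3_sym[OF X Z, of Y] c3_sym[OF Y Z, of X]
        by (rule ar[OF K[OF v(2)[OF X] v(2)[OF Y] v(1)[OF Z]] k lie_g_c3[OF Z X Y]])
    qed
    show "g1 \<xi> (D1 (vl X) (vl Y) \<xi>) (vl Z \<xi>) = g1 \<xi> (- hl (gs2 X Y) \<xi>) (vl Z \<xi>)"
      using K[OF v(2)[OF X] v(2)[OF Y] v(2)[OF Z]] g1_lifts(3)[OF \<xi> gs2_vf[OF X Y] Z]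
        g1_minus(1)[OF \<xi> gs2_vf[OF X Y] t(2)[OF Z]] by (simp add: r Z)
  qed
qed

section \<open>The derivatives of the complex structure and of the fundamental form\<close>

definition dl :: "(('a, 'i) tpoint, 'i) cnx" where
  "dl X Y = (\<lambda>q. tscale (1/2) (gm X Y q - gs X Y q))"

lemma dl_vf: "vf_at N p X \<Longrightarrow> vf_at N p Y \<Longrightarrow> vf_at N p (dl X Y)"
  unfolding dl_def by (rule vf_cscale[OF vf_diff[OF gm_vf gs_vf]])

lemma dl_ip:
  assumes X: "vf_at N p X" and Y: "vf_at N p Y" and Z: "vf_at N p Z"
  shows "g p (dl X Y p) (Z p) = (c3 X Y Z p - c3 X Z Y p) / 2"
  using g_scale1[OF vf_pts[OF X] tspace_diff[OF gm_tspace[OF X Y] gs_tspace[OF X Y]] vf_tspace[OF Z]]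
    g_diff1[OF vf_pts[OF X] gm_tspace[OF X Y] gs_tspace[OF X Y] vf_tspace[OF Z]] gs_ip[OF X Y Z]
  by (simp add: dl_def c3_def)

text \<open>A horizontal lift differentiates horizontal lifts by \<open>LC\<close> and vertical ones
  by \<open>nS\<close>, and \<open>nS - LC\<close> is \<open>- dl\<close>. For a vertical lift the
  mismatch is \<open>SS Y X - gs2 X Y\<close>, which is \<open>dl X Y\<close> by the symmetry of
  \<open>gm\<close>.\<close>

lemma DJ1_lifts:
  assumes \<xi>: "\<xi> \<in> pts TN" and X: "vf_at N (foot \<xi>) X" and Y: "vf_at N (foot \<xi>) Y"
  shows "TJ.DJ D1 (hl X) (hl Y) \<xi> = - vl (dl X Y) \<xi>" "TJ.DJ D1 (hl X) (vl Y) \<xi> = - hl (dl X Y) \<xi>"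
    "TJ.DJ D1 (vl X) (hl Y) \<xi> = hl (dl X Y) \<xi>" "TJ.DJ D1 (vl X) (vl Y) \<xi> = - vl (dl X Y) \<xi>"
proof -
  let ?p = "foot \<xi>"
  note h = conn_J1_lifts[OF TH.LC_conn vf_hl[OF \<xi> X] Y] and v = conn_J1_lifts[OF TH.LC_conn vf_vl[OF \<xi> X] Y]
  note t = vf_tspace[OF LC_vf[OF X Y]] vf_tspace[OF nS_vf[OF X Y]] vf_tspace[OF SS_vf[OF Y X]] vf_tspace[OF gs2_vf[OF X Y]]
  note J = J1_lifts(1)[of "LC X Y" \<xi>, OF t(1)] J1_lifts(2)[of "nS X Y" \<xi>, OF t(2)]
    J1_lifts(2)[of "SS Y X" \<xi>, OF t(3)] J1_lifts(1)[of "gs2 X Y" \<xi>, OF t(4)]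
  note Jm = TJ.J_minus[OF \<xi> T.vf_tspace[OF vf_hl[OF \<xi> gs2_vf[OF X Y]]]]
  have m: "nS X Y ?p - LC X Y ?p = - dl X Y ?p"
    by (auto simp: fun_eq_iff nS_def LC_gm SS_def dl_def field_simps)
  have m': "- gs2 X Y ?p + SS Y X ?p = dl X Y ?p"
    by (auto simp: fun_eq_iff gs2_def SS_def dl_def gm_sym[OF Y X] field_simps)
  note D = D1_lifts[OF \<xi> X Y]
  show "TJ.DJ D1 (hl X) (hl Y) \<xi> = - vl (dl X Y) \<xi>"
    unfolding TJ.DJ_def h D J using arg_cong[OF m, of "vlift N \<xi>"] by (simp add: lift_field_pt vlift_diff vlift_minus)
  show "TJ.DJ D1 (hl X) (vl Y) \<xi> = - hl (dl X Y) \<xi>"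
    unfolding TJ.DJ_def h D J using arg_cong[OF m, of "hlift N nab \<xi>"] by (simp add: lift_field_pt hlift_diff hlift_minus)
  show "TJ.DJ D1 (vl X) (hl Y) \<xi> = hl (dl X Y) \<xi>"
    unfolding TJ.DJ_def v D J using arg_cong[OF m', of "hlift N nab \<xi>"] by (simp add: lift_field_pt hlift_add hlift_minus hlift_diff)
  show "TJ.DJ D1 (vl X) (vl Y) \<xi> = - vl (dl X Y) \<xi>"
    unfolding TJ.DJ_def v D Jm J using arg_cong[OF m', of "vlift N \<xi>"] by (simp add: lift_field_pt vlift_add vlift_minus vlift_diff algebra_simps)
qed

abbreviation "ed \<equiv> ext_deriv2 TN (fund_form J1 g1)"

text \<open>Only components with exactly one vertical argument can survive. With none or two
  vertical arguments every term pairs a horizontal with a vertical lift. With three, the cyclic sum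
  of the skew part vanishes because \<open>c3\<close> is symmetric in its first two
  arguments.\<close>

lemma ed_lifts:
  assumes \<xi>: "\<xi> \<in> pts TN" and X: "vf_at N (foot \<xi>) X" and Y: "vf_at N (foot \<xi>) Y" and Z: "vf_at N (foot \<xi>) Z"
  shows "ed (hl X) (hl Y) (hl Z) \<xi> = 0"
    "ed (hl X) (hl Y) (vl Z) \<xi> = c3 X Z Y (foot \<xi>) - c3 Y Z X (foot \<xi>)"
    "ed (hl X) (vl Y) (hl Z) \<xi> = c3 Z Y X (foot \<xi>) - c3 X Y Z (foot \<xi>)"
    "ed (vl X) (hl Y) (hl Z) \<xi> = c3 Y X Z (foot \<xi>) - c3 Z X Y (foot \<xi>)"
    "ed (hl X) (vl Y) (vl Z) \<xi> = 0" "ed (vl X) (hl Y) (vl Z) \<xi> = 0" "ed (vl X) (vl Y) (hl Z) \<xi> = 0"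
    "ed (vl X) (vl Y) (vl Z) \<xi> = 0"
  using c3_sym[OF X Y, of Z] c3_sym[OF X Z, of Y] c3_sym[OF Y Z, of X]
  by (simp_all add: TH.ext_deriv_fund_form vf_hl[OF \<xi>] vf_vl[OF \<xi>] X Y Z DJ1_lifts[OF \<xi>] g1_minus[OF \<xi>] dl_vf
      T.vf_tspace g1_lifts[OF \<xi>] dl_ip field_simps)

text \<open>Pointwise, \<open>J\<^sub>1\<close> exchanges the lifts up to sign, and a tensorial
  expression sees only values at the point.\<close>

lemma ed_J:
  assumes \<xi>: "\<xi> \<in> pts TN" and X: "vf_at N (foot \<xi>) X" and B: "vf_at TN \<xi> B" and D: "vf_at TN \<xi> D"
  shows "ed (app J1 (hl X)) B D \<xi> = ed (vl X) B D \<xi>" "ed (app J1 (vl X)) B D \<xi> = - ed (hl X) B D \<xi>"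
    "ed B (app J1 (hl X)) D \<xi> = ed B (vl X) D \<xi>" "ed B (app J1 (vl X)) D \<xi> = - ed B (hl X) D \<xi>"
    "ed B D (app J1 (hl X)) \<xi> = ed B D (vl X) \<xi>" "ed B D (app J1 (vl X)) \<xi> = - ed B D (hl X) \<xi>"
proof -
  have hv: "F (app J1 (hl X)) = F (vl X)" if F: "tensorial TN \<xi> F" for F
    by (rule T.tensorial_pt[OF F vf_J1[OF vf_hl[OF \<xi> X]] vf_vl[OF \<xi> X]]) (simp add: J1_lifts vf_tspace[OF X])
  have vh: "F (app J1 (vl X)) = - F (hl X)" if F: "tensorial TN \<xi> F" for F
  proof -
    have "F (app J1 (vl X)) = F (fscale (\<lambda>_. -1) (hl X))"
      by (rule T.tensorial_pt[OF F vf_J1[OF vf_vl[OF \<xi> X]] T.vf_scale[OF T.sf_const[OF \<xi>] vf_hl[OF \<xi> X]]])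
        (simp add: J1_lifts vf_tspace[OF X] tscale_minus_one)
    then show ?thesis using tensorialD(2)[OF F T.sf_const[OF \<xi>, of "-1"] vf_hl[OF \<xi> X]] by simp
  qed
  note t = TH.ext_deriv_tensorial[OF B D]
  show "ed (app J1 (hl X)) B D \<xi> = ed (vl X) B D \<xi>" "ed (app J1 (vl X)) B D \<xi> = - ed (hl X) B D \<xi>"
    "ed B (app J1 (hl X)) D \<xi> = ed B (vl X) D \<xi>" "ed B (app J1 (vl X)) D \<xi> = - ed B (hl X) D \<xi>"
    "ed B D (app J1 (hl X)) \<xi> = ed B D (vl X) \<xi>" "ed B D (app J1 (vl X)) \<xi> = - ed B D (hl X) \<xi>"
    using hv[OF t(1)] vh[OF t(1)] hv[OF t(2)] vh[OF t(2)] hv[OF t(3)] vh[OF t(3)] by simp_all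
qed

text \<open>The correction term changes \<open>LC\<close> to \<open>nS\<close> on horizontal lifts,
  in line with what the Levi-Civita connection already does on vertical ones, so that both lifts are
  differentiated alike. In the notation of \<open>ricci_zero\<close>, \<open>D\<close> is
  \<open>nS\<close> and \<open>A\<close> is \<open>SS\<close>.\<close>

lemma chern_lifts:
  assumes \<xi>: "\<xi> \<in> pts TN" and X: "vf_at N (foot \<xi>) X" and Y: "vf_at N (foot \<xi>) Y"
  shows "chern TN J1 g1 (hl X) (hl Y) \<xi> = hl (nS X Y) \<xi>" "chern TN J1 g1 (hl X) (vl Y) \<xi> = vl (nS X Y) \<xi>"
    "chern TN J1 g1 (vl X) (hl Y) \<xi> = vl (SS X Y) \<xi>" "chern TN J1 g1 (vl X) (vl Y) \<xi> = - hl (SS X Y) \<xi>"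
proof -
  note v = vf_hl[OF \<xi>] vf_vl[OF \<xi>]
  note w = nS_vf[OF X Y] SS_vf[OF X Y] SS_vf[OF Y X] gs2_vf[OF X Y] LC_vf[OF X Y] gs_vf[OF Y X]
  note t = T.conn_tspace[OF TH.chern_conn] and I = TH.chern_ip
  note r = D1_lifts[OF \<xi>] ed_J[OF \<xi>] ed_lifts[OF \<xi>] v w g1_lifts[OF \<xi>] g1_minus[OF \<xi>] T.vf_tspace
    SS_ip nS_ip LC_ip gs_ip vf_J1 X Y
  show "chern TN J1 g1 (hl X) (hl Y) \<xi> = hl (nS X Y) \<xi>"
  proof (rule g1_eqI[OF \<xi> t[OF v(1)[OF X] v(1)[OF Y]] T.vf_tspace[OF v(1)[OF w(1)]]])
    fix Z assume Z: "vf_at N (foot \<xi>) Z"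
    note cs = c3_sym[OF X Y, of Z] c3_sym[OF X Z, of Y] c3_sym[OF Y Z, of X]
    show "g1 \<xi> (chern TN J1 g1 (hl X) (hl Y) \<xi>) (hl Z \<xi>) = g1 \<xi> (hl (nS X Y) \<xi>) (hl Z \<xi>)"
      using cs by (simp add: I[OF v(1)[OF X] v(1)[OF Y] v(1)[OF Z]] r Z field_simps)
    show "g1 \<xi> (chern TN J1 g1 (hl X) (hl Y) \<xi>) (vl Z \<xi>) = g1 \<xi> (hl (nS X Y) \<xi>) (vl Z \<xi>)"
      using cs by (simp add: I[OF v(1)[OF X] v(1)[OF Y] v(2)[OF Z]] r Z field_simps)
  qed
  show "chern TN J1 g1 (hl X) (vl Y) \<xi> = vl (nS X Y) \<xi>"
  proof (rule g1_eqI[OF \<xi> t[OF v(1)[OF X] v(2)[OF Y]] T.vf_tspace[OF v(2)[OF w(1)]]])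
    fix Z assume Z: "vf_at N (foot \<xi>) Z"
    note cs = c3_sym[OF X Y, of Z] c3_sym[OF X Z, of Y] c3_sym[OF Y Z, of X]
    show "g1 \<xi> (chern TN J1 g1 (hl X) (vl Y) \<xi>) (hl Z \<xi>) = g1 \<xi> (vl (nS X Y) \<xi>) (hl Z \<xi>)"
      using cs by (simp add: I[OF v(1)[OF X] v(2)[OF Y] v(1)[OF Z]] r Z field_simps)
    show "g1 \<xi> (chern TN J1 g1 (hl X) (vl Y) \<xi>) (vl Z \<xi>) = g1 \<xi> (vl (nS X Y) \<xi>) (vl Z \<xi>)"
      using cs by (simp add: I[OF v(1)[OF X] v(2)[OF Y] v(2)[OF Z]] r Z field_simps)
  qed
  show "chern TN J1 g1 (vl X) (hl Y) \<xi> = vl (SS X Y) \<xi>"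
  proof (rule g1_eqI[OF \<xi> t[OF v(2)[OF X] v(1)[OF Y]] T.vf_tspace[OF v(2)[OF w(2)]]])
    fix Z assume Z: "vf_at N (foot \<xi>) Z"
    note cs = c3_sym[OF X Y, of Z] c3_sym[OF X Z, of Y] c3_sym[OF Y Z, of X]
    show "g1 \<xi> (chern TN J1 g1 (vl X) (hl Y) \<xi>) (hl Z \<xi>) = g1 \<xi> (vl (SS X Y) \<xi>) (hl Z \<xi>)"
      using cs by (simp add: I[OF v(2)[OF X] v(1)[OF Y] v(1)[OF Z]] r Z field_simps)
    show "g1 \<xi> (chern TN J1 g1 (vl X) (hl Y) \<xi>) (vl Z \<xi>) = g1 \<xi> (vl (SS X Y) \<xi>) (vl Z \<xi>)"
      using cs by (simp add: I[OF v(2)[OF X] v(1)[OF Y] v(2)[OF Z]] r Z field_simps)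
  qed
  show "chern TN J1 g1 (vl X) (vl Y) \<xi> = - hl (SS X Y) \<xi>"
  proof (rule g1_eqI[OF \<xi> t[OF v(2)[OF X] v(2)[OF Y]] tspace_minus[OF T.vf_tspace[OF v(1)[OF w(2)]]]])
    fix Z assume Z: "vf_at N (foot \<xi>) Z"
    note cs = c3_sym[OF X Y, of Z] c3_sym[OF X Z, of Y] c3_sym[OF Y Z, of X]
    show "g1 \<xi> (chern TN J1 g1 (vl X) (vl Y) \<xi>) (hl Z \<xi>) = g1 \<xi> (- hl (SS X Y) \<xi>) (hl Z \<xi>)"
      using cs by (simp add: I[OF v(2)[OF X] v(2)[OF Y] v(1)[OF Z]] r Z field_simps)
    show "g1 \<xi> (chern TN J1 g1 (vl X) (vl Y) \<xi>) (vl Z \<xi>) = g1 \<xi> (- hl (SS X Y) \<xi>) (vl Z \<xi>)"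
      using cs by (simp add: I[OF v(2)[OF X] v(2)[OF Y] v(2)[OF Z]] r Z field_simps)
  qed
qed

text \<open>Here the correction changes \<open>nS\<close> to \<open>LC\<close> on vertical lifts
  instead. In the notation of \<open>ricci_zero\<close>, \<open>D\<close> is \<open>LC\<close> and
  \<open>A X Y\<close> is \<open>gs Y X\<close>, with the arguments exchanged.\<close>

lemma bismut_lifts:
  assumes \<xi>: "\<xi> \<in> pts TN" and X: "vf_at N (foot \<xi>) X" and Y: "vf_at N (foot \<xi>) Y"
  shows "bismut TN J1 g1 (hl X) (hl Y) \<xi> = hl (LC X Y) \<xi>" "bismut TN J1 g1 (hl X) (vl Y) \<xi> = vl (LC X Y) \<xi>"
    "bismut TN J1 g1 (vl X) (hl Y) \<xi> = vl (gs Y X) \<xi>" "bismut TN J1 g1 (vl X) (vl Y) \<xi> = - hl (gs Y X) \<xi>"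
proof -
  note v = vf_hl[OF \<xi>] vf_vl[OF \<xi>]
  note w = nS_vf[OF X Y] SS_vf[OF X Y] SS_vf[OF Y X] gs2_vf[OF X Y] LC_vf[OF X Y] gs_vf[OF Y X]
  note t = T.conn_tspace[OF TH.bismut_conn] and I = TH.bismut_ip
  note r = D1_lifts[OF \<xi>] ed_J[OF \<xi>] ed_lifts[OF \<xi>] v w g1_lifts[OF \<xi>] g1_minus[OF \<xi>] T.vf_tspace
    SS_ip nS_ip LC_ip gs_ip vf_J1 X Y
  show "bismut TN J1 g1 (hl X) (hl Y) \<xi> = hl (LC X Y) \<xi>"
  proof (rule g1_eqI[OF \<xi> t[OF v(1)[OF X] v(1)[OF Y]] T.vf_tspace[OF v(1)[OF w(5)]]])
    fix Z assume Z: "vf_at N (foot \<xi>) Z"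
    note cs = c3_sym[OF X Y, of Z] c3_sym[OF X Z, of Y] c3_sym[OF Y Z, of X]
    show "g1 \<xi> (bismut TN J1 g1 (hl X) (hl Y) \<xi>) (hl Z \<xi>) = g1 \<xi> (hl (LC X Y) \<xi>) (hl Z \<xi>)"
      using cs by (simp add: I[OF v(1)[OF X] v(1)[OF Y] v(1)[OF Z]] r Z field_simps)
    show "g1 \<xi> (bismut TN J1 g1 (hl X) (hl Y) \<xi>) (vl Z \<xi>) = g1 \<xi> (hl (LC X Y) \<xi>) (vl Z \<xi>)"
      using cs by (simp add: I[OF v(1)[OF X] v(1)[OF Y] v(2)[OF Z]] r Z field_simps)
  qed
  show "bismut TN J1 g1 (hl X) (vl Y) \<xi> = vl (LC X Y) \<xi>"
  proof (rule g1_eqI[OF \<xi> t[OF v(1)[OF X] v(2)[OF Y]] T.vf_tspace[OF v(2)[OF w(5)]]])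
    fix Z assume Z: "vf_at N (foot \<xi>) Z"
    note cs = c3_sym[OF X Y, of Z] c3_sym[OF X Z, of Y] c3_sym[OF Y Z, of X]
    show "g1 \<xi> (bismut TN J1 g1 (hl X) (vl Y) \<xi>) (hl Z \<xi>) = g1 \<xi> (vl (LC X Y) \<xi>) (hl Z \<xi>)"
      using cs by (simp add: I[OF v(1)[OF X] v(2)[OF Y] v(1)[OF Z]] r Z field_simps)
    show "g1 \<xi> (bismut TN J1 g1 (hl X) (vl Y) \<xi>) (vl Z \<xi>) = g1 \<xi> (vl (LC X Y) \<xi>) (vl Z \<xi>)"
      using cs by (simp add: I[OF v(1)[OF X] v(2)[OF Y] v(2)[OF Z]] r Z field_simps)
  qed
  show "bismut TN J1 g1 (vl X) (hl Y) \<xi> = vl (gs Y X) \<xi>"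
  proof (rule g1_eqI[OF \<xi> t[OF v(2)[OF X] v(1)[OF Y]] T.vf_tspace[OF v(2)[OF w(6)]]])
    fix Z assume Z: "vf_at N (foot \<xi>) Z"
    note cs = c3_sym[OF X Y, of Z] c3_sym[OF X Z, of Y] c3_sym[OF Y Z, of X]
    show "g1 \<xi> (bismut TN J1 g1 (vl X) (hl Y) \<xi>) (hl Z \<xi>) = g1 \<xi> (vl (gs Y X) \<xi>) (hl Z \<xi>)"
      using cs by (simp add: I[OF v(2)[OF X] v(1)[OF Y] v(1)[OF Z]] r Z field_simps)
    show "g1 \<xi> (bismut TN J1 g1 (vl X) (hl Y) \<xi>) (vl Z \<xi>) = g1 \<xi> (vl (gs Y X) \<xi>) (vl Z \<xi>)"
      using cs by (simp add: I[OF v(2)[OF X] v(1)[OF Y] v(2)[OF Z]] r Z field_simps)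
  qed
  show "bismut TN J1 g1 (vl X) (vl Y) \<xi> = - hl (gs Y X) \<xi>"
  proof (rule g1_eqI[OF \<xi> t[OF v(2)[OF X] v(2)[OF Y]] tspace_minus[OF T.vf_tspace[OF v(1)[OF w(6)]]]])
    fix Z assume Z: "vf_at N (foot \<xi>) Z"
    note cs = c3_sym[OF X Y, of Z] c3_sym[OF X Z, of Y] c3_sym[OF Y Z, of X]
    show "g1 \<xi> (bismut TN J1 g1 (vl X) (vl Y) \<xi>) (hl Z \<xi>) = g1 \<xi> (- hl (gs Y X) \<xi>) (hl Z \<xi>)"
      using cs by (simp add: I[OF v(2)[OF X] v(2)[OF Y] v(1)[OF Z]] r Z field_simps)
    show "g1 \<xi> (bismut TN J1 g1 (vl X) (vl Y) \<xi>) (vl Z \<xi>) = g1 \<xi> (- hl (gs Y X) \<xi>) (vl Z \<xi>)"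
      using cs by (simp add: I[OF v(2)[OF X] v(2)[OF Y] v(2)[OF Z]] r Z field_simps)
  qed
qed

end

section \<open>Traces and Ricci forms on the tangent bundle\<close>

context aff
begin

text \<open>The two lifts of an orthonormal frame of the base together form an orthonormal frame
  upstairs; \<open>trace_frame_indep\<close> puts it in place of the chosen one.\<close>

lemma trace_lift:
  assumes \<xi>: "\<xi> \<in> pts TN"
    and B1: "\<And>Y. vf_at TN \<xi> Y \<Longrightarrow> tensorial TN \<xi> (\<lambda>X. B X Y)" and B2: "\<And>X. vf_at TN \<xi> X \<Longrightarrow> tensorial TN \<xi> (B X)"
    and E: "\<And>a. a < n \<Longrightarrow> vf_at N (foot \<xi>) (E a)" and onb: "onb (foot \<xi>) (\<lambda>a. E a (foot \<xi>))"
  shows "(\<Sum>a<dim TN. B (frame_at TN g1 \<xi> a) (frame_at TN g1 \<xi> a)) =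
    (\<Sum>a<n. B (hl (E a)) (hl (E a))) + (\<Sum>a<n. B (vl (E a)) (vl (E a)))"
proof -
  define F where "F a = (if a < n then hl (E a) else vl (E (a - n)))" for a
  have F_simps: "a < n \<Longrightarrow> F a = hl (E a)" "F (n + a) = vl (E a)" for a by (simp_all add: F_def)
  have vF: "vf_at TN \<xi> (F a)" if "a < dim TN" for a
    by (rule TN_index_cases[OF that]) (auto simp: F_simps vf_hl[OF \<xi> E] vf_vl[OF \<xi> E])
  have ee: "g (foot \<xi>) (E a (foot \<xi>)) (E b (foot \<xi>)) = (if a = b then 1 else 0)" if "a < n" "b < n" for a b
    using onb that by (simp add: onb_def)
  have "TH.onb \<xi> (\<lambda>a. F a \<xi>)"
    unfolding TH.onb_def
  proof (intro conjI allI impI)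
    fix a b assume a: "a < dim TN" and b: "b < dim TN"
    show "F a \<xi> \<in> tspace TN \<xi>" by (rule T.vf_tspace[OF vF[OF a]])
    show "g1 \<xi> (F a \<xi>) (F b \<xi>) = (if a = b then 1 else 0)"
      by (rule TN_index_cases[OF a]; rule TN_index_cases[OF b]) (auto simp: F_simps g1_lifts[OF \<xi> E E] ee)
  qed
  from TH.trace_frame_indep[OF \<xi> B1 B2 TH.vf_frame_at[OF \<xi>] TH.onb_frame_at[OF \<xi>] vF this]
  have "(\<Sum>a<dim TN. B (frame_at TN g1 \<xi> a) (frame_at TN g1 \<xi> a)) = (\<Sum>a<dim TN. B (F a) (F a))" by simp
  also have "\<dots> = (\<Sum>a<n. B (hl (E a)) (hl (E a))) + (\<Sum>a<n. B (vl (E a)) (vl (E a)))"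
    by (simp add: sum_double F_simps)
  finally show ?thesis .
qed

text \<open>In an orthonormal frame \<open>D X\<close> is given by a skew matrix and \<open>A Y\<close> by a symmetric one.\<close>

lemma trace_commutator:
  assumes p: "p \<in> pts N" and X: "vf_at N p X" and Y: "vf_at N p Y"
    and Dvf: "\<And>p X Y. vf_at N p X \<Longrightarrow> vf_at N p Y \<Longrightarrow> vf_at N p (D X Y)"
    and Avf: "\<And>p X Y. vf_at N p X \<Longrightarrow> vf_at N p Y \<Longrightarrow> vf_at N p (A X Y)"
    and Dm: "\<And>p X Y Z. vf_at N p X \<Longrightarrow> vf_at N p Y \<Longrightarrow> vf_at N p Z \<Longrightarrow>
      lie_deriv N X (\<lambda>q. g q (Y q) (Z q)) p = g p (D X Y p) (Z p) + g p (Y p) (D X Z p)"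
    and As: "\<And>p X Y Z. vf_at N p X \<Longrightarrow> vf_at N p Y \<Longrightarrow> vf_at N p Z \<Longrightarrow> g p (A X Y p) (Z p) = g p (Y p) (A X Z p)"
    and At: "\<And>p X E. vf_at N p X \<Longrightarrow> (\<And>a. a < n \<Longrightarrow> vf_at N p (E a)) \<Longrightarrow> onb p (\<lambda>a. E a p) \<Longrightarrow>
      (\<Sum>a<n. g p (A X (E a) p) (E a p)) = 0"
    and E: "\<And>a. a < n \<Longrightarrow> vf_at N p (E a)" and onb: "near N p (\<lambda>q. onb q (\<lambda>a. E a q))"
  shows "(\<Sum>a<n. g p (D X (A Y (E a)) p) (E a p)) = (\<Sum>a<n. g p (A Y (D X (E a)) p) (E a p))"
proof -
  note o = near_point[OF p onb]
  have AE: "vf_at N p (A Y (E a))" if "a < n" for a by (rule Avf[OF Y E[OF that]])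
  have DE: "vf_at N p (D X (E a))" if "a < n" for a by (rule Dvf[OF X E[OF that]])
  have sf: "sf_at N p (\<lambda>q. g q (A Y (E a) q) (E a q))" if "a < n" for a by (rule sf_ip[OF AE[OF that] E[OF that]])
  \<comment> \<open>The trace of \<open>A Y\<close> vanishes at all points near \<open>p\<close>, so
    its derivative along \<open>X\<close> vanishes too. Hence the frame is taken orthonormal near
    \<open>p\<close>, and \<open>At\<close> is assumed at every point.\<close>
  have "lie_deriv N X (\<lambda>q. \<Sum>a<n. g q (A Y (E a) q) (E a q)) p = lie_deriv N X (\<lambda>q. 0) p"
  proof (rule lie_cong[where Y = X, OF p X sf_sum[OF p] _ refl])
    have "near N p (\<lambda>q. \<forall>a\<in>{..<n}. vf_at N q (E a))"
      by (intro eventually_ball_finite) (auto intro: vf_near E)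
    then show "near N p (\<lambda>q. (\<Sum>a<n. g q (A Y (E a) q) (E a q)) = 0)"
      using onb vf_near[OF Y] by eventually_elim (rule At, auto)
  qed (use sf in auto)
  then have "(\<Sum>a<n. lie_deriv N X (\<lambda>q. g q (A Y (E a) q) (E a q)) p) = 0"
    using lie_sum[OF p X, of "{..<n}" "\<lambda>a q. g q (A Y (E a) q) (E a q)"] sf lie_const[OF p X] by simp
  then have 1: "(\<Sum>a<n. g p (D X (A Y (E a)) p) (E a p)) + (\<Sum>a<n. g p (A Y (E a) p) (D X (E a) p)) = 0"
    by (simp add: Dm[OF X AE E] sum.distrib)
  let ?m = "\<lambda>a b. g p (D X (E a) p) (E b p)" and ?s = "\<lambda>a b. g p (A Y (E a) p) (E b p)"
  have m: "?m a b = - ?m b a" if a: "a < n" and b: "b < n" for a b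
  proof -
    have "lie_deriv N X (\<lambda>q. g q (E a q) (E b q)) p = lie_deriv N X (\<lambda>q. if a = b then 1 else 0) p"
      by (rule lie_cong[where Y = X, OF p X sf_ip[OF E[OF a] E[OF b]] _ refl])
        (use onb a b in \<open>auto simp: onb_def elim!: eventually_mono\<close>)
    then have "?m a b + g p (E a p) (D X (E b) p) = 0"
      using Dm[OF X E[OF a] E[OF b]] lie_const[OF p X] by simp
    then show ?thesis using g_sym[OF p vf_tspace[OF E[OF a]] vf_tspace[OF DE[OF b]]] by simp
  qed
  have s: "?s a b = ?s b a" if a: "a < n" and b: "b < n" for a b
    using As[OF Y E[OF a] E[OF b]] g_sym[OF p vf_tspace[OF E[OF a]] vf_tspace[OF AE[OF b]]] by simp
  have x: "g p (A Y (E a) p) (D X (E a) p) = (\<Sum>b<n. ?m a b * ?s a b)" if a: "a < n" for a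
  proof -
    have "g p (A Y (E a) p) (D X (E a) p) = g p (A Y (E a) p) (\<Sum>b<n. tscale (?m a b) (E b p))"
      using onb_expand[OF p o vf_tspace[OF DE[OF a]]] by simp
    also have "\<dots> = (\<Sum>b<n. g p (A Y (E a) p) (tscale (?m a b) (E b p)))"
      using E by (intro g_sum2[OF p vf_tspace[OF AE[OF a]]] tspace_scale) (auto intro: vf_tspace)
    also have "\<dots> = (\<Sum>b<n. ?m a b * ?s a b)"
      by (intro sum.cong refl g_scale2[OF p vf_tspace[OF AE[OF a]] vf_tspace[OF E]]) simp
    finally show ?thesis .
  qed
  let ?Q = "\<Sum>a<n. \<Sum>b<n. ?m a b * ?s a b"
  have "?Q = (\<Sum>b<n. \<Sum>a<n. ?m a b * ?s a b)" by (rule sum.swap)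
  also have "\<dots> = (\<Sum>b<n. \<Sum>a<n. - (?m b a * ?s b a))"
  proof (intro sum.cong refl)
    fix a b assume "b \<in> {..<n}" "a \<in> {..<n}"
    then show "?m a b * ?s a b = - (?m b a * ?s b a)" using m[of a b] s[of a b] by simp
  qed
  also have "\<dots> = - ?Q" by (simp add: sum_negf)
  finally have Q: "?Q = 0" by simp
  have 2: "(\<Sum>a<n. g p (A Y (E a) p) (D X (E a) p)) = 0" using Q by (simp add: x)
  have "g p (A Y (D X (E a)) p) (E a p) = g p (A Y (E a) p) (D X (E a) p)" if a: "a < n" for a
    using As[OF Y DE[OF a] E[OF a]] g_sym[OF p vf_tspace[OF DE[OF a]] vf_tspace[OF AE[OF a]]] by simp
  then show ?thesis using 1 2 by simp
qed

text \<open>The computation shared by Chern and Bismut. The curvature for two horizontal or for two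
  vertical arguments preserves the kind of a lift, while \<open>J\<^sub>1\<close> exchanges the
  kinds, so each term of the trace is zero. The mixed curvature exchanges the kinds and leaves the
  two traces assumed or shown to vanish.\<close>

lemma ricci_zero:
  assumes Cn: "connection TN nb"
    and hh: "\<And>\<xi> X Y. \<xi> \<in> pts TN \<Longrightarrow> vf_at N (foot \<xi>) X \<Longrightarrow> vf_at N (foot \<xi>) Y \<Longrightarrow> nb (hl X) (hl Y) \<xi> = hl (D X Y) \<xi>"
    and hv: "\<And>\<xi> X Y. \<xi> \<in> pts TN \<Longrightarrow> vf_at N (foot \<xi>) X \<Longrightarrow> vf_at N (foot \<xi>) Y \<Longrightarrow> nb (hl X) (vl Y) \<xi> = vl (D X Y) \<xi>"
    and vh: "\<And>\<xi> X Y. \<xi> \<in> pts TN \<Longrightarrow> vf_at N (foot \<xi>) X \<Longrightarrow> vf_at N (foot \<xi>) Y \<Longrightarrow> nb (vl X) (hl Y) \<xi> = vl (A X Y) \<xi>"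
    and vv: "\<And>\<xi> X Y. \<xi> \<in> pts TN \<Longrightarrow> vf_at N (foot \<xi>) X \<Longrightarrow> vf_at N (foot \<xi>) Y \<Longrightarrow> nb (vl X) (vl Y) \<xi> = - hl (A X Y) \<xi>"
    and Dvf: "\<And>p X Y. vf_at N p X \<Longrightarrow> vf_at N p Y \<Longrightarrow> vf_at N p (D X Y)"
    and Avf: "\<And>p X Y. vf_at N p X \<Longrightarrow> vf_at N p Y \<Longrightarrow> vf_at N p (A X Y)"
    and Dm: "\<And>p X Y Z. vf_at N p X \<Longrightarrow> vf_at N p Y \<Longrightarrow> vf_at N p Z \<Longrightarrow>
      lie_deriv N X (\<lambda>q. g q (Y q) (Z q)) p = g p (D X Y p) (Z p) + g p (Y p) (D X Z p)"
    and As: "\<And>p X Y Z. vf_at N p X \<Longrightarrow> vf_at N p Y \<Longrightarrow> vf_at N p Z \<Longrightarrow> g p (A X Y p) (Z p) = g p (Y p) (A X Z p)"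
    and At: "\<And>p X E. vf_at N p X \<Longrightarrow> (\<And>a. a < n \<Longrightarrow> vf_at N p (E a)) \<Longrightarrow> onb p (\<lambda>a. E a p) \<Longrightarrow>
      (\<Sum>a<n. g p (A X (E a) p) (E a p)) = 0"
  shows "ricci_form_zero TN J1 g1 nb"
  unfolding ricci_form_zero_def
proof (intro allI impI ballI)
  fix W P Q \<xi> assume W: "openin (mtop TN) W" and PQ: "P \<in> vfields TN W" "Q \<in> vfields TN W" and \<xi>W: "\<xi> \<in> W"
  have P: "vf_at TN \<xi> P" and Q: "vf_at TN \<xi> Q" using PQ W \<xi>W by (auto simp: vf_at_def)
  note \<xi> = T.vf_pts[OF P]
  let ?p = "foot \<xi>"
  note p = foot_pts[OF \<xi>]
  obtain E where E: "\<And>a. a < n \<Longrightarrow> vf_at N ?p (E a)" and onb: "near N ?p (\<lambda>q. onb q (\<lambda>a. E a q))"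
    by (rule frame_exists[OF p]) blast
  note o = near_point[OF p onb]
  note v = vf_hl[OF \<xi>] vf_vl[OF \<xi>]
  note t = T.vf_tspace[OF v(1)] T.vf_tspace[OF v(2)]
  have e: "near TN \<xi> (\<lambda>\<eta>. X \<eta> = X \<eta>)" for X :: "(('a, 'i) tpoint, 'i) vfield" by simp
  have n1: "near TN \<xi> (\<lambda>\<eta>. nb (hl X) (hl Y) \<eta> = hl (D X Y) \<eta>)" and n2: "near TN \<xi> (\<lambda>\<eta>. nb (hl X) (vl Y) \<eta> = vl (D X Y) \<eta>)"
    and n3: "near TN \<xi> (\<lambda>\<eta>. nb (vl X) (hl Y) \<eta> = vl (A X Y) \<eta>)" and n4: "near TN \<xi> (\<lambda>\<eta>. nb (vl X) (vl Y) \<eta> = - hl (A X Y) \<eta>)"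
    if X: "vf_at N ?p X" and Y: "vf_at N ?p Y" for X Y
  proof -
    note nn = near_foot_vf[OF \<xi> X] near_foot_vf[OF \<xi> Y]
    show "near TN \<xi> (\<lambda>\<eta>. nb (hl X) (hl Y) \<eta> = hl (D X Y) \<eta>)" using nn by eventually_elim (simp add: hh)
    show "near TN \<xi> (\<lambda>\<eta>. nb (hl X) (vl Y) \<eta> = vl (D X Y) \<eta>)" using nn by eventually_elim (simp add: hv)
    show "near TN \<xi> (\<lambda>\<eta>. nb (vl X) (hl Y) \<eta> = vl (A X Y) \<eta>)" using nn by eventually_elim (simp add: vh)
    show "near TN \<xi> (\<lambda>\<eta>. nb (vl X) (vl Y) \<eta> = - hl (A X Y) \<eta>)" using nn by eventually_elim (simp add: vv)
  qed
  have b1: "nb U (nb (hl X) (hl Y)) \<xi> = nb U (hl (D X Y)) \<xi>" and b2: "nb U (nb (hl X) (vl Y)) \<xi> = nb U (vl (D X Y)) \<xi>"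
    and b3: "nb U (nb (vl X) (hl Y)) \<xi> = nb U (vl (A X Y)) \<xi>" and b4: "nb U (nb (vl X) (vl Y)) \<xi> = - nb U (hl (A X Y)) \<xi>"
    if U: "vf_at TN \<xi> U" and X: "vf_at N ?p X" and Y: "vf_at N ?p Y" for U X Y
  proof -
    note cg = T.conn_cong[OF Cn U T.conn_vf[OF Cn] e]
    show "nb U (nb (hl X) (hl Y)) \<xi> = nb U (hl (D X Y)) \<xi>" by (rule cg[OF v(1)[OF X] v(1)[OF Y] n1[OF X Y]])
    show "nb U (nb (hl X) (vl Y)) \<xi> = nb U (vl (D X Y)) \<xi>" by (rule cg[OF v(1)[OF X] v(2)[OF Y] n2[OF X Y]])
    show "nb U (nb (vl X) (hl Y)) \<xi> = nb U (vl (A X Y)) \<xi>" by (rule cg[OF v(2)[OF X] v(1)[OF Y] n3[OF X Y]])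
    have "nb U (nb (vl X) (vl Y)) \<xi> = nb U (\<lambda>\<eta>. - hl (A X Y) \<eta>) \<xi>" by (rule cg[OF v(2)[OF X] v(2)[OF Y] n4[OF X Y]])
    then show "nb U (nb (vl X) (vl Y)) \<xi> = - nb U (hl (A X Y)) \<xi>" using T.conn_minus2[OF Cn U v(1)[OF Avf[OF X Y]]] by simp
  qed
  have br: "nb (bracket TN (hl X) (hl Y)) Z \<xi> = nb (hl (bracket N X Y)) Z \<xi>"
    "nb (bracket TN (hl X) (vl Y)) Z \<xi> = nb (vl (nab X Y)) Z \<xi>" "nb (bracket TN (vl X) (vl Y)) Z \<xi> = 0"
    if X: "vf_at N ?p X" and Y: "vf_at N ?p Y" and Z: "vf_at TN \<xi> Z" for X Y Z
  proof -
    show "nb (bracket TN (hl X) (hl Y)) Z \<xi> = nb (hl (bracket N X Y)) Z \<xi>"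
      by (rule T.conn_pt1[OF Cn T.vf_bracket[OF v(1)[OF X] v(1)[OF Y]] v(1)[OF vf_bracket[OF X Y]] Z bracket_hh[OF \<xi> X Y]])
    show "nb (bracket TN (hl X) (vl Y)) Z \<xi> = nb (vl (nab X Y)) Z \<xi>"
      by (rule T.conn_pt1[OF Cn T.vf_bracket[OF v(1)[OF X] v(2)[OF Y]] v(2)[OF conn_vf[OF C X Y]] Z bracket_hv[OF \<xi> X Y]])
    note z = T.vf_zero[OF \<xi>]
    have "nb (bracket TN (vl X) (vl Y)) Z \<xi> = nb (\<lambda>q. 0) Z \<xi>"
      by (rule T.conn_pt1[OF Cn T.vf_bracket[OF v(2)[OF X] v(2)[OF Y]] z Z]) (rule bracket_vv[OF \<xi> X Y])
    then show "nb (bracket TN (vl X) (vl Y)) Z \<xi> = 0" using T.conn_cscale1[OF Cn z Z, of 0] by simp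
  qed
  note gl = TH.g_add1[OF \<xi>] TH.g_diff1[OF \<xi>] TH.g_minus1[OF \<xi>] TH.g_zero1[OF \<xi>] g1_lifts[OF \<xi>] t tspace_add tspace_diff
    tspace_minus tspace_zero Dvf Avf vf_bracket conn_vf[OF C]
  \<comment> \<open>Kept with \<open>J1\<close> so that tensoriality in both curvature arguments
    follows summand by summand; \<open>RJ\<close> is the form used for evaluation.\<close>
  define R where "R U V = (\<Sum>a<n. g1 \<xi> (curvature TN nb U V (hl (E a)) \<xi>) (J1 \<xi> (hl (E a) \<xi>)))
      + (\<Sum>a<n. g1 \<xi> (curvature TN nb U V (vl (E a)) \<xi>) (J1 \<xi> (vl (E a) \<xi>)))" for U V
  have RJ: "R U V = (\<Sum>a<n. g1 \<xi> (curvature TN nb U V (hl (E a)) \<xi>) (vl (E a) \<xi>)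
      - g1 \<xi> (curvature TN nb U V (vl (E a)) \<xi>) (hl (E a) \<xi>))" if U: "vf_at TN \<xi> U" and V: "vf_at TN \<xi> V" for U V
    unfolding R_def sum.distrib[symmetric]
  proof (intro sum.cong refl)
    fix a assume "a \<in> {..<n}"
    then have a: "vf_at N ?p (E a)" by (simp add: E)
    show "g1 \<xi> (curvature TN nb U V (hl (E a)) \<xi>) (J1 \<xi> (hl (E a) \<xi>)) + g1 \<xi> (curvature TN nb U V (vl (E a)) \<xi>) (J1 \<xi> (vl (E a) \<xi>)) =
        g1 \<xi> (curvature TN nb U V (hl (E a)) \<xi>) (vl (E a) \<xi>) - g1 \<xi> (curvature TN nb U V (vl (E a)) \<xi>) (hl (E a) \<xi>)"
      using TH.g_minus2[OF \<xi> T.curvature_tspace[OF Cn U V v(2)[OF a]] t(1)[OF a]] by (simp add: J1_lifts vf_tspace[OF a])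
  qed
  have Rhh: "R (hl X) (hl Y) = 0" if X: "vf_at N ?p X" and Y: "vf_at N ?p Y" for X Y
    unfolding RJ[OF v(1)[OF X] v(1)[OF Y]] T.curvature_apply
    by (intro sum.neutral ballI) (simp add: br b1 b2 hh[OF \<xi>] hv[OF \<xi>] v X Y E gl)
  have Rvv: "R (vl X) (vl Y) = 0" if X: "vf_at N ?p X" and Y: "vf_at N ?p Y" for X Y
    unfolding RJ[OF v(2)[OF X] v(2)[OF Y]] T.curvature_apply
    by (intro sum.neutral ballI) (simp add: br b3 b4 vh[OF \<xi>] vv[OF \<xi>] v X Y E gl)
  have Rhv: "R (hl X) (vl Y) = 0" if X: "vf_at N ?p X" and Y: "vf_at N ?p Y" for X Y
  proof -
    \<comment> \<open>The horizontal and the vertical member of each frame pair contribute equally,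
      hence the factor 2. The first term comes from the bracket, the other two from the commutator
      of \<open>D X\<close> with \<open>A Y\<close>.\<close>
    have "R (hl X) (vl Y) = (\<Sum>a<n. 2 * (g ?p (A (nab X Y) (E a) ?p) (E a ?p)
        - g ?p (D X (A Y (E a)) ?p) (E a ?p) + g ?p (A Y (D X (E a)) ?p) (E a ?p)))"
      unfolding RJ[OF v(1)[OF X] v(2)[OF Y]] T.curvature_apply
      by (intro sum.cong refl) (simp add: br b1 b2 b3 b4 hh[OF \<xi>] hv[OF \<xi>] vh[OF \<xi>] vv[OF \<xi>] v X Y E gl)
    also have "\<dots> = 2 * ((\<Sum>a<n. g ?p (A (nab X Y) (E a) ?p) (E a ?p))
        - (\<Sum>a<n. g ?p (D X (A Y (E a)) ?p) (E a ?p)) + (\<Sum>a<n. g ?p (A Y (D X (E a)) ?p) (E a ?p)))"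
      by (simp add: sum_distrib_left[symmetric] sum.distrib sum_subtractf)
    also have "(\<Sum>a<n. g ?p (A (nab X Y) (E a) ?p) (E a ?p)) = 0" by (rule At[where E = E, OF conn_vf[OF C X Y] _ o]) (rule E)
    also have "(\<Sum>a<n. g ?p (D X (A Y (E a)) ?p) (E a ?p)) = (\<Sum>a<n. g ?p (A Y (D X (E a)) ?p) (E a ?p))"
      by (rule trace_commutator[where D = D and A = A and E = E, OF p X Y]) (fact Dvf Avf Dm As At E onb)+
    finally show ?thesis by simp
  qed
  have Rll: "R (lf s X) (lf s' Y) = 0" if X: "vf_at N ?p X" and Y: "vf_at N ?p Y" for s s' X Y
  proof -
    have "R (vl X) (hl Y) = - R (hl Y) (vl X)"
      unfolding RJ[OF v(2)[OF X] v(1)[OF Y]] RJ[OF v(1)[OF Y] v(2)[OF X]] sum_negf[symmetric]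
    proof (intro sum.cong refl)
      fix a assume "a \<in> {..<n}"
      then have a: "vf_at N ?p (E a)" by (simp add: E)
      note ct = T.curvature_tspace[OF Cn v(1)[OF Y] v(2)[OF X]]
      show "g1 \<xi> (curvature TN nb (vl X) (hl Y) (hl (E a)) \<xi>) (vl (E a) \<xi>) - g1 \<xi> (curvature TN nb (vl X) (hl Y) (vl (E a)) \<xi>) (hl (E a) \<xi>) =
        - (g1 \<xi> (curvature TN nb (hl Y) (vl X) (hl (E a)) \<xi>) (vl (E a) \<xi>) - g1 \<xi> (curvature TN nb (hl Y) (vl X) (vl (E a)) \<xi>) (hl (E a) \<xi>))"
        unfolding T.curvature_antisym[OF Cn v(2)[OF X] v(1)[OF Y] v(1)[OF a]] T.curvature_antisym[OF Cn v(2)[OF X] v(1)[OF Y] v(2)[OF a]]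
        by (simp add: TH.g_minus1[OF \<xi> ct[OF v(1)[OF a]] t(2)[OF a]] TH.g_minus1[OF \<xi> ct[OF v(2)[OF a]] t(1)[OF a]])
    qed
    then show ?thesis
      using Rhh[OF X Y] Rhv[OF X Y] Rhv[OF Y X] Rvv[OF X Y] by (cases s; cases s') (simp_all add: lf_def)
  qed
  have JE: "J1 \<xi> (hl (E a) \<xi>) \<in> tspace TN \<xi>" "J1 \<xi> (vl (E a) \<xi>) \<in> tspace TN \<xi>" if "a < n" for a
    using TJ.J_tspace[OF \<xi> t(1)[OF E[OF that]]] TJ.J_tspace[OF \<xi> t(2)[OF E[OF that]]] by auto
  have R1: "tensorial TN \<xi> (\<lambda>U. R U V)" if V: "vf_at TN \<xi> V" for V
    unfolding R_def
  proof (intro T.tensorial_add T.tensorial_sum)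
    fix a assume "a \<in> {..<n}"
    then have a: "a < n" by simp
    show "tensorial TN \<xi> (\<lambda>U. g1 \<xi> (curvature TN nb U V (hl (E a)) \<xi>) (J1 \<xi> (hl (E a) \<xi>)))"
      by (rule TH.tensorial_ip_left[OF \<xi> JE(1)[OF a] T.curvature_tspace[OF Cn _ V v(1)[OF E[OF a]]] T.curvature_tensorial1[OF Cn V v(1)[OF E[OF a]]]])
    show "tensorial TN \<xi> (\<lambda>U. g1 \<xi> (curvature TN nb U V (vl (E a)) \<xi>) (J1 \<xi> (vl (E a) \<xi>)))"
      by (rule TH.tensorial_ip_left[OF \<xi> JE(2)[OF a] T.curvature_tspace[OF Cn _ V v(2)[OF E[OF a]]] T.curvature_tensorial1[OF Cn V v(2)[OF E[OF a]]]])
  qed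
  have R2: "tensorial TN \<xi> (\<lambda>V. R U V)" if U: "vf_at TN \<xi> U" for U
    unfolding R_def
  proof (intro T.tensorial_add T.tensorial_sum)
    fix a assume "a \<in> {..<n}"
    then have a: "a < n" by simp
    show "tensorial TN \<xi> (\<lambda>V. g1 \<xi> (curvature TN nb U V (hl (E a)) \<xi>) (J1 \<xi> (hl (E a) \<xi>)))"
      by (rule TH.tensorial_ip_left[OF \<xi> JE(1)[OF a] T.curvature_tspace[OF Cn U _ v(1)[OF E[OF a]]] T.curvature_tensorial2[OF Cn U v(1)[OF E[OF a]]]])
    show "tensorial TN \<xi> (\<lambda>V. g1 \<xi> (curvature TN nb U V (vl (E a)) \<xi>) (J1 \<xi> (vl (E a) \<xi>)))"
      by (rule TH.tensorial_ip_left[OF \<xi> JE(2)[OF a] T.curvature_tspace[OF Cn U _ v(2)[OF E[OF a]]] T.curvature_tensorial2[OF Cn U v(2)[OF E[OF a]]]])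
  qed
  have "R (lf s X) Q = 0" if X: "vf_at N ?p X" for s X
    by (rule tensorial_lifts[OF R2[OF vf_lf[OF \<xi> X]] Q]) (rule Rll[OF X])
  then have "R P Q = 0" by (rule tensorial_lifts[OF R1[OF Q] P])
  moreover have "(\<Sum>a<dim TN. g1 \<xi> (curvature TN nb P Q (frame_at TN g1 \<xi> a) \<xi>) (J1 \<xi> (frame_at TN g1 \<xi> a \<xi>))) = R P Q"
    unfolding R_def
  proof (rule trace_lift[OF \<xi> _ _ E o, where B = "\<lambda>Z V. g1 \<xi> (curvature TN nb P Q Z \<xi>) (J1 \<xi> (V \<xi>))"])
    fix V assume V: "vf_at TN \<xi> V"
    show "tensorial TN \<xi> (\<lambda>Z. g1 \<xi> (curvature TN nb P Q Z \<xi>) (J1 \<xi> (V \<xi>)))"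
      by (rule TH.tensorial_ip_left[OF \<xi> TJ.J_tspace[OF \<xi> T.vf_tspace[OF V]] T.curvature_tspace[OF Cn P Q] T.curvature_tensorial3[OF Cn P Q]])
    show "tensorial TN \<xi> (\<lambda>Z. g1 \<xi> (curvature TN nb P Q V \<xi>) (J1 \<xi> (Z \<xi>)))"
      using TJ.tensorial_app[OF TH.tensorial_ip_right[OF \<xi> T.curvature_tspace[OF Cn P Q V]]] by simp
  qed
  ultimately show "ricci_form TN J1 g1 nb P Q \<xi> = 0" by (simp add: ricci_form_def)
qed

text \<open>A component of the differential with one vertical argument says that \<gamma> Z is
  self-adjoint. Conversely, self-adjointness makes \<open>c3\<close> totally symmetric, and all
  components in \<open>ed_lifts\<close> vanish.\<close>

lemma kaehler_iff: "kaehler TN J1 g1 \<longleftrightarrow> tensor_eq N gm gs"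
proof
  assume K: "kaehler TN J1 g1"
  show "tensor_eq N gm gs"
    unfolding tensor_eq_iff
  proof (intro allI impI)
    fix p Z X assume Z: "vf_at N p Z" and X: "vf_at N p X"
    note p = vf_pts[OF Z]
    \<comment> \<open>The components on lifts depend only on the foot, so one point over
      \<open>p\<close> suffices; the zero vector is always available.\<close>
    let ?\<xi> = "Tan p 0"
    have \<xi>: "?\<xi> \<in> pts TN" using p by (simp add: pts_TN tspace_zero)
    have e0: "ed P Q R ?\<xi> = 0" if "vf_at TN ?\<xi> P" "vf_at TN ?\<xi> Q" "vf_at TN ?\<xi> R" for P Q R
    proof -
      have "near TN ?\<xi> (\<lambda>q. vf_at TN q P \<and> vf_at TN q Q \<and> vf_at TN q R)" by (intro eventually_conj T.vf_near that)
      then obtain W where W: "openin (mtop TN) W" "?\<xi> \<in> W" "\<forall>q\<in>W. vf_at TN q P \<and> vf_at TN q Q \<and> vf_at TN q R"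
        using \<xi> by (rule T.vf_common_open)
      then have v: "P \<in> vfields TN W" "Q \<in> vfields TN W" "R \<in> vfields TN W" by (auto simp: T.vfields_iff)
      from K[unfolded kaehler_def, rule_format, OF W(1) v W(2)] show ?thesis .
    qed
    show "gm Z X p = gs Z X p"
    proof (rule g_nondeg_vf[OF p gm_tspace[OF Z X] gs_tspace[OF Z X]])
      fix Y assume Y: "vf_at N p Y"
      have f: "foot ?\<xi> = p" by simp
      have "c3 X Z Y p = c3 Y Z X p"
        using ed_lifts(2)[OF \<xi>, unfolded f, OF X Y Z] e0[OF vf_hl[OF \<xi>] vf_hl[OF \<xi>] vf_vl[OF \<xi>], unfolded f, OF X Y Z] by simp
      then show "g p (gm Z X p) (Y p) = g p (gs Z X p) (Y p)"
        using gs_ip[OF Z X Y] c3_sym[OF X Z, of Y] c3_sym[OF Y Z, of X] by (simp add: c3_def)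
    qed
  qed
next
  assume "tensor_eq N gm gs"
  then have eq: "gm X Y p = gs X Y p" if "vf_at N p X" "vf_at N p Y" for p X Y using that unfolding tensor_eq_iff by blast
  have c: "c3 X Y Z p = c3 X Z Y p" if X: "vf_at N p X" and Y: "vf_at N p Y" and Z: "vf_at N p Z" for p X Y Z
    using gs_ip[OF X Y Z] eq[OF X Y] by (simp add: c3_def)
  show "kaehler TN J1 g1"
    unfolding kaehler_def
  proof (intro allI impI ballI)
    fix W P Q R \<xi> assume W: "openin (mtop TN) W" and v: "P \<in> vfields TN W" "Q \<in> vfields TN W" "R \<in> vfields TN W" and "\<xi> \<in> W"
    then have P: "vf_at TN \<xi> P" and Q: "vf_at TN \<xi> Q" and R: "vf_at TN \<xi> R" by (auto simp: vf_at_def)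
    note \<xi> = T.vf_pts[OF P] and l = vf_lf[OF T.vf_pts[OF P]]
    have 3: "ed (lf s X) (lf s' Y) (lf s'' Z) \<xi> = 0"
      if X: "vf_at N (foot \<xi>) X" and Y: "vf_at N (foot \<xi>) Y" and Z: "vf_at N (foot \<xi>) Z" for s s' s'' X Y Z
      using c[OF X Y Z] c[OF Y X Z] c[OF Z X Y] c3_sym[OF X Y, of Z] c3_sym[OF X Z, of Y] c3_sym[OF Y Z, of X] ed_lifts[OF \<xi> X Y Z]
      by (cases s; cases s'; cases s'') (simp_all add: lf_def)
    have 2: "ed (lf s X) (lf s' Y) R \<xi> = 0" if X: "vf_at N (foot \<xi>) X" and Y: "vf_at N (foot \<xi>) Y" for s s' X Y
      by (rule tensorial_lifts[OF TH.ext_deriv_tensorial(3)[OF l[OF X] l[OF Y]] R]) (rule 3[OF X Y])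
    have 1: "ed (lf s X) Q R \<xi> = 0" if X: "vf_at N (foot \<xi>) X" for s X
      by (rule tensorial_lifts[OF TH.ext_deriv_tensorial(2)[OF l[OF X] R] Q]) (rule 2[OF X])
    show "ed P Q R \<xi> = 0"
      by (rule tensorial_lifts[OF TH.ext_deriv_tensorial(1)[OF Q R] P]) (rule 1)
  qed
qed

text \<open>The horizontal component reproduces \<gamma>, which keeps the tensor nonzero. Passing to
  two vertical arguments introduces a minus sign, and this breaks self-adjointness.\<close>

lemma gam1_lifts:
  assumes \<xi>: "\<xi> \<in> pts TN" and X: "vf_at N (foot \<xi>) X" and Y: "vf_at N (foot \<xi>) Y"
  shows "gam TN L g1 (hl X) (hl Y) \<xi> = hl (gm X Y) \<xi>" "gam TN L g1 (hl X) (vl Y) \<xi> = vl (SS X Y) \<xi>"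
    "gam TN L g1 (vl X) (hl Y) \<xi> = vl (SS Y X) \<xi>" "gam TN L g1 (vl X) (vl Y) \<xi> = - hl (gs2 X Y) \<xi>"
  by (simp_all add: gam_def[of TN] D1_lifts[OF \<xi> X Y] L_lifts[OF \<xi> X Y] lift_field_pt gm_apply hlift_diff nS_def vlift_add)

lemma aff_TN: "aff TN L g1"
proof -
  interpret A: atlas TN by (rule T.atlas_axioms)
  show ?thesis
    by unfold_locales (rule L_conn riemannian_g1 smooth_manifold_TN[OF smooth_manifold] flat_L torsion_free_L)+
qed

text \<open>Suppose the new tensor is self-adjoint. The purely horizontal components make
  \<open>c3\<close> totally symmetric. Comparing the vertical-vertical-horizontal component with its
  transpose then gives \<open>- c3 = c3\<close> for the chosen arguments.\<close>

lemma gam1_nonzero: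
  assumes nz: "\<not> tensor_eq N gm (\<lambda>X Y p. 0)"
  shows "\<not> tensor_eq TN (gam TN L g1) (\<lambda>X Y p. 0)" "\<not> tensor_eq TN (gam TN L g1) (gam_star TN L g1)"
proof -
  interpret A1: aff TN L g1 by (rule aff_TN)
  obtain p X Y where X: "vf_at N p X" and Y: "vf_at N p Y" and ne: "gm X Y p \<noteq> 0"
    using nz unfolding tensor_eq_iff by blast
  note p = vf_pts[OF X]
  \<comment> \<open>The third argument \<open>gm X Y\<close> makes \<open>c3\<close> the squared
    length of \<open>gm X Y\<close>, which is positive.\<close>
  let ?\<xi> = "Tan p 0" and ?Z = "gm X Y"
  have \<xi>: "?\<xi> \<in> pts TN" using p by (simp add: pts_TN tspace_zero)
  have f: "foot ?\<xi> = p" by simp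
  have Z: "vf_at N p ?Z" by (rule gm_vf[OF X Y])
  have c: "c3 X Y ?Z p > 0" unfolding c3_def using g_pos[OF p gm_tspace[OF X Y] gm_tspace[OF X Y] ne] .
  note v = vf_hl[OF \<xi>, unfolded f] vf_vl[OF \<xi>, unfolded f]
  note G = gam1_lifts[OF \<xi>, unfolded f]
  note g1l = g1_lifts[OF \<xi>, unfolded f]
  have hhh: "g1 ?\<xi> (gam TN L g1 (hl U) (hl V) ?\<xi>) (hl W ?\<xi>) = c3 U V W p"
    if "vf_at N p U" "vf_at N p V" "vf_at N p W" for U V W
    using that by (simp add: G g1l gm_vf c3_def)
  show "\<not> tensor_eq TN (gam TN L g1) (\<lambda>X Y p. 0)"
  proof
    assume "tensor_eq TN (gam TN L g1) (\<lambda>X Y p. 0)"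
    then have "gam TN L g1 (hl X) (hl Y) ?\<xi> = 0" using v(1)[OF X] v(1)[OF Y] unfolding T.tensor_eq_iff by blast
    then show False using hhh[OF X Y Z] c TH.g_zero1[OF \<xi> T.vf_tspace[OF v(1)[OF Z]] T.vf_tspace[OF v(1)[OF Z]]] by simp
  qed
  show "\<not> tensor_eq TN (gam TN L g1) (gam_star TN L g1)"
  proof
    assume "tensor_eq TN (gam TN L g1) (gam_star TN L g1)"
    then have sy: "g1 ?\<xi> (gam TN L g1 P Q ?\<xi>) (R ?\<xi>) = g1 ?\<xi> (gam TN L g1 P R ?\<xi>) (Q ?\<xi>)"
      if "vf_at TN ?\<xi> P" "vf_at TN ?\<xi> Q" "vf_at TN ?\<xi> R" for P Q R
      using A1.gs_ip[OF that] that unfolding T.tensor_eq_iff A1.c3_def by simp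
    have sym: "c3 U V W p = c3 U W V p" if U: "vf_at N p U" and V: "vf_at N p V" and W: "vf_at N p W" for U V W
      using sy[OF v(1)[OF U] v(1)[OF V] v(1)[OF W]] hhh[OF U V W] hhh[OF U W V] by simp
    \<comment> \<open>The left-hand side comes from \<open>gs2\<close> for two vertical lifts, the
      right-hand side from \<open>SS\<close> for a vertical and a horizontal one.\<close>
    have "- ((c3 X ?Z Y p + c3 Y ?Z X p) / 2) = (c3 ?Z X Y p + c3 ?Z Y X p) / 2"
      using sy[OF v(2)[OF X] v(2)[OF Y] v(1)[OF Z]] SS_ip(2)[OF X Y Z] SS_ip(1)[OF Z X Y]
      by (simp add: G X Y Z g1l SS_vf gs2_vf g1_minus[OF \<xi>, unfolded f] T.vf_tspace v)
    then have "c3 X Y ?Z p = 0"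
      using sym[OF X Y Z] sym[OF Y X Z] c3_sym[OF X Y, of ?Z] c3_sym[OF Z X, of Y] c3_sym[OF Z Y, of X] by (simp add: field_simps)
    then show False using c by simp
  qed
qed

end

section \<open>Consequences of the vanishing traces\<close>

locale aff_balanced = aff +
  assumes trace_gm: "p \<in> pts N \<Longrightarrow> metric_trace N g (gam N nab g) p = 0"
    and trace_gs: "p \<in> pts N \<Longrightarrow> metric_trace N g (gam_star N nab g) p = 0"
begin

text \<open>Transfers the hypothesis from the chosen frame to any frame orthonormal at
  \<open>p\<close>, tested against \<open>Z\<close>. The first trace is that of \<gamma>, the second
  that of \<gamma>*, and the third equals the second by symmetry.\<close>

lemma trace_c3:
  assumes Z: "vf_at N p Z" and E: "\<And>a. a < n \<Longrightarrow> vf_at N p (E a)" and o: "onb p (\<lambda>a. E a p)"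
  shows "(\<Sum>a<n. c3 (E a) (E a) Z p) = 0" "(\<Sum>a<n. c3 (E a) Z (E a) p) = 0" "(\<Sum>a<n. c3 Z (E a) (E a) p) = 0"
proof -
  note p = vf_pts[OF Z]
  note F = vf_frame_at[OF p] and oF = onb_frame_at[OF p]
  let ?F = "frame_at N g p"
  have "(\<Sum>a<n. c3 (E a) (E a) Z p) = (\<Sum>a<n. c3 (?F a) (?F a) Z p)"
    using c3_tensorial[OF _ Z]
    by (intro trace_frame_indep[where B = "\<lambda>X Y. c3 X Y Z p", OF p _ _ E o F oF]) auto
  also have "\<dots> = g p (\<Sum>a<n. gm (?F a) (?F a) p) (Z p)"
    unfolding c3_def by (intro g_sum1[OF p vf_tspace[OF Z], symmetric] gm_tspace F) auto
  also have "\<dots> = 0" using trace_gm[OF p] g_zero1[OF p vf_tspace[OF Z] vf_tspace[OF Z]] by (simp add: metric_trace_def)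
  finally show "(\<Sum>a<n. c3 (E a) (E a) Z p) = 0" .
  have "(\<Sum>a<n. c3 (E a) Z (E a) p) = (\<Sum>a<n. c3 (?F a) Z (?F a) p)"
    using c3_tensorial(1)[OF Z] c3_tensorial(3)[OF _ Z]
    by (intro trace_frame_indep[where B = "\<lambda>X Y. c3 X Z Y p", OF p _ _ E o F oF]) auto
  also have "\<dots> = (\<Sum>a<n. g p (gs (?F a) (?F a) p) (Z p))" by (intro sum.cong refl gs_ip[symmetric] F Z) auto
  also have "\<dots> = g p (\<Sum>a<n. gs (?F a) (?F a) p) (Z p)"
    by (intro g_sum1[OF p vf_tspace[OF Z], symmetric] gs_tspace F) auto
  also have "\<dots> = 0" using trace_gs[OF p] g_zero1[OF p vf_tspace[OF Z] vf_tspace[OF Z]] by (simp add: metric_trace_def)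
  finally show *: "(\<Sum>a<n. c3 (E a) Z (E a) p) = 0" .
  have "(\<Sum>a<n. c3 Z (E a) (E a) p) = (\<Sum>a<n. c3 (E a) Z (E a) p)" by (intro sum.cong refl c3_sym Z E) auto
  with * show "(\<Sum>a<n. c3 Z (E a) (E a) p) = 0" by simp
qed

text \<open>The two signs in the Lee form cancel, leaving the divergence of the fundamental form,
  which is a trace of \<open>DJ\<close>.\<close>

lemma balanced_TN: "balanced TN J1 g1"
  unfolding balanced_def
proof (intro allI impI ballI)
  fix W P \<xi> assume "openin (mtop TN) W" "P \<in> vfields TN W" "\<xi> \<in> W"
  then have P: "vf_at TN \<xi> P" by (auto simp: vf_at_def)
  note \<xi> = T.vf_pts[OF P] and JP = vf_J1[OF P]
  note p = foot_pts[OF \<xi>]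
  note E = vf_frame_at[OF p] and o = onb_frame_at[OF p]
  let ?E = "frame_at N g (foot \<xi>)" and ?F = "frame_at TN g1 \<xi>"
  have "lee_form TN J1 g1 P \<xi> = (\<Sum>a<dim TN. g1 \<xi> (TJ.DJ D1 (?F a) (?F a) \<xi>) (app J1 P \<xi>))"
    unfolding lee_form_def codiff_fund_def minus_minus
    by (intro sum.cong refl TH.cov_deriv_fund_form TH.vf_frame_at[OF \<xi>] JP) auto
  also have "\<dots> = (\<Sum>a<n. g1 \<xi> (TJ.DJ D1 (hl (?E a)) (hl (?E a)) \<xi>) (app J1 P \<xi>))
      + (\<Sum>a<n. g1 \<xi> (TJ.DJ D1 (vl (?E a)) (vl (?E a)) \<xi>) (app J1 P \<xi>))"
    using TH.T3_tensorial1[OF _ JP] TH.T3_tensorial2[OF _ JP]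
    by (intro trace_lift[where B = "\<lambda>X Y. g1 \<xi> (TJ.DJ D1 X Y \<xi>) (app J1 P \<xi>)", OF \<xi> _ _ E o]) auto
  \<comment> \<open>Both lifts of a frame vector contribute the vertical lift of
    \<open>- dl\<close>, which explains the factor -2.\<close>
  also have "\<dots> = (\<Sum>a<n. (-2) * g1 \<xi> (vl (dl (?E a) (?E a)) \<xi>) (app J1 P \<xi>))"
    unfolding sum.distrib[symmetric]
  proof (intro sum.cong refl)
    fix a assume "a \<in> {..<n}"
    then have a: "vf_at N (foot \<xi>) (?E a)" by (simp add: E)
    show "g1 \<xi> (TJ.DJ D1 (hl (?E a)) (hl (?E a)) \<xi>) (app J1 P \<xi>) + g1 \<xi> (TJ.DJ D1 (vl (?E a)) (vl (?E a)) \<xi>) (app J1 P \<xi>)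
        = (-2) * g1 \<xi> (vl (dl (?E a) (?E a)) \<xi>) (app J1 P \<xi>)"
      unfolding DJ1_lifts[OF \<xi> a a] g1_minus(2)[OF \<xi> dl_vf[OF a a] T.vf_tspace[OF JP]] by simp
  qed
  also have "\<dots> = 0"
  proof (rule tensorial_lifts[where F = "\<lambda>Q. \<Sum>a<n. (-2) * g1 \<xi> (vl (dl (?E a) (?E a)) \<xi>) (Q \<xi>)", OF _ JP])
    show "tensorial TN \<xi> (\<lambda>Q. \<Sum>a<n. (-2) * g1 \<xi> (vl (dl (?E a) (?E a)) \<xi>) (Q \<xi>))"
    proof (intro T.tensorial_sum T.tensorial_cmult)
      fix a assume "a \<in> {..<n}"
      then have a: "vf_at N (foot \<xi>) (?E a)" by (simp add: E)
      show "tensorial TN \<xi> (\<lambda>Q. g1 \<xi> (vl (dl (?E a) (?E a)) \<xi>) (Q \<xi>))"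
        by (rule TH.tensorial_ip_right[OF \<xi> T.vf_tspace[OF vf_vl[OF \<xi> dl_vf[OF a a]]]])
    qed
    fix s Z assume Z: "vf_at N (foot \<xi>) Z"
    have "(\<Sum>a<n. (-2) * g1 \<xi> (vl (dl (?E a) (?E a)) \<xi>) (vl Z \<xi>)) = (\<Sum>a<n. c3 (?E a) Z (?E a) (foot \<xi>) - c3 (?E a) (?E a) Z (foot \<xi>))"
      by (intro sum.cong refl) (simp add: g1_lifts[OF \<xi>] dl_vf E Z dl_ip field_simps)
    also have "\<dots> = 0" using trace_c3[OF Z E o] by (simp add: sum_subtractf)
    finally show "(\<Sum>a<n. (-2) * g1 \<xi> (vl (dl (?E a) (?E a)) \<xi>) (lf s Z \<xi>)) = 0"
      by (cases s) (simp_all add: lf_def g1_lifts[OF \<xi>] dl_vf E Z)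
  qed
  finally show "lee_form TN J1 g1 P \<xi> = 0" .
qed

text \<open>The diagonal entries of the self-adjoint part are those of \<gamma> X itself, so the
  trace of \<open>A\<close> is the trace of \<gamma>* paired with \<open>X\<close>.\<close>

lemma ricci_chern: "ricci_form_zero TN J1 g1 (chern TN J1 g1)"
proof (rule ricci_zero[where D = nS and A = SS, OF TH.chern_conn chern_lifts nS_vf SS_vf])
  fix p X Y Z assume X: "vf_at N p X" and Y: "vf_at N p Y" and Z: "vf_at N p Z"
  show "lie_deriv N X (\<lambda>q. g q (Y q) (Z q)) p = g p (nS X Y p) (Z p) + g p (Y p) (nS X Z p)"
    using lie_g_c3[OF X Y Z] nS_ip[OF X Y Z] nS_ip[OF X Z Y] g_sym[OF vf_pts[OF X] vf_tspace[OF Y] vf_tspace[OF nS_vf[OF X Z]]]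
    by (simp add: field_simps)
  show "g p (SS X Y p) (Z p) = g p (Y p) (SS X Z p)"
    using SS_ip(1)[OF X Y Z] SS_ip(1)[OF X Z Y] g_sym[OF vf_pts[OF X] vf_tspace[OF Y] vf_tspace[OF SS_vf[OF X Z]]] by simp
next
  fix p X E assume X: "vf_at N p X" and E: "\<And>a. a < n \<Longrightarrow> vf_at N p (E a)" and o: "onb p (\<lambda>a. E a p)"
  have "(\<Sum>a<n. g p (SS X (E a) p) (E a p)) = (\<Sum>a<n. c3 X (E a) (E a) p)"
    by (intro sum.cong refl) (simp add: SS_ip(1)[OF X E E])
  then show "(\<Sum>a<n. g p (SS X (E a) p) (E a p)) = 0" using trace_c3(3)[OF X E o] by simp
qed

text \<open>Here \<open>A\<close> is self-adjoint because \<gamma> is symmetric, and its trace is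
  the trace of \<gamma> paired with \<open>X\<close>.\<close>

lemma ricci_bismut: "ricci_form_zero TN J1 g1 (bismut TN J1 g1)"
proof (rule ricci_zero[where D = LC and A = "\<lambda>X Y. gs Y X", OF TH.bismut_conn bismut_lifts LC_vf gs_vf])
  fix p X Y Z assume X: "vf_at N p X" and Y: "vf_at N p Y" and Z: "vf_at N p Z"
  show "lie_deriv N X (\<lambda>q. g q (Y q) (Z q)) p = g p (LC X Y p) (Z p) + g p (Y p) (LC X Z p)"
    by (rule LC_metric[OF X Y Z])
  show "g p (gs Y X p) (Z p) = g p (Y p) (gs Z X p)"
    using gs_ip[OF Y X Z] gs_ip[OF Z X Y] c3_sym[OF Y Z, of X] g_sym[OF vf_pts[OF X] vf_tspace[OF Y] gs_tspace[OF Z X]] by simp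
next
  fix p X E assume X: "vf_at N p X" and E: "\<And>a. a < n \<Longrightarrow> vf_at N p (E a)" and o: "onb p (\<lambda>a. E a p)"
  have "(\<Sum>a<n. g p (gs (E a) X p) (E a p)) = (\<Sum>a<n. c3 (E a) (E a) X p)"
    by (intro sum.cong refl) (simp add: gs_ip[OF E X E])
  then show "(\<Sum>a<n. g p (gs (E a) X p) (E a p)) = 0" using trace_c3(1)[OF X E o] by simp
qed

text \<open>Against a horizontal lift the trace of the new tensor is the trace of \<gamma> minus
  that of \<gamma>*, and the trace of its adjoint is twice that of \<gamma>*. Against a vertical
  lift every term pairs lifts of different kinds.\<close>

lemma infinitely_balanced_TN: "infinitely_balanced TN L g1"
  unfolding infinitely_balanced_def
proof (intro conjI ballI)
  show "affine_riemann TN L g1" by (rule affine_riemann_TN)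
  interpret A1: aff TN L g1 by (rule aff_TN)
  fix \<xi> assume \<xi>: "\<xi> \<in> pts TN"
  note p = foot_pts[OF \<xi>]
  note E = vf_frame_at[OF p] and o = onb_frame_at[OF p]
  let ?E = "frame_at N g (foot \<xi>)" and ?F = "frame_at TN g1 \<xi>"
  note F = TH.vf_frame_at[OF \<xi>]
  let ?c = "A1.c3"
  note v = vf_hl[OF \<xi>] vf_vl[OF \<xi>]
  note r = A1.c3_def gam1_lifts[OF \<xi>] g1_lifts[OF \<xi>] g1_minus[OF \<xi>] gm_vf SS_vf gs2_vf E T.vf_tspace v
  have tr: "(\<Sum>a<dim TN. ?c (?F a) (?F a) Z \<xi>) = (\<Sum>a<n. ?c (hl (?E a)) (hl (?E a)) Z \<xi>) + (\<Sum>a<n. ?c (vl (?E a)) (vl (?E a)) Z \<xi>)"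
    "(\<Sum>a<dim TN. ?c (?F a) Z (?F a) \<xi>) = (\<Sum>a<n. ?c (hl (?E a)) Z (hl (?E a)) \<xi>) + (\<Sum>a<n. ?c (vl (?E a)) Z (vl (?E a)) \<xi>)"
    if Z: "vf_at TN \<xi> Z" for Z
  proof -
    show "(\<Sum>a<dim TN. ?c (?F a) (?F a) Z \<xi>) = (\<Sum>a<n. ?c (hl (?E a)) (hl (?E a)) Z \<xi>) + (\<Sum>a<n. ?c (vl (?E a)) (vl (?E a)) Z \<xi>)"
      using A1.c3_tensorial[OF _ Z] by (intro trace_lift[where B = "\<lambda>X Y. ?c X Y Z \<xi>", OF \<xi> _ _ E o]) auto
    show "(\<Sum>a<dim TN. ?c (?F a) Z (?F a) \<xi>) = (\<Sum>a<n. ?c (hl (?E a)) Z (hl (?E a)) \<xi>) + (\<Sum>a<n. ?c (vl (?E a)) Z (vl (?E a)) \<xi>)"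
      using A1.c3_tensorial(1)[OF Z] A1.c3_tensorial(3)[OF _ Z] by (intro trace_lift[where B = "\<lambda>X Y. ?c X Z Y \<xi>", OF \<xi> _ _ E o]) auto
  qed
  have z: "(\<Sum>a<dim TN. ?c (?F a) (?F a) (hl Z) \<xi>) = 0" "(\<Sum>a<dim TN. ?c (?F a) (?F a) (vl Z) \<xi>) = 0"
    "(\<Sum>a<dim TN. ?c (?F a) (hl Z) (?F a) \<xi>) = 0" "(\<Sum>a<dim TN. ?c (?F a) (vl Z) (?F a) \<xi>) = 0"
    if Z: "vf_at N (foot \<xi>) Z" for Z
  proof -
    note t0 = trace_c3[OF Z E o]
    have "(\<Sum>a<n. ?c (hl (?E a)) (hl (?E a)) (hl Z) \<xi>) = (\<Sum>a<n. c3 (?E a) (?E a) Z (foot \<xi>))"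
      by (intro sum.cong refl) (simp add: r Z c3_def)
    moreover have "(\<Sum>a<n. ?c (vl (?E a)) (vl (?E a)) (hl Z) \<xi>) = - (\<Sum>a<n. c3 (?E a) Z (?E a) (foot \<xi>))"
      unfolding sum_negf[symmetric] by (intro sum.cong refl) (simp add: r Z SS_ip(2))
    ultimately show "(\<Sum>a<dim TN. ?c (?F a) (?F a) (hl Z) \<xi>) = 0" unfolding tr(1)[OF v(1)[OF Z]] using t0 by simp
    have "(\<Sum>a<n. ?c (hl (?E a)) (hl (?E a)) (vl Z) \<xi>) = 0" "(\<Sum>a<n. ?c (vl (?E a)) (vl (?E a)) (vl Z) \<xi>) = 0"
      by (intro sum.neutral ballI; simp add: r Z)+
    then show "(\<Sum>a<dim TN. ?c (?F a) (?F a) (vl Z) \<xi>) = 0" unfolding tr(1)[OF v(2)[OF Z]] by simp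
    have "(\<Sum>a<n. ?c (hl (?E a)) (hl Z) (hl (?E a)) \<xi>) = (\<Sum>a<n. c3 (?E a) Z (?E a) (foot \<xi>))"
      by (intro sum.cong refl) (simp add: r Z c3_def)
    moreover have "(\<Sum>a<n. ?c (vl (?E a)) (hl Z) (vl (?E a)) \<xi>) = (\<Sum>a<n. c3 Z (?E a) (?E a) (foot \<xi>))"
      by (intro sum.cong refl) (simp add: r Z SS_ip(1))
    ultimately show "(\<Sum>a<dim TN. ?c (?F a) (hl Z) (?F a) \<xi>) = 0" unfolding tr(2)[OF v(1)[OF Z]] using t0 by simp
    have "(\<Sum>a<n. ?c (hl (?E a)) (vl Z) (hl (?E a)) \<xi>) = 0" "(\<Sum>a<n. ?c (vl (?E a)) (vl Z) (vl (?E a)) \<xi>) = 0"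
      by (intro sum.neutral ballI; simp add: r Z)+
    then show "(\<Sum>a<dim TN. ?c (?F a) (vl Z) (?F a) \<xi>) = 0" unfolding tr(2)[OF v(2)[OF Z]] by simp
  qed
  \<comment> \<open>A trace vector vanishes once its inner products with all lifts do.\<close>
  have mt: "metric_trace TN g1 \<beta> \<xi> = 0"
    if b: "\<And>a. a < dim TN \<Longrightarrow> \<beta> (?F a) (?F a) \<xi> \<in> tspace TN \<xi>"
      and s: "\<And>t Z. vf_at N (foot \<xi>) Z \<Longrightarrow> (\<Sum>a<dim TN. g1 \<xi> (\<beta> (?F a) (?F a) \<xi>) (lf t Z \<xi>)) = 0" for \<beta>
  proof (rule g1_eqI[OF \<xi> _ tspace_zero])
    have "g1 \<xi> (metric_trace TN g1 \<beta> \<xi>) (lf t Z \<xi>) = 0" if Z: "vf_at N (foot \<xi>) Z" for t Z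
      unfolding metric_trace_def using s[OF Z, of t] b
      by (subst TH.g_sum1[OF \<xi> T.vf_tspace[OF vf_lf[OF \<xi> Z]]]) auto
    from this[of _ True] this[of _ False]
    show "g1 \<xi> (metric_trace TN g1 \<beta> \<xi>) (hl Z \<xi>) = g1 \<xi> 0 (hl Z \<xi>)" "g1 \<xi> (metric_trace TN g1 \<beta> \<xi>) (vl Z \<xi>) = g1 \<xi> 0 (vl Z \<xi>)"
      if Z: "vf_at N (foot \<xi>) Z" for Z
      using Z TH.g_zero1[OF \<xi> T.vf_tspace[OF v(1)[OF Z]] T.vf_tspace[OF v(1)[OF Z]]]
        TH.g_zero1[OF \<xi> T.vf_tspace[OF v(2)[OF Z]] T.vf_tspace[OF v(2)[OF Z]]] by (simp_all add: lf_def)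
    show "metric_trace TN g1 \<beta> \<xi> \<in> tspace TN \<xi>" unfolding metric_trace_def using b by (intro tspace_sum) auto
  qed
  show "metric_trace TN g1 (gam TN L g1) \<xi> = 0"
  proof (rule mt)
    show "gam TN L g1 (?F a) (?F a) \<xi> \<in> tspace TN \<xi>" if "a < dim TN" for a by (rule A1.gm_tspace[OF F[OF that] F[OF that]])
    show "(\<Sum>a<dim TN. g1 \<xi> (gam TN L g1 (?F a) (?F a) \<xi>) (lf t Z \<xi>)) = 0" if "vf_at N (foot \<xi>) Z" for t Z
      using z(1,2)[OF that] by (cases t) (simp_all add: lf_def A1.c3_def)
  qed
  show "metric_trace TN g1 (gam_star TN L g1) \<xi> = 0"
  proof (rule mt)
    show "gam_star TN L g1 (?F a) (?F a) \<xi> \<in> tspace TN \<xi>" if "a < dim TN" for a by (rule A1.gs_tspace[OF F[OF that] F[OF that]])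
    show "(\<Sum>a<dim TN. g1 \<xi> (gam_star TN L g1 (?F a) (?F a) \<xi>) (lf t Z \<xi>)) = 0" if Z: "vf_at N (foot \<xi>) Z" for t Z
    proof -
      have "(\<Sum>a<dim TN. g1 \<xi> (gam_star TN L g1 (?F a) (?F a) \<xi>) (lf t Z \<xi>)) = (\<Sum>a<dim TN. ?c (?F a) (lf t Z) (?F a) \<xi>)"
        by (intro sum.cong refl A1.gs_ip F vf_lf[OF \<xi> Z]) auto
      then show ?thesis using z(3,4)[OF Z] by (cases t) (simp_all add: lf_def)
    qed
  qed
qed

end

section \<open>Induction along the canonical sequence\<close>

lemma aff_balancedI:
  assumes "infinitely_balanced N nab g" shows "aff_balanced N nab g"
proof -
  have a: "smooth_manifold N" "riemannian N g" "connection N nab" "flat N nab" "torsion_free N nab"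
    using assms by (simp_all add: infinitely_balanced_def affine_riemann_def)
  show ?thesis
    by unfold_locales (use a assms in \<open>auto simp: smooth_manifold_def infinitely_balanced_def\<close>)
qed

theorem theorem8p1:
  fixes M :: "('a, 'i) tmfd" and nab :: "('a, 'i) tcnx" and g :: "('a, 'i) tmetr"
  assumes "infinitely_balanced M nab g"
    and "\<not> tensor_eq M (gam M nab g) (\<lambda>X Y p. 0)"
  shows "hermitian (T_mfd M 1) (T_J M nab 1) (T_metric M nab g 1) \<and>
         balanced (T_mfd M 1) (T_J M nab 1) (T_metric M nab g 1) \<and>
         ricci_form_zero (T_mfd M 1) (T_J M nab 1) (T_metric M nab g 1)
           (bismut (T_mfd M 1) (T_J M nab 1) (T_metric M nab g 1)) \<and>
         ricci_form_zero (T_mfd M 1) (T_J M nab 1) (T_metric M nab g 1)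
           (chern (T_mfd M 1) (T_J M nab 1) (T_metric M nab g 1)) \<and>
         (kaehler (T_mfd M 1) (T_J M nab 1) (T_metric M nab g 1) \<longleftrightarrow>
           tensor_eq M (gam M nab g) (gam_star M nab g)) \<and>
         (\<forall>k\<ge>2.
           hermitian (T_mfd M k) (T_J M nab k) (T_metric M nab g k) \<and>
           balanced (T_mfd M k) (T_J M nab k) (T_metric M nab g k) \<and>
           \<not> kaehler (T_mfd M k) (T_J M nab k) (T_metric M nab g k) \<and>
           ricci_form_zero (T_mfd M k) (T_J M nab k) (T_metric M nab g k)
             (bismut (T_mfd M k) (T_J M nab k) (T_metric M nab g k)) \<and>
           ricci_form_zero (T_mfd M k) (T_J M nab k) (T_metric M nab g k)
             (chern (T_mfd M k) (T_J M nab k) (T_metric M nab g k)))"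
proof (intro conjI allI impI)
  have M0: "T_mfd M 0 = M" by (simp add: T_mfd_def)
  have S: "T_mfd M (Suc k) = tangent_bundle (T_mfd M k)" "T_J M nab (Suc k) = lift_J (T_mfd M k) (T_cnx M nab k)" for k
    by (simp_all add: T_mfd_def T_J_def)
  note S = S T_cnx.simps(2) T_metric.simps(2)
  \<comment> \<open>The invariant carries the nonvanishing of the difference tensor besides the
    trace conditions, because every later level draws its failure of the Kaehler condition from
    it.\<close>
  have inv: "aff_balanced (T_mfd M k) (T_cnx M nab k) (T_metric M nab g k) \<and>
      \<not> tensor_eq (T_mfd M k) (gam (T_mfd M k) (T_cnx M nab k) (T_metric M nab g k)) (\<lambda>X Y p. 0)" for k
  proof (induction k)
    case 0
    show ?case unfolding M0 T_cnx.simps(1) T_metric.simps(1) by (rule conjI[OF aff_balancedI[OF assms(1)] assms(2)])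
  next
    case (Suc k)
    then interpret aff_balanced "T_mfd M k" "T_cnx M nab k" "T_metric M nab g k" by simp
    show ?case unfolding S by (rule conjI[OF aff_balancedI[OF infinitely_balanced_TN] gam1_nonzero(1)[OF conjunct2[OF Suc]]])
  qed
  have hermitian: "hermitian (T_mfd M (Suc k)) (T_J M nab (Suc k)) (T_metric M nab g (Suc k))"
    and balanced: "balanced (T_mfd M (Suc k)) (T_J M nab (Suc k)) (T_metric M nab g (Suc k))"
    and bismut: "ricci_form_zero (T_mfd M (Suc k)) (T_J M nab (Suc k)) (T_metric M nab g (Suc k))
      (bismut (T_mfd M (Suc k)) (T_J M nab (Suc k)) (T_metric M nab g (Suc k)))"
    and chern: "ricci_form_zero (T_mfd M (Suc k)) (T_J M nab (Suc k)) (T_metric M nab g (Suc k))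
      (chern (T_mfd M (Suc k)) (T_J M nab (Suc k)) (T_metric M nab g (Suc k)))"
    and kaehler: "kaehler (T_mfd M (Suc k)) (T_J M nab (Suc k)) (T_metric M nab g (Suc k)) \<longleftrightarrow>
      tensor_eq (T_mfd M k) (gam (T_mfd M k) (T_cnx M nab k) (T_metric M nab g k))
        (gam_star (T_mfd M k) (T_cnx M nab k) (T_metric M nab g k))"
    and nonsym: "\<not> tensor_eq (T_mfd M (Suc k)) (gam (T_mfd M (Suc k)) (T_cnx M nab (Suc k)) (T_metric M nab g (Suc k)))
        (gam_star (T_mfd M (Suc k)) (T_cnx M nab (Suc k)) (T_metric M nab g (Suc k)))" for k
  proof -
    interpret aff_balanced "T_mfd M k" "T_cnx M nab k" "T_metric M nab g k" using inv[of k] by simp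
    note facts = hermitian_TN balanced_TN ricci_bismut ricci_chern kaehler_iff gam1_nonzero(2)[OF conjunct2[OF inv[of k]]]
    show "hermitian (T_mfd M (Suc k)) (T_J M nab (Suc k)) (T_metric M nab g (Suc k))"
      "balanced (T_mfd M (Suc k)) (T_J M nab (Suc k)) (T_metric M nab g (Suc k))"
      "ricci_form_zero (T_mfd M (Suc k)) (T_J M nab (Suc k)) (T_metric M nab g (Suc k))
        (bismut (T_mfd M (Suc k)) (T_J M nab (Suc k)) (T_metric M nab g (Suc k)))"
      "ricci_form_zero (T_mfd M (Suc k)) (T_J M nab (Suc k)) (T_metric M nab g (Suc k))
        (chern (T_mfd M (Suc k)) (T_J M nab (Suc k)) (T_metric M nab g (Suc k)))"
      "kaehler (T_mfd M (Suc k)) (T_J M nab (Suc k)) (T_metric M nab g (Suc k)) \<longleftrightarrow>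
        tensor_eq (T_mfd M k) (gam (T_mfd M k) (T_cnx M nab k) (T_metric M nab g k))
          (gam_star (T_mfd M k) (T_cnx M nab k) (T_metric M nab g k))"
      "\<not> tensor_eq (T_mfd M (Suc k)) (gam (T_mfd M (Suc k)) (T_cnx M nab (Suc k)) (T_metric M nab g (Suc k)))
          (gam_star (T_mfd M (Suc k)) (T_cnx M nab (Suc k)) (T_metric M nab g (Suc k)))"
      unfolding S by (fact facts)+
  qed
  note one = One_nat_def[symmetric]
  show "hermitian (T_mfd M 1) (T_J M nab 1) (T_metric M nab g 1)" by (rule hermitian[of 0, unfolded one])
  show "balanced (T_mfd M 1) (T_J M nab 1) (T_metric M nab g 1)" by (rule balanced[of 0, unfolded one])
  show "ricci_form_zero (T_mfd M 1) (T_J M nab 1) (T_metric M nab g 1)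
      (bismut (T_mfd M 1) (T_J M nab 1) (T_metric M nab g 1))" by (rule bismut[of 0, unfolded one])
  show "ricci_form_zero (T_mfd M 1) (T_J M nab 1) (T_metric M nab g 1)
      (chern (T_mfd M 1) (T_J M nab 1) (T_metric M nab g 1))" by (rule chern[of 0, unfolded one])
  show "kaehler (T_mfd M 1) (T_J M nab 1) (T_metric M nab g 1) \<longleftrightarrow> tensor_eq M (gam M nab g) (gam_star M nab g)"
    by (rule kaehler[of 0, unfolded one M0 T_cnx.simps(1) T_metric.simps(1)])
  fix k :: nat assume "k \<ge> 2"
  \<comment> \<open>Two successors are needed: level \<open>Suc (Suc m)\<close> is Kaehler only if
    the difference tensor of level \<open>Suc m\<close> is self-adjoint, and this fails because the
    tensor of level \<open>m\<close> is nonzero.\<close>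
  then obtain m where k: "k = Suc (Suc m)" using le_Suc_ex[of 2 k] by auto
  show "hermitian (T_mfd M k) (T_J M nab k) (T_metric M nab g k)" "balanced (T_mfd M k) (T_J M nab k) (T_metric M nab g k)"
    "ricci_form_zero (T_mfd M k) (T_J M nab k) (T_metric M nab g k) (bismut (T_mfd M k) (T_J M nab k) (T_metric M nab g k))"
    "ricci_form_zero (T_mfd M k) (T_J M nab k) (T_metric M nab g k) (chern (T_mfd M k) (T_J M nab k) (T_metric M nab g k))"
    unfolding k by (fact hermitian balanced bismut chern)+
  show "\<not> kaehler (T_mfd M k) (T_J M nab k) (T_metric M nab g k)" unfolding k kaehler[of "Suc m"] by (rule nonsym)
qed

end
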